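(* Let $f_0(t),\dots,f_n(t)$ be differentiable real functions, and let $A_0,\dots,A_n$ be random real $p\times p$ matrices such that the $p^2$ random vectors $((A_0)_{ij},(A_1)_{ij},\dots,(A_n)_{ij})$, $i,j=1,\dots,p$, are independent and identically distributed multivariate normal with mean zero and covariance matrix $C$. Let $\alpha_p$ denote the expected number of real solutions $t$ in the interval $[a,b]$ of $$0=\det\left[A_0f_0(t)+A_1f_1(t)+\cdots+A_nf_n(t)\right]$$ (so $\alpha_1$ is the expected number of zeros in $[a,b]$ of the scalar random function $\sum a_if_i(t)$ with $(a_0,\dots,a_n)$ multivariate normal with mean zero and covariance $C$). Then $$\frac{\alpha_p}{\alpha_1}=\sqrt\pi\,\frac{\Gamma((p+1)/2)}{\Gamma(p/2)}.$$
   Formalization: Adds that f(t)^T C f(t) > 0 for all t in [a,b] (otherwise false: C = diag(1,0), f_0 = t, f_1 = 1 on [-1,1] gives α_1 = α_p = 1), and that α_1 is neither 0 nor infinite, so that the ratio is defined. *)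

theory Defs
  imports "HOL-Probability.Probability"
begin

text \<open>Centered multivariate normal law on vectors indexed by 0..n (elements of
  PiM over 0..n with Borel components), with covariance matrix C:
  it is the law of L Z, where Z has i.i.d. standard normal components and
  L L^T = C.  (Any such L gives the same law; existence of L expresses that C
  is a covariance matrix, i.e. symmetric positive semidefinite.)\<close>

definition is_centered_gaussian ::
  "nat \<Rightarrow> (nat \<Rightarrow> nat \<Rightarrow> real) \<Rightarrow> (nat \<Rightarrow> real) measure \<Rightarrow> bool" where
  "is_centered_gaussian n C M \<longleftrightarrow>
     (\<exists>L :: nat \<Rightarrow> nat \<Rightarrow> real.
        (\<forall>i\<le>n. \<forall>j\<le>n. (\<Sum>k\<le>n. L i k * L j k) = C i j) \<and>
        M = distr (PiM {..n} (\<lambda>_. density lborel std_normal_density))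
                  (PiM {..n} (\<lambda>_. borel))
                  (\<lambda>z. \<lambda>i\<in>{..n}. \<Sum>k\<le>n. L i k * z k))"

definition num_points :: "real set \<Rightarrow> ennreal" where
  "num_points S = emeasure (count_space UNIV) S"

end

theory Submission
  imports Defs
begin

text \<open>Write the covariance as $C = L L^T$ and $w_l(t) = \sum_k L_{kl} f_k(t)$. The random matrix becomes
  $\sum_l w_l(t) Z_l$ with independent standard Gaussian matrices $Z_l$, and the scalar function
  becomes the same expression with Gaussian numbers. Almost surely every zero of the determinant is a
  sign change, so the expected number of zeros is the limit of the sums of sign change probabilities
  over the cells of a grid. The probability for a cell depends only on the angle $\theta$ between the vectors
  $w$ at its end points: it is $\theta / \pi$ in the scalar case and
  $P(\det X \det (X + \tau Y) < 0)$ with $\tau = \tan \theta$ in the matrix case. Conditioning on all rows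
  but one, the latter is again an angle divided by $\pi$, and as $\tau \to 0$ it is asymptotic to
  $(\tau / \pi) E \sqrt{1 + |y|^2}$, where $y$ is the velocity of the unit normal to the remaining rows. The
  expectation is $\sqrt{\pi / 2}$ times the expected norm of a Gaussian vector in dimension $p$, so the
  two sums have this constant as the limit of their ratio, cell by cell.\<close>

section \<open>Standard Gaussian vectors\<close>

text \<open>The functions are merely differentiable, so a Kac-Rice integral is not at hand;
  comparing the two sums cell by cell avoids evaluating either limit. Each grid sum bounds the
  expected number of zeros from below, and the liminf bounds it from above. Two points are delicate.
  A zero of the determinant may fail to be a sign change where the rows other than a fixed one
  become dependent. This must be excluded at uncountably many times at once, and it works because
  the matrices concerned lie in finitely many differentiable images of a hyperplane. Next, the limit
  \<tau> -> 0 under the expectation needs uniform integrability: the angle divided by \<tau> is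
  controlled by quotients |w| / |v| of planar Gaussian norms. The square of such a quotient is not
  integrable, so a power strictly between 1 and 2 is used, namely 3/2. The constant arises as
  follows: given the other data, |y| = r / |h| with h a planar Gaussian vector. The radial density
  of h cancels the denominator and leaves sqrt (z^2 + r^2) with one more scalar Gaussian z; this
  raises the dimension from p - 1 to p and costs the factor sqrt (pi / 2).\<close>

definition gauss :: "'a::euclidean_space measure" where
  "gauss = density lborel (\<lambda>x. ennreal ((1 / sqrt (2 * pi)) ^ DIM('a) * exp (- (norm x)\<^sup>2 / 2)))"

lemma sets_gauss [measurable_cong, simp]: "sets gauss = sets borel"
  and space_gauss [simp]: "space gauss = UNIV"
  by (simp_all add: gauss_def)

lemma gauss_real: "(gauss :: real measure) = density lborel std_normal_density"
  by (simp add: gauss_def std_normal_density_def)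

text \<open>Boxes determine a finite product measure, and on a box the integral of the product of
  densities splits into one factor per coordinate.\<close>

lemma PiM_density_finite:
  fixes M :: "'b measure" and f :: "'b \<Rightarrow> ennreal"
  assumes "finite I" "sigma_finite_measure M" "sigma_finite_measure (density M f)"
    and [measurable]: "f \<in> borel_measurable M"
  shows "density (PiM I (\<lambda>_. M)) (\<lambda>x. \<Prod>i\<in>I. f (x i)) = PiM I (\<lambda>_. density M f)"
proof -
  interpret A: product_sigma_finite "\<lambda>_. M" using assms by (simp add: product_sigma_finite_def)
  interpret B: product_sigma_finite "\<lambda>_. density M f" using assms by (simp add: product_sigma_finite_def)
  show ?thesis
  proof (rule B.PiM_eqI)
    fix A assume A: "\<And>i. i \<in> I \<Longrightarrow> A i \<in> sets (density M f)"
    have ind: "(\<Prod>i\<in>I. f (x i)) * indicator (Pi\<^sub>E I A) x = (\<Prod>i\<in>I. f (x i) * indicator (A i) (x i))"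
      if "x \<in> space (PiM I (\<lambda>_. M))" for x
    proof (cases "x \<in> Pi\<^sub>E I A")
      case True then show ?thesis by (auto intro!: prod.cong simp: PiE_iff)
    next
      case False
      with that obtain i where "i \<in> I" "x i \<notin> A i" by (auto simp: space_PiM PiE_iff)
      then have "(\<Prod>i\<in>I. f (x i) * indicator (A i) (x i)) = 0"
        using assms(1) by (intro prod_zero) (auto intro!: bexI[of _ i])
      with False show ?thesis by simp
    qed
    have [measurable]: "Pi\<^sub>E I A \<in> sets (PiM I (\<lambda>_. M))"
      using A assms(1) by (intro sets_PiM_I_finite) auto
    have "emeasure (density (PiM I (\<lambda>_. M)) (\<lambda>x. \<Prod>i\<in>I. f (x i))) (Pi\<^sub>E I A)
      = (\<integral>\<^sup>+x. (\<Prod>i\<in>I. f (x i)) * indicator (Pi\<^sub>E I A) x \<partial>PiM I (\<lambda>_. M))"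
      by (intro emeasure_density) measurable
    also have "\<dots> = (\<integral>\<^sup>+x. (\<Prod>i\<in>I. f (x i) * indicator (A i) (x i)) \<partial>PiM I (\<lambda>_. M))"
      by (intro nn_integral_cong ind)
    also have "\<dots> = (\<Prod>i\<in>I. \<integral>\<^sup>+x. f x * indicator (A i) x \<partial>M)"
      using A assms(1) by (intro A.product_nn_integral_prod) auto
    also have "\<dots> = (\<Prod>i\<in>I. emeasure (density M f) (A i))"
      using A by (intro prod.cong refl emeasure_density[symmetric]) auto
    finally show "emeasure (density (PiM I (\<lambda>_. M)) (\<lambda>x. \<Prod>i\<in>I. f (x i))) (Pi\<^sub>E I A) =
       (\<Prod>i\<in>I. emeasure (density M f) (A i))" .
  qed (use assms in \<open>auto intro!: sets_PiM_cong\<close>)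
qed

lemma prob_space_std_normal: "prob_space (density lborel std_normal_density)"
  by (rule prob_space_normal_density) simp

text \<open>The squared norm is the sum of the squared coordinates, so the density is a product with
  one factor 1 / sqrt (2 pi) per basis vector. Total mass one is inherited from the product of
  scalar Gaussians.\<close>

lemma gauss_eq_distr_PiM:
  "(gauss :: 'a::euclidean_space measure) =
     distr (PiM Basis (\<lambda>_. density lborel std_normal_density)) borel (\<lambda>f. \<Sum>b\<in>Basis. f b *\<^sub>R b)"
proof -
  have [measurable]: "(\<lambda>f. \<Sum>b\<in>Basis. f b *\<^sub>R b) \<in> PiM Basis (\<lambda>_. lborel::real measure) \<rightarrow>\<^sub>M (borel::'a measure)"
    by measurable
  have "(gauss :: 'a measure) = density (distr (\<Pi>\<^sub>M b\<in>Basis. lborel) borel (\<lambda>f. \<Sum>b\<in>Basis. f b *\<^sub>R b))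
     (\<lambda>x. ennreal ((1 / sqrt (2 * pi)) ^ DIM('a) * exp (- (norm x)\<^sup>2 / 2)))"
    unfolding gauss_def by (subst lborel_eq) simp
  also have "\<dots> = distr (density (\<Pi>\<^sub>M b\<in>Basis. lborel) (\<lambda>f. ennreal ((1 / sqrt (2 * pi)) ^ DIM('a) * exp (- (norm (\<Sum>b\<in>Basis. f b *\<^sub>R b :: 'a))\<^sup>2 / 2))))
      borel (\<lambda>f. \<Sum>b\<in>Basis. f b *\<^sub>R b)"
    by (rule density_distr) auto
  also have "(\<lambda>f. ennreal ((1 / sqrt (2 * pi)) ^ DIM('a) * exp (- (norm (\<Sum>b\<in>Basis. f b *\<^sub>R b :: 'a))\<^sup>2 / 2)))
     = (\<lambda>f. \<Prod>b\<in>Basis. ennreal (std_normal_density (f b)))"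
  proof
    fix f :: "'a \<Rightarrow> real"
    have "(norm (\<Sum>b\<in>Basis. f b *\<^sub>R b :: 'a))\<^sup>2 = (\<Sum>b\<in>Basis. (f b)\<^sup>2)"
      by (subst power2_norm_eq_inner, subst euclidean_inner) (simp add: inner_sum_left_Basis power2_eq_square)
    then have "exp (- (norm (\<Sum>b\<in>Basis. f b *\<^sub>R b :: 'a))\<^sup>2 / 2) = (\<Prod>b\<in>Basis. exp (- (f b)\<^sup>2 / 2))"
      by (simp add: exp_sum[symmetric] sum_negf sum_divide_distrib)
    then have "(1 / sqrt (2 * pi)) ^ DIM('a) * exp (- (norm (\<Sum>b\<in>Basis. f b *\<^sub>R b :: 'a))\<^sup>2 / 2)
      = (\<Prod>b\<in>(Basis::'a set). std_normal_density (f b))"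
      by (simp add: std_normal_density_def prod.distrib prod_dividef power_one_over)
    then show "ennreal ((1 / sqrt (2 * pi)) ^ DIM('a) * exp (- (norm (\<Sum>b\<in>Basis. f b *\<^sub>R b :: 'a))\<^sup>2 / 2))
      = (\<Prod>b\<in>Basis. ennreal (std_normal_density (f b)))"
      by (simp add: prod_ennreal)
  qed
  also have "density (\<Pi>\<^sub>M b\<in>Basis. lborel) (\<lambda>f::'a \<Rightarrow> real. \<Prod>b\<in>Basis. ennreal (std_normal_density (f b)))
    = PiM Basis (\<lambda>_. density lborel std_normal_density)"
    using prob_space_std_normal
    by (intro PiM_density_finite) (auto intro: sigma_finite_lborel prob_space_imp_sigma_finite)
  finally show ?thesis .
qed

lemma prob_space_gauss: "prob_space (gauss :: 'a::euclidean_space measure)"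
proof -
  interpret P: prob_space "PiM (Basis::'a set) (\<lambda>_. density lborel std_normal_density)"
    by (rule prob_space_PiM) (rule prob_space_std_normal)
  show ?thesis unfolding gauss_eq_distr_PiM by (rule P.prob_space_distr) measurable
qed

lemma gauss_prod: "(gauss :: ('a::euclidean_space \<times> 'b::euclidean_space) measure) = gauss \<Otimes>\<^sub>M gauss"
proof -
  have "gauss \<Otimes>\<^sub>M gauss = density (lborel \<Otimes>\<^sub>M lborel) (\<lambda>(x::'a,y::'b).
      ennreal ((1 / sqrt (2 * pi)) ^ DIM('a) * exp (- (norm x)\<^sup>2 / 2)) * ennreal ((1 / sqrt (2 * pi)) ^ DIM('b) * exp (- (norm y)\<^sup>2 / 2)))"
    unfolding gauss_def
    by (rule pair_measure_density)
      (use prob_space_imp_sigma_finite[OF prob_space_gauss[where 'a='b]] in \<open>auto simp: gauss_def intro: sigma_finite_lborel\<close>)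
  also have "\<dots> = gauss"
    unfolding gauss_def lborel_prod
  proof (intro density_cong)
    show "(\<lambda>(x::'a, y::'b). ennreal ((1 / sqrt (2 * pi)) ^ DIM('a) * exp (- (norm x)\<^sup>2 / 2)) *
        ennreal ((1 / sqrt (2 * pi)) ^ DIM('b) * exp (- (norm y)\<^sup>2 / 2))) \<in> borel_measurable lborel"
      unfolding lborel_prod[symmetric] by measurable
  qed (auto simp: norm_Pair power_add exp_add[symmetric] ennreal_mult'[symmetric] mult_ac add_divide_distrib)
  finally show ?thesis by simp
qed

text \<open>Uniqueness of Haar measure by Fubini: shifting the variables against each other
  exchanges the roles of the two measures on A and B, and on the unit ball they agree by assumption.
  It serves to identify the image of Lebesgue measure under an orthogonal map.\<close>

lemma translation_invariant_eq_lborel: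
  fixes M :: "'a::euclidean_space measure"
  assumes sets_M: "sets M = sets borel" and sf: "sigma_finite_measure M"
    and inv: "\<And>t. distr M borel (\<lambda>x. x + t) = M"
    and ball: "emeasure M (ball 0 1) = emeasure lborel (ball (0::'a) 1)"
  shows "M = lborel"
proof (rule measure_eqI)
  note [measurable_cong] = sets_M
  interpret M: sigma_finite_measure M by fact
  interpret pair_sigma_finite M "lborel :: 'a measure" by standard
  fix A assume "A \<in> sets M"
  then have [measurable]: "A \<in> sets borel" by (simp add: sets_M)
  define B where "B = ball (0::'a) 1"
  have [measurable]: "B \<in> sets borel" by (simp add: B_def)
  have transM: "(\<integral>\<^sup>+x. f x \<partial>M) = (\<integral>\<^sup>+x. f (x + t) \<partial>M)" if [measurable]: "f \<in> borel_measurable borel" for f t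
  proof -
    have "(\<integral>\<^sup>+x. f x \<partial>M) = (\<integral>\<^sup>+x. f x \<partial>distr M borel (\<lambda>x. x + t))" by (simp add: inv)
    also have "\<dots> = (\<integral>\<^sup>+x. f (x + t) \<partial>M)" by (subst nn_integral_distr) auto
    finally show ?thesis .
  qed
  \<comment> \<open>\<open>c\<close> is 1 or -1, so this covers translations and point reflections;
    both occur below.\<close>
  have transL: "(\<integral>\<^sup>+x. f x \<partial>lborel) = (\<integral>\<^sup>+x. f (c *\<^sub>R x + t) \<partial>lborel)"
    if [measurable]: "f \<in> borel_measurable borel" and c: "\<bar>c\<bar> = 1" for f c and t :: 'a
  proof -
    have c0: "c \<noteq> 0" using c by auto
    have "(\<integral>\<^sup>+x. f x \<partial>lborel) = (\<integral>\<^sup>+x. f x \<partial>density (distr lborel borel (\<lambda>x. t + c *\<^sub>R x)) (\<lambda>_. \<bar>c\<bar>^DIM('a)))"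
      by (subst lborel_affine[OF c0, of t]) simp
    also have "\<dots> = (\<integral>\<^sup>+x. f (t + c *\<^sub>R x) \<partial>lborel)"
      by (subst nn_integral_density) (auto simp: c nn_integral_distr)
    finally show ?thesis by (simp add: add.commute)
  qed
  \<comment> \<open>Replace y by y + x, then x by x - y, then reflect y to x - y. In the end
    \<open>A\<close> is measured by \<open>lborel\<close> and \<open>B\<close> by
    \<open>M\<close>.\<close>
  have "emeasure M A * emeasure lborel B = (\<integral>\<^sup>+y. \<integral>\<^sup>+x. indicator A x * indicator B y \<partial>M \<partial>lborel)"
    by (simp add: nn_integral_multc nn_integral_cmult sets_M)
  also have "\<dots> = (\<integral>\<^sup>+x. \<integral>\<^sup>+y. indicator A x * indicator B y \<partial>lborel \<partial>M)"
    by (intro Fubini') measurable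
  also have "\<dots> = (\<integral>\<^sup>+x. \<integral>\<^sup>+y. indicator A x * indicator B (y + x) \<partial>lborel \<partial>M)"
    by (intro nn_integral_cong transL[where c=1, simplified]) measurable
  also have "\<dots> = (\<integral>\<^sup>+y. \<integral>\<^sup>+x. indicator A x * indicator B (y + x) \<partial>M \<partial>lborel)"
    by (intro Fubini'[symmetric]) measurable
  also have "\<dots> = (\<integral>\<^sup>+y. \<integral>\<^sup>+x. indicator A (x + - y) * indicator B (y + (x + - y)) \<partial>M \<partial>lborel)"
    by (intro nn_integral_cong transM) measurable
  also have "\<dots> = (\<integral>\<^sup>+y. \<integral>\<^sup>+x. indicator A (x - y) * indicator B x \<partial>M \<partial>lborel)"
    by simp
  also have "\<dots> = (\<integral>\<^sup>+x. \<integral>\<^sup>+y. indicator A (x - y) * indicator B x \<partial>lborel \<partial>M)"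
    by (intro Fubini') measurable
  also have "\<dots> = (\<integral>\<^sup>+x. \<integral>\<^sup>+y. indicator A y * indicator B x \<partial>lborel \<partial>M)"
  proof (rule nn_integral_cong)
    fix x
    show "(\<integral>\<^sup>+y. indicator A (x - y) * indicator B x \<partial>lborel) = (\<integral>\<^sup>+y. indicator A y * indicator B x \<partial>lborel)"
      using transL[of "\<lambda>y. indicator A y * indicator B x" "-1" x] by simp
  qed
  also have "\<dots> = emeasure lborel A * emeasure M B"
    by (simp add: nn_integral_multc nn_integral_cmult sets_M)
  finally have "emeasure M A * emeasure lborel B = emeasure lborel A * emeasure lborel B"
    by (simp add: B_def ball)
  moreover have "emeasure lborel B \<noteq> 0" "emeasure lborel B \<noteq> top"
    unfolding B_def using emeasure_lborel_ball_finite[of "0::'a" 1] content_ball_gt_0_iff[of "0::'a" 1]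
    by (auto simp: measure_def)
  ultimately show "emeasure M A = emeasure lborel A"
    by (metis mult_divide_eq_ennreal)
qed (simp add: sets_M)

text \<open>The image measure is translation invariant because T x + T s = T (x + s) and T is onto.
  Balls around 0 are their own preimages, which fixes the normalisation.\<close>

lemma distr_lborel_orthogonal:
  fixes T :: "'a::euclidean_space \<Rightarrow> 'a"
  assumes T: "orthogonal_transformation T"
  shows "distr lborel borel T = lborel"
proof (rule translation_invariant_eq_lborel)
  note lin = orthogonal_transformation_linear[OF T]
  have [measurable]: "T \<in> borel_measurable borel"
    using lin by (intro borel_measurable_continuous_onI linear_continuous_on linear_conv_bounded_linear[THEN iffD1])
  have ball: "T -` ball 0 r = ball 0 r" for r
    by (auto simp: orthogonal_transformation_norm[OF T])
  show "sets (distr lborel borel T) = sets borel" by simp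
  show "emeasure (distr lborel borel T) (ball 0 1) = emeasure lborel (ball (0::'a) 1)"
    by (simp add: emeasure_distr ball)
  show "sigma_finite_measure (distr lborel borel T)"
  proof
    show "\<exists>A. countable A \<and> A \<subseteq> sets (distr lborel borel T) \<and> \<Union>A = space (distr lborel borel T)
       \<and> (\<forall>a\<in>A. emeasure (distr lborel borel T) a \<noteq> \<infinity>)"
    proof (intro exI[of _ "range (\<lambda>n::nat. ball 0 (real n))"] conjI ballI)
      have "\<exists>n. norm x < real n" for x :: 'a by (rule reals_Archimedean2)
      then show "\<Union>(range (\<lambda>n::nat. ball 0 (real n))) = space (distr lborel borel T)"
        by (auto simp: mem_ball)
    next
      fix a assume "a \<in> range (\<lambda>n::nat. ball (0::'a) (real n))"
      then show "emeasure (distr lborel borel T) a \<noteq> \<infinity>"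
        using emeasure_lborel_ball_finite[of "0::'a"] by (auto simp: emeasure_distr ball less_top[symmetric] simp del: emeasure_ball)
    qed auto
  qed
  fix t
  obtain s where s: "t = T s" using orthogonal_transformation_surj[OF T] by (metis surjD)
  have "distr (distr lborel borel T) borel (\<lambda>x. x + t) = distr lborel borel (\<lambda>x. T (s + x))"
    by (subst distr_distr) (auto simp: o_def s linear_add[OF lin] add.commute)
  also have "\<dots> = distr (distr lborel borel (\<lambda>x. s + x)) borel T"
    by (subst distr_distr) (auto simp: o_def)
  also have "distr lborel borel (\<lambda>x. s + x) = lborel"
    using lborel_distr_plus[of s] by simp
  finally show "distr (distr lborel borel T) borel (\<lambda>x. x + t) = distr lborel borel T" .
qed

lemma borel_measurable_linear:
  fixes T :: "'a::euclidean_space \<Rightarrow> 'b::real_normed_vector"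
  assumes "linear T" shows "T \<in> borel_measurable borel"
  using assms by (intro borel_measurable_continuous_onI linear_continuous_on linear_conv_bounded_linear[THEN iffD1])

lemma distr_gauss_orthogonal:
  fixes T :: "'a::euclidean_space \<Rightarrow> 'a"
  assumes T: "orthogonal_transformation T"
  shows "distr gauss borel T = gauss"
proof -
  note [measurable] = borel_measurable_linear[OF orthogonal_transformation_linear[OF T]]
  let ?d = "\<lambda>x::'a. ennreal ((1 / sqrt (2 * pi)) ^ DIM('a) * exp (- (norm x)\<^sup>2 / 2))"
  have "gauss = density (distr lborel borel T) ?d"
    by (simp add: distr_lborel_orthogonal[OF T] gauss_def)
  also have "\<dots> = distr (density lborel (\<lambda>x. ?d (T x))) borel T"
    by (rule density_distr) auto
  also have "\<dots> = distr gauss borel T"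
    by (simp add: gauss_def orthogonal_transformation_norm[OF T])
  finally show ?thesis by simp
qed

text \<open>\<open>J\<close> is the adjoint of \<open>T\<close>, and \<open>T\<close> is a left
  inverse of it. Extending \<open>T\<close> to an orthogonal map of the product and reading off one
  marginal in two ways gives the claim. Reals, vectors, matrices and tuples of them are all
  Euclidean spaces, so this one statement provides every projection, rotation and resampling of a
  coordinate or row used later.\<close>

lemma distr_gauss_coisometry:
  fixes T :: "'a::euclidean_space \<Rightarrow> 'b::euclidean_space"
  assumes T: "linear T" and J: "linear J" and adj: "\<And>x y. T x \<bullet> y = x \<bullet> J y" and TJ: "\<And>y. T (J y) = y"
  shows "distr gauss borel T = gauss"
proof -
  note [measurable] = borel_measurable_linear[OF T]
  interpret A: prob_space "gauss :: 'a measure" by (rule prob_space_gauss)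
  interpret B: prob_space "gauss :: 'b measure" by (rule prob_space_gauss)
  \<comment> \<open>\<open>U\<close> exchanges the component J (T x) of \<open>x\<close> with J y,
    keeps the kernel part x - J (T x), and stores T x in the second slot.\<close>
  define U where "U = (\<lambda>(x, y). (x + J (y - T x), T x))"
  have lin: "linear U"
    unfolding U_def
    by (rule linearI)
      (auto simp: linear_add[OF T] linear_add[OF J] linear_diff[OF J] linear_scale[OF T] linear_scale[OF J] algebra_simps)
  have "norm (U z) = norm z" for z
  proof -
    obtain x y where z: "z = (x, y)" by (cases z)
    have JJ: "J v \<bullet> J w = v \<bullet> w" for v w by (metis TJ adj)
    have "(x + J v) \<bullet> (x + J v) = x \<bullet> x + 2 * (T x \<bullet> v) + v \<bullet> v" for v
      by (simp add: inner_add_left inner_add_right JJ adj inner_commute[of "J v" x])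
    then have "U z \<bullet> U z = z \<bullet> z"
      unfolding z U_def
      by (simp add: inner_Pair inner_diff_left inner_diff_right inner_commute[of y "T x"])
    then have "(norm (U z))\<^sup>2 = (norm z)\<^sup>2"
      by (simp add: power2_norm_eq_inner)
    then show ?thesis by simp
  qed
  then have U: "orthogonal_transformation U" using lin by (simp add: orthogonal_transformation)
  note [measurable] = borel_measurable_linear[OF lin]
  have [measurable]: "fst \<in> (borel :: ('a \<times> 'b) measure) \<rightarrow>\<^sub>M borel" "snd \<in> (borel :: ('a \<times> 'b) measure) \<rightarrow>\<^sub>M borel"
    by (simp_all add: borel_prod[symmetric])
  have "gauss = distr (gauss \<Otimes>\<^sub>M gauss) borel (snd :: 'a \<times> 'b \<Rightarrow> 'b)"
    by (intro measure_eqI) (auto simp: emeasure_distr B.emeasure_pair_measure_Times space_pair_measure snd_vimage_eq_Times  A.emeasure_space_1[simplified])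
  also have "\<dots> = distr (distr gauss borel U) borel snd"
    by (subst distr_gauss_orthogonal[OF U]) (simp add: gauss_prod)
  also have "\<dots> = distr gauss borel (\<lambda>z::'a\<times>'b. T (fst z))"
    by (subst distr_distr) (measurable, simp add: o_def U_def split_beta')
  also have "\<dots> = distr (distr (gauss \<Otimes>\<^sub>M gauss) borel (fst :: 'a \<times> 'b \<Rightarrow> 'a)) borel T"
    by (subst distr_distr) (auto simp: o_def gauss_prod)
  also have "distr (gauss \<Otimes>\<^sub>M gauss) borel (fst :: 'a \<times> 'b \<Rightarrow> 'a) = gauss"
    by (intro measure_eqI) (auto simp: emeasure_distr B.emeasure_pair_measure_Times space_pair_measure fst_vimage_eq_Times  B.emeasure_space_1[simplified])
  finally show ?thesis by simp
qed

section \<open>Planar Gaussian integrals\<close>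

lemma distr_gauss_inner:
  fixes u :: "'a::euclidean_space"
  assumes "norm u = 1"
  shows "distr gauss borel (\<lambda>v. v \<bullet> u) = (gauss :: real measure)"
  using assms
  by (intro distr_gauss_coisometry[where J="\<lambda>r. r *\<^sub>R u"])
     (auto intro!: linearI simp: inner_add_left scaleR_add_left inner_commute[of u] dot_square_norm)

lemma distr_gauss_inner_pair:
  fixes u w :: "'a::euclidean_space"
  assumes "norm u = 1" "norm w = 1" "u \<bullet> w = 0"
  shows "distr gauss borel (\<lambda>v. (v \<bullet> u, v \<bullet> w)) = (gauss :: (real \<times> real) measure)"
  using assms
  by (intro distr_gauss_coisometry[where J="\<lambda>(r, s). r *\<^sub>R u + s *\<^sub>R w"])
     (auto intro!: linearI simp: inner_add_left inner_add_right scaleR_add_left scaleR_add_right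
        inner_commute[of w u] dot_square_norm)

lemma nn_integral_gauss_real:
  assumes [measurable]: "f \<in> borel_measurable borel"
  shows "(\<integral>\<^sup>+x. f x \<partial>(gauss::real measure)) = (\<integral>\<^sup>+x. ennreal (std_normal_density x) * f x \<partial>lborel)"
  unfolding gauss_real by (rule nn_integral_density) auto

lemma nn_integral_abs_exp: "(\<integral>\<^sup>+u. ennreal (\<bar>u\<bar> * exp (- u\<^sup>2 / 2)) \<partial>lborel) = ennreal 2"
proof -
  have "has_bochner_integral lborel (\<lambda>x. sqrt (2 * pi) * (std_normal_density x * \<bar>x\<bar>)) (sqrt (2 * pi) * sqrt (2 / pi))"
    using has_bochner_integral_mult_right[OF std_normal_moment_abs_odd[of 0], of "sqrt (2 * pi)"] by simp
  moreover have "sqrt (2 * pi) * (std_normal_density x * \<bar>x\<bar>) = \<bar>x\<bar> * exp (- x\<^sup>2 / 2)" for x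
    by (simp add: std_normal_density_def)
  moreover have "sqrt (2 * pi) * sqrt (2 / pi) = 2"
    by (simp add: real_sqrt_mult[symmetric])
  ultimately have "has_bochner_integral lborel (\<lambda>x::real. \<bar>x\<bar> * exp (- x\<^sup>2 / 2)) 2"
    by (simp only:)
  then show ?thesis
    by (subst nn_integral_eq_integral) (auto simp: has_bochner_integral_iff)
qed

lemma nn_integral_inverse_one_plus_square:
  "(\<integral>\<^sup>+t\<in>{a..}. ennreal (1 / (1 + t\<^sup>2)) \<partial>lborel) = ennreal (pi / 2 - arctan a)"
  by (rule nn_integral_FTC_atLeast) (auto intro!: derivative_eq_intros tendsto_arctan_at_top simp: inverse_eq_divide)

text \<open>Slope coordinates y = x t instead of polar coordinates. The factor |x| is the Jacobian,
  and the line x = 0 is a null set.\<close>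

lemma nn_integral_gauss_ratio:
  fixes F :: "real \<Rightarrow> real \<Rightarrow> ennreal"
  assumes [measurable]: "(\<lambda>(x, y). F x y) \<in> borel_measurable (borel \<Otimes>\<^sub>M borel)"
  shows "(\<integral>\<^sup>+(x, y). F x y \<partial>gauss) =
    (\<integral>\<^sup>+t. \<integral>\<^sup>+x. F x (x * t) * ennreal (\<bar>x\<bar> * exp (- x\<^sup>2 * (1 + t\<^sup>2) / 2) / (2 * pi)) \<partial>lborel \<partial>lborel)"
proof -
  interpret G: prob_space "gauss :: real measure" by (rule prob_space_gauss)
  have "(\<integral>\<^sup>+(x, y). F x y \<partial>gauss) = (\<integral>\<^sup>+x. \<integral>\<^sup>+y. F x y \<partial>gauss \<partial>gauss)"
    unfolding gauss_prod by (subst G.nn_integral_fst[symmetric]) auto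
  also have "\<dots> = (\<integral>\<^sup>+x. ennreal (std_normal_density x) * (\<integral>\<^sup>+y. F x y \<partial>gauss) \<partial>lborel)"
    by (rule nn_integral_gauss_real) measurable
  also have "\<dots> = (\<integral>\<^sup>+x. \<integral>\<^sup>+t. F x (x * t) * ennreal (\<bar>x\<bar> * exp (- x\<^sup>2 * (1 + t\<^sup>2) / 2) / (2 * pi)) \<partial>lborel \<partial>lborel)"
  proof (rule nn_integral_cong_AE)
    show "AE x in lborel. ennreal (std_normal_density x) * (\<integral>\<^sup>+y. F x y \<partial>gauss)
       = (\<integral>\<^sup>+t. F x (x * t) * ennreal (\<bar>x\<bar> * exp (- x\<^sup>2 * (1 + t\<^sup>2) / 2) / (2 * pi)) \<partial>lborel)"
      using AE_lborel_singleton[of "0::real"]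
    proof eventually_elim
      fix x :: real assume x: "x \<noteq> 0"
      have "ennreal (std_normal_density x) * (\<integral>\<^sup>+y. F x y \<partial>gauss)
          = ennreal (std_normal_density x) * (\<integral>\<^sup>+y. ennreal (std_normal_density y) * F x y \<partial>lborel)"
        by (subst nn_integral_gauss_real) auto
      also have "\<dots> = ennreal (std_normal_density x) * (ennreal \<bar>x\<bar> * (\<integral>\<^sup>+t. ennreal (std_normal_density (x * t)) * F x (x * t) \<partial>lborel))"
        by (subst nn_integral_real_affine[OF _ x, of _ 0]) auto
      also have "\<dots> = (\<integral>\<^sup>+t. ennreal (std_normal_density x) * (ennreal \<bar>x\<bar> * (ennreal (std_normal_density (x * t)) * F x (x * t))) \<partial>lborel)"
        by (simp add: nn_integral_cmult)
      also have "\<dots> = (\<integral>\<^sup>+t. F x (x * t) * ennreal (\<bar>x\<bar> * exp (- x\<^sup>2 * (1 + t\<^sup>2) / 2) / (2 * pi)) \<partial>lborel)"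
      proof (rule nn_integral_cong)
        fix t
        have "\<bar>x\<bar> * exp (- x\<^sup>2 * (1 + t\<^sup>2) / 2) / (2 * pi) = std_normal_density x * (\<bar>x\<bar> * std_normal_density (x * t))"
          by (simp add: std_normal_density_def field_simps exp_add[symmetric] power_mult_distrib)
        then show "ennreal (std_normal_density x) * (ennreal \<bar>x\<bar> * (ennreal (std_normal_density (x * t)) * F x (x * t)))
          = F x (x * t) * ennreal (\<bar>x\<bar> * exp (- x\<^sup>2 * (1 + t\<^sup>2) / 2) / (2 * pi))"
          by (simp only: ennreal_mult' normal_density_nonneg abs_ge_zero mult_ac)
      qed
      finally show "ennreal (std_normal_density x) * (\<integral>\<^sup>+y. F x y \<partial>gauss)
       = (\<integral>\<^sup>+t. F x (x * t) * ennreal (\<bar>x\<bar> * exp (- x\<^sup>2 * (1 + t\<^sup>2) / 2) / (2 * pi)) \<partial>lborel)" .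
    qed
  qed
  also have "\<dots> = (\<integral>\<^sup>+t. \<integral>\<^sup>+x. F x (x * t) * ennreal (\<bar>x\<bar> * exp (- x\<^sup>2 * (1 + t\<^sup>2) / 2) / (2 * pi)) \<partial>lborel \<partial>lborel)"
    by (rule lborel_pair.Fubini') measurable
  finally show ?thesis .
qed

text \<open>The substitution u = x sqrt (1 + t^2) separates radius and slope. The two factors sqrt
  (1 + t^2), from dx and from |x|, leave the Cauchy weight 1 / (1 + t^2).\<close>

lemma nn_integral_scaled_abs_exp:
  fixes H :: "real \<Rightarrow> ennreal" and t :: real
  assumes [measurable]: "H \<in> borel_measurable borel"
  shows "(\<integral>\<^sup>+x. H (\<bar>x\<bar> * sqrt (1 + t\<^sup>2)) * ennreal (\<bar>x\<bar> * exp (- x\<^sup>2 * (1 + t\<^sup>2) / 2) / (2 * pi)) \<partial>lborel)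
    = ennreal (1 / (1 + t\<^sup>2)) * (\<integral>\<^sup>+u. H \<bar>u\<bar> * ennreal (\<bar>u\<bar> * exp (- u\<^sup>2 / 2) / (2 * pi)) \<partial>lborel)"
proof -
  define k where "k = sqrt (1 + t\<^sup>2)"
  have k: "k > 0" "k\<^sup>2 = 1 + t\<^sup>2" by (auto simp: k_def add_pos_nonneg)
  have "(\<integral>\<^sup>+u. H \<bar>u\<bar> * ennreal (\<bar>u\<bar> * exp (- u\<^sup>2 / 2) / (2 * pi)) \<partial>lborel) =
     ennreal k * (\<integral>\<^sup>+x. H \<bar>k * x\<bar> * ennreal (\<bar>k * x\<bar> * exp (- (k * x)\<^sup>2 / 2) / (2 * pi)) \<partial>lborel)"
    using nn_integral_real_affine[of "\<lambda>u. H \<bar>u\<bar> * ennreal (\<bar>u\<bar> * exp (- u\<^sup>2 / 2) / (2 * pi))" k 0] k(1) by simp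
  also have "\<dots> = ennreal k * (\<integral>\<^sup>+x. ennreal k * (H (\<bar>x\<bar> * k) * ennreal (\<bar>x\<bar> * exp (- x\<^sup>2 * (1 + t\<^sup>2) / 2) / (2 * pi))) \<partial>lborel)"
  proof (rule arg_cong[where f="\<lambda>z. ennreal k * z"], rule nn_integral_cong)
    fix x
    have "\<bar>k * x\<bar> * exp (- (k * x)\<^sup>2 / 2) / (2 * pi) = k * (\<bar>x\<bar> * exp (- x\<^sup>2 * (1 + t\<^sup>2) / 2) / (2 * pi))"
      using k(1) by (simp add: abs_mult power_mult_distrib k(2) mult_ac)
    then have "ennreal (\<bar>k * x\<bar> * exp (- (k * x)\<^sup>2 / 2) / (2 * pi)) = ennreal k * ennreal (\<bar>x\<bar> * exp (- x\<^sup>2 * (1 + t\<^sup>2) / 2) / (2 * pi))"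
      using k(1) by (simp flip: ennreal_mult')
    moreover have "\<bar>k * x\<bar> = \<bar>x\<bar> * k" using k(1) by (simp add: abs_mult)
    ultimately show "H \<bar>k * x\<bar> * ennreal (\<bar>k * x\<bar> * exp (- (k * x)\<^sup>2 / 2) / (2 * pi))
      = ennreal k * (H (\<bar>x\<bar> * k) * ennreal (\<bar>x\<bar> * exp (- x\<^sup>2 * (1 + t\<^sup>2) / 2) / (2 * pi)))"
      by (metis mult.left_commute)
  qed
  also have "\<dots> = ennreal (k\<^sup>2) * (\<integral>\<^sup>+x. (H (\<bar>x\<bar> * k) * ennreal (\<bar>x\<bar> * exp (- x\<^sup>2 * (1 + t\<^sup>2) / 2) / (2 * pi))) \<partial>lborel)"
    using k(1) by (subst nn_integral_cmult) (auto simp: power2_eq_square ennreal_mult' mult.assoc)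
  finally have "ennreal (1 / k\<^sup>2) * (\<integral>\<^sup>+u. H \<bar>u\<bar> * ennreal (\<bar>u\<bar> * exp (- u\<^sup>2 / 2) / (2 * pi)) \<partial>lborel)
     = ennreal (1 / k\<^sup>2 * k\<^sup>2) * (\<integral>\<^sup>+x. (H (\<bar>x\<bar> * k) * ennreal (\<bar>x\<bar> * exp (- x\<^sup>2 * (1 + t\<^sup>2) / 2) / (2 * pi))) \<partial>lborel)"
    by (simp only: ennreal_mult' zero_le_power2 divide_nonneg_nonneg zero_le_one mult.assoc)
  then show ?thesis
    using k(1) by (simp add: k(2)[symmetric] k_def[symmetric])
qed

text \<open>Integrating out the slope yields the total Cauchy mass pi, which turns 1 / (2 pi) into 1
  / 2. The weight on the right is the Rayleigh density, symmetrised over the whole line.\<close>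

lemma nn_integral_gauss_radial:
  fixes H :: "real \<Rightarrow> ennreal"
  assumes [measurable]: "H \<in> borel_measurable borel"
  shows "(\<integral>\<^sup>+h. H (norm h) \<partial>(gauss :: (real \<times> real) measure)) =
     (\<integral>\<^sup>+u. H \<bar>u\<bar> * ennreal (\<bar>u\<bar> * exp (- u\<^sup>2 / 2) / 2) \<partial>lborel)"
proof -
  define A where "A = (\<integral>\<^sup>+u. H \<bar>u\<bar> * ennreal (\<bar>u\<bar> * exp (- u\<^sup>2 / 2) / (2 * pi)) \<partial>lborel)"
  have sq: "sqrt (x\<^sup>2 + (x * t)\<^sup>2) = \<bar>x\<bar> * sqrt (1 + t\<^sup>2)" for x t :: real
  proof -
    have "x\<^sup>2 + (x * t)\<^sup>2 = x\<^sup>2 * (1 + t\<^sup>2)" by (simp add: power_mult_distrib algebra_simps)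
    then show ?thesis by (simp add: real_sqrt_mult)
  qed
  have "(\<integral>\<^sup>+h. H (norm h) \<partial>(gauss :: (real \<times> real) measure)) = (\<integral>\<^sup>+(x, y). H (sqrt (x\<^sup>2 + y\<^sup>2)) \<partial>gauss)"
    by (intro nn_integral_cong) (auto simp: norm_Pair)
  also have "\<dots> = (\<integral>\<^sup>+t. \<integral>\<^sup>+x. H (sqrt (x\<^sup>2 + (x * t)\<^sup>2)) * ennreal (\<bar>x\<bar> * exp (- x\<^sup>2 * (1 + t\<^sup>2) / 2) / (2 * pi)) \<partial>lborel \<partial>lborel)"
    by (rule nn_integral_gauss_ratio) measurable
  also have "\<dots> = (\<integral>\<^sup>+t. ennreal (1 / (1 + t\<^sup>2)) * A \<partial>lborel)"
    unfolding sq A_def by (rule nn_integral_cong) (rule nn_integral_scaled_abs_exp, measurable)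
  also have "\<dots> = (\<integral>\<^sup>+t. ennreal (1 / (1 + t\<^sup>2)) \<partial>lborel) * A"
    by (rule nn_integral_multc) measurable
  also have "(\<integral>\<^sup>+t. ennreal (1 / (1 + t\<^sup>2)) \<partial>lborel) = ennreal pi"
  proof -
    have "(\<integral>\<^sup>+t. ennreal (1 / (1 + t\<^sup>2)) \<partial>lborel)
       = (\<integral>\<^sup>+t. ennreal (1 / (1 + t\<^sup>2)) * indicator {0..} t + ennreal (1 / (1 + t\<^sup>2)) * indicator {..<0} t \<partial>lborel)"
      by (intro nn_integral_cong) (auto split: split_indicator)
    also have "\<dots> = (\<integral>\<^sup>+t\<in>{0..}. ennreal (1 / (1 + t\<^sup>2)) \<partial>lborel) + (\<integral>\<^sup>+t\<in>{..<0}. ennreal (1 / (1 + t\<^sup>2)) \<partial>lborel)"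
      by (rule nn_integral_add) auto
    also have "(\<integral>\<^sup>+t\<in>{..<0}. ennreal (1 / (1 + t\<^sup>2)) \<partial>lborel) = (\<integral>\<^sup>+t\<in>{0<..}. ennreal (1 / (1 + t\<^sup>2)) \<partial>lborel)"
      by (subst nn_integral_real_affine[where c="-1" and t=0]) (auto intro!: nn_integral_cong split: split_indicator)
    also have "\<dots> = (\<integral>\<^sup>+t\<in>{0..}. ennreal (1 / (1 + t\<^sup>2)) \<partial>lborel)"
      by (intro nn_integral_cong_AE eventually_mono[OF AE_lborel_singleton[of "0::real"]]) (auto split: split_indicator)
    finally show ?thesis by (simp add: nn_integral_inverse_one_plus_square flip: ennreal_plus)
  qed
  also have "ennreal pi * A = (\<integral>\<^sup>+u. ennreal pi * (H \<bar>u\<bar> * ennreal (\<bar>u\<bar> * exp (- u\<^sup>2 / 2) / (2 * pi))) \<partial>lborel)"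
    unfolding A_def by (simp add: nn_integral_cmult)
  also have "\<dots> = (\<integral>\<^sup>+u. H \<bar>u\<bar> * ennreal (\<bar>u\<bar> * exp (- u\<^sup>2 / 2) / 2) \<partial>lborel)"
  proof (rule nn_integral_cong)
    fix u :: real
    have "pi * (\<bar>u\<bar> * exp (- u\<^sup>2 / 2) / (2 * pi)) = \<bar>u\<bar> * exp (- u\<^sup>2 / 2) / 2" by simp
    then have "ennreal pi * ennreal (\<bar>u\<bar> * exp (- u\<^sup>2 / 2) / (2 * pi)) = ennreal (\<bar>u\<bar> * exp (- u\<^sup>2 / 2) / 2)"
      by (simp flip: ennreal_mult')
    then show "ennreal pi * (H \<bar>u\<bar> * ennreal (\<bar>u\<bar> * exp (- u\<^sup>2 / 2) / (2 * pi))) = H \<bar>u\<bar> * ennreal (\<bar>u\<bar> * exp (- u\<^sup>2 / 2) / 2)"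
      by (metis mult.left_commute)
  qed
  finally show ?thesis .
qed

text \<open>On the line of slope t the product is x^2 (c + s t), so the event only restricts the
  Cauchy distributed slope to t < - c / s. Its mass is (pi / 2 - arctan (c / s)) / pi, and the
  bracket is arccos c.\<close>

lemma emeasure_gauss_wedge:
  assumes s: "s > 0" and cs: "c\<^sup>2 + s\<^sup>2 = 1"
  shows "emeasure gauss {(x, y). x * (c * x + s * y) < (0::real)} = ennreal (arccos c / pi)"
proof -
  have "c\<^sup>2 < 1" using cs s by (smt (verit) zero_less_power)
  then have c: "\<bar>c\<bar> < 1" by (simp add: abs_square_less_1)
  have "Measurable.pred (borel \<Otimes>\<^sub>M borel) (\<lambda>(x, y). x * (c * x + s * y) < (0::real))" by measurable
  then have m: "{(x, y). x * (c * x + s * y) < 0} \<in> sets (borel :: (real \<times> real) measure)"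
    by (simp add: pred_def borel_prod space_pair_measure split_beta')
  have "emeasure gauss {(x, y). x * (c * x + s * y) < (0::real)} = (\<integral>\<^sup>+z. indicator {(x, y). x * (c * x + s * y) < 0} z \<partial>gauss)"
    using m by simp
  also have "\<dots> = (\<integral>\<^sup>+(x, y). indicator {..<0} (x * (c * x + s * y)) \<partial>gauss)"
    by (intro nn_integral_cong) (auto split: split_indicator)
  also have "\<dots> = (\<integral>\<^sup>+t. \<integral>\<^sup>+x. indicator {..<0} (x * (c * x + s * (x * t))) * ennreal (\<bar>x\<bar> * exp (- x\<^sup>2 * (1 + t\<^sup>2) / 2) / (2 * pi)) \<partial>lborel \<partial>lborel)"
    by (rule nn_integral_gauss_ratio) measurable
  also have "\<dots> = (\<integral>\<^sup>+t. (\<integral>\<^sup>+x. 1 * ennreal (\<bar>x\<bar> * exp (- x\<^sup>2 * (1 + t\<^sup>2) / 2) / (2 * pi)) \<partial>lborel) * indicator {..<- c / s} t \<partial>lborel)"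
  proof (rule nn_integral_cong)
    fix t :: real
    have "indicator {..<0} (x * (c * x + s * (x * t))) = (indicator {..<- c / s} t :: ennreal)" if "x \<noteq> 0" for x
    proof -
      have "x * (c * x + s * (x * t)) = x\<^sup>2 * (c + s * t)" by (simp add: algebra_simps power2_eq_square)
      moreover have "x\<^sup>2 * (c + s * t) < 0 \<longleftrightarrow> c + s * t < 0" using that by (simp add: mult_less_0_iff)
      moreover have "c + s * t < 0 \<longleftrightarrow> t < - c / s" using s by (simp add: field_simps) linarith
      ultimately show ?thesis by (simp split: split_indicator)
    qed
    then have "(\<integral>\<^sup>+x. indicator {..<0} (x * (c * x + s * (x * t))) * ennreal (\<bar>x\<bar> * exp (- x\<^sup>2 * (1 + t\<^sup>2) / 2) / (2 * pi)) \<partial>lborel)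
       = (\<integral>\<^sup>+x. 1 * ennreal (\<bar>x\<bar> * exp (- x\<^sup>2 * (1 + t\<^sup>2) / 2) / (2 * pi)) * indicator {..<- c / s} t \<partial>lborel)"
      by (intro nn_integral_cong_AE eventually_mono[OF AE_lborel_singleton[of "0::real"]]) (simp add: mult_ac)
    then show "(\<integral>\<^sup>+x. indicator {..<0} (x * (c * x + s * (x * t))) * ennreal (\<bar>x\<bar> * exp (- x\<^sup>2 * (1 + t\<^sup>2) / 2) / (2 * pi)) \<partial>lborel)
       = (\<integral>\<^sup>+x. 1 * ennreal (\<bar>x\<bar> * exp (- x\<^sup>2 * (1 + t\<^sup>2) / 2) / (2 * pi)) \<partial>lborel) * indicator {..<- c / s} t"
      by (simp add: nn_integral_multc)
  qed
  also have "\<dots> = (\<integral>\<^sup>+t. ennreal (1 / pi) * (ennreal (1 / (1 + t\<^sup>2)) * indicator {..<- c / s} t) \<partial>lborel)"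
  proof (rule nn_integral_cong)
    fix t :: real
    have "(\<integral>\<^sup>+u. 1 * ennreal (\<bar>u\<bar> * exp (- u\<^sup>2 / 2) / (2 * pi)) \<partial>lborel) = (\<integral>\<^sup>+u. ennreal (1 / (2 * pi)) * ennreal (\<bar>u\<bar> * exp (- u\<^sup>2 / 2)) \<partial>lborel)"
    proof (intro nn_integral_cong)
      fix u :: real
      have "\<bar>u\<bar> * exp (- u\<^sup>2 / 2) / (2 * pi) = 1 / (2 * pi) * (\<bar>u\<bar> * exp (- u\<^sup>2 / 2))" by simp
      then show "1 * ennreal (\<bar>u\<bar> * exp (- u\<^sup>2 / 2) / (2 * pi)) = ennreal (1 / (2 * pi)) * ennreal (\<bar>u\<bar> * exp (- u\<^sup>2 / 2))"
        by (simp only: ennreal_mult' mult_1 divide_nonneg_nonneg zero_le_one pi_ge_zero mult_nonneg_nonneg zero_le_numeral)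
    qed
    also have "\<dots> = ennreal (1 / pi)"
      by (subst nn_integral_cmult, measurable, subst nn_integral_abs_exp, subst ennreal_mult'[symmetric]) simp_all
    finally show "(\<integral>\<^sup>+x. 1 * ennreal (\<bar>x\<bar> * exp (- x\<^sup>2 * (1 + t\<^sup>2) / 2) / (2 * pi)) \<partial>lborel) * indicator {..<- c / s} t
      = ennreal (1 / pi) * (ennreal (1 / (1 + t\<^sup>2)) * indicator {..<- c / s} t)"
      using nn_integral_scaled_abs_exp[of "\<lambda>_. 1" t] by (simp add: mult_ac)
  qed
  also have "\<dots> = ennreal (1 / pi) * (\<integral>\<^sup>+t\<in>{..<- c / s}. ennreal (1 / (1 + t\<^sup>2)) \<partial>lborel)"
    by (rule nn_integral_cmult) measurable
  also have "(\<integral>\<^sup>+t\<in>{..<- c / s}. ennreal (1 / (1 + t\<^sup>2)) \<partial>lborel) = (\<integral>\<^sup>+t\<in>{c / s<..}. ennreal (1 / (1 + t\<^sup>2)) \<partial>lborel)"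
    by (subst nn_integral_real_affine[where c="-1" and t=0]) (auto intro!: nn_integral_cong split: split_indicator)
  also have "\<dots> = (\<integral>\<^sup>+t\<in>{c / s..}. ennreal (1 / (1 + t\<^sup>2)) \<partial>lborel)"
    by (intro nn_integral_cong_AE eventually_mono[OF AE_lborel_singleton[of "c / s"]]) (auto split: split_indicator)
  also have "\<dots> = ennreal (pi / 2 - arctan (c / s))" by (rule nn_integral_inverse_one_plus_square)
  also have "s = sqrt (1 - c\<^sup>2)" using cs s by (metis add_diff_cancel_left' less_imp_le real_sqrt_unique)
  then have "pi / 2 - arctan (c / s) = arccos c" using c by (subst arccos_arctan) auto
  finally show ?thesis using arccos_lbound[of c] c by (simp flip: ennreal_mult')
qed

text \<open>For U = V the product is a square, for U = - V it is the negative of a square that is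
  almost surely nonzero. Otherwise Gram-Schmidt gives V = c U + s W and the planar wedge
  applies.\<close>

lemma emeasure_gauss_sign_change:
  fixes U V :: "'a::euclidean_space"
  assumes U: "norm U = 1" and V: "norm V = 1"
  shows "emeasure gauss {z. (z \<bullet> U) * (z \<bullet> V) < 0} = ennreal (arccos (U \<bullet> V) / pi)"
proof -
  define c where "c = U \<bullet> V"
  have n2: "norm (U - V) ^ 2 = 2 - 2 * c" "norm (U + V) ^ 2 = 2 + 2 * c"
    using U V by (simp_all add: c_def power2_norm_eq_inner inner_diff_left inner_diff_right inner_add_left inner_add_right inner_commute[of V U] norm_eq_1)
  have c1: "-1 \<le> c" "c \<le> 1"
    using n2 zero_le_power2[of "norm (U - V)"] zero_le_power2[of "norm (U + V)"] by auto
  consider "c = 1" | "c = -1" | "-1 < c" "c < 1" using c1 by linarith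
  then show ?thesis
  proof cases
    case 1
    then have "U = V" using n2 by simp
    then show ?thesis using 1 V by (simp add: dot_square_norm not_less[symmetric])
  next
    case 2
    then have V: "V = - U" using n2 by (simp add: add_eq_0_iff)
    interpret prob_space "gauss :: 'a measure" by (rule prob_space_gauss)
    have "emeasure gauss {z. z \<bullet> U = 0} = emeasure (distr gauss borel (\<lambda>z. z \<bullet> U)) {0}"
      by (subst emeasure_distr) (auto intro!: arg_cong[where f="emeasure gauss"])
    also have "\<dots> = 0"
      unfolding distr_gauss_inner[OF U] gauss_real by (subst emeasure_density) (auto simp: nn_integral_cmult_indicator nn_integral_0_iff_AE intro!: eventually_mono[OF AE_lborel_singleton[of "0::real"]])
    finally have "AE z in gauss. z \<bullet> U \<noteq> 0"
      by (subst AE_iff_measurable[OF _ refl]) auto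
    moreover have "(z \<bullet> U) * (z \<bullet> V) < 0 \<longleftrightarrow> z \<bullet> U \<noteq> 0" for z
      by (auto simp: V zero_less_mult_iff)
    ultimately have "emeasure gauss {z. (z \<bullet> U) * (z \<bullet> V) < 0} = emeasure gauss (space (gauss :: 'a measure))"
      by (intro emeasure_eq_AE) auto
    then show ?thesis using 2 emeasure_space_1 by (simp add: c_def)
  next
    case 3
    define s where "s = sqrt (1 - c\<^sup>2)"
    have "c\<^sup>2 < 1" using 3 by (simp add: abs_square_less_1 abs_less_iff)
    then have s: "s > 0" and cs: "c\<^sup>2 + s\<^sup>2 = 1" by (auto simp: s_def)
    define W where "W = (1 / s) *\<^sub>R (V - c *\<^sub>R U)"
    have "(V - c *\<^sub>R U) \<bullet> (V - c *\<^sub>R U) = 1 - c\<^sup>2"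
    proof -
      have "U \<bullet> U = 1" "V \<bullet> V = 1" using U V by (simp_all add: dot_square_norm)
      then show ?thesis
        by (simp add: inner_diff_left inner_diff_right c_def[symmetric] inner_commute[of V U] power2_eq_square del: inner_gt_zero_iff)
    qed
    then have "(norm (V - c *\<^sub>R U))\<^sup>2 = s\<^sup>2"
      using cs by (simp add: power2_norm_eq_inner)
    then have W: "norm W = 1" using s by (simp add: W_def)
    have UW: "U \<bullet> W = 0" using U by (simp add: W_def inner_diff_right dot_square_norm c_def[symmetric])
    have V': "V = c *\<^sub>R U + s *\<^sub>R W" using s by (simp add: W_def)
    have "Measurable.pred (borel \<Otimes>\<^sub>M borel) (\<lambda>(x, y). x * (c * x + s * y) < (0::real))" by measurable
    then have m: "{(x, y). x * (c * x + s * y) < 0} \<in> sets (borel :: (real \<times> real) measure)"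
      by (simp add: pred_def borel_prod space_pair_measure split_beta')
    have "emeasure gauss {z. (z \<bullet> U) * (z \<bullet> V) < 0} = emeasure (distr gauss borel (\<lambda>v. (v \<bullet> U, v \<bullet> W))) {(x, y). x * (c * x + s * y) < (0::real)}"
      using m by (subst emeasure_distr) (auto simp: V' inner_add_right borel_prod[symmetric] intro!: arg_cong[where f="emeasure gauss"])
    also have "\<dots> = ennreal (arccos c / pi)"
      unfolding distr_gauss_inner_pair[OF U W UW] by (rule emeasure_gauss_wedge[OF s cs])
    finally show ?thesis by (simp add: c_def)
  qed
qed

text \<open>An angle \<theta> subtends a chord of length 2 sin (\<theta> / 2). The chord form is
  smooth at small angles, where arccos itself has a vertical tangent.\<close>

lemma arccos_inner_unit:
  fixes U V :: "'a::real_inner"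
  assumes U: "norm U = 1" and V: "norm V = 1"
  shows "arccos (U \<bullet> V) = 2 * arcsin (norm (U - V) / 2)"
proof -
  define c where "c = U \<bullet> V"
  have n2: "norm (U - V) ^ 2 = 2 - 2 * c"
    using U V by (simp add: c_def power2_norm_eq_inner inner_diff_left inner_diff_right inner_commute[of V U] norm_eq_1)
  have le: "norm (U - V) \<le> 2" using norm_triangle_ineq4[of U V] U V by simp
  define x where "x = arcsin (norm (U - V) / 2)"
  have ge: "-1 \<le> norm (U - V) / 2" by (rule order_trans[of _ 0]) simp_all
  have sx: "sin x = norm (U - V) / 2" unfolding x_def using le ge by (intro sin_arcsin) simp_all
  from ge have x: "0 \<le> x" "x \<le> pi / 2"
    unfolding x_def using le arcsin_bounded[of "norm (U - V) / 2"] arcsin_le_arcsin[of 0 "norm (U - V) / 2"]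
    by auto
  have "cos (2 * x) = c"
    unfolding cos_double_sin sx power_divide n2 by (simp add: field_simps)
  then have "arccos c = 2 * x" using x arccos_cos[of "2 * x"] by simp
  then show ?thesis by (simp add: c_def x_def)
qed

text \<open>The radial weight |u| cancels the denominator: |u| sqrt (1 + r^2 / u^2) = sqrt (u^2 +
  r^2). The constant is the quotient of the prefactor 1 / 2 of the radial density and the prefactor
  1 / sqrt (2 pi) of the scalar Gaussian.\<close>

lemma nn_integral_gauss_sqrt_ratio:
  "(\<integral>\<^sup>+h. ennreal (sqrt (1 + r\<^sup>2 / (norm h)\<^sup>2)) \<partial>(gauss :: (real \<times> real) measure)) =
    ennreal (sqrt (pi / 2)) * (\<integral>\<^sup>+z. ennreal (sqrt (z\<^sup>2 + r\<^sup>2)) \<partial>(gauss :: real measure))"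
proof -
  have "(\<integral>\<^sup>+h. ennreal (sqrt (1 + r\<^sup>2 / (norm h)\<^sup>2)) \<partial>(gauss :: (real \<times> real) measure))
     = (\<integral>\<^sup>+u. ennreal (sqrt (1 + r\<^sup>2 / \<bar>u\<bar>\<^sup>2)) * ennreal (\<bar>u\<bar> * exp (- u\<^sup>2 / 2) / 2) \<partial>lborel)"
    by (rule nn_integral_gauss_radial) measurable
  also have "\<dots> = (\<integral>\<^sup>+u. ennreal (sqrt (pi / 2)) * (ennreal (std_normal_density u) * ennreal (sqrt (u\<^sup>2 + r\<^sup>2))) \<partial>lborel)"
  proof (intro nn_integral_cong_AE eventually_mono[OF AE_lborel_singleton[of "0::real"]])
    fix u :: real assume u: "u \<noteq> 0"
    have "sqrt (u\<^sup>2 + r\<^sup>2) = sqrt (u\<^sup>2 * (1 + r\<^sup>2 / u\<^sup>2))" using u by (simp add: distrib_left)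
    also have "\<dots> = \<bar>u\<bar> * sqrt (1 + r\<^sup>2 / \<bar>u\<bar>\<^sup>2)" by (simp only: real_sqrt_mult real_sqrt_abs power2_abs)
    finally have 1: "sqrt (u\<^sup>2 + r\<^sup>2) = \<bar>u\<bar> * sqrt (1 + r\<^sup>2 / \<bar>u\<bar>\<^sup>2)" .
    have "sqrt (pi / 2) / sqrt (2 * pi) = sqrt ((pi / 2) / (2 * pi))"
      by (simp only: real_sqrt_divide)
    also have "(pi / 2) / (2 * pi) = (1 / 2)\<^sup>2"
      by (simp add: power2_eq_square)
    finally have "sqrt (pi / 2) / sqrt (2 * pi) = 1 / 2"
      by simp
    then have "sqrt (1 + r\<^sup>2 / \<bar>u\<bar>\<^sup>2) * (\<bar>u\<bar> * exp (- u\<^sup>2 / 2) / 2) = sqrt (pi / 2) * (std_normal_density u * sqrt (u\<^sup>2 + r\<^sup>2))"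
      unfolding 1 std_normal_density_def by (simp add: field_simps)
    moreover have "ennreal (sqrt (1 + r\<^sup>2 / \<bar>u\<bar>\<^sup>2) * (\<bar>u\<bar> * exp (- u\<^sup>2 / 2) / 2)) = ennreal (sqrt (1 + r\<^sup>2 / \<bar>u\<bar>\<^sup>2)) * ennreal (\<bar>u\<bar> * exp (- u\<^sup>2 / 2) / 2)"
      by (rule ennreal_mult'') simp
    moreover have "ennreal (sqrt (pi / 2) * (std_normal_density u * sqrt (u\<^sup>2 + r\<^sup>2))) = ennreal (sqrt (pi / 2)) * (ennreal (std_normal_density u) * ennreal (sqrt (u\<^sup>2 + r\<^sup>2)))"
      by (simp add: ennreal_mult')
    ultimately show "ennreal (sqrt (1 + r\<^sup>2 / \<bar>u\<bar>\<^sup>2)) * ennreal (\<bar>u\<bar> * exp (- u\<^sup>2 / 2) / 2) = ennreal (sqrt (pi / 2)) * (ennreal (std_normal_density u) * ennreal (sqrt (u\<^sup>2 + r\<^sup>2)))"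
      by (simp only:)
  qed
  also have "\<dots> = ennreal (sqrt (pi / 2)) * (\<integral>\<^sup>+z. ennreal (sqrt (z\<^sup>2 + r\<^sup>2)) \<partial>(gauss :: real measure))"
    by (subst nn_integral_gauss_real, measurable, subst nn_integral_cmult, auto)
  finally show ?thesis .
qed

section \<open>Planar moments of order 3/2 and -3/2\<close>

lemma nn_integral_abs_power_exp_finite: "(\<integral>\<^sup>+u. ennreal (\<bar>u\<bar> ^ k * exp (- u\<^sup>2 / 2)) \<partial>lborel) < \<infinity>"
proof -
  have "integrable lborel (\<lambda>u. sqrt (2 * pi) * (std_normal_density u * \<bar>u\<bar> ^ k))"
    by (intro integrable_mult_right integrable_std_normal_moment_abs)
  moreover have "sqrt (2 * pi) * (std_normal_density u * \<bar>u\<bar> ^ k) = \<bar>u\<bar> ^ k * exp (- u\<^sup>2 / 2)" for u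
    by (simp add: std_normal_density_def)
  ultimately have "integrable lborel (\<lambda>u::real. \<bar>u\<bar> ^ k * exp (- u\<^sup>2 / 2))" by (simp only:)
  then show ?thesis by (subst nn_integral_eq_integral) auto
qed

lemma nn_integral_gauss_norm_powr_finite:
  "(\<integral>\<^sup>+h. ennreal (sqrt (norm h) ^ 3) \<partial>(gauss :: (real \<times> real) measure)) < \<infinity>"
proof -
  have le: "sqrt \<bar>u\<bar> ^ 3 * (\<bar>u\<bar> * e / 2) \<le> \<bar>u\<bar> ^ 1 * e + \<bar>u\<bar> ^ 3 * e" if "e \<ge> 0" for u e :: real
  proof -
    have "sqrt \<bar>u\<bar> ^ 3 \<le> 1 + \<bar>u\<bar>\<^sup>2"
    proof (cases "\<bar>u\<bar> \<le> 1")
      case True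
      then have "sqrt \<bar>u\<bar> ^ 3 \<le> 1 ^ 3" by (intro power_mono) auto
      then have "sqrt \<bar>u\<bar> ^ 3 \<le> 1" by simp
      then show ?thesis using zero_le_power2[of "\<bar>u\<bar>"] by linarith
    next
      case False
      then have "sqrt \<bar>u\<bar> ^ 3 \<le> sqrt \<bar>u\<bar> ^ 4" by (intro power_increasing) auto
      also have "sqrt \<bar>u\<bar> ^ 4 = \<bar>u\<bar>\<^sup>2"
        using power_mult[of "sqrt \<bar>u\<bar>" 2 2] by simp
      finally show ?thesis by simp
    qed
    then have "sqrt \<bar>u\<bar> ^ 3 * (\<bar>u\<bar> * e) \<le> (1 + \<bar>u\<bar>\<^sup>2) * (\<bar>u\<bar> * e)" using that by (intro mult_right_mono) auto
    moreover have "0 \<le> sqrt \<bar>u\<bar> ^ 3 * (\<bar>u\<bar> * e)" using that by simp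
    ultimately show ?thesis by (simp add: algebra_simps power2_eq_square power3_eq_cube)
  qed
  have "(\<integral>\<^sup>+h. ennreal (sqrt (norm h) ^ 3) \<partial>(gauss :: (real \<times> real) measure))
     = (\<integral>\<^sup>+u. ennreal (sqrt \<bar>u\<bar> ^ 3) * ennreal (\<bar>u\<bar> * exp (- u\<^sup>2 / 2) / 2) \<partial>lborel)"
    by (rule nn_integral_gauss_radial) measurable
  also have "\<dots> \<le> (\<integral>\<^sup>+u. ennreal (\<bar>u\<bar> ^ 1 * exp (- u\<^sup>2 / 2)) + ennreal (\<bar>u\<bar> ^ 3 * exp (- u\<^sup>2 / 2)) \<partial>lborel)"
  proof (rule nn_integral_mono)
    fix u :: real
    have "ennreal (sqrt \<bar>u\<bar> ^ 3 * (\<bar>u\<bar> * exp (- u\<^sup>2 / 2) / 2)) \<le> ennreal (\<bar>u\<bar> ^ 1 * exp (- u\<^sup>2 / 2) + \<bar>u\<bar> ^ 3 * exp (- u\<^sup>2 / 2))"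
      by (intro ennreal_leI le) auto
    then show "ennreal (sqrt \<bar>u\<bar> ^ 3) * ennreal (\<bar>u\<bar> * exp (- u\<^sup>2 / 2) / 2) \<le> ennreal (\<bar>u\<bar> ^ 1 * exp (- u\<^sup>2 / 2)) + ennreal (\<bar>u\<bar> ^ 3 * exp (- u\<^sup>2 / 2))"
      by (subst ennreal_mult'[symmetric], simp, subst ennreal_plus[symmetric], simp_all del: ennreal_plus)
  qed
  also have "\<dots> = (\<integral>\<^sup>+u. ennreal (\<bar>u\<bar> ^ 1 * exp (- u\<^sup>2 / 2)) \<partial>lborel) + (\<integral>\<^sup>+u. ennreal (\<bar>u\<bar> ^ 3 * exp (- u\<^sup>2 / 2)) \<partial>lborel)"
    by (rule nn_integral_add) auto
  also have "\<dots> < \<infinity>"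
    using nn_integral_abs_power_exp_finite[of 1] nn_integral_abs_power_exp_finite[of 3] by simp
  finally show ?thesis .
qed

text \<open>\<open>sqrt (norm h) ^ 3\<close> is the power 3/2 of the norm. Its inverse is integrable
  in the plane because the radial weight |u| reduces the singularity to |u| powr (-1/2).\<close>

lemma nn_integral_gauss_inverse_norm_powr_finite:
  "(\<integral>\<^sup>+h. ennreal (1 / sqrt (norm h) ^ 3) \<partial>(gauss :: (real \<times> real) measure)) < \<infinity>"
proof -
  \<comment> \<open>f u + f (- u) dominates the singular part for |u| \<le> 1, one summand for each
    sign; outside, the Gaussian factor alone dominates.\<close>
  define f :: "real \<Rightarrow> real" where "f u = (if u \<in> {0..1} then u powr (-1/2) else 0)" for u
  have f_meas [measurable]: "f \<in> borel_measurable borel" unfolding f_def by measurable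
  have "((\<lambda>u::real. u powr (-1/2)) has_integral (1 powr (-1/2 + 1) / (-1/2 + 1))) {0..1}"
    by (rule has_integral_powr_from_0) auto
  then have "(f has_integral 2) UNIV" unfolding f_def by (subst has_integral_restrict_UNIV) simp
  moreover have fpos: "0 \<le> f u" for u by (auto simp: f_def)
  ultimately have f_int: "(\<integral>\<^sup>+u. ennreal (f u) \<partial>lborel) = ennreal 2"
    by (intro nn_integral_has_integral_lborel) auto
  have le: "1 / sqrt \<bar>u\<bar> ^ 3 * (\<bar>u\<bar> * exp (- u\<^sup>2 / 2) / 2) \<le> f u + f (- u) + \<bar>u\<bar> ^ 0 * exp (- u\<^sup>2 / 2)" if "u \<noteq> 0" for u
  proof -
    define s where "s = sqrt \<bar>u\<bar>"
    have s: "s > 0" "\<bar>u\<bar> = s * s" using that by (auto simp: s_def)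
    have "1 / sqrt \<bar>u\<bar> ^ 3 * \<bar>u\<bar> = 1 / sqrt \<bar>u\<bar>"
      unfolding s_def[symmetric] unfolding s(2) using s(1) by (simp add: power3_eq_cube)
    then have "1 / sqrt \<bar>u\<bar> ^ 3 * (\<bar>u\<bar> * exp (- u\<^sup>2 / 2) / 2) = 1 / sqrt \<bar>u\<bar> * exp (- u\<^sup>2 / 2) / 2"
      by (metis mult.assoc times_divide_eq_right)
    also have "\<dots> \<le> 1 / sqrt \<bar>u\<bar> * exp (- u\<^sup>2 / 2)"
      using that by (simp add: divide_simps)
    also have "\<dots> \<le> f u + f (- u) + exp (- u\<^sup>2 / 2)"
    proof (cases "\<bar>u\<bar> \<le> 1")
      case True
      have "1 / sqrt \<bar>u\<bar> * exp (- u\<^sup>2 / 2) \<le> 1 / sqrt \<bar>u\<bar> * 1" by (intro mult_left_mono) auto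
      also have "\<dots> = \<bar>u\<bar> powr (-1/2)" using that by (simp add: powr_minus powr_half_sqrt divide_simps)
      also have "\<dots> \<le> f u + f (- u)" using True by (auto simp: f_def abs_if)
      finally show ?thesis by (simp add: add_increasing2)
    next
      case False
      then have "1 / sqrt \<bar>u\<bar> * exp (- u\<^sup>2 / 2) \<le> 1 * exp (- u\<^sup>2 / 2)" by (intro mult_right_mono) auto
      moreover have "0 \<le> f u" "0 \<le> f (- u)" by (auto simp: f_def)
      ultimately show ?thesis by simp
    qed
    finally show ?thesis by simp
  qed
  have "(\<integral>\<^sup>+h. ennreal (1 / sqrt (norm h) ^ 3) \<partial>(gauss :: (real \<times> real) measure))
     = (\<integral>\<^sup>+u. ennreal (1 / sqrt \<bar>u\<bar> ^ 3) * ennreal (\<bar>u\<bar> * exp (- u\<^sup>2 / 2) / 2) \<partial>lborel)"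
    by (rule nn_integral_gauss_radial) measurable
  also have "\<dots> \<le> (\<integral>\<^sup>+u. ennreal (f u) + ennreal (f (- u)) + ennreal (\<bar>u\<bar> ^ 0 * exp (- u\<^sup>2 / 2)) \<partial>lborel)"
  proof (intro nn_integral_mono_AE eventually_mono[OF AE_lborel_singleton[of "0::real"]])
    fix u :: real assume "u \<noteq> 0"
    from le[OF this] have "ennreal (1 / sqrt \<bar>u\<bar> ^ 3 * (\<bar>u\<bar> * exp (- u\<^sup>2 / 2) / 2)) \<le> ennreal (f u + f (- u) + \<bar>u\<bar> ^ 0 * exp (- u\<^sup>2 / 2))"
      by (rule ennreal_leI)
    moreover have "ennreal (f u + f (- u) + \<bar>u\<bar> ^ 0 * exp (- u\<^sup>2 / 2)) = ennreal (f u) + ennreal (f (- u)) + ennreal (\<bar>u\<bar> ^ 0 * exp (- u\<^sup>2 / 2))"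
      using fpos[of u] fpos[of "- u"] by simp
    moreover have "ennreal (1 / sqrt \<bar>u\<bar> ^ 3 * (\<bar>u\<bar> * exp (- u\<^sup>2 / 2) / 2)) = ennreal (1 / sqrt \<bar>u\<bar> ^ 3) * ennreal (\<bar>u\<bar> * exp (- u\<^sup>2 / 2) / 2)"
      by (rule ennreal_mult') simp
    ultimately show "ennreal (1 / sqrt \<bar>u\<bar> ^ 3) * ennreal (\<bar>u\<bar> * exp (- u\<^sup>2 / 2) / 2) \<le> ennreal (f u) + ennreal (f (- u)) + ennreal (\<bar>u\<bar> ^ 0 * exp (- u\<^sup>2 / 2))"
      by simp
  qed
  also have "\<dots> = (\<integral>\<^sup>+u. ennreal (f u) \<partial>lborel) + (\<integral>\<^sup>+u. ennreal (f (- u)) \<partial>lborel) + (\<integral>\<^sup>+u. ennreal (\<bar>u\<bar> ^ 0 * exp (- u\<^sup>2 / 2)) \<partial>lborel)"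
    by (simp add: nn_integral_add)
  also have "(\<integral>\<^sup>+u. ennreal (f (- u)) \<partial>lborel) = (\<integral>\<^sup>+u. ennreal (f u) \<partial>lborel)"
    using nn_integral_real_affine[of "\<lambda>u. ennreal (f u)" "-1" 0] by simp
  also note f_int
  also have "ennreal 2 + ennreal 2 + (\<integral>\<^sup>+u. ennreal (\<bar>u\<bar> ^ 0 * exp (- u\<^sup>2 / 2)) \<partial>lborel) < \<infinity>"
    using nn_integral_abs_power_exp_finite[of 0] by simp
  finally show ?thesis .
qed

section \<open>Counting zeros by sign changes on a grid\<close>

text \<open>The parameter \<open>N\<close> stands for \<open>Suc N\<close> cells, so no grid is
  empty and no division by zero occurs.\<close>

definition grid :: "real \<Rightarrow> real \<Rightarrow> nat \<Rightarrow> nat \<Rightarrow> real" where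
  "grid a b N i = a + (b - a) * real i / real (Suc N)"

lemma grid_mem: "a \<le> b \<Longrightarrow> i \<le> Suc N \<Longrightarrow> grid a b N i \<in> {a..b}"
proof -
  assume "a \<le> b" "i \<le> Suc N"
  moreover from this have "real i / real (Suc N) \<le> 1" by simp
  ultimately have "0 \<le> (b - a) * (real i / real (Suc N))" "(b - a) * (real i / real (Suc N)) \<le> (b - a) * 1"
    by (simp, intro mult_left_mono, simp_all only: diff_ge_0_iff_ge)
  then show ?thesis unfolding grid_def times_divide_eq_right[symmetric] by simp
qed

lemma grid_mono: "a \<le> b \<Longrightarrow> i \<le> j \<Longrightarrow> grid a b N i \<le> grid a b N j"
  by (auto simp: grid_def intro!: divide_right_mono mult_left_mono)

lemma grid_Suc: "grid a b N (Suc i) = grid a b N i + (b - a) / real (Suc N)"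
  by (simp add: grid_def algebra_simps add_divide_distrib diff_divide_distrib)

lemma discrete_sign_change:
  fixes h :: "nat \<Rightarrow> real"
  assumes "i \<le> j" "h i * h j < 0" "\<And>k. k \<in> {i..j} \<Longrightarrow> h k \<noteq> 0"
  shows "\<exists>k\<in>{i..<j}. h k * h (Suc k) < 0"
proof (rule ccontr)
  assume no: "\<not> ?thesis"
  have "h i * h k > 0" if "i \<le> k" "k \<le> j" for k
    using that
  proof (induction k rule: dec_induct)
    case base then show ?case using assms(3)[of i] assms(1) by (auto simp: zero_less_mult_iff linorder_neq_iff)
  next
    case (step k)
    then have "h k * h (Suc k) \<ge> 0" "h (Suc k) \<noteq> 0" using no assms(3)[of "Suc k"] by (auto simp: not_less)
    with step show ?case by (auto simp: zero_less_mult_iff zero_le_mult_iff)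
  qed
  from this[of j] assms show False by simp
qed

definition sign_changes :: "(real \<Rightarrow> real) \<Rightarrow> real \<Rightarrow> real \<Rightarrow> nat \<Rightarrow> nat set" where
  "sign_changes F a b N = {i. i < Suc N \<and> F (grid a b N i) * F (grid a b N (Suc i)) < 0}"

lemma finite_sign_changes [simp]: "finite (sign_changes F a b N)"
  by (rule finite_subset[of _ "{..<Suc N}"]) (auto simp: sign_changes_def)

text \<open>The intermediate value theorem gives a zero strictly inside each cell with a sign
  change, and interiors of different cells are disjoint.\<close>

lemma card_sign_changes_le_num_points:
  assumes ab: "a \<le> b" and cont: "continuous_on {a..b} F"
  shows "of_nat (card (sign_changes F a b N)) \<le> num_points {t \<in> {a..b}. F t = 0}"
proof -
  let ?Z = "{t \<in> {a..b}. F t = 0}" and ?S = "sign_changes F a b N" and ?g = "grid a b N"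
  have "\<exists>z. ?g i < z \<and> z < ?g (Suc i) \<and> F z = 0" if "i \<in> ?S" for i
  proof -
    have i: "i < Suc N" "F (?g i) * F (?g (Suc i)) < 0" using that by (auto simp: sign_changes_def)
    have le: "?g i \<le> ?g (Suc i)" using ab by (intro grid_mono) auto
    have sub: "{?g i..?g (Suc i)} \<subseteq> {a..b}"
      using grid_mem[OF ab, of i N] grid_mem[OF ab, of "Suc i" N] i(1) by auto
    have c: "continuous_on {?g i..?g (Suc i)} F" by (rule continuous_on_subset[OF cont sub])
    have "\<exists>z. ?g i \<le> z \<and> z \<le> ?g (Suc i) \<and> F z = 0"
      using i(2) IVT'[of F "?g i" 0 "?g (Suc i)", OF _ _ le c] IVT2'[of F "?g (Suc i)" 0 "?g i", OF _ _ le c]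
      by (auto simp: mult_less_0_iff)
    then obtain z where "?g i \<le> z" "z \<le> ?g (Suc i)" "F z = 0" by blast
    moreover have "z \<noteq> ?g i" "z \<noteq> ?g (Suc i)" using \<open>F z = 0\<close> i(2) by auto
    ultimately show ?thesis by (intro exI[of _ z]) auto
  qed
  then obtain z where z: "\<And>i. i \<in> ?S \<Longrightarrow> ?g i < z i \<and> z i < ?g (Suc i) \<and> F (z i) = 0" by metis
  have "inj_on z ?S"
  proof (rule linorder_inj_onI)
    fix i j assume "i < j" "i \<in> ?S" "j \<in> ?S"
    with z[of i] z[of j] grid_mono[OF ab, of "Suc i" j N] show "z i \<noteq> z j" by auto
  qed auto
  moreover have "z ` ?S \<subseteq> ?Z"
  proof
    fix x assume "x \<in> z ` ?S"
    then obtain i where i: "i \<in> ?S" "x = z i" by blast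
    then have "i < Suc N" by (auto simp: sign_changes_def)
    with z[OF i(1)] i grid_mem[OF ab, of i N] grid_mem[OF ab, of "Suc i" N] show "x \<in> ?Z" by auto
  qed
  ultimately have "of_nat (card ?S) \<le> emeasure (count_space UNIV) ?Z"
    using emeasure_mono[of "z ` ?S" ?Z "count_space UNIV"]
    by (simp add: card_image)
  then show ?thesis by (simp add: num_points_def)
qed

text \<open>F keeps its sign near \<open>p\<close> and near \<open>q\<close>. A fine grid has points
  close to both, and between two grid points of opposite sign some cell changes sign; the cell lies
  between them and hence in the ball.\<close>

lemma eventually_sign_change_in_ball:
  assumes ab: "a < b" and cont: "continuous_on {a..b} F"
    and nz: "\<And>N i. i \<le> Suc N \<Longrightarrow> F (grid a b N i) \<noteq> 0"
    and p: "p \<in> {a<..<b}" "\<bar>p - t\<bar> < e" "F p < 0" and q: "q \<in> {a<..<b}" "\<bar>q - t\<bar> < e" "F q > 0"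
  shows "\<forall>\<^sub>F N in sequentially. \<exists>i\<in>sign_changes F a b N. \<bar>grid a b N i - t\<bar> < e \<and> \<bar>grid a b N (Suc i) - t\<bar> < e"
proof -
  have c: "isCont F x" if "x \<in> {a<..<b}" for x
    using cont that by (intro continuous_on_interior[of "{a..b}"]) auto
  have "\<forall>\<^sub>F x in at p. F x < 0" "\<forall>\<^sub>F x in at q. F x > 0"
    using c[OF p(1)] c[OF q(1)] p(3) q(3) by (auto simp: isCont_def intro: order_tendstoD)
  then obtain d1 d2 where d: "d1 > 0" "d2 > 0" "\<And>x. x \<noteq> p \<Longrightarrow> dist x p < d1 \<Longrightarrow> F x < 0" "\<And>x. x \<noteq> q \<Longrightarrow> dist x q < d2 \<Longrightarrow> F x > 0"
    unfolding eventually_at by auto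
  \<comment> \<open>Within distance \<eta> to the left of \<open>p\<close> and \<open>q\<close> the
    sign persists and the ball is not left.\<close>
  define \<eta> where "\<eta> = Min {d1, d2, e - \<bar>p - t\<bar>, e - \<bar>q - t\<bar>}"
  have \<eta>: "\<eta> > 0" "\<eta> \<le> d1" "\<eta> \<le> d2" "\<eta> \<le> e - \<bar>p - t\<bar>" "\<eta> \<le> e - \<bar>q - t\<bar>"
    using d p q by (auto simp: \<eta>_def)
  have "(\<lambda>N. (b - a) / real (Suc N)) \<longlonglongrightarrow> 0"
    by (rule LIMSEQ_Suc) (rule lim_const_over_n)
  then have "\<forall>\<^sub>F N in sequentially. (b - a) / real (Suc N) < \<eta>"
    using \<eta>(1) by (rule order_tendstoD(2))
  then show ?thesis
  proof eventually_elim
    fix N assume N: "(b - a) / real (Suc N) < \<eta>"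
    have approx: "\<exists>i\<le>Suc N. grid a b N i \<le> x \<and> x - \<eta> < grid a b N i" if x: "x \<in> {a<..<b}" for x
    proof -
      \<comment> \<open>The index of the last grid point that is not to the right of
        \<open>x\<close>.\<close>
      define i where "i = nat \<lfloor>(x - a) * real (Suc N) / (b - a)\<rfloor>"
      have pos: "0 \<le> (x - a) * real (Suc N) / (b - a)" using x ab by auto
      then have i: "real i \<le> (x - a) * real (Suc N) / (b - a)" "(x - a) * real (Suc N) / (b - a) < real i + 1"
        unfolding i_def by linarith+
      have h: "(b - a) / real (Suc N) > 0" using ab by simp
      have "(x - a) * real (Suc N) / (b - a) * ((b - a) / real (Suc N)) = x - a" using ab by (simp del: of_nat_Suc)
      then have "real i * ((b - a) / real (Suc N)) \<le> x - a" "x - a < (real i + 1) * ((b - a) / real (Suc N))"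
        using mult_right_mono[OF i(1), of "(b - a) / real (Suc N)"] mult_strict_right_mono[OF i(2) h] h by simp_all
      then have g: "grid a b N i \<le> x" "x < grid a b N i + (b - a) / real (Suc N)"
        by (simp_all add: grid_def algebra_simps add_divide_distrib diff_divide_distrib del: of_nat_Suc)
      have "(x - a) * real (Suc N) / (b - a) < real (Suc N)"
        using x ab by (simp add: field_simps del: of_nat_Suc)
      then have "i \<le> Suc N" using i(1) by linarith
      with g N show ?thesis by (intro exI[of _ i]) auto
    qed
    from approx[OF p(1)] obtain i where i: "i \<le> Suc N" "grid a b N i \<le> p" "p - \<eta> < grid a b N i" by blast
    from approx[OF q(1)] obtain j where j: "j \<le> Suc N" "grid a b N j \<le> q" "q - \<eta> < grid a b N j" by blast
    have Fi: "F (grid a b N i) < 0" using d(3)[of "grid a b N i"] i \<eta> p(3) by (cases "grid a b N i = p") (auto simp: dist_real_def)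
    have Fj: "F (grid a b N j) > 0" using d(4)[of "grid a b N j"] j \<eta> q(3) by (cases "grid a b N j = q") (auto simp: dist_real_def)
    have bi: "\<bar>grid a b N i - t\<bar> < e" "\<bar>grid a b N j - t\<bar> < e" using i j \<eta> by linarith+
    define i' j' where "i' = min i j" and "j' = max i j"
    have ij: "i' \<le> j'" "j' \<le> Suc N" using i j by (auto simp: i'_def j'_def)
    have "F (grid a b N i') * F (grid a b N j') < 0" using Fi Fj by (auto simp: i'_def j'_def min_def max_def mult_less_0_iff)
    then obtain k where k: "k \<in> {i'..<j'}" "F (grid a b N k) * F (grid a b N (Suc k)) < 0"
      using discrete_sign_change[of i' j' "\<lambda>k. F (grid a b N k)"] ij nz by auto
    have b': "\<bar>grid a b N i' - t\<bar> < e" "\<bar>grid a b N j' - t\<bar> < e" using bi by (auto simp: i'_def j'_def min_def max_def)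
    have "grid a b N i' \<le> grid a b N k" "grid a b N k \<le> grid a b N (Suc k)" "grid a b N (Suc k) \<le> grid a b N j'"
      using k(1) ab by (auto intro!: grid_mono)
    with b' have "\<bar>grid a b N k - t\<bar> < e" "\<bar>grid a b N (Suc k) - t\<bar> < e" by linarith+
    moreover have "k \<in> sign_changes F a b N" using k ij by (auto simp: sign_changes_def)
    ultimately show "\<exists>i\<in>sign_changes F a b N. \<bar>grid a b N i - t\<bar> < e \<and> \<bar>grid a b N (Suc i) - t\<bar> < e" by blast
  qed
qed

text \<open>Finitely many zeros have disjoint neighbourhoods of a common radius, and each
  neighbourhood eventually contains a cell with a sign change. An infinite zero set is treated
  through its finite subsets of every size.\<close>

lemma num_points_le_liminf_sign_changes:
  assumes ab: "a < b" and cont: "continuous_on {a..b} F"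
    and nz: "\<And>N i. i \<le> Suc N \<Longrightarrow> F (grid a b N i) \<noteq> 0"
    and cross: "\<And>t e. t \<in> {a<..<b} \<Longrightarrow> F t = 0 \<Longrightarrow> e > 0 \<Longrightarrow>
      (\<exists>p\<in>{a<..<b}. \<bar>p - t\<bar> < e \<and> F p < 0) \<and> (\<exists>q\<in>{a<..<b}. \<bar>q - t\<bar> < e \<and> F q > 0)"
  shows "num_points {t \<in> {a..b}. F t = 0} \<le> liminf (\<lambda>N. of_nat (card (sign_changes F a b N)))"
proof -
  let ?Z = "{t \<in> {a..b}. F t = 0}"
  \<comment> \<open>The end points are grid points, so all zeros are interior and
    \<open>cross\<close> applies to them.\<close>
  have ends: "F a \<noteq> 0" "F b \<noteq> 0" using nz[of 0 0] nz[of 1 0] by (simp_all add: grid_def)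
  have fin: "of_nat (card T) \<le> liminf (\<lambda>N. of_nat (card (sign_changes F a b N)) :: ennreal)"
    if T: "finite T" "T \<subseteq> ?Z" for T
  proof (rule Liminf_bounded)
    have "\<exists>e>0. \<forall>x\<in>T. \<forall>y\<in>T. x \<noteq> y \<longrightarrow> 2 * e \<le> \<bar>x - y\<bar>"
    proof -
      \<comment> \<open>The element 1 keeps \<open>D\<close> nonempty when \<open>T\<close> has at
        most one point.\<close>
      define D where "D = insert 1 ((\<lambda>(x, y). \<bar>x - y\<bar> / 2) ` {(x, y) \<in> T \<times> T. x \<noteq> y})"
      have f: "finite D" unfolding D_def using T(1) by (intro finite.insertI finite_imageI finite_subset[of "{(x, y) \<in> T \<times> T. x \<noteq> y}" "T \<times> T"]) auto
      have pos: "Min D > 0" using f by (subst Min_gr_iff) (auto simp: D_def)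
      moreover have "2 * Min D \<le> \<bar>x - y\<bar>" if "x \<in> T" "y \<in> T" "x \<noteq> y" for x y
      proof -
        have "\<bar>x - y\<bar> / 2 \<in> D" using that by (force simp: D_def)
        then have "Min D \<le> \<bar>x - y\<bar> / 2" using f by (rule Min_le[rotated])
        then show ?thesis by simp
      qed
      ultimately show ?thesis by blast
    qed
    then obtain e where e: "e > 0" "\<And>x y. x \<in> T \<Longrightarrow> y \<in> T \<Longrightarrow> x \<noteq> y \<Longrightarrow> 2 * e \<le> \<bar>x - y\<bar>" by blast
    have "\<forall>\<^sub>F N in sequentially. \<forall>x\<in>T. \<exists>i\<in>sign_changes F a b N. \<bar>grid a b N i - x\<bar> < e \<and> \<bar>grid a b N (Suc i) - x\<bar> < e"
    proof (rule eventually_ball_finite[OF T(1)], rule ballI)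
      fix x assume x: "x \<in> T"
      then have x': "x \<in> {a<..<b}" "F x = 0" using T(2) ends by (auto simp: less_le)
      from cross[OF x' e(1)] obtain p q where "p\<in>{a<..<b}" "\<bar>p - x\<bar> < e" "F p < 0" "q\<in>{a<..<b}" "\<bar>q - x\<bar> < e" "F q > 0" by blast
      then show "\<forall>\<^sub>F N in sequentially. \<exists>i\<in>sign_changes F a b N. \<bar>grid a b N i - x\<bar> < e \<and> \<bar>grid a b N (Suc i) - x\<bar> < e"
        by (intro eventually_sign_change_in_ball[OF ab cont nz]) auto
    qed
    then show "\<forall>\<^sub>F N in sequentially. of_nat (card T) \<le> (of_nat (card (sign_changes F a b N)) :: ennreal)"
    proof eventually_elim
      fix N assume "\<forall>x\<in>T. \<exists>i\<in>sign_changes F a b N. \<bar>grid a b N i - x\<bar> < e \<and> \<bar>grid a b N (Suc i) - x\<bar> < e"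
      then obtain f where f: "\<And>x. x \<in> T \<Longrightarrow> f x \<in> sign_changes F a b N \<and> \<bar>grid a b N (f x) - x\<bar> < e" by metis
      have "inj_on f T"
      proof (rule inj_onI, rule ccontr)
        fix x y assume xy: "x \<in> T" "y \<in> T" "f x = f y" "x \<noteq> y"
        from f[OF xy(1)] f[OF xy(2)] xy(3) have "\<bar>x - y\<bar> < 2 * e" by auto
        with e(2)[OF xy(1,2,4)] show False by simp
      qed
      then have "card T \<le> card (sign_changes F a b N)"
        by (rule card_inj_on_le) (use f in auto)
      then show "of_nat (card T) \<le> (of_nat (card (sign_changes F a b N)) :: ennreal)" by simp
    qed
  qed
  show ?thesis
  proof (cases "finite ?Z")
    case True
    then show ?thesis using fin[of ?Z] by (simp add: num_points_def)
  next
    case False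
    have "of_nat n \<le> liminf (\<lambda>N. of_nat (card (sign_changes F a b N)) :: ennreal)" for n
    proof -
      obtain T where "finite T" "card T = n" "T \<subseteq> ?Z" using infinite_arbitrarily_large[OF False, of n] by blast
      with fin[of T] show ?thesis by simp
    qed
    then have "liminf (\<lambda>N. of_nat (card (sign_changes F a b N)) :: ennreal) = \<top>"
      by (metis ennreal_Ex_less_of_nat infinity_ennreal_def leD top.not_eq_extremum)
    then show ?thesis by simp
  qed
qed

lemma of_nat_card_sign_changes:
  "of_nat (card (sign_changes F a b N)) = (\<Sum>i<Suc N. indicator {x. x < 0} (F (grid a b N i) * F (grid a b N (Suc i))) :: ennreal)"
proof -
  have "sign_changes F a b N = {i \<in> {..<Suc N}. F (grid a b N i) * F (grid a b N (Suc i)) < 0}"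
    by (auto simp: sign_changes_def)
  then show ?thesis by (simp add: indicator_def sum.If_cases del: sum.lessThan_Suc) (simp add: Int_def conj_commute)
qed

lemma nn_integral_card_sign_changes:
  assumes ab: "a \<le> b" and [measurable]: "\<And>t. t \<in> {a..b} \<Longrightarrow> (\<lambda>\<omega>. F \<omega> t) \<in> borel_measurable P"
  shows "(\<integral>\<^sup>+\<omega>. of_nat (card (sign_changes (F \<omega>) a b N)) \<partial>P) =
    (\<Sum>i<Suc N. emeasure P {\<omega> \<in> space P. F \<omega> (grid a b N i) * F \<omega> (grid a b N (Suc i)) < 0})"
proof -
  have m: "(\<lambda>\<omega>. F \<omega> (grid a b N i)) \<in> borel_measurable P" if "i \<le> Suc N" for i
    using grid_mem[OF ab that] by measurable
  have "(\<integral>\<^sup>+\<omega>. of_nat (card (sign_changes (F \<omega>) a b N)) \<partial>P) =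
     (\<Sum>i<Suc N. \<integral>\<^sup>+\<omega>. indicator {x. x < 0} (F \<omega> (grid a b N i) * F \<omega> (grid a b N (Suc i))) \<partial>P)"
    unfolding of_nat_card_sign_changes by (rule nn_integral_sum) (use m in measurable)
  also have "\<dots> = (\<Sum>i<Suc N. emeasure P {\<omega> \<in> space P. F \<omega> (grid a b N i) * F \<omega> (grid a b N (Suc i)) < 0})"
  proof (rule sum.cong[OF refl])
    fix i assume "i \<in> {..<Suc N}"
    then have [measurable]: "(\<lambda>\<omega>. F \<omega> (grid a b N i)) \<in> borel_measurable P" "(\<lambda>\<omega>. F \<omega> (grid a b N (Suc i))) \<in> borel_measurable P"
      using m[of i] m[of "Suc i"] by auto
    have "(\<integral>\<^sup>+\<omega>. indicator {x. x < 0} (F \<omega> (grid a b N i) * F \<omega> (grid a b N (Suc i))) \<partial>P)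
      = (\<integral>\<^sup>+\<omega>. indicator {\<omega> \<in> space P. F \<omega> (grid a b N i) * F \<omega> (grid a b N (Suc i)) < 0} \<omega> \<partial>P)"
      by (intro nn_integral_cong) (auto split: split_indicator)
    also have "\<dots> = emeasure P {\<omega> \<in> space P. F \<omega> (grid a b N i) * F \<omega> (grid a b N (Suc i)) < 0}"
      by (rule nn_integral_indicator) measurable
    finally show "(\<integral>\<^sup>+\<omega>. indicator {x. x < 0} (F \<omega> (grid a b N i) * F \<omega> (grid a b N (Suc i))) \<partial>P) = \<dots>" .
  qed
  finally show ?thesis .
qed

lemma sum_sign_change_prob_le:
  fixes F :: "'a \<Rightarrow> real \<Rightarrow> real"
  assumes ab: "a \<le> b" and m: "\<And>t. t \<in> {a..b} \<Longrightarrow> (\<lambda>\<omega>. F \<omega> t) \<in> borel_measurable P"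
    and c: "\<And>\<omega>. \<omega> \<in> space P \<Longrightarrow> continuous_on {a..b} (F \<omega>)"
  shows "(\<Sum>i<Suc N. emeasure P {\<omega> \<in> space P. F \<omega> (grid a b N i) * F \<omega> (grid a b N (Suc i)) < 0})
    \<le> (\<integral>\<^sup>+\<omega>. num_points {t \<in> {a..b}. F \<omega> t = 0} \<partial>P)"
  using nn_integral_mono[of P "\<lambda>\<omega>. of_nat (card (sign_changes (F \<omega>) a b N))" "\<lambda>\<omega>. num_points {t \<in> {a..b}. F \<omega> t = 0}"]
  by (simp only: nn_integral_card_sign_changes[where F=F, OF ab m] card_sign_changes_le_num_points[OF ab c])

text \<open>Fatou's lemma applied to the pathwise bound. All grids together consist of countably
  many points, so almost surely none of them is a zero.\<close>

lemma expected_num_points_le_liminf: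
  fixes F :: "'a \<Rightarrow> real \<Rightarrow> real"
  assumes ab: "a < b" and m: "\<And>t. t \<in> {a..b} \<Longrightarrow> (\<lambda>\<omega>. F \<omega> t) \<in> borel_measurable P"
    and c: "\<And>\<omega>. \<omega> \<in> space P \<Longrightarrow> continuous_on {a..b} (F \<omega>)"
    and nz: "\<And>t. t \<in> {a..b} \<Longrightarrow> AE \<omega> in P. F \<omega> t \<noteq> 0"
    and cross: "AE \<omega> in P. \<forall>t\<in>{a<..<b}. \<forall>e>0. F \<omega> t = 0 \<longrightarrow>
      (\<exists>p\<in>{a<..<b}. \<bar>p - t\<bar> < e \<and> F \<omega> p < 0) \<and> (\<exists>q\<in>{a<..<b}. \<bar>q - t\<bar> < e \<and> F \<omega> q > 0)"
  shows "(\<integral>\<^sup>+\<omega>. num_points {t \<in> {a..b}. F \<omega> t = 0} \<partial>P) \<le>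
    liminf (\<lambda>N. \<Sum>i<Suc N. emeasure P {\<omega> \<in> space P. F \<omega> (grid a b N i) * F \<omega> (grid a b N (Suc i)) < 0})"
proof -
  have ab': "a \<le> b" using ab by simp
  have "AE \<omega> in P. \<forall>N. \<forall>i\<in>{..Suc N}. F \<omega> (grid a b N i) \<noteq> 0"
    using grid_mem[OF ab'] nz by (intro AE_all_countable[THEN iffD2] allI AE_finite_allI) auto
  with cross have "AE \<omega> in P. num_points {t \<in> {a..b}. F \<omega> t = 0} \<le> liminf (\<lambda>N. of_nat (card (sign_changes (F \<omega>) a b N)))"
    using AE_space
  proof eventually_elim
    fix \<omega> assume *: "\<forall>t\<in>{a<..<b}. \<forall>e>0. F \<omega> t = 0 \<longrightarrow>
      (\<exists>p\<in>{a<..<b}. \<bar>p - t\<bar> < e \<and> F \<omega> p < 0) \<and> (\<exists>q\<in>{a<..<b}. \<bar>q - t\<bar> < e \<and> F \<omega> q > 0)"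
      "\<forall>N. \<forall>i\<in>{..Suc N}. F \<omega> (grid a b N i) \<noteq> 0" "\<omega> \<in> space P"
    show "num_points {t \<in> {a..b}. F \<omega> t = 0} \<le> liminf (\<lambda>N. of_nat (card (sign_changes (F \<omega>) a b N)))"
      by (rule num_points_le_liminf_sign_changes[OF ab c[OF *(3)]]) (use * in auto)
  qed
  then have "(\<integral>\<^sup>+\<omega>. num_points {t \<in> {a..b}. F \<omega> t = 0} \<partial>P) \<le> (\<integral>\<^sup>+\<omega>. liminf (\<lambda>N. of_nat (card (sign_changes (F \<omega>) a b N))) \<partial>P)"
    by (rule nn_integral_mono_AE)
  also have "\<dots> \<le> liminf (\<lambda>N. \<integral>\<^sup>+\<omega>. of_nat (card (sign_changes (F \<omega>) a b N)) \<partial>P)"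
  proof (rule nn_integral_liminf)
    fix N
    show "(\<lambda>\<omega>. of_nat (card (sign_changes (F \<omega>) a b N)) :: ennreal) \<in> borel_measurable P"
      unfolding of_nat_card_sign_changes
    proof (rule borel_measurable_sum)
      fix i assume "i \<in> {..<Suc N}"
      then have [measurable]: "(\<lambda>\<omega>. F \<omega> (grid a b N i)) \<in> borel_measurable P" "(\<lambda>\<omega>. F \<omega> (grid a b N (Suc i))) \<in> borel_measurable P"
        using m[OF grid_mem[OF ab', of i N]] m[OF grid_mem[OF ab', of "Suc i" N]] by auto
      show "(\<lambda>\<omega>. indicator {x. x < 0} (F \<omega> (grid a b N i) * F \<omega> (grid a b N (Suc i)))) \<in> borel_measurable P"
        by measurable
    qed
  qed
  finally show ?thesis by (simp only: nn_integral_card_sign_changes[where F=F, OF ab' m])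
qed

section \<open>Zeros along random linear paths\<close>

text \<open>The map \<open>T\<close> replaces the coordinate along \<open>b\<close> by an
  independent scalar Gaussian without changing the law. By Fubini it is enough that each line in
  direction \<open>b\<close> meets the set in at most one point, which the scalar Gaussian hits with
  probability zero.\<close>

lemma gauss_null_if_lines_subsingleton:
  fixes E :: "'a::euclidean_space set"
  assumes [measurable]: "E \<in> sets borel" and b: "norm b = 1"
    and line: "\<And>x z z'. x + z *\<^sub>R b \<in> E \<Longrightarrow> x + z' *\<^sub>R b \<in> E \<Longrightarrow> z = z'"
  shows "emeasure gauss E = 0"
proof -
  interpret G: prob_space "gauss :: real measure" by (rule prob_space_gauss)
  define T where "T = (\<lambda>(x, z). x + (z - x \<bullet> b) *\<^sub>R b)"
  have bb: "b \<bullet> b = 1" using b by (simp add: norm_eq_1)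
  have lin: "linear T"
    unfolding T_def by (rule linearI) (auto simp: algebra_simps inner_add_left scaleR_diff_left)
  note [measurable] = borel_measurable_linear[OF lin]
  have "distr gauss borel T = gauss"
  proof (rule distr_gauss_coisometry[OF lin])
    show "linear (\<lambda>y. (y - (y \<bullet> b) *\<^sub>R b, y \<bullet> b))"
      by (rule linearI) (auto simp: algebra_simps inner_add_left)
  qed (auto simp: T_def bb inner_add_left inner_add_right inner_diff_left inner_diff_right inner_commute algebra_simps)
  then have "emeasure gauss E = emeasure (distr gauss borel T) E" by simp
  also have "\<dots> = (\<integral>\<^sup>+p. indicator E (T p) \<partial>gauss)"
    by (simp add: nn_integral_distr flip: nn_integral_indicator)
  also have "\<dots> = (\<integral>\<^sup>+x. \<integral>\<^sup>+z. indicator E (T (x, z)) \<partial>gauss \<partial>gauss)"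
    unfolding gauss_prod by (rule G.nn_integral_fst[symmetric]) (unfold gauss_prod[symmetric], measurable)
  also have "\<dots> = (\<integral>\<^sup>+x. 0 \<partial>(gauss :: 'a measure))"
  proof (rule nn_integral_cong)
    fix x :: 'a
    have "AE z in (gauss::real measure). indicator E (T (x, z)) = (0::ennreal)"
    proof (cases "\<exists>z0. T (x, z0) \<in> E")
      case True
      then obtain z0 where z0: "T (x, z0) \<in> E" by blast
      have "T (x, z) \<in> E \<Longrightarrow> z = z0" for z
        using line[of "x" "z - x \<bullet> b" "z0 - x \<bullet> b"] z0 by (simp add: T_def)
      then have "z \<noteq> z0 \<Longrightarrow> indicator E (T (x, z)) = (0::ennreal)" for z by (auto split: split_indicator)
      moreover have "AE z in (gauss::real measure). z \<noteq> z0"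
        unfolding gauss_real by (subst AE_density) (auto intro!: eventually_mono[OF AE_lborel_singleton[of z0]])
      ultimately show ?thesis by auto
    qed auto
    then show "(\<integral>\<^sup>+z. indicator E (T (x, z)) \<partial>(gauss::real measure)) = 0"
      by (simp add: nn_integral_0_iff_AE[THEN iffD2] nn_integral_cong_AE)
  qed
  finally show ?thesis by simp
qed

text \<open>Fubini in coordinate \<open>l\<close>, with sections written as updates of a full point
  so that the index set need not be split where the lemma is applied.\<close>

lemma PiM_null_if_sections_null:
  fixes M :: "'b \<Rightarrow> 'a measure"
  assumes "finite I" "l \<in> I" and "\<And>i. prob_space (M i)"
    and [measurable]: "E \<in> sets (PiM I M)"
    and sec: "\<And>Z. Z \<in> space (PiM I M) \<Longrightarrow> emeasure (M l) {y \<in> space (M l). Z(l := y) \<in> E} = 0"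
  shows "emeasure (PiM I M) E = 0"
proof -
  interpret product_sigma_finite M
    using assms(3) by (auto simp: product_sigma_finite_def intro: prob_space_imp_sigma_finite)
  let ?J = "I - {l}"
  have I: "insert l ?J = I" using assms(2) by auto
  have ne: "space (M l) \<noteq> {}" using assms(3) prob_space.not_empty by blast
  have "emeasure (PiM I M) E = (\<integral>\<^sup>+Z. indicator E Z \<partial>PiM (insert l ?J) M)"
    unfolding I by (rule nn_integral_indicator[symmetric]) fact
  also have "\<dots> = (\<integral>\<^sup>+Z. \<integral>\<^sup>+y. indicator E (Z(l := y)) \<partial>M l \<partial>PiM ?J M)"
    by (rule product_nn_integral_insert) (use assms(1) I in auto)
  also have "\<dots> = (\<integral>\<^sup>+Z. 0 \<partial>PiM ?J M)"
  proof (rule nn_integral_cong)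
    fix Z assume Z: "Z \<in> space (PiM ?J M)"
    obtain y0 where y0: "y0 \<in> space (M l)" using ne by blast
    have upd: "Z(l := y) \<in> space (PiM I M)" if "y \<in> space (M l)" for y
      using Z that assms(2) by (auto simp: space_PiM PiE_iff extensional_def)
    have "(\<lambda>y. Z(l := y)) \<in> M l \<rightarrow>\<^sub>M PiM (insert l ?J) M"
      by (rule measurable_fun_upd[where J="?J"]) (use Z in auto)
    then have [measurable]: "(\<lambda>y. Z(l := y)) \<in> M l \<rightarrow>\<^sub>M PiM I M" unfolding I .
    \<comment> \<open>\<open>Z\<close> lacks coordinate \<open>l\<close>. The value
      \<open>y0\<close> completes it to a point of the full product and is overwritten by the update
      with \<open>y\<close>.\<close>
    have "(\<integral>\<^sup>+y. indicator E (Z(l := y)) \<partial>M l) = (\<integral>\<^sup>+y. indicator {y \<in> space (M l). (Z(l := y0))(l := y) \<in> E} y \<partial>M l)"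
      by (intro nn_integral_cong) (auto split: split_indicator)
    also have "\<dots> = emeasure (M l) {y \<in> space (M l). (Z(l := y0))(l := y) \<in> E}"
      by (rule nn_integral_indicator) simp
    also have "\<dots> = 0" by (rule sec[OF upd[OF y0]])
    finally show "(\<integral>\<^sup>+y. indicator E (Z(l := y)) \<partial>M l) = 0" .
  qed
  finally show ?thesis by simp
qed

text \<open>By continuity the infimum over a dense subset is the minimum over the compact set. With
  a countable \<open>D\<close> this makes conditions on uncountably many times measurable.\<close>

lemma INF_dense_attained:
  fixes h :: "'b::metric_space \<Rightarrow> real"
  assumes K: "compact K" "K \<noteq> {}" and D: "D \<subseteq> K" "K \<subseteq> closure D" and cont: "continuous_on K h"
  shows "\<And>t. t \<in> K \<Longrightarrow> (INF t\<in>D. h t) \<le> h t"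
    and "\<exists>t\<in>K. (INF t\<in>D. h t) = h t"
proof -
  obtain t0 where t0: "t0 \<in> K" "\<And>t. t \<in> K \<Longrightarrow> h t0 \<le> h t"
    using continuous_attains_inf[OF K cont] by auto
  have ne: "D \<noteq> {}" using K(2) D(2) by auto
  have bdd: "bdd_below (h ` D)" using t0 D(1) by (intro bdd_belowI2[of _ "h t0"]) auto
  have "h t0 \<le> (INF t\<in>D. h t)" using t0 ne D(1) by (intro cINF_greatest) auto
  moreover have "(INF t\<in>D. h t) \<le> h t0"
  proof (rule ccontr)
    assume "\<not> ?thesis"
    then have lt: "h t0 < (INF t\<in>D. h t)" by simp
    have "(h \<longlongrightarrow> h t0) (at t0 within K)" using cont t0(1) by (simp add: continuous_on)
    then have "\<forall>\<^sub>F t in at t0 within K. h t < (INF t\<in>D. h t)" using lt by (rule order_tendstoD)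
    then obtain d where d: "d > 0" "\<And>t. t \<in> K \<Longrightarrow> t \<noteq> t0 \<Longrightarrow> dist t t0 < d \<Longrightarrow> h t < (INF t\<in>D. h t)"
      unfolding eventually_at by auto
    obtain t where t: "t \<in> D" "dist t t0 < d" using t0(1) D(2) d(1) closure_approachable by blast
    have "(INF t\<in>D. h t) \<le> h t" using t(1) by (rule cINF_lower[OF bdd])
    moreover have "h t < (INF t\<in>D. h t)"
      using d(2)[of t] t lt D(1) by (cases "t = t0") auto
    ultimately show False by simp
  qed
  ultimately have eq: "(INF t\<in>D. h t) = h t0" by simp
  show "\<And>t. t \<in> K \<Longrightarrow> (INF t\<in>D. h t) \<le> h t" using eq t0 by auto
  show "\<exists>t\<in>K. (INF t\<in>D. h t) = h t" using eq t0 by auto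
qed

text \<open>For a nonnegative function a zero exists exactly when the minimum is zero, and the
  minimum is an infimum over countably many times.\<close>

lemma sets_ex_zero_on_compact:
  fixes h :: "'a \<Rightarrow> real \<Rightarrow> real"
  assumes K: "compact K" and meas: "\<And>t. t \<in> K \<Longrightarrow> (\<lambda>\<omega>. h \<omega> t) \<in> borel_measurable M"
    and cont: "\<And>\<omega>. continuous_on K (h \<omega>)" and pos: "\<And>\<omega> t. 0 \<le> h \<omega> t"
  shows "{\<omega> \<in> space M. \<exists>t\<in>K. h \<omega> t = 0} \<in> sets M"
proof (cases "K = {}")
  case False
  obtain D where D: "countable D" "D \<subseteq> K" "K \<subseteq> closure D" using separable by blast
  note inf = INF_dense_attained[OF K False D(2,3) cont]
  have "bdd_below (h \<omega> ` D)" for \<omega> using pos by (intro bdd_belowI2[of _ 0]) auto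
  then have [measurable]: "(\<lambda>\<omega>. INF t\<in>D. h \<omega> t) \<in> borel_measurable M"
    using D meas by (intro borel_measurable_cINF) auto
  have "(\<exists>t\<in>K. h \<omega> t = 0) \<longleftrightarrow> (INF t\<in>D. h \<omega> t) = 0" for \<omega>
  proof
    assume "\<exists>t\<in>K. h \<omega> t = 0"
    then have "(INF t\<in>D. h \<omega> t) \<le> 0" using inf(1)[of _ \<omega>] by force
    moreover have "(INF t\<in>D. h \<omega> t) \<ge> 0" using inf(2)[of \<omega>] pos by auto
    ultimately show "(INF t\<in>D. h \<omega> t) = 0" by simp
  next
    assume "(INF t\<in>D. h \<omega> t) = 0"
    then show "\<exists>t\<in>K. h \<omega> t = 0" using inf(2)[of \<omega>] by auto
  qed
  then have "{\<omega> \<in> space M. \<exists>t\<in>K. h \<omega> t = 0} = {\<omega> \<in> space M. (INF t\<in>D. h \<omega> t) = 0}" by simp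
  also have "\<dots> \<in> sets M" by measurable
  finally show ?thesis .
qed simp

definition lin_path :: "nat \<Rightarrow> (nat \<Rightarrow> real \<Rightarrow> real) \<Rightarrow> (nat \<Rightarrow> 'a::real_vector) \<Rightarrow> real \<Rightarrow> 'a" where
  "lin_path n w Z t = (\<Sum>l\<le>n. w l t *\<^sub>R Z l)"

lemma lin_path_upd: "l \<le> n \<Longrightarrow> lin_path n w (Z(l := Z l + y)) t = lin_path n w Z t + w l t *\<^sub>R y"
  unfolding lin_path_def
  by (subst (1 2) sum.remove[of _ l]) (auto simp: scaleR_add_right intro!: sum.cong)

lemma measurable_lin_path [measurable]:
  "(\<lambda>Z. lin_path n w Z t) \<in> PiM {..n} (\<lambda>_. gauss :: 'a::euclidean_space measure) \<rightarrow>\<^sub>M borel"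
  unfolding lin_path_def by measurable

lemma continuous_on_lin_path:
  fixes Z :: "nat \<Rightarrow> 'a::real_normed_vector"
  assumes "\<And>l. l \<le> n \<Longrightarrow> continuous_on S (w l)"
  shows "continuous_on S (lin_path n w Z)"
  unfolding lin_path_def using assms by (intro continuous_on_sum continuous_on_scaleR continuous_on_const) auto

text \<open>A function \<^term>\<open>d\<close> that is affine in the directions of \<^term>\<open>B\<close>, with slope \<^term>\<open>c b\<close> in
  direction \<^term>\<open>b\<close>, evaluated along a random linear path. If a slope is nonzero at each time, then
  moving one Gaussian coordinate moves the value monotonically, so a local extremum has value
  zero for at most one value of that coordinate.\<close>

locale affine_path =
  fixes n :: nat and w :: "nat \<Rightarrow> real \<Rightarrow> real" and a b :: real
    and d :: "'a::euclidean_space \<Rightarrow> real" and B :: "'a set" and c :: "'a \<Rightarrow> 'a \<Rightarrow> real"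
  assumes w_cont: "\<And>l. l \<le> n \<Longrightarrow> continuous_on {a..b} (w l)"
    and d_cont: "continuous_on UNIV d"
    and B: "countable B" "\<And>v. v \<in> B \<Longrightarrow> norm v = 1"
    and c_cont: "\<And>v. v \<in> B \<Longrightarrow> continuous_on UNIV (c v)"
    and affine: "\<And>v x z. v \<in> B \<Longrightarrow> d (x + z *\<^sub>R v) = d x + z * c v x"
    and nondeg: "AE Z in PiM {..n} (\<lambda>_. gauss). \<forall>t\<in>{a..b}. \<exists>l\<le>n. \<exists>v\<in>B. w l t * c v (lin_path n w Z t) \<noteq> 0"
begin

abbreviation "P \<equiv> PiM {..n} (\<lambda>_. gauss :: 'a measure)"

text \<open>Expanding d (x + (z + 1) v) once from x and once from x + z v and comparing.\<close>

lemma c_const: "v \<in> B \<Longrightarrow> c v (x + z *\<^sub>R v) = c v x"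
  using affine[of v "x + z *\<^sub>R v" 1] affine[of v x "z + 1"] affine[of v x z] by (simp add: algebra_simps)

lemma d_meas [measurable]: "d \<in> borel_measurable borel"
  using d_cont by (rule borel_measurable_continuous_onI)

lemma c_meas: "v \<in> B \<Longrightarrow> c v \<in> borel_measurable borel"
  using c_cont by (intro borel_measurable_continuous_onI) auto

text \<open>The premise asks only for an inequality; exchanging \<open>z\<close> and
  \<open>z'\<close> gives equality, so each line in direction \<open>v\<close> of coordinate
  \<open>l\<close> meets \<open>E\<close> at most once.\<close>

lemma null_if_line_unique:
  assumes "l \<le> n" "v \<in> B" and [measurable]: "E \<in> sets P"
    and line: "\<And>Z z z'. Z(l := Z l + z *\<^sub>R v) \<in> E \<Longrightarrow> Z(l := Z l + z' *\<^sub>R v) \<in> E \<Longrightarrow> z \<le> z'"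
  shows "AE Z in P. Z \<notin> E"
proof -
  have "emeasure P E = 0"
  proof (rule PiM_null_if_sections_null[where l=l])
    fix Z assume "Z \<in> space P"
    then have upd [measurable]: "(\<lambda>y. Z(l := y)) \<in> gauss \<rightarrow>\<^sub>M P"
      using assms(1) by (intro measurable_fun_upd[where J="{..n}"]) auto
    show "emeasure gauss {y \<in> space gauss. Z(l := y) \<in> E} = 0"
    proof (rule gauss_null_if_lines_subsingleton[where b=v])
      show "{y \<in> space gauss. Z(l := y) \<in> E} \<in> sets borel"
        unfolding sets_gauss[symmetric] by measurable
      show "norm v = 1" using assms B by auto
      fix x z z' assume "x + z *\<^sub>R v \<in> {y \<in> space gauss. Z(l := y) \<in> E}" "x + z' *\<^sub>R v \<in> {y \<in> space gauss. Z(l := y) \<in> E}"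
      then show "z = z'" using line[of "Z(l := x)" z z'] line[of "Z(l := x)" z' z] by auto
    qed
  qed (use assms prob_space_gauss in auto)
  then show ?thesis by (intro AE_not_in) auto
qed

text \<open>Along a line in direction \<open>v\<close> of coordinate \<open>l\<close> the value is
  affine with slope w l t * c v, and a nonzero slope allows one zero only. The nondegeneracy
  condition provides such \<open>l\<close> and \<open>v\<close>, and there are countably
  many.\<close>

lemma AE_nonzero_at:
  assumes t: "t \<in> {a..b}"
  shows "AE Z in P. d (lin_path n w Z t) \<noteq> 0"
proof -
  have "AE Z in P. \<forall>l\<in>{..n}. \<forall>v\<in>B. \<not> (d (lin_path n w Z t) = 0 \<and> w l t * c v (lin_path n w Z t) \<noteq> 0)"
  proof (intro AE_ball_countable[THEN iffD2] B countable_finite finite_atMost ballI)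
    fix l v assume lv: "l \<in> {..n}" "v \<in> B"
    note [measurable] = c_meas[OF lv(2)]
    let ?E = "{Z \<in> space P. d (lin_path n w Z t) = 0 \<and> w l t * c v (lin_path n w Z t) \<noteq> 0}"
    have "AE Z in P. Z \<notin> ?E"
    proof (rule null_if_line_unique)
      fix Z z z' assume "Z(l := Z l + z *\<^sub>R v) \<in> ?E" "Z(l := Z l + z' *\<^sub>R v) \<in> ?E"
      then have "d (lin_path n w Z t) + z * w l t * c v (lin_path n w Z t) = 0"
        "d (lin_path n w Z t) + z' * w l t * c v (lin_path n w Z t) = 0" "w l t * c v (lin_path n w Z t) \<noteq> 0"
        using lv by (auto simp: lin_path_upd affine c_const mult_ac)
      then have "(z - z') * (w l t * c v (lin_path n w Z t)) = 0" "w l t * c v (lin_path n w Z t) \<noteq> 0"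
        by (auto simp only: algebra_simps)
      then show "z \<le> z'" by simp
    qed (use lv in auto)
    with AE_space show "AE Z in P. \<not> (d (lin_path n w Z t) = 0 \<and> w l t * c v (lin_path n w Z t) \<noteq> 0)"
      by eventually_elim auto
  qed
  with nondeg show ?thesis by eventually_elim (use t in blast)
qed

text \<open>If the slopes have one strict sign on the whole interval, moving the Gaussian coordinate
  moves all values there in the same direction. The minimum of \<open>s\<close> times the value is
  then strictly monotone in that coordinate and equals zero for at most one value of it.\<close>

lemma AE_no_tangency:
  assumes qr: "q < r" "{q..r} \<subseteq> {a..b}" and l: "l \<le> n" and v: "v \<in> B"
    and s: "s \<in> {1, -1}" "s' \<in> {1, -1}"
  shows "AE Z in P. \<not> ((\<forall>t\<in>{q..r}. s * d (lin_path n w Z t) \<ge> 0) \<and> (\<exists>t\<in>{q..r}. d (lin_path n w Z t) = 0)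
     \<and> (\<forall>t\<in>{q..r}. s' * (w l t * c v (lin_path n w Z t)) > 0))"
proof -
  note [measurable] = c_meas[OF v]
  have K: "compact {q..r}" "{q..r} \<noteq> {}" using qr(1) by auto
  obtain D where ctb: "countable D" and D: "D \<subseteq> {q..r}" "{q..r} \<subseteq> closure D" using separable by blast
  let ?f = "\<lambda>Z t. s * d (lin_path n w Z t)" and ?g = "\<lambda>Z t. s' * (w l t * c v (lin_path n w Z t))"
  have cp: "continuous_on {q..r} (lin_path n w Z)" for Z :: "nat \<Rightarrow> 'a"
    by (intro continuous_on_lin_path continuous_on_subset[OF w_cont qr(2)])
  have cf: "continuous_on {q..r} (?f Z)" for Z
    by (intro continuous_intros continuous_on_compose2[OF d_cont cp]) auto
  have cg: "continuous_on {q..r} (?g Z)" for Z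
    by (intro continuous_intros continuous_on_compose2[OF c_cont[OF v] cp] continuous_on_subset[OF w_cont[OF l] qr(2)]) auto
  note If = INF_dense_attained[OF K D cf] and Ig = INF_dense_attained[OF K D cg]
  have bddf: "bdd_below (?f Z ` D)" for Z
    using compact_continuous_image[OF cf[of Z] K(1)] D(1)
    by (intro bdd_below_mono[OF bounded_imp_bdd_below[OF compact_imp_bounded] image_mono])
  have bddg: "bdd_below (?g Z ` D)" for Z
    using compact_continuous_image[OF cg[of Z] K(1)] D(1)
    by (intro bdd_below_mono[OF bounded_imp_bdd_below[OF compact_imp_bounded] image_mono])
  have [measurable]: "(\<lambda>Z. INF t\<in>D. ?f Z t) \<in> borel_measurable P"
    by (rule borel_measurable_cINF[OF ctb _ bddf]) measurable
  have [measurable]: "(\<lambda>Z. INF t\<in>D. ?g Z t) \<in> borel_measurable P"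
    by (rule borel_measurable_cINF[OF ctb _ bddg]) measurable
  \<comment> \<open>The event expressed by infima over the countable set \<open>D\<close>, which
    makes it measurable.\<close>
  let ?E = "{Z \<in> space P. (INF t\<in>D. ?f Z t) = 0 \<and> (INF t\<in>D. ?g Z t) > 0}"
  have "AE Z in P. Z \<notin> ?E"
  proof (rule null_if_line_unique[OF l v])
    fix Z z z' assume 1: "Z(l := Z l + z *\<^sub>R v) \<in> ?E" and 2: "Z(l := Z l + z' *\<^sub>R v) \<in> ?E"
    have fz: "?f (Z(l := Z l + y *\<^sub>R v)) t = ?f Z t + y * (s * s' * ?g Z t)" for y t
      using s(2) l v by (auto simp: lin_path_upd affine algebra_simps)
    have gz: "?g (Z(l := Z l + y *\<^sub>R v)) t = ?g Z t" for y t
      using l v by (simp add: lin_path_upd c_const)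
    have gpos: "?g Z t > 0" if "t \<in> {q..r}" for t
    proof -
      have "0 < (INF t\<in>D. ?g (Z(l := Z l + z *\<^sub>R v)) t)" using 1 by simp
      also have "\<dots> \<le> ?g (Z(l := Z l + z *\<^sub>R v)) t" by (rule Ig(1)[OF that])
      finally show ?thesis unfolding gz .
    qed
    show "z \<le> z'"
    proof (rule ccontr)
      assume "\<not> z \<le> z'"
      then have zz: "z - z' > 0" by simp
      obtain t where t: "t \<in> {q..r}" "?f (Z(l := Z l + z *\<^sub>R v)) t = 0" using If(2)[of "Z(l := Z l + z *\<^sub>R v)"] 1 by auto
      obtain t' where t': "t' \<in> {q..r}" "?f (Z(l := Z l + z' *\<^sub>R v)) t' = 0" using If(2)[of "Z(l := Z l + z' *\<^sub>R v)"] 2 by auto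
      have A: "?f (Z(l := Z l + z' *\<^sub>R v)) t \<ge> 0" using If(1)[OF t(1), of "Z(l := Z l + z' *\<^sub>R v)"] 2 by auto
      have B: "?f (Z(l := Z l + z *\<^sub>R v)) t' \<ge> 0" using If(1)[OF t'(1), of "Z(l := Z l + z *\<^sub>R v)"] 1 by auto
      \<comment> \<open>\<open>t\<close> and \<open>t'\<close> are the places where the minimum zero
        is attained for \<open>z\<close> and \<open>z'\<close>. Comparing the two functions there
        would force s s' to be both nonpositive and nonnegative.\<close>
      have "(z - z') * (s * s' * ?g Z t) \<le> 0" using t(2) A unfolding fz by (simp add: algebra_simps)
      moreover have "(z - z') * (s * s' * ?g Z t') \<ge> 0" using t'(2) B unfolding fz by (simp add: algebra_simps)
      ultimately have "s * s' * ?g Z t \<le> 0" "s * s' * ?g Z t' \<ge> 0" using zz by (auto simp: mult_le_0_iff zero_le_mult_iff)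
      then show False using gpos[OF t(1)] gpos[OF t'(1)] s by auto
    qed
  qed simp
  with AE_space show ?thesis
  proof eventually_elim
    fix Z assume Z: "Z \<in> space P" "Z \<notin> ?E"
    show "\<not> ((\<forall>t\<in>{q..r}. s * d (lin_path n w Z t) \<ge> 0) \<and> (\<exists>t\<in>{q..r}. d (lin_path n w Z t) = 0)
     \<and> (\<forall>t\<in>{q..r}. s' * (w l t * c v (lin_path n w Z t)) > 0))"
    proof
      assume *: "(\<forall>t\<in>{q..r}. s * d (lin_path n w Z t) \<ge> 0) \<and> (\<exists>t\<in>{q..r}. d (lin_path n w Z t) = 0)
       \<and> (\<forall>t\<in>{q..r}. s' * (w l t * c v (lin_path n w Z t)) > 0)"
      then obtain t0 where t0: "t0 \<in> {q..r}" "d (lin_path n w Z t0) = 0" by blast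
      have "(INF t\<in>D. ?f Z t) \<le> 0" using If(1)[OF t0(1), of Z] t0(2) by simp
      moreover have "(INF t\<in>D. ?f Z t) \<ge> 0" using If(2)[of Z] * by auto
      moreover have "(INF t\<in>D. ?g Z t) > 0" using Ig(2)[of Z] * by auto
      ultimately show False using Z by auto
    qed
  qed
qed

text \<open>Near a zero that is not crossed the values have one sign, while by continuity some
  nonzero slope keeps its sign. Shrinking to rational end points leaves countably many
  configurations, each excluded by \<open>AE_no_tangency\<close>.\<close>

lemma AE_all_zeros_cross:
  "AE Z in P. \<forall>t\<in>{a<..<b}. \<forall>e>0. d (lin_path n w Z t) = 0 \<longrightarrow>
      (\<exists>p\<in>{a<..<b}. \<bar>p - t\<bar> < e \<and> d (lin_path n w Z p) < 0) \<and> (\<exists>q\<in>{a<..<b}. \<bar>q - t\<bar> < e \<and> d (lin_path n w Z q) > 0)"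
proof -
  let ?bad = "\<lambda>Z q r l v s s'. (\<forall>t\<in>{q..r}. s * d (lin_path n w Z t) \<ge> 0) \<and> (\<exists>t\<in>{q..r}. d (lin_path n w Z t) = 0)
     \<and> (\<forall>t\<in>{q..r}. s' * (w l t * c v (lin_path n w Z t)) > 0)"
  have "AE Z in P. \<forall>q\<in>\<rat>. \<forall>r\<in>\<rat>. \<forall>l\<in>{..n}. \<forall>v\<in>B. \<forall>s\<in>{1, -1}. \<forall>s'\<in>{1, -1}. q < r \<and> {q..r} \<subseteq> {a..b} \<longrightarrow> \<not> ?bad Z q r l v s s'"
  proof (intro AE_ball_countable[THEN iffD2] B ballI countable_rat countable_finite)
    fix q r l v s s' assume "l \<in> {..n}" "v \<in> B" "s \<in> {1, -1::real}" "s' \<in> {1, -1::real}"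
    then show "AE Z in P. q < r \<and> {q..r} \<subseteq> {a..b} \<longrightarrow> \<not> ?bad Z q r l v s s'"
      using AE_no_tangency[of q r l v s s'] by (cases "q < r \<and> {q..r} \<subseteq> {a..b}") (auto simp del: atLeastatMost_subset_iff)
  qed simp_all
  with nondeg show ?thesis
  proof (eventually_elim, intro ballI allI impI)
    fix Z t and e :: real
    assume nd: "\<forall>t\<in>{a..b}. \<exists>l\<le>n. \<exists>v\<in>B. w l t * c v (lin_path n w Z t) \<noteq> 0"
      and good: "\<forall>q\<in>\<rat>. \<forall>r\<in>\<rat>. \<forall>l\<in>{..n}. \<forall>v\<in>B. \<forall>s\<in>{1, -1}. \<forall>s'\<in>{1, -1}. q < r \<and> {q..r} \<subseteq> {a..b} \<longrightarrow> \<not> ?bad Z q r l v s s'"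
      and t: "t \<in> {a<..<b}" "d (lin_path n w Z t) = 0" and e: "e > 0"
    from nd t obtain l v where lv: "l \<le> n" "v \<in> B" "w l t * c v (lin_path n w Z t) \<noteq> 0" by force
    define g where "g = (\<lambda>t. w l t * c v (lin_path n w Z t))"
    have "continuous_on {a..b} g"
      unfolding g_def using lv w_cont
      by (intro continuous_intros continuous_on_compose2[OF c_cont[OF lv(2)] continuous_on_lin_path]) auto
    then have "isCont g t" using t by (intro continuous_on_interior[of "{a..b}"]) auto
    define s' where "s' = sgn (g t)"
    have s': "s' \<in> {1, -1}" "s' * g t > 0"
    proof -
      have "g t \<noteq> 0" using lv(3) by (simp add: g_def)
      then show "s' \<in> {1, -1}" "s' * g t > 0" by (auto simp: s'_def sgn_if)
    qed
    have "isCont (\<lambda>t. s' * g t) t" using \<open>isCont g t\<close> by simp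
    then have "\<forall>\<^sub>F x in at t. 0 < s' * g x" using s'(2) by (auto simp: isCont_def intro: order_tendstoD)
    then obtain e' where e': "e' > 0" "\<And>x. \<bar>x - t\<bar> < e' \<Longrightarrow> s' * g x > 0"
      using s'(2) unfolding eventually_at by (metis dist_real_def UNIV_I)
    define \<eta> where "\<eta> = Min {e, e', t - a, b - t}"
    have \<eta>: "\<eta> > 0" "\<eta> \<le> e" "\<eta> \<le> e'" "\<eta> \<le> t - a" "\<eta> \<le> b - t" using e e' t by (auto simp: \<eta>_def)
    \<comment> \<open>Rational end points bring the interval into the countable family of
      \<open>good\<close>.\<close>
    obtain q where q: "q \<in> \<rat>" "t - \<eta> < q" "q < t" using Rats_dense_in_real[of "t - \<eta>" t] \<eta> by auto
    obtain r where r: "r \<in> \<rat>" "t < r" "r < t + \<eta>" using Rats_dense_in_real[of t "t + \<eta>"] \<eta> by auto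
    have nb: "\<not> (\<forall>x\<in>{q..r}. s * d (lin_path n w Z x) \<ge> 0)" if "s \<in> {1, -1}" for s
    proof
      assume *: "\<forall>x\<in>{q..r}. s * d (lin_path n w Z x) \<ge> 0"
      have "?bad Z q r l v s s'"
        using * t q r e'(2) \<eta> by (auto simp: g_def intro!: bexI[of _ t])
      moreover have "q < r \<and> {q..r} \<subseteq> {a..b}" using q r \<eta> by auto
      ultimately show False using good[rule_format, OF q(1) r(1), of l v s s'] lv s' that by auto
    qed
    have sub: "x \<in> {a<..<b} \<and> \<bar>x - t\<bar> < e" if "x \<in> {q..r}" for x using that q r \<eta> by auto
    from nb[of "-1"] obtain x where x: "x \<in> {q..r}" "d (lin_path n w Z x) > 0" by (auto simp: not_le)
    from nb[of 1] obtain y where y: "y \<in> {q..r}" "d (lin_path n w Z y) < 0" by (auto simp: not_le)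
    from x y sub show "(\<exists>p\<in>{a<..<b}. \<bar>p - t\<bar> < e \<and> d (lin_path n w Z p) < 0) \<and> (\<exists>q\<in>{a<..<b}. \<bar>q - t\<bar> < e \<and> d (lin_path n w Z q) > 0)"
      by blast
  qed
qed

end

section \<open>Cofactor vectors\<close>

definition row_upd :: "real^'p^'p \<Rightarrow> 'p \<Rightarrow> real^'p \<Rightarrow> real^'p^'p" where
  "row_upd X k v = (\<chi> i. if i = k then v else X $ i)"

text \<open>The generalised cross product of the rows other than \<open>k\<close>: a normal vector
  to all of them, representing the determinant as a linear form in row \<open>k\<close>. Row
  \<open>k\<close> of \<open>X\<close> itself does not enter.\<close>

definition cofac :: "'p::finite \<Rightarrow> real^'p^'p \<Rightarrow> real^'p" where
  "cofac k X = (\<chi> j. det (row_upd X k (axis j 1)))"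

lemma row_upd_nth: "row_upd X k v $ i = (if i = k then v else X $ i)"
  by (simp add: row_upd_def)

lemma row_upd_same [simp]: "row_upd X k (X $ k) = X"
  by (simp add: vec_eq_iff row_upd_nth)

lemma row_upd_upd [simp]: "row_upd (row_upd X k v) k w = row_upd X k w"
  by (simp add: vec_eq_iff row_upd_nth)

lemma row_upd_commute: "i \<noteq> k \<Longrightarrow> row_upd (row_upd X i v) k w = row_upd (row_upd X k w) i v"
  by (simp add: vec_eq_iff row_upd_nth)

lemma linear_det_row_upd: "linear (\<lambda>v. det (row_upd X k v))" for X :: "real^'p^'p::finite"
proof (rule linearI)
  fix v w :: "real^'p" and r :: real
  show "det (row_upd X k (v + w)) = det (row_upd X k v) + det (row_upd X k w)"
    unfolding row_upd_def by (rule det_row_add)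
  show "det (row_upd X k (r *\<^sub>R v)) = r *\<^sub>R det (row_upd X k v)"
    unfolding row_upd_def using det_row_mul[of k r "\<lambda>_. v" "\<lambda>i. X $ i", unfolded scalar_mult_eq_scaleR] by simp
qed

lemma cofac_inner: "cofac k X \<bullet> v = det (row_upd X k v)" for X :: "real^'p^'p::finite"
proof -
  have "det (row_upd X k v) = det (row_upd X k (\<Sum>j\<in>UNIV. v $ j *\<^sub>R axis j 1))"
    by (simp add: basis_expansion flip: scalar_mult_eq_scaleR)
  also have "\<dots> = (\<Sum>j\<in>UNIV. v $ j * det (row_upd X k (axis j 1)))"
    by (simp add: linear_sum[OF linear_det_row_upd] linear_scale[OF linear_det_row_upd])
  finally show ?thesis by (simp add: inner_vec_def cofac_def mult.commute)
qed

lemma det_eq_inner_cofac: "det X = X $ k \<bullet> cofac k X" for X :: "real^'p^'p::finite"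
  by (metis cofac_inner inner_commute row_upd_same)

lemma cofac_row_upd_same [simp]: "cofac k (row_upd X k v) = cofac k X"
  by (simp add: cofac_def)

lemma cofac_orth: "i \<noteq> k \<Longrightarrow> cofac k X \<bullet> X $ i = 0" for X :: "real^'p^'p::finite"
  unfolding cofac_inner
  by (rule det_identical_rows[of i k]) (auto simp: row_def row_upd_nth vec_eq_iff)

lemma continuous_on_det [continuous_intros]:
  "continuous_on S f \<Longrightarrow> continuous_on S (\<lambda>x. det (f x :: real^'p^'p::finite))"
  unfolding det_def by (intro continuous_intros) auto

lemma continuous_on_row_upd [continuous_intros]:
  assumes "continuous_on S f" "continuous_on S g"
  shows "continuous_on S (\<lambda>x. row_upd (f x) k (g x) :: real^'p^'p::finite)"
  unfolding row_upd_def
proof (rule continuous_on_vec_lambda)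
  fix i show "continuous_on S (\<lambda>x. if i = k then g x else f x $ i)"
    using assms by (cases "i = k") (auto intro!: continuous_intros)
qed

lemma continuous_on_cofac [continuous_intros]:
  "continuous_on S f \<Longrightarrow> continuous_on S (\<lambda>x. cofac k (f x :: real^'p^'p::finite))"
  unfolding cofac_def by (intro continuous_on_vec_lambda continuous_intros) auto

lemma borel_measurable_det [measurable]: "det \<in> borel_measurable (borel :: (real^'p^'p::finite) measure)"
  by (intro borel_measurable_continuous_onI continuous_intros)

lemma borel_measurable_cofac [measurable]: "cofac k \<in> (borel :: (real^'p^'p::finite) measure) \<rightarrow>\<^sub>M borel"
  by (intro borel_measurable_continuous_onI continuous_intros)

lemma linear_cofac_row_upd:
  fixes X :: "real^'p^'p::finite"
  assumes "i \<noteq> k"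
  shows "linear (\<lambda>v. cofac k (row_upd X i v))"
proof -
  have "cofac k (row_upd X i v) = (\<chi> j. det (row_upd (row_upd X k (axis j 1)) i v))" for v
    using assms by (simp add: cofac_def row_upd_commute)
  then show ?thesis
    by (intro linearI) (auto simp: vec_eq_iff linear_add[OF linear_det_row_upd] linear_scale[OF linear_det_row_upd])
qed

text \<open>Polarisation: the form is additive in each of the two rows and vanishes when they
  coincide.\<close>

lemma det_row_upd_swap:
  fixes X :: "real^'p^'p::finite"
  assumes "i \<noteq> k"
  shows "det (row_upd (row_upd X i v) k u) = - det (row_upd (row_upd X i u) k v)"
proof -
  define D where "D u v = det (row_upd (row_upd X i v) k u)" for u v
  have D2: "D u v = det (row_upd (row_upd X k u) i v)" for u v using assms by (simp add: D_def row_upd_commute)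
  have alt: "D u u = 0" for u
    unfolding D_def using assms by (intro det_identical_rows[of i k]) (auto simp: row_def row_upd_nth vec_eq_iff)
  have "D (x + y) z = D x z + D y z" for x y z
    unfolding D_def by (rule linear_add[OF linear_det_row_upd])
  moreover have "D z (x + y) = D z x + D z y" for x y z
    unfolding D2 by (rule linear_add[OF linear_det_row_upd])
  ultimately have "D (u + v) (u + v) = D u u + D u v + D v u + D v v"
    by simp
  then show ?thesis using alt by (simp add: D_def)
qed

text \<open>As a function of row \<^term>\<open>i\<close>, the cofactor vector of row \<^term>\<open>k\<close> is a multiple of the
  rotation by a right angle in the plane orthogonal to the remaining rows.\<close>

lemma cofac_row_upd_plane:
  fixes X :: "real^'p^'p::finite"
  assumes ik: "i \<noteq> k"
  obtains u w \<kappa> where "norm u = 1" "norm w = 1" "u \<bullet> w = 0"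
    "\<And>v. cofac k (row_upd X i v) = \<kappa> *\<^sub>R ((v \<bullet> w) *\<^sub>R u - (v \<bullet> u) *\<^sub>R w)"
proof (cases "\<forall>v. cofac k (row_upd X i v) = 0")
  case True
  \<comment> \<open>For the zero map \<open>\<kappa>\<close> is 0 and any orthonormal pair will do;
    two different axes exist because of \<open>ik\<close>.\<close>
  show ?thesis
    by (rule that[of "axis i 1" "axis k 1" 0]) (use True ik in \<open>auto simp: inner_axis_axis\<close>)
next
  case False
  define N where "N v = cofac k (row_upd X i v)" for v
  have lin: "linear N" using linear_cofac_row_upd[OF ik] by (simp add: N_def[abs_def])
  have D: "N v \<bullet> u = det (row_upd (row_upd X i v) k u)" for u v by (simp add: N_def cofac_inner)
  have anti: "N v \<bullet> u = - (N u \<bullet> v)" for u v unfolding D by (rule det_row_upd_swap[OF ik])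
  have self: "N v \<bullet> v = 0" for v using anti[of v v] by simp
  define R where "R = {X $ m |m. m \<noteq> i \<and> m \<noteq> k}"
  have NR: "N v \<bullet> r = 0" if "r \<in> R" for v r
    using that cofac_orth[of _ k "row_upd X i v"] ik by (fastforce simp: R_def N_def row_upd_nth)
  from False obtain v0 where v0: "N v0 \<noteq> 0" by (auto simp: N_def)
  define u where "u = N v0 /\<^sub>R norm (N v0)"
  have u: "norm u = 1" using v0 by (simp add: u_def)
  have "N u \<bullet> v0 = - norm (N v0)"
    using anti[of u v0] v0 by (simp add: u_def dot_square_norm power2_eq_square)
  then have Nu: "N u \<noteq> 0" using v0 by auto
  define w where "w = N u /\<^sub>R norm (N u)"
  have w: "norm w = 1" using Nu by (simp add: w_def)
  have uw: "u \<bullet> w = 0" using self[of u] by (simp add: w_def inner_commute)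
  have wu: "w \<bullet> u = 0" using uw by (simp add: inner_commute)
  have uR: "u \<bullet> r = 0" "w \<bullet> r = 0" if "r \<in> R" for r using NR[OF that] by (simp_all add: u_def w_def)
  \<comment> \<open>A nonzero determinant of \<open>A\<close> shows that \<open>u\<close>,
    \<open>w\<close> and the remaining rows span the space. As \<open>u\<close> and \<open>w\<close>
    are orthonormal and orthogonal to those rows, every vector orthogonal to both lies in the span
    of the rows in \<open>R\<close>.\<close>
  define A where "A = row_upd (row_upd X i u) k w"
  have "N u \<bullet> w = norm (N u)" using Nu by (simp add: w_def dot_square_norm power2_eq_square)
  then have "det A = norm (N u)" by (simp only: A_def D)
  then have "det A \<noteq> 0" using Nu by simp
  then have span: "span (rows A) = UNIV"
    by (simp add: invertible_det_nz[symmetric] invertible_left_inverse[symmetric] matrix_left_invertible_span_rows[symmetric])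
  have rows: "rows A \<subseteq> {u, w} \<union> R"
    by (auto simp: rows_def row_def A_def row_upd_nth R_def)
  have orth: "\<rho> \<in> span R" if "\<rho> \<bullet> u = 0" "\<rho> \<bullet> w = 0" for \<rho>
  proof -
    have "\<rho> \<in> span ({u, w} \<union> R)" using span span_mono[OF rows] by auto
    obtain p \<alpha> \<beta> where p: "p \<in> span R" and \<rho>: "\<rho> = p + \<alpha> *\<^sub>R u + \<beta> *\<^sub>R w"
    proof -
      obtain \<alpha> where "\<rho> - \<alpha> *\<^sub>R u \<in> span (insert w R)" using \<open>\<rho> \<in> span ({u, w} \<union> R)\<close> by (auto simp: span_insert)
      then obtain \<beta> where "\<rho> - \<alpha> *\<^sub>R u - \<beta> *\<^sub>R w \<in> span R" by (auto simp: span_insert)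
      then show ?thesis by (rule that[of _ \<alpha> \<beta>]) simp
    qed
    have "linear (\<lambda>r. u \<bullet> r)" "linear (\<lambda>r. w \<bullet> r)" by (auto intro: linearI simp: inner_add_right)
    from linear_eq_0_on_span[OF this(1) _ p] linear_eq_0_on_span[OF this(2) _ p] uR
    have "u \<bullet> p = 0" "w \<bullet> p = 0" by auto
    with that u w uw have "\<alpha> = 0" "\<beta> = 0"
      unfolding \<rho> by (auto simp: inner_add_left inner_commute[of p] wu norm_eq_1)
    then show ?thesis using p \<rho> by simp
  qed
  have N0: "N \<rho> = 0" if "\<rho> \<in> span R" for \<rho>
  proof (rule linear_eq_0_on_span[OF lin _ that])
    fix r assume "r \<in> R"
    have "N r \<bullet> x = 0" for x using anti[of r x] NR[OF \<open>r \<in> R\<close>] by simp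
    then show "N r = 0" using inner_eq_zero_iff by blast
  qed
  define \<kappa> where "\<kappa> = - norm (N u)"
  have Nu': "N u = - \<kappa> *\<^sub>R w" using Nu by (simp add: w_def \<kappa>_def)
  have Nw: "N w = \<kappa> *\<^sub>R u"
  proof -
    \<comment> \<open>What \<open>N w\<close> has beyond its component along \<open>u\<close> lies
      in the span of \<open>R\<close> and is orthogonal to \<open>R\<close>, hence vanishes.\<close>
    define \<rho> where "\<rho> = N w - (N w \<bullet> u) *\<^sub>R u"
    have "N w \<bullet> w = 0" by (rule self)
    then have "\<rho> \<in> span R"
      using u uw by (intro orth) (auto simp: \<rho>_def inner_diff_left norm_eq_1)
    moreover have "\<rho> \<bullet> r = 0" if "r \<in> R" for r using NR[OF that] uR[OF that] by (simp add: \<rho>_def inner_diff_left)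
    moreover have "linear (\<lambda>r. \<rho> \<bullet> r)" by (auto intro: linearI simp: inner_add_right)
    ultimately have "\<rho> \<bullet> \<rho> = 0" using linear_eq_0_on_span[of "\<lambda>r. \<rho> \<bullet> r" R \<rho>] by blast
    then have "N w = (N w \<bullet> u) *\<^sub>R u" by (simp add: \<rho>_def)
    moreover have "N w \<bullet> u = \<kappa>" using anti[of w u] Nu' w by (simp add: norm_eq_1)
    ultimately show ?thesis by simp
  qed
  show ?thesis
  proof (rule that[OF u w uw])
    fix v
    have "v - (v \<bullet> u) *\<^sub>R u - (v \<bullet> w) *\<^sub>R w \<in> span R"
      using u w uw wu by (intro orth) (auto simp: inner_diff_left norm_eq_1)
    from N0[OF this] have "N v = (v \<bullet> u) *\<^sub>R N u + (v \<bullet> w) *\<^sub>R N w"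
      by (simp add: linear_add[OF lin] linear_diff[OF lin] linear_scale[OF lin] algebra_simps)
    then show "cofac k (row_upd X i v) = \<kappa> *\<^sub>R ((v \<bullet> w) *\<^sub>R u - (v \<bullet> u) *\<^sub>R w)"
      by (simp add: N_def[symmetric] Nu' Nw algebra_simps)
  qed
qed

text \<open>The rows other than \<open>k\<close> cannot span the space, so some vector
  \<open>a\<close> lies outside their span. Putting \<open>a\<close> in row \<open>k\<close> still
  gives determinant zero, hence a linear relation; \<open>a\<close> cannot occur in it, so it
  relates the other rows.\<close>

lemma cofac_eq_0_imp_dependent:
  fixes X :: "real^'p^'p::finite"
  assumes "cofac k X = 0"
  obtains j c where "j \<noteq> k" "X $ j = (\<Sum>m\<in>UNIV - {j, k}. c m *\<^sub>R X $ m)"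
proof -
  let ?R = "(\<lambda>i. X $ i) ` (UNIV - {k})"
  have "dim (span ?R) \<le> card ?R" by (simp add: dim_le_card')
  also have "\<dots> \<le> card (UNIV - {k})" by (rule card_image_le) simp
  also have "\<dots> < CARD('p)" by (rule psubset_card_mono) auto
  finally have "dim (span ?R) < DIM(real^'p)" by simp
  then have "span ?R \<noteq> UNIV" by (metis dim_UNIV less_irrefl)
  then obtain a where a: "a \<notin> span ?R" by blast
  have "det (row_upd X k a) = 0" using assms by (simp flip: cofac_inner)
  then have "\<not> (\<exists>B. row_upd X k a ** B = mat 1)"
    by (metis invertible_det_nz invertible_right_inverse)
  then obtain c i where c: "(\<Sum>i\<in>UNIV. c i *s row i (row_upd X k a)) = 0" and i: "c i \<noteq> 0"
    unfolding matrix_right_invertible_independent_rows by blast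
  have rows: "row i (row_upd X k a) = (if i = k then a else X $ i)" for i
    by (simp add: row_def row_upd_nth vec_eq_iff)
  have eq: "c k *\<^sub>R a + (\<Sum>i\<in>UNIV - {k}. c i *\<^sub>R X $ i) = 0"
    using c unfolding rows scalar_mult_eq_scaleR by (subst (asm) sum.remove[of _ k]) auto
  have ck: "c k = 0"
  proof (rule ccontr)
    assume "c k \<noteq> 0"
    have "c k *\<^sub>R a = - (\<Sum>i\<in>UNIV - {k}. c i *\<^sub>R X $ i)" using eq by (simp add: eq_neg_iff_add_eq_0)
    then have "(1 / c k) *\<^sub>R c k *\<^sub>R a = (1 / c k) *\<^sub>R (- (\<Sum>i\<in>UNIV - {k}. c i *\<^sub>R X $ i))" by simp
    then have "a = (1 / c k) *\<^sub>R (- (\<Sum>i\<in>UNIV - {k}. c i *\<^sub>R X $ i))" using \<open>c k \<noteq> 0\<close> by simp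
    also have "\<dots> \<in> span ?R" by (intro span_scale span_neg span_sum) (auto intro: span_base)
    finally show False using a by simp
  qed
  with i have ik: "i \<noteq> k" by auto
  have set: "UNIV - {k} - {i} = UNIV - {i, k}" by auto
  have "c i *\<^sub>R X $ i + (\<Sum>m\<in>UNIV - {i, k}. c m *\<^sub>R X $ m) = 0"
    using eq ck ik by (subst (asm) sum.remove[of _ i]) (auto simp: set)
  then have "c i *\<^sub>R X $ i = - (\<Sum>m\<in>UNIV - {i, k}. c m *\<^sub>R X $ m)" by (simp add: eq_neg_iff_add_eq_0)
  then have "(1 / c i) *\<^sub>R c i *\<^sub>R X $ i = (1 / c i) *\<^sub>R (- (\<Sum>m\<in>UNIV - {i, k}. c m *\<^sub>R X $ m))" by simp
  then have "X $ i = (\<Sum>m\<in>UNIV - {i, k}. (- c m / c i) *\<^sub>R X $ m)"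
    using i by (simp add: scaleR_sum_right sum_negf[symmetric])
  then show ?thesis by (rule that[OF ik])
qed

text \<open>Row and column \<open>k\<close> of \<open>Q\<close> are those of the identity, so
  \<open>Q\<close> mixes only the other rows and commutes with replacing row \<open>k\<close>. The
  determinant is then multiplicative.\<close>

lemma cofac_matrix_mult:
  fixes X Q :: "real^'p^'p::finite"
  assumes row: "\<And>j. Q $ k $ j = (if j = k then 1 else 0)" and col: "\<And>i. Q $ i $ k = (if i = k then 1 else 0)"
  shows "cofac k (Q ** X) = det Q *\<^sub>R cofac k X"
proof -
  have *: "row_upd (Q ** X) k v = Q ** row_upd X k v" for v
  proof -
    have "row_upd (Q ** X) k v $ i $ l = (Q ** row_upd X k v) $ i $ l" for i l
    proof (cases "i = k")
      case True
      then show ?thesis by (simp add: row_upd_nth matrix_matrix_mult_def row if_distrib[of "\<lambda>x. x * _"] cong: if_cong)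
    next
      case False
      then have "Q $ i $ k = 0" by (simp add: col)
      then show ?thesis using False
        by (auto simp: row_upd_nth matrix_matrix_mult_def intro!: sum.cong)
    qed
    then show ?thesis by (simp add: vec_eq_iff)
  qed
  show ?thesis unfolding cofac_def * by (simp add: det_mul vec_eq_iff)
qed

text \<open>Putting the cofactor vector into row \<open>k\<close> gives a matrix whose determinant
  is the squared norm of that vector, hence an invertible one.\<close>

lemma cofac_solution_unique:
  fixes X :: "real^'p^'p::finite"
  assumes nz: "cofac k X \<noteq> 0" and rows: "\<And>i. i \<noteq> k \<Longrightarrow> X $ i \<bullet> y = 0" and "cofac k X \<bullet> y = 0"
  shows "y = 0"
proof -
  define A where "A = row_upd X k (cofac k X)"
  have "det A = cofac k X \<bullet> cofac k X" by (simp add: A_def cofac_inner)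
  then have "det A \<noteq> 0" using nz by simp
  then obtain B where "B ** A = mat 1" unfolding invertible_det_nz[symmetric] invertible_def by blast
  moreover have "A *v y = 0"
    using rows assms(3) by (auto simp: vec_eq_iff matrix_vector_mul_component A_def row_upd_nth)
  ultimately show ?thesis by (metis matrix_vector_mul_assoc matrix_vector_mul_lid matrix_vector_mult_0_right)
qed

lemma linear_row_upd: "linear (\<lambda>(X, v). row_upd X k v :: real^'p^'p::finite)"
  by (rule linearI) (auto simp: vec_eq_iff row_upd_nth)

text \<open>Where the rows other than \<^term>\<open>k\<close> become dependent, row \<^term>\<open>j\<close> of \<^term>\<open>M\<close> is determined by the other
  rows, the time and \<^term>\<open>CARD('p) - 2\<close> coefficients. Storing the time and the coefficients in row
  \<^term>\<open>j\<close>, whose entry \<^term>\<open>j\<close> stays unused, exhibits the set as a differentiable image of a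
  hyperplane.\<close>

lemma negligible_cofac_zero:
  fixes g :: "real \<Rightarrow> real" and r :: "real \<Rightarrow> real^'p^'p::finite"
  assumes g: "\<And>t. g differentiable (at t)" and r: "\<And>t. r differentiable (at t)"
    and T: "\<And>t. t \<in> T \<Longrightarrow> g t \<noteq> 0"
  shows "negligible {M. \<exists>t\<in>T. cofac k (g t *\<^sub>R M + r t) = 0}"
proof -
  \<comment> \<open>This is row \<open>j\<close> of \<open>M\<close>, solved from the relation that
    row \<open>j\<close> of g M + r is a combination of its other rows. The time is read from N $ j
    $ k and the coefficients from N $ j $ m.\<close>
  define v where "v j N = (1 / g (N $ j $ k)) *\<^sub>R ((\<Sum>m\<in>UNIV - {j, k}. N $ j $ m *\<^sub>R (g (N $ j $ k) *\<^sub>R N $ m + r (N $ j $ k) $ m)) - r (N $ j $ k) $ j)"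
    for j and N :: "real^'p^'p"
  define \<Phi> where "\<Phi> j N = row_upd N j (v j N)" for j and N :: "real^'p^'p"
  define S where "S j = {N :: real^'p^'p. N $ j $ j = 0 \<and> g (N $ j $ k) \<noteq> 0}" for j
  have "negligible (\<Phi> j ` S j)" for j
  proof (rule negligible_differentiable_image_negligible)
    have "(axis j (axis j 1) :: real^'p^'p) \<in> Basis" by (auto simp: Basis_vec_def)
    then have "negligible {N :: real^'p^'p. N \<bullet> axis j (axis j 1) = 0}" by (rule negligible_standard_hyperplane)
    then show "negligible (S j)"
      by (rule negligible_subset) (auto simp: S_def inner_axis)
    show "\<Phi> j differentiable_on S j"
      unfolding differentiable_on_def
    proof
      fix N assume N: "N \<in> S j"
      then have nz: "g (N $ j $ k) \<noteq> 0" by (simp add: S_def)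
      have nth: "(\<lambda>N::real^'p^'p. N $ i $ m) differentiable (at N within S j)" for i m
        by (intro bounded_linear_imp_differentiable bounded_linear_compose[OF bounded_linear_vec_nth bounded_linear_vec_nth])
      have rw: "(\<lambda>N::real^'p^'p. N $ m) differentiable (at N within S j)" for m
        by (intro bounded_linear_imp_differentiable bounded_linear_vec_nth)
      have g': "(\<lambda>N. g (N $ j $ k)) differentiable (at N within S j)"
        by (rule differentiable_compose[OF g nth])
      have r': "(\<lambda>N. r (N $ j $ k)) differentiable (at N within S j)"
        by (rule differentiable_compose[OF r nth])
      have r'': "(\<lambda>N. r (N $ j $ k) $ m) differentiable (at N within S j)" for m
        by (rule differentiable_compose[OF bounded_linear_imp_differentiable[OF bounded_linear_vec_nth] r'])
      have "v j differentiable (at N within S j)"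
        unfolding v_def
        by (intro differentiable_scaleR differentiable_divide differentiable_const differentiable_diff
            differentiable_sum ballI differentiable_add nth rw g' r'' nz) auto
      then have "(\<lambda>N. (N, v j N)) differentiable (at N within S j)"
        by (intro differentiable_Pair differentiable_ident)
      from differentiable_compose[OF linear_imp_differentiable[OF linear_row_upd[of j]] this]
      show "\<Phi> j differentiable (at N within S j)" by (simp add: \<Phi>_def[abs_def])
    qed
  qed simp
  then have "negligible (\<Union>j. \<Phi> j ` S j)" by (intro negligible_Union) auto
  moreover have "{M. \<exists>t\<in>T. cofac k (g t *\<^sub>R M + r t) = 0} \<subseteq> (\<Union>j. \<Phi> j ` S j)"
  proof
    fix M assume "M \<in> {M. \<exists>t\<in>T. cofac k (g t *\<^sub>R M + r t) = 0}"
    then obtain t where t: "t \<in> T" "cofac k (g t *\<^sub>R M + r t) = 0" by blast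
    from cofac_eq_0_imp_dependent[OF t(2)] obtain j c where j: "j \<noteq> k"
      and c: "(g t *\<^sub>R M + r t) $ j = (\<Sum>m\<in>UNIV - {j, k}. c m *\<^sub>R (g t *\<^sub>R M + r t) $ m)" by blast
    \<comment> \<open>Row \<open>j\<close> of \<open>M\<close> is overwritten by the time in entry
      \<open>k\<close>, zero in entry \<open>j\<close>, and the coefficients elsewhere.\<close>
    define N where "N = row_upd M j (\<chi> m. if m = k then t else if m = j then 0 else c m)"
    have N: "N $ j $ k = t" "N $ j $ j = 0" "\<And>m. m \<noteq> j \<Longrightarrow> N $ m = M $ m"
      "\<And>m. m \<noteq> j \<Longrightarrow> m \<noteq> k \<Longrightarrow> N $ j $ m = c m"
      using j by (auto simp: N_def row_upd_nth)
    have "(\<Sum>m\<in>UNIV - {j, k}. N $ j $ m *\<^sub>R (g t *\<^sub>R N $ m + r t $ m)) = g t *\<^sub>R M $ j + r t $ j"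
      using c by (simp add: N)
    then have "v j N = M $ j" using T[OF t(1)] by (simp add: v_def N)
    then have "\<Phi> j N = M" by (simp add: \<Phi>_def vec_eq_iff row_upd_nth N)
    moreover have "N \<in> S j" using N T[OF t(1)] by (simp add: S_def)
    ultimately show "M \<in> (\<Union>j. \<Phi> j ` S j)" by blast
  qed
  ultimately show ?thesis by (rule negligible_subset)
qed

lemma emeasure_gauss_negligible:
  assumes "E \<in> sets borel" "negligible E"
  shows "emeasure gauss E = 0"
proof -
  have "E \<in> null_sets lborel"
    using assms by (auto simp: negligible_iff_null_sets null_sets_def)
  then have "AE x in lborel. x \<notin> E" by (rule AE_not_in)
  then have "AE x in gauss. x \<notin> E" unfolding gauss_def by (subst AE_density) auto
  then show ?thesis using assms(1) by (subst (asm) AE_iff_measurable[where N=E]) auto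
qed

text \<open>The case of factor 1 and offset 0, constant in time.\<close>

lemma AE_gauss_cofac_nonzero: "AE X in (gauss :: (real^'p^'p::finite) measure). cofac k X \<noteq> 0"
proof -
  have "{X. cofac k X = 0} = {M. \<exists>t\<in>UNIV. cofac k ((\<lambda>_::real. 1) t *\<^sub>R M + (\<lambda>_. 0) t) = 0}" by auto
  also have "negligible \<dots>" by (rule negligible_cofac_zero) auto
  finally have "emeasure gauss {X :: real^'p^'p. cofac k X = 0} = 0" by (intro emeasure_gauss_negligible) measurable
  then show ?thesis by (subst AE_iff_measurable[where N="{X. cofac k X = 0}"]) auto
qed

text \<open>On the compact set \<open>T l m\<close> the coefficient \<open>w l\<close> stays away
  from zero. With the other matrices fixed, the path is there a nonzero multiple of
  \<open>Z l\<close> plus a known curve, so the negligible set above covers all these times at once.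
  Countably many such sets exhaust the interval, and compactness makes the exceptional event
  measurable.\<close>

lemma AE_path_cofac_nonzero:
  assumes w: "\<And>l t. l \<le> n \<Longrightarrow> w l differentiable (at t)"
    and nz: "\<And>t. t \<in> {a..b} \<Longrightarrow> \<exists>l\<le>n. w l t \<noteq> 0"
  shows "AE Z in PiM {..n} (\<lambda>_. gauss :: (real^'p^'p::finite) measure). \<forall>t\<in>{a..b}. cofac k (lin_path n w Z t) \<noteq> 0"
proof -
  let ?P = "PiM {..n} (\<lambda>_. gauss :: (real^'p^'p) measure)"
  define T where "T l m = {t \<in> {a..b}. \<bar>w l t\<bar> \<ge> 1 / real (Suc m)}" for l m
  have wc: "continuous_on S (w l)" if "l \<le> n" for l S
    using w[OF that] by (auto intro!: continuous_at_imp_continuous_on differentiable_imp_continuous_within)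
  have cT: "compact (T l m)" if "l \<le> n" for l m
  proof -
    have "T l m = {a..b} \<inter> (\<lambda>t. \<bar>w l t\<bar>) -` {1 / real (Suc m)..}" by (auto simp: T_def)
    also have "closed ({a..b} \<inter> (\<lambda>t. \<bar>w l t\<bar>) -` {1 / real (Suc m)..})"
      by (intro continuous_closed_preimage continuous_intros wc that)
    finally show ?thesis by (auto simp: compact_eq_bounded_closed T_def intro: bounded_subset[of "{a..b}"])
  qed
  have "AE Z in ?P. \<not> (\<exists>t\<in>T l m. norm (cofac k (lin_path n w Z t)) = 0)" if l: "l \<le> n" for l m
  proof -
    let ?E = "{Z \<in> space ?P. \<exists>t\<in>T l m. norm (cofac k (lin_path n w Z t)) = 0}"
    have E: "?E \<in> sets ?P"
      by (rule sets_ex_zero_on_compact[OF cT[OF l]]) (auto intro!: continuous_intros continuous_on_lin_path wc)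
    have "emeasure ?P ?E = 0"
    proof (rule PiM_null_if_sections_null[where l=l])
      fix Z assume Z: "Z \<in> space ?P"
      then have upd: "(\<lambda>y. Z(l := y)) \<in> gauss \<rightarrow>\<^sub>M ?P"
        using l by (intro measurable_fun_upd[where J="{..n}"]) auto
      define r where "r t = (\<Sum>i\<in>{..n} - {l}. w i t *\<^sub>R Z i)" for t
      have path: "lin_path n w (Z(l := y)) t = w l t *\<^sub>R y + r t" for y t
        unfolding lin_path_def r_def using l by (subst sum.remove[of _ l]) (auto intro!: sum.cong)
      have sec: "{y \<in> space gauss. Z(l := y) \<in> ?E} = {M. \<exists>t\<in>T l m. cofac k (w l t *\<^sub>R M + r t) = 0}"
        using measurable_space[OF upd] by (auto simp: path)
      have "{y \<in> space gauss. Z(l := y) \<in> ?E} \<in> sets gauss"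
        using measurable_sets[OF upd E] by (simp add: vimage_def)
      moreover have "negligible {M. \<exists>t\<in>T l m. cofac k (w l t *\<^sub>R M + r t) = 0}"
      proof (rule negligible_cofac_zero)
        show "r differentiable (at t)" for t
          unfolding r_def by (intro differentiable_sum ballI differentiable_scaleR differentiable_const w) simp_all
        show "w l t \<noteq> 0" if "t \<in> T l m" for t
        proof -
          have "0 < 1 / real (Suc m)" by simp
          also have "\<dots> \<le> \<bar>w l t\<bar>" using that by (simp add: T_def)
          finally show ?thesis by simp
        qed
      qed (rule w[OF l])
      ultimately show "emeasure gauss {y \<in> space gauss. Z(l := y) \<in> ?E} = 0"
        unfolding sec by (intro emeasure_gauss_negligible) auto
    qed (use l E prob_space_gauss in auto)
    with E have "AE Z in ?P. Z \<notin> ?E" by (intro AE_not_in) auto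
    with AE_space show ?thesis by eventually_elim auto
  qed
  then have "AE Z in ?P. \<forall>l\<in>{..n}. \<forall>m. \<not> (\<exists>t\<in>T l m. norm (cofac k (lin_path n w Z t)) = 0)"
    by (intro AE_ball_countable[THEN iffD2] ballI AE_all_countable[THEN iffD2] allI countable_finite) auto
  then show ?thesis
  proof (eventually_elim, intro ballI)
    fix Z t assume *: "\<forall>l\<in>{..n}. \<forall>m. \<not> (\<exists>t\<in>T l m. norm (cofac k (lin_path n w Z t)) = 0)" and t: "t \<in> {a..b}"
    obtain l where l: "l \<le> n" "w l t \<noteq> 0" using nz[OF t] by blast
    obtain m where "inverse (real (Suc m)) < \<bar>w l t\<bar>" using reals_Archimedean[of "\<bar>w l t\<bar>"] l by auto
    then have "t \<in> T l m" using t by (simp add: T_def inverse_eq_divide)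
    with * l show "cofac k (lin_path n w Z t) \<noteq> 0" by auto
  qed
qed

section \<open>The expected norm of a Gaussian vector\<close>

text \<open>exp (- s^2 / 2) is the integral of r exp (- r^2 / 2) over r \<ge> s. Exchanging the
  integrals reduces Gaussian expectations to Lebesgue integrals over balls, in place of polar
  coordinates.\<close>

lemma nn_integral_gauss_layer_cake:
  fixes h :: "'a::euclidean_space \<Rightarrow> ennreal"
  assumes [measurable]: "h \<in> borel_measurable borel"
  shows "(\<integral>\<^sup>+x. h x \<partial>gauss) =
    (\<integral>\<^sup>+r. ennreal ((1 / sqrt (2 * pi)) ^ DIM('a) * r * exp (- r\<^sup>2 / 2)) * indicator {0..} r * (\<integral>\<^sup>+x. h x * indicator (cball 0 r) x \<partial>lborel) \<partial>lborel)"
proof -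
  define c where "c = (1 / sqrt (2 * pi)) ^ DIM('a)"
  have c: "c \<ge> 0" by (simp add: c_def)
  have tail: "ennreal (c * exp (- s\<^sup>2 / 2)) = (\<integral>\<^sup>+r. ennreal (c * r * exp (- r\<^sup>2 / 2)) * indicator {s..} r \<partial>lborel)" if "s \<ge> 0" for s
  proof -
    have "((\<lambda>r. - c * exp (- r\<^sup>2 / 2)) \<longlongrightarrow> - c * 0) at_top"
    proof (intro tendsto_mult tendsto_const)
      have "filterlim (\<lambda>r::real. r\<^sup>2 * (1/2)) at_top at_top"
        by (intro filterlim_at_top_mult_tendsto_pos[OF tendsto_const] filterlim_pow_at_top filterlim_ident) auto
      then have "filterlim (\<lambda>r::real. - r\<^sup>2 / 2) at_bot at_top"
        by (simp add: filterlim_uminus_at_bot)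
      then show "((\<lambda>r::real. exp (- r\<^sup>2 / 2)) \<longlongrightarrow> 0) at_top"
        by (rule filterlim_compose[OF exp_at_bot])
    qed
    then have "(\<integral>\<^sup>+r. ennreal (c * r * exp (- r\<^sup>2 / 2)) * indicator {s..} r \<partial>lborel) = ennreal (0 - (- c * exp (- s\<^sup>2 / 2)))"
      using that c by (intro nn_integral_FTC_atLeast) (auto intro!: derivative_eq_intros)
    then show ?thesis by simp
  qed
  have "(\<integral>\<^sup>+x. h x \<partial>gauss) = (\<integral>\<^sup>+x. ennreal (c * exp (- (norm x)\<^sup>2 / 2)) * h x \<partial>lborel)"
    unfolding gauss_def c_def by (rule nn_integral_density) auto
  also have "\<dots> = (\<integral>\<^sup>+x. \<integral>\<^sup>+r. ennreal (c * r * exp (- r\<^sup>2 / 2)) * indicator {norm x..} r * h x \<partial>lborel \<partial>lborel)"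
    by (intro nn_integral_cong) (subst tail, simp, simp add: nn_integral_multc)
  also have "\<dots> = (\<integral>\<^sup>+r. \<integral>\<^sup>+x. ennreal (c * r * exp (- r\<^sup>2 / 2)) * indicator {norm x..} r * h x \<partial>lborel \<partial>lborel)"
  proof (rule lborel_pair.Fubini')
    have "(\<lambda>(r, x::'a). ennreal (c * r * exp (- r\<^sup>2 / 2)) * indicator {p. norm (snd p) \<le> fst p} (r, x) * h x) \<in> borel_measurable (lborel \<Otimes>\<^sub>M lborel)"
      by measurable
    moreover have "indicator {p. norm (snd p) \<le> fst p} (r, x) = (indicator {norm x..} r :: ennreal)" for r and x :: 'a
      by (auto split: split_indicator)
    ultimately show "(\<lambda>(r, x::'a). ennreal (c * r * exp (- r\<^sup>2 / 2)) * indicator {norm x..} r * h x) \<in> borel_measurable (lborel \<Otimes>\<^sub>M lborel)"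
      by simp
  qed
  also have "\<dots> = (\<integral>\<^sup>+r. ennreal (c * r * exp (- r\<^sup>2 / 2)) * indicator {0..} r * (\<integral>\<^sup>+x. h x * indicator (cball 0 r) x \<partial>lborel) \<partial>lborel)"
  proof (rule nn_integral_cong)
    fix r :: real
    have [measurable]: "cball (0::'a) r \<in> sets borel" by simp
    have m: "(\<lambda>x. h x * indicator (cball 0 r) x) \<in> borel_measurable lborel" by measurable
    have "(\<integral>\<^sup>+x. ennreal (c * r * exp (- r\<^sup>2 / 2)) * indicator {norm x..} r * h x \<partial>lborel)
       = (\<integral>\<^sup>+x. ennreal (c * r * exp (- r\<^sup>2 / 2)) * indicator {0..} r * (h x * indicator (cball 0 r) x) \<partial>lborel)"
      by (intro nn_integral_cong) (auto split: split_indicator intro: order_trans[OF norm_ge_zero])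
    then show "(\<integral>\<^sup>+x. ennreal (c * r * exp (- r\<^sup>2 / 2)) * indicator {norm x..} r * h x \<partial>lborel)
      = ennreal (c * r * exp (- r\<^sup>2 / 2)) * indicator {0..} r * (\<integral>\<^sup>+x. h x * indicator (cball 0 r) x \<partial>lborel)"
      by (simp only: nn_integral_cmult[OF m])
  qed
  finally show ?thesis unfolding c_def .
qed

text \<open>The norm of x is the length of the set of t with 0 \<le> t < norm x. Fubini leaves the
  volumes of the shells between radius t and radius r.\<close>

lemma nn_integral_norm_cball:
  assumes r: "r \<ge> 0"
  shows "(\<integral>\<^sup>+x. ennreal (norm x) * indicator (cball 0 r) x \<partial>(lborel :: 'a::euclidean_space measure)) =
    ennreal (unit_ball_vol (real DIM('a)) * (real DIM('a) / (real DIM('a) + 1)) * r ^ (DIM('a) + 1))"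
proof -
  define d where "d = DIM('a)"
  define \<kappa> where "\<kappa> = unit_ball_vol (real d)"
  have \<kappa>: "\<kappa> \<ge> 0" by (simp add: \<kappa>_def)
  have [measurable]: "cball (0::'a) s \<in> sets borel" for s by simp
  have "(\<integral>\<^sup>+x. ennreal (norm x) * indicator (cball 0 r) x \<partial>(lborel :: 'a measure))
     = (\<integral>\<^sup>+x. \<integral>\<^sup>+t. indicator {p. fst p < norm (snd p) \<and> 0 \<le> fst p \<and> fst p \<le> r} (t, x) * indicator (cball 0 r) x \<partial>lborel \<partial>(lborel :: 'a measure))"
  proof (rule nn_integral_cong)
    fix x :: 'a
    have "(\<integral>\<^sup>+t. indicator {p. fst p < norm (snd p) \<and> 0 \<le> fst p \<and> fst p \<le> r} (t, x) * indicator (cball 0 r) x \<partial>lborel)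
       = (\<integral>\<^sup>+t. indicator {0..<norm x} t * indicator (cball 0 r) x \<partial>lborel)"
      by (intro nn_integral_cong) (auto split: split_indicator)
    then show "ennreal (norm x) * indicator (cball 0 r) x = (\<integral>\<^sup>+t. indicator {p. fst p < norm (snd p) \<and> 0 \<le> fst p \<and> fst p \<le> r} (t, x) * indicator (cball 0 r) x \<partial>lborel)"
      by (simp add: nn_integral_multc)
  qed
  also have "\<dots> = (\<integral>\<^sup>+t. \<integral>\<^sup>+x. indicator {p. fst p < norm (snd p) \<and> 0 \<le> fst p \<and> fst p \<le> r} (t, x) * indicator (cball 0 r) x \<partial>(lborel :: 'a measure) \<partial>lborel)"
    by (rule lborel_pair.Fubini'[symmetric]) measurable
  also have "\<dots> = (\<integral>\<^sup>+t. ennreal (\<kappa> * r ^ d - \<kappa> * t ^ d) * indicator {0..r} t \<partial>lborel)"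
  proof (rule nn_integral_cong)
    fix t :: real
    show "(\<integral>\<^sup>+x. indicator {p. fst p < norm (snd p) \<and> 0 \<le> fst p \<and> fst p \<le> r} (t, x) * indicator (cball 0 r) x \<partial>(lborel :: 'a measure))
      = ennreal (\<kappa> * r ^ d - \<kappa> * t ^ d) * indicator {0..r} t"
    proof (cases "0 \<le> t \<and> t \<le> r")
      case True
      have "(\<integral>\<^sup>+x. indicator {p. fst p < norm (snd p) \<and> 0 \<le> fst p \<and> fst p \<le> r} (t, x) * indicator (cball 0 r) x \<partial>(lborel :: 'a measure))
        = (\<integral>\<^sup>+x. indicator (cball 0 r - cball 0 t) x \<partial>(lborel :: 'a measure))"
        using True by (intro nn_integral_cong) (auto split: split_indicator)
      also have "\<dots> = emeasure lborel (cball (0::'a) r) - emeasure lborel (cball (0::'a) t)"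
        using True emeasure_lborel_cball_finite[of "0::'a" t]
        by (subst nn_integral_indicator, simp, intro emeasure_Diff) (auto simp: less_top[symmetric])
      also have "\<dots> = ennreal (\<kappa> * r ^ d - \<kappa> * t ^ d)"
        using True \<kappa> by (simp add: emeasure_cball \<kappa>_def d_def ennreal_minus)
      finally show ?thesis using True by simp
    qed auto
  qed
  also have "\<dots> = ennreal ((\<kappa> * r ^ d * r - \<kappa> * r ^ (d + 1) / (real d + 1)) - (\<kappa> * r ^ d * 0 - \<kappa> * 0 ^ (d + 1) / (real d + 1)))"
  proof (rule nn_integral_FTC_Icc[where F="\<lambda>t. \<kappa> * r ^ d * t - \<kappa> * t ^ (d + 1) / (real d + 1)"])
    show "(\<lambda>t. \<kappa> * r ^ d - \<kappa> * t ^ d) \<in> borel_measurable borel" by measurable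
    show "((\<lambda>t. \<kappa> * r ^ d * t - \<kappa> * t ^ (d + 1) / (real d + 1)) has_real_derivative \<kappa> * r ^ d - \<kappa> * t ^ d) (at t)" for t
    proof -
      have "((\<lambda>t. t ^ (d + 1) / (real d + 1)) has_real_derivative t ^ d) (at t)"
        by (rule DERIV_cong[OF DERIV_cdivide[OF DERIV_pow]]) (simp add: add.commute)
      from DERIV_diff[OF DERIV_cmult_Id DERIV_cmult[OF this]] show ?thesis by simp
    qed
    show "0 \<le> \<kappa> * r ^ d - \<kappa> * t ^ d" if "t \<in> {0..r}" for t
      using power_mono[of t r d] that \<kappa> by (simp add: mult_left_mono)
  qed (use r in auto)
  also have "(\<kappa> * r ^ d * r - \<kappa> * r ^ (d + 1) / (real d + 1)) - (\<kappa> * r ^ d * 0 - \<kappa> * 0 ^ (d + 1) / (real d + 1))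
    = \<kappa> * (real d / (real d + 1)) * r ^ (d + 1)"
  proof -
    have "\<kappa> * R - \<kappa> * R / y = \<kappa> * ((y - 1) / y) * R" if "y > 0" for R y :: real
      using that by (simp add: field_simps)
    from this[of "real d + 1" "r ^ (d + 1)"] show ?thesis by (simp add: mult_ac)
  qed
  finally show ?thesis by (simp add: \<kappa>_def d_def)
qed

definition radial_moment :: "nat \<Rightarrow> ennreal" where
  "radial_moment k = (\<integral>\<^sup>+r. ennreal (r ^ k * exp (- r\<^sup>2 / 2)) * indicator {0..} r \<partial>lborel)"

text \<open>Total mass one of the Gaussian measure in dimension d evaluates the radial moment of
  order d + 1, without computing the integral itself.\<close>

lemma radial_moment_DIM:
  "ennreal ((1 / sqrt (2 * pi)) ^ DIM('a::euclidean_space) * unit_ball_vol (real DIM('a))) * radial_moment (DIM('a) + 1) = 1"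
proof -
  interpret prob_space "gauss :: 'a measure" by (rule prob_space_gauss)
  let ?c = "(1 / sqrt (2 * pi)) ^ DIM('a)" and ?k = "unit_ball_vol (real DIM('a))"
  have k: "?k \<ge> 0" by simp
  have "1 = (\<integral>\<^sup>+x. 1 \<partial>(gauss :: 'a measure))" using emeasure_space_1 by simp
  also have "\<dots> = (\<integral>\<^sup>+r. ennreal (?c * r * exp (- r\<^sup>2 / 2)) * indicator {0..} r * (\<integral>\<^sup>+x. 1 * indicator (cball 0 r) x \<partial>(lborel :: 'a measure)) \<partial>lborel)"
    by (rule nn_integral_gauss_layer_cake) simp
  also have "\<dots> = (\<integral>\<^sup>+r. ennreal (?c * ?k) * (ennreal (r ^ (DIM('a) + 1) * exp (- r\<^sup>2 / 2)) * indicator {0..} r) \<partial>lborel)"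
  proof (rule nn_integral_cong)
    fix r :: real
    show "ennreal (?c * r * exp (- r\<^sup>2 / 2)) * indicator {0..} r * (\<integral>\<^sup>+x. 1 * indicator (cball 0 r) x \<partial>(lborel :: 'a measure))
      = ennreal (?c * ?k) * (ennreal (r ^ (DIM('a) + 1) * exp (- r\<^sup>2 / 2)) * indicator {0..} r)"
    proof (cases "r \<ge> 0")
      case True
      then have "(\<integral>\<^sup>+x. 1 * indicator (cball 0 r) x \<partial>(lborel :: 'a measure)) = ennreal (?k * r ^ DIM('a))"
        by (simp add: emeasure_cball)
      then show ?thesis using True k
        by (simp add: ennreal_mult[symmetric] mult_ac)
    qed auto
  qed
  also have "\<dots> = ennreal (?c * ?k) * radial_moment (DIM('a) + 1)"
    unfolding radial_moment_def by (rule nn_integral_cmult) measurable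
  finally show ?thesis by simp
qed

text \<open>The norm raises the order of the radial moment by one, and that moment is known from
  total mass one in dimension d + 1. The quotient of the two unit ball volumes becomes the quotient
  of Gamma values.\<close>

lemma nn_integral_gauss_norm:
  "(\<integral>\<^sup>+x. ennreal (norm x) \<partial>(gauss :: 'a::euclidean_space measure)) =
     ennreal (sqrt 2 * Gamma ((real DIM('a) + 1) / 2) / Gamma (real DIM('a) / 2))"
proof -
  define d where "d = DIM('a)"
  have d: "d > 0" by (simp add: d_def)
  define c where "c k = (1 / sqrt (2 * pi)) ^ k" for k :: nat
  define \<kappa> where "\<kappa> k = unit_ball_vol (real k)" for k :: nat
  have pos: "c k > 0" "\<kappa> k > 0" for k by (simp_all add: c_def \<kappa>_def)
  have "(\<integral>\<^sup>+x. ennreal (norm x) \<partial>(gauss :: 'a measure))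
     = (\<integral>\<^sup>+r. ennreal (c d * r * exp (- r\<^sup>2 / 2)) * indicator {0..} r * (\<integral>\<^sup>+x. ennreal (norm x) * indicator (cball 0 r) x \<partial>(lborel :: 'a measure)) \<partial>lborel)"
    unfolding c_def d_def by (rule nn_integral_gauss_layer_cake) simp
  also have "\<dots> = (\<integral>\<^sup>+r. ennreal (c d * \<kappa> d * (real d / (real d + 1))) * (ennreal (r ^ (d + 1 + 1) * exp (- r\<^sup>2 / 2)) * indicator {0..} r) \<partial>lborel)"
  proof (rule nn_integral_cong)
    fix r :: real
    show "ennreal (c d * r * exp (- r\<^sup>2 / 2)) * indicator {0..} r * (\<integral>\<^sup>+x. ennreal (norm x) * indicator (cball 0 r) x \<partial>(lborel :: 'a measure))
      = ennreal (c d * \<kappa> d * (real d / (real d + 1))) * (ennreal (r ^ (d + 1 + 1) * exp (- r\<^sup>2 / 2)) * indicator {0..} r)"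
    proof (cases "r \<ge> 0")
      case True
      have "(\<integral>\<^sup>+x. ennreal (norm x) * indicator (cball 0 r) x \<partial>(lborel :: 'a measure)) = ennreal (\<kappa> d * (real d / (real d + 1)) * r ^ (d + 1))"
        unfolding \<kappa>_def d_def by (rule nn_integral_norm_cball[OF True])
      then show ?thesis using True pos[of d]
        by (simp add: ennreal_mult[symmetric] mult_ac less_imp_le)
    qed auto
  qed
  also have "\<dots> = ennreal (c d * \<kappa> d * (real d / (real d + 1))) * radial_moment (d + 1 + 1)"
    unfolding radial_moment_def by (rule nn_integral_cmult) measurable
  also have "radial_moment (d + 1 + 1) = ennreal (1 / (c (d + 1) * \<kappa> (d + 1)))"
  proof -
    \<comment> \<open>The product with the real line realises dimension d + 1.\<close>
    have "ennreal (c (d + 1) * \<kappa> (d + 1)) * radial_moment (d + 1 + 1) = 1"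
      using radial_moment_DIM[where 'a="'a \<times> real"] by (simp add: c_def \<kappa>_def d_def)
    then have "ennreal (1 / (c (d + 1) * \<kappa> (d + 1))) * (ennreal (c (d + 1) * \<kappa> (d + 1)) * radial_moment (d + 1 + 1)) = ennreal (1 / (c (d + 1) * \<kappa> (d + 1)))"
      by simp
    moreover have "ennreal (1 / (c (d + 1) * \<kappa> (d + 1))) * ennreal (c (d + 1) * \<kappa> (d + 1)) = 1"
      using pos[of "d + 1"] by (subst ennreal_mult[symmetric]) auto
    ultimately show ?thesis by (metis mult.assoc mult_1)
  qed
  also have "ennreal (c d * \<kappa> d * (real d / (real d + 1))) * ennreal (1 / (c (d + 1) * \<kappa> (d + 1)))
     = ennreal (c d * \<kappa> d * (real d / (real d + 1)) * (1 / (c (d + 1) * \<kappa> (d + 1))))"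
    using pos[of d] pos[of "d + 1"] by (intro ennreal_mult[symmetric]) (auto simp: less_imp_le)
  also have "c d * \<kappa> d * (real d / (real d + 1)) * (1 / (c (d + 1) * \<kappa> (d + 1))) = sqrt 2 * Gamma ((real d + 1) / 2) / Gamma (real d / 2)"
  proof -
    have c1: "c (d + 1) = c d / sqrt (2 * pi)" by (simp add: c_def)
    have G1: "Gamma (real d / 2 + 1) = real d / 2 * Gamma (real d / 2)" using d by (intro Gamma_plus1) auto
    have G2: "Gamma (real (d + 1) / 2 + 1) = (real d + 1) / 2 * Gamma ((real d + 1) / 2)"
    proof -
      have "(real d + 1) / 2 \<notin> \<int>\<^sub>\<le>\<^sub>0" using nonpos_Ints_nonpos[of "(real d + 1) / 2"] by force
      moreover have "real (d + 1) = real d + 1" by simp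
      ultimately show ?thesis using Gamma_plus1[of "(real d + 1) / 2"] by (simp only: not_False_eq_True)
    qed
    have p1: "pi powr (real (d + 1) / 2) = pi powr (real d / 2) * sqrt pi"
      by (simp add: add_divide_distrib powr_add powr_half_sqrt)
    have gp: "Gamma (real d / 2) > 0" "Gamma ((real d + 1) / 2) > 0" using d by (auto intro: Gamma_real_pos)
    \<comment> \<open>Here A is \<open>c d\<close>, B is pi to the power d / 2, x is d, y is d + 1,
      G and H are the two Gamma values, q is sqrt 2 and s is sqrt pi.\<close>
    have alg: "A * (B / (x / 2 * G)) * (x / y) * (1 / (A / (q * s) * ((B * s) / (y / 2 * H)))) = q * H / G"
      if "A > 0" "B > 0" "x > 0" "y > 0" "G > 0" "H > 0" "q > 0" "s > 0" for A B x y G H q s :: real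
      using that by simp
    show ?thesis
      unfolding \<kappa>_def unit_ball_vol_def c1 G1 G2 p1 real_sqrt_mult using d gp
      by (intro alg) (simp_all add: c_def)
  qed
  finally show ?thesis by (simp add: d_def)
qed

section \<open>Sign changes of pairs of Gaussian vectors\<close>

lemma polar_coordinates_ex: "\<exists>r c s. a = r * c \<and> b = r * s \<and> c\<^sup>2 + s\<^sup>2 = (1::real)"
proof (cases "a = 0 \<and> b = 0")
  case True
  then show ?thesis by (intro exI[of _ 0] exI[of _ 1] exI[of _ 0]) auto
next
  case False
  define r where "r = sqrt (a\<^sup>2 + b\<^sup>2)"
  have "a\<^sup>2 + b\<^sup>2 > 0" using False by (simp add: sum_power2_gt_zero_iff)
  then have r: "r > 0" "r\<^sup>2 = a\<^sup>2 + b\<^sup>2" by (simp_all add: r_def)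
  then have "(a / r)\<^sup>2 + (b / r)\<^sup>2 = 1" by (simp add: power_divide add_divide_distrib[symmetric] r(2)[symmetric])
  then show ?thesis using r(1) by (intro exI[of _ r] exI[of _ "a / r"] exI[of _ "b / r"]) auto
qed

text \<open>Two linear combinations of i.i.d. Gaussian vectors have the law given by the Cholesky factor of
  their Gram matrix; each further vector is absorbed by two planar rotations.\<close>

lemma distr_PiM_gauss_pair:
  fixes u v :: "'i \<Rightarrow> real"
  assumes "finite I"
  shows "\<exists>\<alpha> \<beta> \<delta>. \<alpha>\<^sup>2 = (\<Sum>l\<in>I. (u l)\<^sup>2) \<and> \<alpha> * \<beta> = (\<Sum>l\<in>I. u l * v l) \<and> \<beta>\<^sup>2 + \<delta>\<^sup>2 = (\<Sum>l\<in>I. (v l)\<^sup>2) \<and>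
    distr (PiM I (\<lambda>_. gauss :: 'a::euclidean_space measure)) borel (\<lambda>Z. (\<Sum>l\<in>I. u l *\<^sub>R Z l, \<Sum>l\<in>I. v l *\<^sub>R Z l))
      = distr gauss borel (\<lambda>(x::'a, y::'a). (\<alpha> *\<^sub>R x, \<beta> *\<^sub>R x + \<delta> *\<^sub>R y))"
  using assms
proof (induction I)
  case empty
  interpret A: prob_space "PiM {} (\<lambda>_. gauss :: 'a measure) :: ('i \<Rightarrow> 'a) measure" by (rule prob_space_PiM) (rule prob_space_gauss)
  interpret B: prob_space "gauss :: ('a \<times> 'a) measure" by (rule prob_space_gauss)
  have "distr (PiM {} (\<lambda>_. gauss :: 'a measure) :: ('i \<Rightarrow> 'a) measure) borel (\<lambda>Z. (0::'a, 0::'a)) = distr (gauss :: ('a \<times> 'a) measure) borel (\<lambda>Z. (0::'a, 0::'a))"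
    by (rule measure_eqI) (auto simp: emeasure_distr A.emeasure_space_1 B.emeasure_space_1[simplified] split: if_splits)
  then show ?case by (intro exI[of _ 0]) (simp add: split_beta' zero_prod_def)
next
  case (insert i I)
  then obtain \<alpha> \<beta> \<delta> where gram: "\<alpha>\<^sup>2 = (\<Sum>l\<in>I. (u l)\<^sup>2)" "\<alpha> * \<beta> = (\<Sum>l\<in>I. u l * v l)" "\<beta>\<^sup>2 + \<delta>\<^sup>2 = (\<Sum>l\<in>I. (v l)\<^sup>2)"
    and law: "distr (PiM I (\<lambda>_. gauss :: 'a measure)) borel (\<lambda>Z. (\<Sum>l\<in>I. u l *\<^sub>R Z l, \<Sum>l\<in>I. v l *\<^sub>R Z l))
      = distr gauss borel (\<lambda>(x::'a, y::'a). (\<alpha> *\<^sub>R x, \<beta> *\<^sub>R x + \<delta> *\<^sub>R y))" by blast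
  \<comment> \<open>The rotation (c, s) merges the new vector with \<open>x\<close> into one vector
    that alone carries the first combination. The leftover direction c z - s x is merged with
    \<open>y\<close> by the rotation (c2, s2) below.\<close>
  obtain r c s where rcs: "\<alpha> = r * c" "u i = r * s" "c\<^sup>2 + s\<^sup>2 = 1" using polar_coordinates_ex[of \<alpha> "u i"] by blast
  obtain r2 c2 s2 where rcs2: "\<delta> = r2 * c2" "v i * c - \<beta> * s = r2 * s2" "c2\<^sup>2 + s2\<^sup>2 = 1"
    using polar_coordinates_ex[of \<delta> "v i * c - \<beta> * s"] by blast
  \<comment> \<open>\<open>T\<close> maps three vectors to two; the third orthogonal combination
    occurs in neither sum and is dropped. \<open>J\<close> is its adjoint.\<close>
  define T where "T = (\<lambda>(z::'a, x::'a, y::'a). (c *\<^sub>R x + s *\<^sub>R z, c2 *\<^sub>R y + s2 *\<^sub>R (c *\<^sub>R z - s *\<^sub>R x)))"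
  define J where "J = (\<lambda>(p::'a, q::'a). (s *\<^sub>R p + (s2 * c) *\<^sub>R q, c *\<^sub>R p - (s2 * s) *\<^sub>R q, c2 *\<^sub>R q))"
  have linT: "linear T" unfolding T_def by (rule linearI) (auto simp: algebra_simps)
  have linJ: "linear J" unfolding J_def by (rule linearI) (auto simp: algebra_simps)
  have T: "distr gauss borel T = gauss"
  proof (rule distr_gauss_coisometry[OF linT linJ])
    show "T x \<bullet> y = x \<bullet> J y" for x y
      by (cases x; cases y) (auto simp: T_def J_def inner_add_left inner_add_right inner_diff_left inner_diff_right algebra_simps)
    show "T (J y) = y" for y
    proof -
      obtain p q where y: "y = (p, q)" by (cases y)
      have "c *\<^sub>R (c *\<^sub>R p - (s2 * s) *\<^sub>R q) + s *\<^sub>R (s *\<^sub>R p + (s2 * c) *\<^sub>R q) = (c\<^sup>2 + s\<^sup>2) *\<^sub>R p"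
        by (simp add: algebra_simps power2_eq_square)
      moreover have "c2 *\<^sub>R c2 *\<^sub>R q + s2 *\<^sub>R (c *\<^sub>R (s *\<^sub>R p + (s2 * c) *\<^sub>R q) - s *\<^sub>R (c *\<^sub>R p - (s2 * s) *\<^sub>R q)) = (c2\<^sup>2 + s2\<^sup>2 * (c\<^sup>2 + s\<^sup>2)) *\<^sub>R q"
        by (simp add: algebra_simps power2_eq_square)
      ultimately show ?thesis using rcs(3) rcs2(3) by (simp add: y T_def J_def)
    qed
  qed
  define \<beta>' where "\<beta>' = \<beta> * c + v i * s"
  have g1: "r\<^sup>2 = (\<Sum>l\<in>insert i I. (u l)\<^sup>2)"
  proof -
    have "r\<^sup>2 = r\<^sup>2 * (c\<^sup>2 + s\<^sup>2)" using rcs(3) by simp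
    also have "\<dots> = (u i)\<^sup>2 + \<alpha>\<^sup>2" unfolding rcs(1,2) by (simp add: algebra_simps power_mult_distrib)
    finally show ?thesis using insert gram by simp
  qed
  have g2: "r * \<beta>' = (\<Sum>l\<in>insert i I. u l * v l)"
  proof -
    have "r * \<beta>' = \<alpha> * \<beta> + u i * v i" unfolding rcs(1,2) \<beta>'_def by (simp add: algebra_simps)
    then show ?thesis using insert gram by simp
  qed
  have g3: "\<beta>'\<^sup>2 + r2\<^sup>2 = (\<Sum>l\<in>insert i I. (v l)\<^sup>2)"
  proof -
    have "r2\<^sup>2 = r2\<^sup>2 * (c2\<^sup>2 + s2\<^sup>2)" using rcs2(3) by simp
    also have "\<dots> = \<delta>\<^sup>2 + (v i * c - \<beta> * s)\<^sup>2" unfolding rcs2(1,2) by (simp add: algebra_simps power_mult_distrib)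
    finally have "\<beta>'\<^sup>2 + r2\<^sup>2 = \<delta>\<^sup>2 + (\<beta>\<^sup>2 + (v i)\<^sup>2) * (c\<^sup>2 + s\<^sup>2)" by (simp add: \<beta>'_def algebra_simps power2_eq_square)
    then show ?thesis using insert gram rcs(3) by simp
  qed
  let ?S = "\<lambda>Z. (\<Sum>l\<in>I. u l *\<^sub>R Z l, \<Sum>l\<in>I. v l *\<^sub>R Z l) :: 'a \<times> 'a"
  have S: "?S \<in> PiM I (\<lambda>_. gauss :: 'a measure) \<rightarrow>\<^sub>M borel"
    unfolding borel_prod[symmetric] by measurable
  let ?h = "\<lambda>(z, p). (u i *\<^sub>R z + fst p, v i *\<^sub>R z + snd p) :: 'a \<times> 'a"
  have h: "?h \<in> gauss \<Otimes>\<^sub>M borel \<rightarrow>\<^sub>M borel"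
  proof -
    have "(\<lambda>(z, p). (u i *\<^sub>R z + fst p, v i *\<^sub>R z + snd p) :: 'a \<times> 'a) \<in> gauss \<Otimes>\<^sub>M (borel \<Otimes>\<^sub>M borel) \<rightarrow>\<^sub>M borel \<Otimes>\<^sub>M borel"
      by measurable
    then show ?thesis by (simp add: borel_prod)
  qed
  have G: "(\<lambda>(x::'a, y::'a). (\<alpha> *\<^sub>R x, \<beta> *\<^sub>R x + \<delta> *\<^sub>R y)) \<in> gauss \<rightarrow>\<^sub>M borel"
    unfolding gauss_prod borel_prod[symmetric] by measurable
  have sf: "sigma_finite_measure (distr M borel f)" if "prob_space M" "f \<in> M \<rightarrow>\<^sub>M borel" for M :: "'c measure" and f :: "'c \<Rightarrow> 'a \<times> 'a"
    using prob_space.prob_space_distr[OF that] by (rule prob_space_imp_sigma_finite)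
  have pI: "prob_space (PiM I (\<lambda>_. gauss :: 'a measure))" by (rule prob_space_PiM) (rule prob_space_gauss)
  have upd: "(\<lambda>(x, X). X(i := x)) \<in> gauss \<Otimes>\<^sub>M PiM I (\<lambda>_. gauss :: 'a measure) \<rightarrow>\<^sub>M PiM (insert i I) (\<lambda>_. gauss)"
    by measurable
  have S': "(\<lambda>Z. (\<Sum>l\<in>insert i I. u l *\<^sub>R Z l, \<Sum>l\<in>insert i I. v l *\<^sub>R Z l)) \<in> PiM (insert i I) (\<lambda>_. gauss :: 'a measure) \<rightarrow>\<^sub>M borel"
    unfolding borel_prod[symmetric] by measurable
  have "distr (PiM (insert i I) (\<lambda>_. gauss :: 'a measure)) borel (\<lambda>Z. (\<Sum>l\<in>insert i I. u l *\<^sub>R Z l, \<Sum>l\<in>insert i I. v l *\<^sub>R Z l))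
    = distr (distr (gauss \<Otimes>\<^sub>M PiM I (\<lambda>_. gauss :: 'a measure)) (PiM (insert i I) (\<lambda>_. gauss)) (\<lambda>(x, X). X(i := x)))
        borel (\<lambda>Z. (\<Sum>l\<in>insert i I. u l *\<^sub>R Z l, \<Sum>l\<in>insert i I. v l *\<^sub>R Z l))"
    by (subst distr_pair_PiM_eq_PiM) (auto intro: prob_space_gauss)
  also have "\<dots> = distr (gauss \<Otimes>\<^sub>M PiM I (\<lambda>_. gauss :: 'a measure)) borel (\<lambda>(z, Z). ?h (z, ?S Z))"
  proof (subst distr_distr[OF S' upd], rule distr_cong)
    fix p :: "'a \<times> ('i \<Rightarrow> 'a)"
    obtain z Z where p: "p = (z, Z)" by (cases p)
    have "(\<Sum>l\<in>I. k l *\<^sub>R (Z(i := z)) l) = (\<Sum>l\<in>I. k l *\<^sub>R Z l)" for k :: "'i \<Rightarrow> real"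
      using insert by (intro sum.cong) auto
    then show "((\<lambda>Z. (\<Sum>l\<in>insert i I. u l *\<^sub>R Z l, \<Sum>l\<in>insert i I. v l *\<^sub>R Z l)) \<circ> (\<lambda>(x, X). X(i := x))) p = (case p of (z, Z) \<Rightarrow> ?h (z, ?S Z))"
      using insert by (simp add: p del: fun_upd_apply) simp
  qed simp_all
  also have "\<dots> = distr (distr (gauss \<Otimes>\<^sub>M PiM I (\<lambda>_. gauss :: 'a measure)) (gauss \<Otimes>\<^sub>M borel) (\<lambda>(z, Z). (z, ?S Z))) borel ?h"
    by (subst distr_distr[OF h]) (use S in \<open>auto simp: o_def split_beta'\<close>)
  also have "distr (gauss \<Otimes>\<^sub>M PiM I (\<lambda>_. gauss :: 'a measure)) (gauss \<Otimes>\<^sub>M borel) (\<lambda>(z, Z). (z, ?S Z))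
     = distr gauss gauss (\<lambda>z. z) \<Otimes>\<^sub>M distr (PiM I (\<lambda>_. gauss :: 'a measure)) borel ?S"
    by (rule pair_measure_distr[symmetric]) (use S sf[OF pI] in auto)
  also have "\<dots> = distr gauss gauss (\<lambda>z. z) \<Otimes>\<^sub>M distr gauss borel (\<lambda>(x::'a, y::'a). (\<alpha> *\<^sub>R x, \<beta> *\<^sub>R x + \<delta> *\<^sub>R y))"
    by (simp add: law)
  also have "\<dots> = distr (gauss \<Otimes>\<^sub>M gauss) (gauss \<Otimes>\<^sub>M borel) (\<lambda>(z, p). (z, (\<lambda>(x::'a, y::'a). (\<alpha> *\<^sub>R x, \<beta> *\<^sub>R x + \<delta> *\<^sub>R y)) p))"
    by (rule pair_measure_distr) (use G sf[OF prob_space_gauss] in auto)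
  also have "distr \<dots> borel ?h = distr (gauss \<Otimes>\<^sub>M gauss) borel (\<lambda>(z, x, y). (u i *\<^sub>R z + \<alpha> *\<^sub>R x, v i *\<^sub>R z + (\<beta> *\<^sub>R x + \<delta> *\<^sub>R y)))"
    by (subst distr_distr[OF h]) (use G in \<open>auto simp: o_def split_beta'\<close>)
  also have "\<dots> = distr gauss borel (\<lambda>p. (\<lambda>(x, y). (r *\<^sub>R x, \<beta>' *\<^sub>R x + r2 *\<^sub>R y)) (T p))"
    unfolding gauss_prod[symmetric]
  proof (rule distr_cong)
    fix p :: "'a \<times> 'a \<times> 'a"
    obtain z x y where p: "p = (z, x, y)" by (cases p)
    have "r *\<^sub>R (c *\<^sub>R x + s *\<^sub>R z) = u i *\<^sub>R z + \<alpha> *\<^sub>R x" by (simp add: rcs algebra_simps)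
    moreover have "\<beta>' *\<^sub>R (c *\<^sub>R x + s *\<^sub>R z) + r2 *\<^sub>R (c2 *\<^sub>R y + s2 *\<^sub>R (c *\<^sub>R z - s *\<^sub>R x)) = v i *\<^sub>R z + (\<beta> *\<^sub>R x + \<delta> *\<^sub>R y)"
    proof -
      have "r2 *\<^sub>R (c2 *\<^sub>R y + s2 *\<^sub>R (c *\<^sub>R z - s *\<^sub>R x)) = \<delta> *\<^sub>R y + (v i * c - \<beta> * s) *\<^sub>R (c *\<^sub>R z - s *\<^sub>R x)"
        by (simp add: rcs2 scaleR_add_right)
      then have "\<beta>' *\<^sub>R (c *\<^sub>R x + s *\<^sub>R z) + r2 *\<^sub>R (c2 *\<^sub>R y + s2 *\<^sub>R (c *\<^sub>R z - s *\<^sub>R x))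
        = (\<beta>' *\<^sub>R (c *\<^sub>R x + s *\<^sub>R z) + (v i * c - \<beta> * s) *\<^sub>R (c *\<^sub>R z - s *\<^sub>R x)) + \<delta> *\<^sub>R y"
        by (simp only: add_ac)
      also have "\<beta>' *\<^sub>R (c *\<^sub>R x + s *\<^sub>R z) + (v i * c - \<beta> * s) *\<^sub>R (c *\<^sub>R z - s *\<^sub>R x) = (v i * (c\<^sup>2 + s\<^sup>2)) *\<^sub>R z + (\<beta> * (c\<^sup>2 + s\<^sup>2)) *\<^sub>R x"
        by (simp add: \<beta>'_def algebra_simps power2_eq_square)
      finally show ?thesis using rcs(3) by (simp add: add_ac)
    qed
    ultimately show "(case p of (z, x, y) \<Rightarrow> (u i *\<^sub>R z + \<alpha> *\<^sub>R x, v i *\<^sub>R z + (\<beta> *\<^sub>R x + \<delta> *\<^sub>R y))) = (\<lambda>(x, y). (r *\<^sub>R x, \<beta>' *\<^sub>R x + r2 *\<^sub>R y)) (T p)"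
      by (simp add: p T_def)
  qed simp_all
  also have "\<dots> = distr (distr gauss borel T) borel (\<lambda>(x, y). (r *\<^sub>R x, \<beta>' *\<^sub>R x + r2 *\<^sub>R y))"
  proof (subst distr_distr)
    have "(\<lambda>(x::'a, y::'a). (r *\<^sub>R x, \<beta>' *\<^sub>R x + r2 *\<^sub>R y)) \<in> borel \<Otimes>\<^sub>M borel \<rightarrow>\<^sub>M borel \<Otimes>\<^sub>M borel" by measurable
    then show "(\<lambda>(x::'a, y::'a). (r *\<^sub>R x, \<beta>' *\<^sub>R x + r2 *\<^sub>R y)) \<in> borel \<rightarrow>\<^sub>M borel" by (simp add: borel_prod)
    show "T \<in> gauss \<rightarrow>\<^sub>M borel" using borel_measurable_linear[OF linT] by simp
  qed (simp add: o_def)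
  finally show ?case unfolding T using g1 g2 g3 by blast
qed

text \<open>The cosine \<open>c\<close> is the parameter because it is what the inner product of two
  unit coefficient vectors provides. The second argument of \<open>d\<close> has correlation
  \<open>c\<close> with the first.\<close>

definition sign_change_prob :: "('a::euclidean_space \<Rightarrow> real) \<Rightarrow> real \<Rightarrow> ennreal" where
  "sign_change_prob d c = emeasure gauss {p. d (fst p) * d (c *\<^sub>R fst p + sqrt (1 - c\<^sup>2) *\<^sub>R snd p) < 0}"

lemma measurable_sign_change_set:
  fixes d :: "'a::euclidean_space \<Rightarrow> real"
  assumes [measurable]: "d \<in> borel_measurable borel"
  shows "{p. d (\<alpha> *\<^sub>R fst p) * d (\<beta> *\<^sub>R fst p + \<delta> *\<^sub>R snd p) < 0} \<in> sets (borel :: ('a \<times> 'a) measure)"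
proof -
  have "Measurable.pred (borel \<Otimes>\<^sub>M borel) (\<lambda>p::'a \<times> 'a. d (\<alpha> *\<^sub>R fst p) * d (\<beta> *\<^sub>R fst p + \<delta> *\<^sub>R snd p) < 0)"
    by measurable
  then show ?thesis by (simp add: pred_def borel_prod space_pair_measure)
qed

text \<open>For unit vectors the Cholesky factor is determined up to signs. The sign
  \<open>\<alpha>\<close> disappears by homogeneity, as it enters with an even power, and the sign
  of \<open>\<delta>\<close> by reflecting the second Gaussian vector.\<close>

lemma emeasure_PiM_sign_change:
  fixes d :: "'a::euclidean_space \<Rightarrow> real" and u v :: "'i \<Rightarrow> real"
  assumes I: "finite I" and [measurable]: "d \<in> borel_measurable borel" and hom: "\<And>r x. d (r *\<^sub>R x) = r ^ m * d x"
    and u: "(\<Sum>l\<in>I. (u l)\<^sup>2) = 1" and v: "(\<Sum>l\<in>I. (v l)\<^sup>2) = 1"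
  shows "emeasure (PiM I (\<lambda>_. gauss)) {Z \<in> space (PiM I (\<lambda>_. gauss)). d (\<Sum>l\<in>I. u l *\<^sub>R Z l) * d (\<Sum>l\<in>I. v l *\<^sub>R Z l) < 0}
    = sign_change_prob d (\<Sum>l\<in>I. u l * v l)"
proof -
  obtain \<alpha> \<beta> \<delta> where gram: "\<alpha>\<^sup>2 = 1" "\<alpha> * \<beta> = (\<Sum>l\<in>I. u l * v l)" "\<beta>\<^sup>2 + \<delta>\<^sup>2 = 1"
    and law: "distr (PiM I (\<lambda>_. gauss :: 'a measure)) borel (\<lambda>Z. (\<Sum>l\<in>I. u l *\<^sub>R Z l, \<Sum>l\<in>I. v l *\<^sub>R Z l))
      = distr gauss borel (\<lambda>(x::'a, y::'a). (\<alpha> *\<^sub>R x, \<beta> *\<^sub>R x + \<delta> *\<^sub>R y))"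
    using distr_PiM_gauss_pair[OF I, of u v, where 'a='a] unfolding u v by blast
  define c where "c = (\<Sum>l\<in>I. u l * v l)"
  define s where "s = sqrt (1 - c\<^sup>2)"
  have c: "c = \<alpha> * \<beta>" using gram(2) by (simp add: c_def)
  then have c2: "c\<^sup>2 = \<beta>\<^sup>2" using gram(1) by (simp add: power_mult_distrib)
  then have "1 - c\<^sup>2 = \<delta>\<^sup>2" using gram(3) by simp
  then have s2: "s\<^sup>2 = \<delta>\<^sup>2" by (simp add: s_def)
  have \<beta>: "\<beta> = \<alpha> * c"
  proof -
    have "\<alpha> * c = \<alpha>\<^sup>2 * \<beta>" by (simp add: c power2_eq_square)
    then show ?thesis using gram(1) by simp
  qed
  \<comment> \<open>\<open>e\<close> is the sign needed to reach \<open>\<delta>\<close> from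
    \<open>\<alpha>\<close> times the nonnegative root \<open>s\<close>.\<close>
  obtain e where e: "e\<^sup>2 = 1" "\<alpha> * e * s = \<delta>"
  proof (cases "\<delta> = \<alpha> * s")
    case True then show ?thesis by (intro that[of 1]) auto
  next
    case False
    have "\<delta>\<^sup>2 = (\<alpha> * s)\<^sup>2" using s2 gram(1) by (simp add: power_mult_distrib)
    with False have "\<delta> = - (\<alpha> * s)" by (auto simp: power2_eq_iff)
    then show ?thesis by (intro that[of "-1"]) auto
  qed
  let ?A = "{p :: 'a \<times> 'a. d (fst p) * d (snd p) < 0}"
  have A: "?A \<in> sets borel" using measurable_sign_change_set[of d 1 0 1] by simp
  have S: "(\<lambda>Z. (\<Sum>l\<in>I. u l *\<^sub>R Z l, \<Sum>l\<in>I. v l *\<^sub>R Z l)) \<in> PiM I (\<lambda>_. gauss :: 'a measure) \<rightarrow>\<^sub>M borel"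
    unfolding borel_prod[symmetric] by measurable
  have G: "(\<lambda>(x::'a, y::'a). (\<alpha> *\<^sub>R x, \<beta> *\<^sub>R x + \<delta> *\<^sub>R y)) \<in> gauss \<rightarrow>\<^sub>M borel"
    unfolding gauss_prod borel_prod[symmetric] by measurable
  define F where "F = (\<lambda>p::'a \<times> 'a. (fst p, e *\<^sub>R snd p))"
  have linF: "linear F" unfolding F_def by (rule linearI) (auto simp: algebra_simps)
  have F: "distr gauss borel F = gauss"
    using e(1) by (intro distr_gauss_coisometry[OF linF linF]) (auto simp: F_def power2_eq_square)
  let ?B = "{p :: 'a \<times> 'a. d (fst p) * d (c *\<^sub>R fst p + s *\<^sub>R snd p) < 0}"
  have B: "?B \<in> sets borel" using measurable_sign_change_set[of d 1 c s] by simp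
  have "emeasure (PiM I (\<lambda>_. gauss)) {Z \<in> space (PiM I (\<lambda>_. gauss)). d (\<Sum>l\<in>I. u l *\<^sub>R Z l) * d (\<Sum>l\<in>I. v l *\<^sub>R Z l) < 0}
     = emeasure (distr (PiM I (\<lambda>_. gauss :: 'a measure)) borel (\<lambda>Z. (\<Sum>l\<in>I. u l *\<^sub>R Z l, \<Sum>l\<in>I. v l *\<^sub>R Z l))) ?A"
    by (subst emeasure_distr[OF S A]) (auto intro!: arg_cong[where f="emeasure _"])
  also have "\<dots> = emeasure gauss {p :: 'a \<times> 'a. d (\<alpha> *\<^sub>R fst p) * d (\<beta> *\<^sub>R fst p + \<delta> *\<^sub>R snd p) < 0}"
    unfolding law by (subst emeasure_distr[OF G A]) (auto intro!: arg_cong[where f="emeasure _"])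
  also have "{p :: 'a \<times> 'a. d (\<alpha> *\<^sub>R fst p) * d (\<beta> *\<^sub>R fst p + \<delta> *\<^sub>R snd p) < 0} = F -` ?B \<inter> space gauss"
  proof -
    have "\<alpha> ^ m * \<alpha> ^ m = (\<alpha>\<^sup>2) ^ m" by (simp add: power2_eq_square power_mult_distrib)
    then have am: "\<alpha> ^ m * \<alpha> ^ m = 1" using gram(1) by simp
    have "\<beta> *\<^sub>R x + \<delta> *\<^sub>R y = \<alpha> *\<^sub>R (c *\<^sub>R x + s *\<^sub>R e *\<^sub>R y)" for x y :: 'a
      using e(2) \<beta> by (simp add: scaleR_add_right mult_ac)
    then have "d (\<beta> *\<^sub>R x + \<delta> *\<^sub>R y) = \<alpha> ^ m * d (c *\<^sub>R x + s *\<^sub>R e *\<^sub>R y)" for x y :: 'a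
      by (simp only: hom[of \<alpha>])
    then have "d (\<alpha> *\<^sub>R x) * d (\<beta> *\<^sub>R x + \<delta> *\<^sub>R y) = (\<alpha> ^ m * \<alpha> ^ m) * (d x * d (c *\<^sub>R x + s *\<^sub>R e *\<^sub>R y))" for x y :: 'a
      by (simp only: hom[of \<alpha> x] mult_ac)
    then have "d (\<alpha> *\<^sub>R x) * d (\<beta> *\<^sub>R x + \<delta> *\<^sub>R y) = d x * d (c *\<^sub>R x + s *\<^sub>R e *\<^sub>R y)" for x y :: 'a
      by (simp only: am mult_1)
    then show ?thesis by (simp add: F_def vimage_def)
  qed
  also have "emeasure gauss (F -` ?B \<inter> space gauss) = emeasure (distr gauss borel F) ?B"
    using borel_measurable_linear[OF linF] B by (intro emeasure_distr[symmetric]) auto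
  also have "\<dots> = sign_change_prob d c"
    unfolding F by (simp add: sign_change_prob_def s_def)
  finally show ?thesis by (simp add: c_def)
qed

section \<open>The speed of the cofactor direction\<close>

text \<open>Cramer's rule for the system X_i . y = - g_i for i \<noteq> k and cofac k X . y = 0,
  written out so that measurability is visible. With g the image under Y of the unit normal, y is
  the velocity of the unit normal of X + \<tau> Y at \<tau> = 0.\<close>

definition speed_sol :: "'p::finite \<Rightarrow> real^'p^'p \<Rightarrow> real^'p \<Rightarrow> real^'p" where
  "speed_sol k X g = (\<chi> j. det (\<chi> i l. if l = j then (if i = k then 0 else - g $ i) else row_upd X k (cofac k X) $ i $ l)
      / det (row_upd X k (cofac k X)))"

text \<open>If the unit normal \<nu> moves with velocity y, the pair (\<nu>, \<tau> \<nu>) has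
  velocity (y, \<nu>) at \<tau> = 0, and \<nu> contributes the 1 under the root.\<close>

definition speed :: "'p::finite \<Rightarrow> real^'p^'p \<Rightarrow> real^'p \<Rightarrow> real" where
  "speed k X g = sqrt (1 + (norm (speed_sol k X g))\<^sup>2)"

lemma speed_sol_props:
  fixes X :: "real^'p^'p::finite"
  assumes nz: "cofac k X \<noteq> 0"
  shows "i \<noteq> k \<Longrightarrow> X $ i \<bullet> speed_sol k X g = - g $ i" and "cofac k X \<bullet> speed_sol k X g = 0"
proof -
  let ?A = "row_upd X k (cofac k X)"
  have "det ?A = cofac k X \<bullet> cofac k X" by (simp add: cofac_inner)
  then have "det ?A \<noteq> 0" using nz by simp
  then have "?A *v speed_sol k X g = (\<chi> i. if i = k then 0 else - g $ i)"
    by (subst cramer) (simp_all add: speed_sol_def cong: if_cong)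
  then have *: "?A $ i \<bullet> speed_sol k X g = (if i = k then 0 else - g $ i)" for i
    by (simp add: vec_eq_iff matrix_vector_mul_component)
  show "i \<noteq> k \<Longrightarrow> X $ i \<bullet> speed_sol k X g = - g $ i" using *[of i] by (simp add: row_upd_nth)
  show "cofac k X \<bullet> speed_sol k X g = 0" using *[of k] by (simp add: row_upd_nth)
qed

lemma speed_eqI:
  fixes X :: "real^'p^'p::finite"
  assumes nz: "cofac k X \<noteq> 0" and "\<And>i. i \<noteq> k \<Longrightarrow> X $ i \<bullet> y = - g $ i" and "cofac k X \<bullet> y = 0"
  shows "speed k X g = sqrt (1 + (norm y)\<^sup>2)"
proof -
  have "speed_sol k X g - y = 0"
    by (rule cofac_solution_unique[OF nz]) (use assms speed_sol_props[OF nz] in \<open>auto simp: inner_diff_right\<close>)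
  then show ?thesis by (simp add: speed_def)
qed

lemma borel_measurable_speed: "(\<lambda>(X, g). speed k X g) \<in> borel_measurable (borel :: ((real^'p^'p) \<times> (real^'p::finite)) measure)"
proof -
  have c: "continuous_on UNIV (\<lambda>p. det (\<chi> i l. if l = j then (if i = k then 0 else - snd p $ i) else row_upd (fst p) k (cofac k (fst p)) $ i $ l))"
    for j :: 'p
  proof (intro continuous_on_det continuous_on_vec_lambda)
    fix i l
    show "continuous_on UNIV (\<lambda>p :: (real^'p^'p) \<times> (real^'p). if l = j then (if i = k then 0 else - snd p $ i) else row_upd (fst p) k (cofac k (fst p)) $ i $ l)"
      by (cases "l = j"; cases "i = k") (auto intro!: continuous_intros)
  qed
  have d: "continuous_on UNIV (\<lambda>p::(real^'p^'p) \<times> (real^'p). det (row_upd (fst p) k (cofac k (fst p))))"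
    by (intro continuous_intros)
  note [measurable] = borel_measurable_continuous_onI[OF c] borel_measurable_continuous_onI[OF d]
  have "(\<lambda>p. sqrt (1 + (\<Sum>j\<in>UNIV. (det (\<chi> i l. if l = j then (if i = k then 0 else - snd p $ i) else row_upd (fst p) k (cofac k (fst p)) $ i $ l)
     / det (row_upd (fst p) k (cofac k (fst p))))\<^sup>2))) \<in> borel_measurable (borel :: ((real^'p^'p) \<times> (real^'p)) measure)"
    by measurable
  then show ?thesis
    by (simp add: speed_def speed_sol_def norm_vec_def L2_set_def sum_nonneg split_beta')
qed

text \<open>Resampling row \<open>i\<close> by an independent Gaussian vector. The adjoint sends a
  matrix to itself with row \<open>i\<close> cleared, paired with that row.\<close>

lemma distr_gauss_row_upd:
  "distr gauss borel (\<lambda>(X, v). row_upd X i v) = (gauss :: (real^'p^'p::finite) measure)"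
proof (rule distr_gauss_coisometry[OF linear_row_upd])
  show "linear (\<lambda>X :: real^'p^'p. (row_upd X i 0, X $ i))"
    by (rule linearI) (auto simp: vec_eq_iff row_upd_nth)
  fix p :: "(real^'p^'p) \<times> (real^'p)" and Y :: "real^'p^'p"
  obtain X v where p: "p = (X, v)" by (cases p)
  have 1: "row_upd X i v \<bullet> Y = (\<Sum>m\<in>UNIV. row_upd X i v $ m \<bullet> Y $ m)" by (rule inner_vec_def)
  have 2: "X \<bullet> row_upd Y i 0 = (\<Sum>m\<in>UNIV. X $ m \<bullet> row_upd Y i 0 $ m)" by (rule inner_vec_def)
  have "(\<Sum>m\<in>UNIV. row_upd X i v $ m \<bullet> Y $ m) = v \<bullet> Y $ i + (\<Sum>m\<in>UNIV - {i}. X $ m \<bullet> Y $ m)"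
    by (subst sum.remove[of _ i]) (auto simp: row_upd_nth intro!: sum.cong)
  moreover have "(\<Sum>m\<in>UNIV. X $ m \<bullet> row_upd Y i 0 $ m) = (\<Sum>m\<in>UNIV - {i}. X $ m \<bullet> Y $ m)"
    by (subst sum.remove[of _ i]) (auto simp: row_upd_nth intro!: sum.cong)
  ultimately show "(case p of (X, v) \<Rightarrow> row_upd X i v) \<bullet> Y = p \<bullet> (row_upd Y i 0, Y $ i)"
    unfolding p by (simp only: prod.case inner_Pair 1 2)
qed simp

lemma nn_integral_gauss_row_upd:
  fixes F :: "real^'p^'p::finite \<Rightarrow> ennreal"
  assumes [measurable]: "F \<in> borel_measurable borel"
  shows "(\<integral>\<^sup>+X. F X \<partial>gauss) = (\<integral>\<^sup>+X. \<integral>\<^sup>+v. F (row_upd X i v) \<partial>gauss \<partial>gauss)"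
proof -
  interpret G: prob_space "gauss :: (real^'p) measure" by (rule prob_space_gauss)
  note [measurable] = borel_measurable_linear[OF linear_row_upd[of i]]
  have "(\<integral>\<^sup>+X. F X \<partial>gauss) = (\<integral>\<^sup>+p. F (case p of (X, v) \<Rightarrow> row_upd X i v) \<partial>gauss)"
    by (subst distr_gauss_row_upd[of i, symmetric], rule nn_integral_distr) measurable
  also have "\<dots> = (\<integral>\<^sup>+X. \<integral>\<^sup>+v. F (row_upd X i v) \<partial>gauss \<partial>gauss)"
    unfolding gauss_prod by (subst G.nn_integral_fst[symmetric]) (unfold gauss_prod[symmetric], auto)
  finally show ?thesis .
qed

lemma nn_integral_gauss_plane:
  fixes u w :: "'a::euclidean_space" and H :: "real \<Rightarrow> ennreal"
  assumes "norm u = 1" "norm w = 1" "u \<bullet> w = 0" and [measurable]: "H \<in> borel_measurable borel"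
  shows "(\<integral>\<^sup>+v. H (norm (v \<bullet> u, v \<bullet> w)) \<partial>gauss) = (\<integral>\<^sup>+h. H (norm h) \<partial>(gauss :: (real \<times> real) measure))"
proof -
  have [measurable]: "(\<lambda>v. (v \<bullet> u, v \<bullet> w)) \<in> borel_measurable (borel :: 'a measure)"
    by (intro borel_measurable_continuous_onI continuous_intros)
  have "(\<integral>\<^sup>+h. H (norm h) \<partial>(gauss :: (real \<times> real) measure)) = (\<integral>\<^sup>+h. H (norm h) \<partial>distr gauss borel (\<lambda>v. (v \<bullet> u, v \<bullet> w)))"
    by (simp add: distr_gauss_inner_pair[OF assms(1-3)])
  also have "\<dots> = (\<integral>\<^sup>+v. H (norm (v \<bullet> u, v \<bullet> w)) \<partial>gauss)"
    by (rule nn_integral_distr) measurable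
  finally show ?thesis by simp
qed

lemma AE_gauss_plane_nonzero:
  fixes u w :: "'a::euclidean_space"
  assumes "norm u = 1" "norm w = 1" "u \<bullet> w = 0"
  shows "AE v in gauss. norm (v \<bullet> u, v \<bullet> w) \<noteq> 0"
proof -
  have "(\<integral>\<^sup>+v. indicator {0} (norm (v \<bullet> u, v \<bullet> w)) \<partial>gauss) = (\<integral>\<^sup>+h. indicator {0} (norm h) \<partial>(gauss :: (real \<times> real) measure))"
    by (rule nn_integral_gauss_plane[OF assms]) measurable
  also have "\<dots> = (\<integral>\<^sup>+u. indicator {0} \<bar>u\<bar> * ennreal (\<bar>u\<bar> * exp (- u\<^sup>2 / 2) / 2) \<partial>lborel)"
    by (rule nn_integral_gauss_radial) measurable
  also have "\<dots> = (\<integral>\<^sup>+u. 0 \<partial>(lborel :: real measure))"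
    by (intro nn_integral_cong) (auto split: split_indicator)
  finally have "(\<integral>\<^sup>+v. indicator {0} (norm (v \<bullet> u, v \<bullet> w)) \<partial>gauss) = 0" by simp
  moreover have "(\<lambda>v. indicator {0} (norm (v \<bullet> u, v \<bullet> w)) :: ennreal) \<in> borel_measurable gauss" by measurable
  ultimately have "AE v in gauss. (indicator {0} (norm (v \<bullet> u, v \<bullet> w)) :: ennreal) = 0"
    by (subst (asm) nn_integral_0_iff_AE) auto
  then show ?thesis by eventually_elim (auto split: split_indicator_asm)
qed

text \<open>Only the distance of row \<^term>\<open>i\<close> to the span of the rows other than \<^term>\<open>i\<close> and \<^term>\<open>k\<close> matters;
  it is the norm of a standard Gaussian vector in the plane.\<close>

lemma nn_integral_speed_axis:
  fixes k i :: "'p::finite"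
  assumes ik: "i \<noteq> k"
  shows "(\<integral>\<^sup>+X. ennreal (speed k X (r *\<^sub>R axis i 1)) \<partial>gauss) =
    ennreal (sqrt (pi / 2)) * (\<integral>\<^sup>+z. ennreal (sqrt (z\<^sup>2 + r\<^sup>2)) \<partial>(gauss :: real measure))" (is "_ = ?K")
proof -
  interpret G: prob_space "gauss :: (real^'p^'p) measure" by (rule prob_space_gauss)
  have [measurable]: "(\<lambda>X. speed k X g) \<in> borel_measurable borel" for g
  proof -
    have "(\<lambda>X. (X, g)) \<in> borel \<rightarrow>\<^sub>M (borel :: ((real^'p^'p) \<times> (real^'p)) measure)" unfolding borel_prod[symmetric] by measurable
    from measurable_compose[OF this borel_measurable_speed[of k]] show ?thesis by simp
  qed
  have inner: "(\<integral>\<^sup>+v. ennreal (speed k (row_upd X i v) (r *\<^sub>R axis i 1)) \<partial>gauss) = ?K" if nz: "cofac k X \<noteq> 0" for X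
  proof -
    obtain u w \<kappa> where u: "norm u = 1" "norm w = 1" "u \<bullet> w = 0"
      and N: "\<And>v. cofac k (row_upd X i v) = \<kappa> *\<^sub>R ((v \<bullet> w) *\<^sub>R u - (v \<bullet> u) *\<^sub>R w)"
      using cofac_row_upd_plane[OF ik, of X] by blast
    \<comment> \<open>\<open>X\<close> is its own update by its own row \<open>i\<close>, so a
      vanishing \<open>\<kappa>\<close> would make the cofactor vector of \<open>X\<close>
      zero.\<close>
    have \<kappa>: "\<kappa> \<noteq> 0" using N[of "X $ i"] nz by auto
    have uu: "u \<bullet> u = 1" "w \<bullet> w = 1" "w \<bullet> u = 0" using u by (simp_all add: norm_eq_1 inner_commute)
    have orth: "X $ m \<bullet> u = 0" "X $ m \<bullet> w = 0" if "m \<noteq> i" "m \<noteq> k" for m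
    proof -
      have "cofac k (row_upd X i v) \<bullet> X $ m = 0" for v
        using cofac_orth[of m k "row_upd X i v"] that by (simp add: row_upd_nth)
      from this[of w] this[of u] show "X $ m \<bullet> u = 0" "X $ m \<bullet> w = 0"
        unfolding N using \<kappa> u uu by (simp_all add: inner_commute)
    qed
    have "AE v in gauss. ennreal (speed k (row_upd X i v) (r *\<^sub>R axis i 1)) = ennreal (sqrt (1 + r\<^sup>2 / (norm (v \<bullet> u, v \<bullet> w))\<^sup>2))"
      using AE_gauss_plane_nonzero[OF u]
    proof eventually_elim
      fix v assume v: "norm (v \<bullet> u, v \<bullet> w) \<noteq> 0"
      define q where "q = (v \<bullet> u)\<^sup>2 + (v \<bullet> w)\<^sup>2"
      have q: "q = (norm (v \<bullet> u, v \<bullet> w))\<^sup>2" "q \<noteq> 0" using v by (auto simp: q_def norm_Pair sum_power2_eq_zero_iff)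
      \<comment> \<open>Orthogonality to the other rows suggests a vector in the plane of
        \<open>u\<close> and \<open>w\<close>. Orthogonality to the cofactor vector makes it
        parallel to the projection of \<open>v\<close> to that plane, and the factor - r / q gives v
        . y = - r.\<close>
      define y where "y = (- r / q) *\<^sub>R ((v \<bullet> u) *\<^sub>R u + (v \<bullet> w) *\<^sub>R w)"
      have nz': "cofac k (row_upd X i v) \<noteq> 0"
      proof
        assume "cofac k (row_upd X i v) = 0"
        then have "(v \<bullet> w) *\<^sub>R u - (v \<bullet> u) *\<^sub>R w = 0" using \<kappa> by (simp add: N)
        then have "((v \<bullet> w) *\<^sub>R u - (v \<bullet> u) *\<^sub>R w) \<bullet> u = 0" "((v \<bullet> w) *\<^sub>R u - (v \<bullet> u) *\<^sub>R w) \<bullet> w = 0" by simp_all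
        then have "v \<bullet> w = 0" "v \<bullet> u = 0" using u uu by (simp_all add: inner_diff_left)
        then show False using v by simp
      qed
      have "speed k (row_upd X i v) (r *\<^sub>R axis i 1) = sqrt (1 + (norm y)\<^sup>2)"
      proof (rule speed_eqI[OF nz'])
        show "row_upd X i v $ m \<bullet> y = - (r *\<^sub>R axis i 1) $ m" if "m \<noteq> k" for m
        proof (cases "m = i")
          case True
          have "v \<bullet> y = (- r / q) * q" by (simp add: y_def q_def inner_add_right power2_eq_square)
          then show ?thesis using True q by (simp add: row_upd_nth axis_def)
        next
          case False
          then show ?thesis using orth[of m] that by (simp add: row_upd_nth y_def inner_add_right axis_def)
        qed
        show "cofac k (row_upd X i v) \<bullet> y = 0"
          unfolding N y_def using u uu by (simp add: inner_add_right inner_diff_left)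
      qed
      also have "(norm y)\<^sup>2 = r\<^sup>2 / q"
      proof -
        define p where "p = (v \<bullet> u) *\<^sub>R u + (v \<bullet> w) *\<^sub>R w"
        have "p \<bullet> p = q" using u uu by (simp add: p_def inner_add_right inner_add_left q_def power2_eq_square)
        then have "(norm y)\<^sup>2 = (r / q)\<^sup>2 * q"
          unfolding power2_norm_eq_inner y_def p_def[symmetric] by (simp add: power2_eq_square)
        then show ?thesis using q(2) by (simp add: power2_eq_square)
      qed
      finally show "ennreal (speed k (row_upd X i v) (r *\<^sub>R axis i 1)) = ennreal (sqrt (1 + r\<^sup>2 / (norm (v \<bullet> u, v \<bullet> w))\<^sup>2))"
        by (simp add: q(1))
    qed
    then have "(\<integral>\<^sup>+v. ennreal (speed k (row_upd X i v) (r *\<^sub>R axis i 1)) \<partial>gauss) = (\<integral>\<^sup>+v. ennreal (sqrt (1 + r\<^sup>2 / (norm (v \<bullet> u, v \<bullet> w))\<^sup>2)) \<partial>gauss)"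
      by (rule nn_integral_cong_AE)
    also have "\<dots> = (\<integral>\<^sup>+h. ennreal (sqrt (1 + r\<^sup>2 / (norm h)\<^sup>2)) \<partial>(gauss :: (real \<times> real) measure))"
      by (rule nn_integral_gauss_plane[OF u]) measurable
    also have "\<dots> = ?K" by (rule nn_integral_gauss_sqrt_ratio)
    finally show ?thesis .
  qed
  have "(\<integral>\<^sup>+X. ennreal (speed k X (r *\<^sub>R axis i 1)) \<partial>gauss) = (\<integral>\<^sup>+X. \<integral>\<^sup>+v. ennreal (speed k (row_upd X i v) (r *\<^sub>R axis i 1)) \<partial>gauss \<partial>gauss)"
    by (rule nn_integral_gauss_row_upd) measurable
  also have "\<dots> = (\<integral>\<^sup>+X. ?K \<partial>(gauss :: (real^'p^'p) measure))"
    using AE_gauss_cofac_nonzero[of k] by (intro nn_integral_cong_AE) (auto elim!: eventually_mono intro: inner)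
  also have "\<dots> = ?K" using G.emeasure_space_1 by simp
  finally show ?thesis .
qed

text \<open>The same vector solves both systems: the equations for the rows other than
  \<open>k\<close> are recombined by \<open>Q\<close>, and the cofactor vector only changes by the
  factor det Q.\<close>

lemma speed_orthogonal_mult:
  fixes X Q :: "real^'p^'p::finite"
  assumes Q: "orthogonal_matrix Q" and row: "\<And>j. Q $ k $ j = (if j = k then 1 else 0)" and col: "\<And>i. Q $ i $ k = (if i = k then 1 else 0)"
    and nz: "cofac k X \<noteq> 0"
  shows "speed k (Q ** X) (Q *v g) = speed k X g"
proof -
  have det: "det Q \<noteq> 0" using det_orthogonal_matrix[OF Q] by auto
  have c: "cofac k (Q ** X) = det Q *\<^sub>R cofac k X" by (rule cofac_matrix_mult[OF row col])
  define y where "y = speed_sol k X g"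
  have "speed k (Q ** X) (Q *v g) = sqrt (1 + (norm y)\<^sup>2)"
  proof (rule speed_eqI)
    show "cofac k (Q ** X) \<noteq> 0" using nz det by (simp add: c)
    show "cofac k (Q ** X) \<bullet> y = 0" using speed_sol_props(2)[OF nz] by (simp add: c y_def)
    fix i assume i: "i \<noteq> k"
    have "(Q ** X) $ i \<bullet> y = (Q ** X *v y) $ i" by (simp add: matrix_vector_mul_component)
    also have "\<dots> = (Q *v (X *v y)) $ i" by (simp add: matrix_vector_mul_assoc)
    also have "\<dots> = (\<Sum>l\<in>UNIV. Q $ i $ l * (X $ l \<bullet> y))" by (simp add: matrix_vector_mult_def matrix_vector_mul_component[symmetric] inner_vec_def mult_ac)
    also have "\<dots> = (\<Sum>l\<in>UNIV. Q $ i $ l * (- g $ l))"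
    proof (rule sum.cong[OF refl])
      fix l show "Q $ i $ l * (X $ l \<bullet> y) = Q $ i $ l * (- g $ l)"
        using col[of i] i speed_sol_props(1)[OF nz, of l g] by (cases "l = k") (auto simp: y_def)
    qed
    also have "\<dots> = - (Q *v g) $ i" by (simp add: matrix_vector_mult_def sum_negf)
    finally show "(Q ** X) $ i \<bullet> y = - (Q *v g) $ i" .
  qed
  then show ?thesis by (simp add: speed_def y_def)
qed

text \<open>The inner product of matrices is the sum of the inner products of their columns, and
  \<open>Q\<close> acts on each column isometrically.\<close>

lemma orthogonal_transformation_matrix_mult_left:
  fixes Q :: "real^'p^'p::finite"
  assumes Q: "orthogonal_matrix Q"
  shows "orthogonal_transformation (\<lambda>X :: real^'p^'p. Q ** X)"
proof -
  have lin: "linear (\<lambda>X :: real^'p^'p. Q ** X)"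
    by (rule linearI) (simp_all add: matrix_add_ldistrib matrix_scalar_ac scalar_mult_eq_scaleR flip: scalar_mult_eq_scaleR, simp_all add: matrix_matrix_mult_def vec_eq_iff sum_distrib_left mult_ac)
  have sw: "A \<bullet> B = (\<Sum>j\<in>UNIV. column j A \<bullet> column j B)" for A B :: "real^'p^'p"
    unfolding inner_vec_def column_def by simp (rule sum.swap)
  have col: "column j (Q ** X) = Q *v column j X" for j X
    by (simp add: column_def matrix_matrix_mult_def matrix_vector_mult_def vec_eq_iff)
  have oQ: "orthogonal_transformation ((*v) Q)" using Q by (simp add: orthogonal_transformation_matrix)
  then have "(Q *v a) \<bullet> (Q *v b) = a \<bullet> b" for a b by (simp add: orthogonal_transformation_def)
  then have "(Q ** A) \<bullet> (Q ** B) = A \<bullet> B" for A B :: "real^'p^'p" by (simp add: sw col)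
  with lin show ?thesis by (simp add: orthogonal_transformation_def)
qed

text \<open>A Householder reflection that fixes coordinate \<^term>\<open>k\<close>.\<close>

lemma householder_ex:
  fixes g :: "real^'p::finite"
  assumes ik: "i \<noteq> k" and gk: "g $ k = 0"
  obtains Q :: "real^'p^'p" where "orthogonal_matrix Q" "\<And>j. Q $ k $ j = (if j = k then 1 else 0)"
    "\<And>i. Q $ i $ k = (if i = k then 1 else 0)" "Q *v g = norm g *\<^sub>R axis i 1"
proof (cases "g = norm g *\<^sub>R axis i 1")
  \<comment> \<open>The reflection vector \<open>q\<close> of the other case would be zero
    here.\<close>
  case True
  then show ?thesis
    by (intro that[of "mat 1"]) (simp_all add: orthogonal_matrix_id, simp_all add: mat_def)
next
  case False
  define q where "q = g - norm g *\<^sub>R axis i 1"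
  define e where "e = axis i (1::real)"
  have ee: "e \<bullet> e = 1" by (simp add: e_def inner_axis_axis)
  have qq: "q \<bullet> q > 0" using False by (simp add: q_def)
  have qk: "q $ k = 0" using gk ik by (simp add: q_def axis_def)
  define f where "f x = x - (2 * (x \<bullet> q) / (q \<bullet> q)) *\<^sub>R q" for x
  have lin: "linear f" by (rule linearI) (auto simp: f_def algebra_simps inner_add_left add_divide_distrib)
  have orth: "orthogonal_transformation f"
    unfolding orthogonal_transformation_def
  proof (intro conjI allI lin)
    fix v w
    have "f v \<bullet> f w = v \<bullet> w - 2 * (w \<bullet> q) / (q \<bullet> q) * (v \<bullet> q) - 2 * (v \<bullet> q) / (q \<bullet> q) * (q \<bullet> w) + (2 * (v \<bullet> q) / (q \<bullet> q)) * (2 * (w \<bullet> q) / (q \<bullet> q)) * (q \<bullet> q)"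
      by (simp add: f_def inner_diff_left inner_diff_right algebra_simps)
    then show "f v \<bullet> f w = v \<bullet> w" using qq by (simp add: inner_commute[of q w])
  qed
  define Q where "Q = matrix f"
  have Qf: "Q *v x = f x" for x unfolding Q_def by (rule matrix_works) (use lin in \<open>simp add: linear_matrix_vector_mul_eq\<close>)
  have Qn: "Q $ a $ b = f (axis b 1) $ a" for a b by (simp add: Q_def matrix_def)
  have comp: "f (axis b 1) $ a = axis b 1 $ a - 2 * q $ b / (q \<bullet> q) * q $ a" for a b
    by (simp add: f_def inner_axis inner_commute[of "axis b 1" q])
  have nn: "g \<bullet> g = norm g * norm g" by (simp add: dot_square_norm power2_eq_square)
  have gq: "2 * (g \<bullet> q) = q \<bullet> q"
    using nn ee by (simp add: q_def e_def[symmetric] inner_diff_left inner_diff_right inner_commute[of e g] algebra_simps)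
  have fg: "f g = norm g *\<^sub>R axis i 1" using qq by (simp add: f_def gq) (simp add: q_def)
  show ?thesis
  proof (rule that[of Q])
    show "orthogonal_matrix Q" using orth by (simp add: Q_def orthogonal_transformation_matrix)
    show "Q *v g = norm g *\<^sub>R axis i 1" using fg by (simp add: Qf)
    show "Q $ k $ j = (if j = k then 1 else 0)" for j unfolding Qn comp qk by (simp add: axis_def)
    show "Q $ i $ k = (if i = k then 1 else 0)" for i unfolding Qn comp qk by (simp add: axis_def)
  qed
qed

text \<open>Entry \<open>k\<close> of \<open>g\<close> does not enter the system. The rest is
  rotated by a Householder matrix to a multiple of one axis, under which neither the Gaussian law of
  X nor the speed changes.\<close>

lemma nn_integral_speed:
  fixes k :: "'p::finite" and g :: "real^'p"
  defines "g0 \<equiv> g - g $ k *\<^sub>R axis k 1"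
  shows "(\<integral>\<^sup>+X. ennreal (speed k X g) \<partial>gauss) =
    ennreal (sqrt (pi / 2)) * (\<integral>\<^sup>+z. ennreal (sqrt (z\<^sup>2 + (norm g0)\<^sup>2)) \<partial>(gauss :: real measure))"
proof -
  interpret G: prob_space "gauss :: (real^'p^'p) measure" by (rule prob_space_gauss)
  interpret H: prob_space "gauss :: (real \<times> real) measure" by (rule prob_space_gauss)
  have meas [measurable]: "(\<lambda>X. speed k X g) \<in> borel_measurable borel" for g
  proof -
    have "(\<lambda>X. (X, g)) \<in> borel \<rightarrow>\<^sub>M (borel :: ((real^'p^'p) \<times> (real^'p)) measure)" unfolding borel_prod[symmetric] by measurable
    from measurable_compose[OF this borel_measurable_speed[of k]] show ?thesis by simp
  qed
  have dep: "speed k X g = speed k X g0" for X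
  proof -
    have "g0 $ i = g $ i" if "i \<noteq> k" for i using that by (simp add: g0_def axis_def)
    then have "speed_sol k X g = speed_sol k X g0" by (simp add: speed_sol_def cong: if_cong)
    then show ?thesis by (simp add: speed_def)
  qed
  show ?thesis
  proof (cases "g0 = 0")
    \<comment> \<open>This case covers dimension one, where no row index other than \<open>k\<close>
      exists.\<close>
    case True
    have "speed k X g = 1" if "cofac k X \<noteq> 0" for X
      unfolding dep True using speed_eqI[OF that, of 0 0] by simp
    then have "(\<integral>\<^sup>+X. ennreal (speed k X g) \<partial>gauss) = (\<integral>\<^sup>+X. 1 \<partial>(gauss :: (real^'p^'p) measure))"
      using AE_gauss_cofac_nonzero[of k] by (intro nn_integral_cong_AE) (auto elim!: eventually_mono)
    also have "\<dots> = 1" using G.emeasure_space_1 by simp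
    \<comment> \<open>The value 1 is read as the planar integral with r = 0, to bring it into the
      common form.\<close>
    also have "1 = (\<integral>\<^sup>+h. ennreal (sqrt (1 + 0\<^sup>2 / (norm h)\<^sup>2)) \<partial>(gauss :: (real \<times> real) measure))"
      using H.emeasure_space_1 by simp
    also have "\<dots> = ennreal (sqrt (pi / 2)) * (\<integral>\<^sup>+z. ennreal (sqrt (z\<^sup>2 + 0\<^sup>2)) \<partial>(gauss :: real measure))"
      by (rule nn_integral_gauss_sqrt_ratio)
    finally show ?thesis using True by simp
  next
    case False
    have gk: "g0 $ k = 0" by (simp add: g0_def axis_def)
    obtain i where i: "i \<noteq> k" using False gk by (metis vec_eq_iff zero_index)
    obtain Q :: "real^'p^'p" where Q: "orthogonal_matrix Q" "\<And>j. Q $ k $ j = (if j = k then 1 else 0)"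
      "\<And>i. Q $ i $ k = (if i = k then 1 else 0)" "Q *v g0 = norm g0 *\<^sub>R axis i 1"
      using householder_ex[OF i gk] by blast
    note orth = orthogonal_transformation_matrix_mult_left[OF Q(1)]
    note [measurable] = borel_measurable_linear[OF orthogonal_transformation_linear[OF orth]]
    have "(\<integral>\<^sup>+X. ennreal (speed k X g) \<partial>gauss) = (\<integral>\<^sup>+X. ennreal (speed k (Q ** X) (Q *v g0)) \<partial>gauss)"
      using AE_gauss_cofac_nonzero[of k]
      by (intro nn_integral_cong_AE) (auto elim!: eventually_mono simp: dep speed_orthogonal_mult[OF Q(1-3)])
    also have "\<dots> = (\<integral>\<^sup>+X. ennreal (speed k X (Q *v g0)) \<partial>distr gauss borel (\<lambda>X. Q ** X))"
      by (rule nn_integral_distr[symmetric]) measurable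
    also have "\<dots> = (\<integral>\<^sup>+X. ennreal (speed k X (norm g0 *\<^sub>R axis i 1)) \<partial>gauss)"
      by (simp add: distr_gauss_orthogonal[OF orth] Q(4))
    finally show ?thesis by (simp add: nn_integral_speed_axis[OF i])
  qed
qed

text \<open>Each row is projected to the same unit vector, which keeps the entries independent and
  standard. The law does not depend on \<open>u\<close>, so it persists when \<open>u\<close> is the
  normal of an independent matrix.\<close>

lemma distr_gauss_matrix_vector:
  fixes u :: "real^'p::finite"
  assumes "norm u = 1"
  shows "distr (gauss :: (real^'p^'p) measure) borel (\<lambda>Y. Y *v u) = gauss"
proof (rule distr_gauss_coisometry)
  show "linear (\<lambda>Y :: real^'p^'p. Y *v u)"
    by (rule linearI) (auto simp: matrix_vector_mult_add_rdistrib scaleR_matrix_vector_assoc)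
  show "linear (\<lambda>y. (\<chi> i. y $ i *\<^sub>R u) :: real^'p^'p)"
    by (rule linearI) (auto simp: vec_eq_iff algebra_simps)
  show "(Y *v u) \<bullet> y = Y \<bullet> (\<chi> i. y $ i *\<^sub>R u)" for Y :: "real^'p^'p" and y
  proof -
    have "(Y *v u) \<bullet> y = (\<Sum>i\<in>UNIV. (Y $ i \<bullet> u) * y $ i)" by (simp add: inner_vec_def[of "Y *v u"] matrix_vector_mul_component)
    also have "\<dots> = (\<Sum>i\<in>UNIV. Y $ i \<bullet> (\<chi> i. y $ i *\<^sub>R u) $ i)" by (simp add: mult.commute)
    also have "\<dots> = Y \<bullet> (\<chi> i. y $ i *\<^sub>R u)" by (simp only: inner_vec_def[of Y])
    finally show ?thesis .
  qed
  have "u \<bullet> u = 1" using assms by (simp add: norm_eq_1)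
  then show "(\<chi> i. y $ i *\<^sub>R u) *v u = y" for y :: "real^'p" by (simp add: vec_eq_iff matrix_vector_mul_component)
qed

text \<open>The scalar Gaussian left over from the radial computation takes the place of the dropped
  coordinate \<open>k\<close>, so the full Gaussian norm in dimension p reappears.\<close>

lemma nn_integral_gauss_norm_split_coordinate:
  fixes k :: "'p::finite"
  shows "(\<lambda>g. \<integral>\<^sup>+z. ennreal (sqrt (z\<^sup>2 + (norm (g - g $ k *\<^sub>R axis k 1))\<^sup>2)) \<partial>(gauss :: real measure)) \<in> borel_measurable (gauss :: (real^'p) measure)"
    and "(\<integral>\<^sup>+g. \<integral>\<^sup>+z. ennreal (sqrt (z\<^sup>2 + (norm (g - g $ k *\<^sub>R axis k 1))\<^sup>2)) \<partial>(gauss :: real measure) \<partial>(gauss :: (real^'p) measure))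
      = (\<integral>\<^sup>+g. ennreal (norm g) \<partial>(gauss :: (real^'p) measure))"
proof -
  interpret R: prob_space "gauss :: real measure" by (rule prob_space_gauss)
  define T where "T = (\<lambda>(g :: real^'p, z :: real). g - g $ k *\<^sub>R axis k 1 + z *\<^sub>R axis k 1)"
  have linT: "linear T" unfolding T_def by (rule linearI) (auto simp: algebra_simps)
  have T: "distr gauss borel T = gauss"
  proof (rule distr_gauss_coisometry[OF linT])
    show "linear (\<lambda>y :: real^'p. (y - y $ k *\<^sub>R axis k 1, y $ k))" by (rule linearI) (auto simp: algebra_simps)
    show "T x \<bullet> y = x \<bullet> (y - y $ k *\<^sub>R axis k 1, y $ k)" for x y
      by (cases x) (simp add: T_def inner_add_left inner_diff_left inner_diff_right inner_axis inner_axis')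
    show "T (y - y $ k *\<^sub>R axis k 1, y $ k) = y" for y by (simp add: T_def)
  qed
  have n: "norm (T (g, z)) = sqrt (z\<^sup>2 + (norm (g - g $ k *\<^sub>R axis k 1))\<^sup>2)" for g z
  proof -
    define h where "h = g - g $ k *\<^sub>R axis k 1"
    have "h \<bullet> axis k 1 = 0" by (simp add: h_def inner_diff_left inner_axis)
    then have "orthogonal h (z *\<^sub>R axis k 1)" by (simp add: orthogonal_def)
    then have "(norm (T (g, z)))\<^sup>2 = z\<^sup>2 + (norm h)\<^sup>2"
      by (simp add: T_def h_def[symmetric] norm_add_Pythagorean norm_axis_1)
    then show ?thesis unfolding h_def[symmetric] by (simp add: real_sqrt_unique)
  qed
  have mT: "(\<lambda>p. ennreal (norm (T p))) \<in> borel_measurable (gauss \<Otimes>\<^sub>M (gauss :: real measure))"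
    unfolding gauss_prod[symmetric] using borel_measurable_linear[OF linT] by simp
  show "(\<lambda>g. \<integral>\<^sup>+z. ennreal (sqrt (z\<^sup>2 + (norm (g - g $ k *\<^sub>R axis k 1))\<^sup>2)) \<partial>(gauss :: real measure)) \<in> borel_measurable (gauss :: (real^'p) measure)"
    using R.borel_measurable_nn_integral_fst[OF mT] by (simp only: n)
  have "(\<integral>\<^sup>+g. \<integral>\<^sup>+z. ennreal (norm (T (g, z))) \<partial>(gauss :: real measure) \<partial>gauss) = (\<integral>\<^sup>+p. ennreal (norm (T p)) \<partial>gauss)"
    unfolding gauss_prod by (rule R.nn_integral_fst[OF mT])
  also have "\<dots> = (\<integral>\<^sup>+g. ennreal (norm g) \<partial>distr gauss borel T)"
    by (rule nn_integral_distr[symmetric]) (use borel_measurable_linear[OF linT] in auto)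
  finally show "(\<integral>\<^sup>+g. \<integral>\<^sup>+z. ennreal (sqrt (z\<^sup>2 + (norm (g - g $ k *\<^sub>R axis k 1))\<^sup>2)) \<partial>(gauss :: real measure) \<partial>(gauss :: (real^'p) measure))
      = (\<integral>\<^sup>+g. ennreal (norm g) \<partial>(gauss :: (real^'p) measure))"
    by (simp only: n T)
qed

lemma borel_measurable_speed_matrix:
  "(\<lambda>(X, Y). speed k X (Y *v sgn (cofac k X))) \<in> borel_measurable (borel :: ((real^'p^'p) \<times> (real^'p^'p::finite)) measure)"
proof -
  have c: "continuous_on UNIV (\<lambda>p :: (real^'p^'p) \<times> (real^'p). fst p *v snd p)"
    unfolding matrix_vector_mult_def by (intro continuous_on_vec_lambda continuous_intros)
  have 1: "(\<lambda>p :: (real^'p^'p) \<times> (real^'p). fst p *v snd p) \<in> borel \<Otimes>\<^sub>M borel \<rightarrow>\<^sub>M borel"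
    using borel_measurable_continuous_onI[OF c] by (simp add: borel_prod)
  have sgn: "sgn \<in> borel \<rightarrow>\<^sub>M (borel :: (real^'p) measure)"
    unfolding sgn_div_norm[abs_def] by measurable
  have 2: "(\<lambda>p :: (real^'p^'p) \<times> (real^'p^'p). sgn (cofac k (fst p))) \<in> borel \<Otimes>\<^sub>M borel \<rightarrow>\<^sub>M borel"
    by (rule measurable_compose[OF measurable_compose[OF measurable_fst borel_measurable_cofac] sgn])
  have 3: "(\<lambda>p :: (real^'p^'p) \<times> (real^'p^'p). snd p *v sgn (cofac k (fst p))) \<in> borel \<Otimes>\<^sub>M borel \<rightarrow>\<^sub>M borel"
    using measurable_compose[OF measurable_Pair[OF measurable_snd 2] 1] by simp
  have 4: "(\<lambda>p :: (real^'p^'p) \<times> (real^'p^'p). (fst p, snd p *v sgn (cofac k (fst p)))) \<in> borel \<Otimes>\<^sub>M borel \<rightarrow>\<^sub>M borel \<Otimes>\<^sub>M borel"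
    by (rule measurable_Pair[OF measurable_fst 3])
  have 5: "(\<lambda>(X, g). speed k X g) \<in> borel_measurable ((borel :: (real^'p^'p) measure) \<Otimes>\<^sub>M (borel :: (real^'p) measure))"
    unfolding borel_prod by (rule borel_measurable_speed)
  show ?thesis
    using measurable_compose[OF 4 5] unfolding borel_prod by (simp add: split_beta')
qed

text \<open>For fixed X the image of the unit normal under Y is a standard Gaussian vector g, so the
  average over X can be taken first. The constant is sqrt (pi / 2) times the expected norm, and sqrt
  (pi / 2) * sqrt 2 = sqrt pi.\<close>

lemma nn_integral_speed_matrix:
  fixes k :: "'p::finite"
  shows "(\<integral>\<^sup>+(X, Y). ennreal (speed k X (Y *v sgn (cofac k X))) \<partial>(gauss :: ((real^'p^'p) \<times> (real^'p^'p)) measure)) =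
    ennreal (sqrt pi * Gamma ((real CARD('p) + 1) / 2) / Gamma (real CARD('p) / 2))"
proof -
  let ?M = "gauss :: (real^'p^'p) measure" and ?V = "gauss :: (real^'p) measure"
  interpret M: prob_space ?M by (rule prob_space_gauss)
  interpret V: prob_space ?V by (rule prob_space_gauss)
  interpret MV: pair_sigma_finite ?M ?V by standard
  have sp: "(\<lambda>(X, g). speed k X g) \<in> borel_measurable (?M \<Otimes>\<^sub>M ?V)"
    unfolding gauss_prod[symmetric] using borel_measurable_speed[of k] by simp
  then have sp': "(\<lambda>(X, g). ennreal (speed k X g)) \<in> borel_measurable (?M \<Otimes>\<^sub>M ?V)"
    unfolding split_beta' by (rule measurable_compose[OF _ measurable_ennreal])
  have m2: "(\<lambda>(X, Y). ennreal (speed k X (Y *v sgn (cofac k X)))) \<in> borel_measurable (?M \<Otimes>\<^sub>M ?M)"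
    using borel_measurable_speed_matrix[of k] unfolding gauss_prod[symmetric] split_beta' by simp
  have "(\<integral>\<^sup>+(X, Y). ennreal (speed k X (Y *v sgn (cofac k X))) \<partial>(gauss :: ((real^'p^'p) \<times> (real^'p^'p)) measure))
    = (\<integral>\<^sup>+X. \<integral>\<^sup>+Y. ennreal (speed k X (Y *v sgn (cofac k X))) \<partial>?M \<partial>?M)"
    unfolding gauss_prod using M.nn_integral_fst[OF m2] by simp
  also have "\<dots> = (\<integral>\<^sup>+X. \<integral>\<^sup>+g. ennreal (speed k X g) \<partial>?V \<partial>?M)"
  proof (rule nn_integral_cong_AE)
    show "AE X in ?M. (\<integral>\<^sup>+Y. ennreal (speed k X (Y *v sgn (cofac k X))) \<partial>?M) = (\<integral>\<^sup>+g. ennreal (speed k X g) \<partial>?V)"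
      using AE_gauss_cofac_nonzero[of k]
    proof eventually_elim
      fix X :: "real^'p^'p" assume "cofac k X \<noteq> 0"
      then have u: "norm (sgn (cofac k X)) = 1" by (simp add: norm_sgn)
      have mv: "(\<lambda>Y :: real^'p^'p. Y *v sgn (cofac k X)) \<in> gauss \<rightarrow>\<^sub>M borel"
        unfolding matrix_vector_mult_def measurable_cong_sets[OF sets_gauss refl]
        by (intro borel_measurable_continuous_onI continuous_on_vec_lambda continuous_intros)
      have "(\<lambda>g. ennreal (speed k X g)) \<in> borel_measurable ?V"
        using measurable_compose[OF measurable_Pair1' sp', of X] by simp
      then have "(\<integral>\<^sup>+g. ennreal (speed k X g) \<partial>distr ?M borel (\<lambda>Y. Y *v sgn (cofac k X)))
          = (\<integral>\<^sup>+Y. ennreal (speed k X (Y *v sgn (cofac k X))) \<partial>?M)"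
        by (intro nn_integral_distr[OF mv]) simp
      then show "(\<integral>\<^sup>+Y. ennreal (speed k X (Y *v sgn (cofac k X))) \<partial>?M) = (\<integral>\<^sup>+g. ennreal (speed k X g) \<partial>?V)"
        by (simp only: distr_gauss_matrix_vector[OF u])
    qed
  qed
  also have "\<dots> = (\<integral>\<^sup>+g. \<integral>\<^sup>+X. ennreal (speed k X g) \<partial>?M \<partial>?V)"
    by (rule MV.Fubini'[OF sp', symmetric])
  also have "\<dots> = (\<integral>\<^sup>+g. ennreal (sqrt (pi / 2)) * (\<integral>\<^sup>+z. ennreal (sqrt (z\<^sup>2 + (norm (g - g $ k *\<^sub>R axis k 1))\<^sup>2)) \<partial>(gauss :: real measure)) \<partial>?V)"
    by (simp only: nn_integral_speed)
  also have "\<dots> = ennreal (sqrt (pi / 2)) * (\<integral>\<^sup>+g. ennreal (norm g) \<partial>?V)"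
    by (subst nn_integral_cmult[OF nn_integral_gauss_norm_split_coordinate(1)])
      (simp only: nn_integral_gauss_norm_split_coordinate(2))
  also have "\<dots> = ennreal (sqrt (pi / 2)) * ennreal (sqrt 2 * Gamma ((real CARD('p) + 1) / 2) / Gamma (real CARD('p) / 2))"
    by (simp add: nn_integral_gauss_norm)
  also have "\<dots> = ennreal (sqrt (pi / 2) * (sqrt 2 * Gamma ((real CARD('p) + 1) / 2) / Gamma (real CARD('p) / 2)))"
    by (rule ennreal_mult'[symmetric]) simp
  also have "sqrt (pi / 2) * (sqrt 2 * Gamma ((real CARD('p) + 1) / 2) / Gamma (real CARD('p) / 2)) = sqrt pi * Gamma ((real CARD('p) + 1) / 2) / Gamma (real CARD('p) / 2)"
    by (simp add: real_sqrt_divide)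
  finally show ?thesis .
qed

section \<open>Uniform integrability of the angle\<close>

text \<open>Equivalent to sin y \<ge> y / 2 on the first quadrant. Up to pi / 3 the cosine is at
  least 1 / 2; beyond, sin (pi / 3) \<ge> 0.85 > pi / 4.\<close>

lemma arcsin_le_double:
  assumes "0 \<le> x" "x \<le> 1"
  shows "arcsin x \<le> 2 * x"
proof -
  define y where "y = arcsin x"
  have y: "0 \<le> y" "y \<le> pi / 2"
    unfolding y_def using assms arcsin_le_arcsin[of 0 x] arcsin_bounded[of x] by auto
  have sx: "sin y = x" using assms by (simp add: y_def)
  have "y / 2 \<le> sin y"
  proof (cases "y \<le> pi / 3")
    case True
    have "sin 0 - 0 / 2 \<le> sin y - y / 2"
    proof (rule DERIV_nonneg_imp_nondecreasing[OF y(1)])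
      fix t assume t: "0 \<le> t" "t \<le> y"
      have "cos (pi / 3) \<le> cos t" using t True by (intro cos_monotone_0_pi_le) auto
      then have "0 \<le> cos t - 1 / 2" by (simp add: cos_60)
      moreover have "((\<lambda>y. sin y - y / 2) has_real_derivative cos t - 1 / 2) (at t)" by (auto intro!: derivative_eq_intros)
      ultimately show "\<exists>D. ((\<lambda>y. sin y - y / 2) has_real_derivative D) (at t) \<and> 0 \<le> D" by blast
    qed
    then show ?thesis by simp
  next
    case False
    have "sin (pi / 3) \<le> sin y" using False y by (intro sin_monotone_2pi_le) auto
    moreover have "sin (pi / 3) = sqrt 3 / 2" by (rule sin_60)
    moreover have "17 / 10 \<le> sqrt 3" by (rule real_le_rsqrt) (simp add: power2_eq_square)
    moreover have "pi < 34 / 10" using pi_less_4 pi_approx by simp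
    ultimately show ?thesis using y by linarith
  qed
  then show ?thesis unfolding sx unfolding y_def by simp
qed

lemma arccos_inner_le_norm_diff:
  fixes U V :: "'a::real_inner"
  assumes "norm U = 1" "norm V = 1"
  shows "arccos (U \<bullet> V) \<le> 2 * norm (U - V)"
proof -
  have "norm (U - V) \<le> 2" using norm_triangle_ineq4[of U V] assms by simp
  then have "arcsin (norm (U - V) / 2) \<le> 2 * (norm (U - V) / 2)" by (intro arcsin_le_double) auto
  then show ?thesis by (simp add: arccos_inner_unit[OF assms])
qed

text \<open>Only the norm of \<open>x\<close> stands in the denominator; \<open>y\<close> may be
  arbitrarily small or zero. This asymmetry lets the later moment bound involve the unshifted row
  alone.\<close>

lemma norm_sgn_diff_le:
  fixes x y :: "'a::real_normed_vector"
  assumes "x \<noteq> 0"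
  shows "norm (sgn x - sgn y) \<le> 2 * norm (x - y) / norm x"
proof (cases "y = 0")
  case True
  then show ?thesis using assms by (simp add: norm_sgn)
next
  case False
  have "norm z *\<^sub>R sgn z = z" for z :: 'a by (cases "z = 0") (simp_all add: sgn_div_norm)
  then have "norm x *\<^sub>R (sgn x - sgn y) = (x - y) + (norm y - norm x) *\<^sub>R sgn y"
    by (simp add: scaleR_diff_right scaleR_diff_left)
  then have "norm x * norm (sgn x - sgn y) \<le> norm (x - y) + norm ((norm y - norm x) *\<^sub>R sgn y)"
    by (metis abs_norm_cancel norm_scaleR norm_triangle_ineq)
  also have "norm ((norm y - norm x) *\<^sub>R sgn y) \<le> norm (x - y)"
    using False norm_triangle_ineq3[of y x] by (simp add: norm_sgn norm_minus_commute)
  finally show ?thesis using assms by (simp add: field_simps)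
qed

text \<open>Boundedness in $L^{3/2}$ gives uniform integrability.\<close>

lemma nn_integral_tendsto_of_power_bound:
  fixes f :: "nat \<Rightarrow> 'a \<Rightarrow> real" and g :: "'a \<Rightarrow> real"
  assumes M: "prob_space M" and [measurable]: "\<And>m. f m \<in> borel_measurable M" "g \<in> borel_measurable M"
    and pos: "\<And>m x. 0 \<le> f m x" and K: "\<And>m. (\<integral>\<^sup>+x. ennreal (sqrt (f m x) ^ 3) \<partial>M) \<le> ennreal K"
    and lim: "AE x in M. (\<lambda>m. f m x) \<longlonglongrightarrow> g x"
  shows "(\<lambda>m. \<integral>\<^sup>+x. ennreal (f m x) \<partial>M) \<longlonglongrightarrow> (\<integral>\<^sup>+x. ennreal (g x) \<partial>M)"
proof -
  interpret prob_space M by fact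
  let ?a = "\<lambda>m. \<integral>\<^sup>+x. ennreal (f m x) \<partial>M" and ?b = "\<integral>\<^sup>+x. ennreal (g x) \<partial>M"
  have "?b = (\<integral>\<^sup>+x. liminf (\<lambda>m. ennreal (f m x)) \<partial>M)"
    using lim by (intro nn_integral_cong_AE) (auto elim!: eventually_mono intro!: lim_imp_Liminf[symmetric] tendsto_ennrealI)
  also have "\<dots> \<le> liminf ?a" by (rule nn_integral_liminf) measurable
  finally have A: "?b \<le> liminf ?a" .
  have B: "limsup ?a \<le> ?b"
  proof (rule ennreal_le_epsilon)
    fix e :: real assume e: "0 < e"
    \<comment> \<open>\<open>R\<close> is the truncation level; the part above it will contribute at
      most K / sqrt R.\<close>
    obtain R :: nat where R: "R > 0" "\<bar>K\<bar> / sqrt (real R) < e"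
    proof -
      obtain R :: nat where "(\<bar>K\<bar> / e)\<^sup>2 < real R" using reals_Archimedean2 by blast
      then have "(\<bar>K\<bar> / e)\<^sup>2 < real (Suc R)" by simp
      then have "\<bar>K\<bar> / e < sqrt (real (Suc R))" by (intro real_less_rsqrt)
      then have "\<bar>K\<bar> / sqrt (real (Suc R)) < e" using e by (simp add: field_simps)
      then show ?thesis by (intro that[of "Suc R"]) auto
    qed
    \<comment> \<open>Where f exceeds R, f is at most its power 3/2 divided by sqrt R.\<close>
    have split: "ennreal (f m x) \<le> ennreal (min (f m x) (real R)) + ennreal (1 / sqrt (real R)) * ennreal (sqrt (f m x) ^ 3)" for m x
    proof -
      have "f m x \<le> min (f m x) (real R) + 1 / sqrt (real R) * sqrt (f m x) ^ 3"
      proof (cases "f m x \<le> real R")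
        case True then show ?thesis using pos[of m x] by simp
      next
        case False
        define s where "s = sqrt (f m x)"
        have s: "f m x = s * s" "s \<ge> 0" using pos[of m x] by (simp_all add: s_def)
        have "sqrt (real R) \<le> s" unfolding s_def using False by simp
        then have "s * s * sqrt (real R) \<le> s * s * s" using s by (intro mult_left_mono) auto
        then have "s * s \<le> 1 / sqrt (real R) * s ^ 3" using R by (simp add: field_simps power3_eq_cube)
        then have "f m x \<le> 1 / sqrt (real R) * sqrt (f m x) ^ 3" unfolding s_def[symmetric] using s(1) by simp
        then show ?thesis using pos[of m x] by (auto simp: min_def)
      qed
      then have "ennreal (f m x) \<le> ennreal (min (f m x) (real R) + 1 / sqrt (real R) * sqrt (f m x) ^ 3)" by (rule ennreal_leI)
      also have "\<dots> = ennreal (min (f m x) (real R)) + ennreal (1 / sqrt (real R)) * ennreal (sqrt (f m x) ^ 3)"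
      proof -
        have "0 \<le> min (f m x) (real R)" "0 \<le> 1 / sqrt (real R)" "0 \<le> sqrt (f m x) ^ 3" using pos[of m x] by auto
        then show ?thesis by (simp only: ennreal_plus ennreal_mult mult_nonneg_nonneg)
      qed
      finally show ?thesis .
    qed
    have le: "?a m \<le> (\<integral>\<^sup>+x. ennreal (min (f m x) (real R)) \<partial>M) + ennreal e" for m
    proof -
      have "?a m \<le> (\<integral>\<^sup>+x. ennreal (min (f m x) (real R)) + ennreal (1 / sqrt (real R)) * ennreal (sqrt (f m x) ^ 3) \<partial>M)"
        by (intro nn_integral_mono split)
      also have "\<dots> = (\<integral>\<^sup>+x. ennreal (min (f m x) (real R)) \<partial>M) + ennreal (1 / sqrt (real R)) * (\<integral>\<^sup>+x. ennreal (sqrt (f m x) ^ 3) \<partial>M)"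
        by (simp add: nn_integral_add nn_integral_cmult)
      also have "\<dots> \<le> (\<integral>\<^sup>+x. ennreal (min (f m x) (real R)) \<partial>M) + ennreal (1 / sqrt (real R)) * ennreal K"
        by (intro add_left_mono mult_left_mono K) simp
      also have "ennreal (1 / sqrt (real R)) * ennreal K = ennreal (K / sqrt (real R))"
        by (simp add: ennreal_mult'[symmetric])
      also have "\<dots> \<le> ennreal e"
        using R(2) divide_right_mono[OF abs_ge_self, of "sqrt (real R)" K] by (intro ennreal_leI) auto
      finally show ?thesis by (simp add: add_left_mono)
    qed
    have "(\<lambda>m. \<integral>\<^sup>+x. ennreal (min (f m x) (real R)) \<partial>M) \<longlonglongrightarrow> (\<integral>\<^sup>+x. ennreal (min (g x) (real R)) \<partial>M)"
    proof (rule nn_integral_dominated_convergence[where w="\<lambda>_. ennreal (real R)"])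
      show "(\<integral>\<^sup>+x. ennreal (real R) \<partial>M) < \<infinity>" by (simp add: emeasure_space_1)
      show "AE x in M. (\<lambda>m. ennreal (min (f m x) (real R))) \<longlonglongrightarrow> ennreal (min (g x) (real R))"
        using lim by eventually_elim (intro tendsto_ennrealI tendsto_min tendsto_const)
    qed (auto intro!: ennreal_leI)
    then have "(\<lambda>m. (\<integral>\<^sup>+x. ennreal (min (f m x) (real R)) \<partial>M) + ennreal e) \<longlonglongrightarrow> (\<integral>\<^sup>+x. ennreal (min (g x) (real R)) \<partial>M) + ennreal e"
      by (intro tendsto_add tendsto_const)
    then have "limsup (\<lambda>m. (\<integral>\<^sup>+x. ennreal (min (f m x) (real R)) \<partial>M) + ennreal e) = (\<integral>\<^sup>+x. ennreal (min (g x) (real R)) \<partial>M) + ennreal e"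
      by (intro lim_imp_Limsup) auto
    moreover have L: "limsup ?a \<le> limsup (\<lambda>m. (\<integral>\<^sup>+x. ennreal (min (f m x) (real R)) \<partial>M) + ennreal e)"
      by (intro Limsup_mono always_eventually allI le)
    moreover have "(\<integral>\<^sup>+x. ennreal (min (g x) (real R)) \<partial>M) + ennreal e \<le> ?b + ennreal e"
      by (intro add_right_mono nn_integral_mono ennreal_leI) simp
    ultimately show "limsup ?a \<le> ?b + ennreal e" by (simp only: order_trans[OF L])
  qed
  have "liminf ?a \<le> limsup ?a" by (rule Liminf_le_Limsup) simp
  with A B show ?thesis by (intro Liminf_eq_Limsup) auto
qed

section \<open>Moment bound for the turning of the normal, row by row\<close>

lemma nn_integral_gauss_row_upd_pair:
  fixes F :: "(real^'p^'p) \<times> (real^'p^'p::finite) \<Rightarrow> ennreal"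
  assumes [measurable]: "F \<in> borel_measurable borel"
  shows "(\<integral>\<^sup>+q. F q \<partial>gauss) = (\<integral>\<^sup>+(X, Y). \<integral>\<^sup>+(v, w). F (row_upd X i v, row_upd Y i w) \<partial>gauss \<partial>gauss)"
proof -
  interpret G: prob_space "gauss :: ((real^'p) \<times> (real^'p)) measure" by (rule prob_space_gauss)
  define T where "T = (\<lambda>((X :: real^'p^'p, Y :: real^'p^'p), (v, w)). (row_upd X i v, row_upd Y i w))"
  define J where "J = (\<lambda>(X :: real^'p^'p, Y :: real^'p^'p). ((row_upd X i 0, row_upd Y i 0), (X $ i, Y $ i)))"
  have linT: "linear T" unfolding T_def by (rule linearI) (auto simp: vec_eq_iff row_upd_nth)
  have linJ: "linear J" unfolding J_def by (rule linearI) (auto simp: vec_eq_iff row_upd_nth)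
  have one: "row_upd X i v \<bullet> A = X \<bullet> row_upd A i 0 + v \<bullet> A $ i" for X A :: "real^'p^'p" and v
  proof -
    have "row_upd X i v \<bullet> A = v \<bullet> A $ i + (\<Sum>m\<in>UNIV - {i}. X $ m \<bullet> A $ m)"
      unfolding inner_vec_def[of "row_upd X i v"] by (subst sum.remove[of _ i]) (auto simp: row_upd_nth intro!: sum.cong)
    moreover have "X \<bullet> row_upd A i 0 = (\<Sum>m\<in>UNIV - {i}. X $ m \<bullet> A $ m)"
      unfolding inner_vec_def[of X] by (subst sum.remove[of _ i]) (auto simp: row_upd_nth intro!: sum.cong)
    ultimately show ?thesis by simp
  qed
  have T: "distr gauss borel T = gauss"
  proof (rule distr_gauss_coisometry[OF linT linJ])
    show "T x \<bullet> y = x \<bullet> J y" for x y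
    proof -
      obtain X Y v w where x: "x = ((X, Y), (v, w))" by (metis surj_pair)
      obtain A B where y: "y = (A, B)" by (cases y)
      show ?thesis unfolding x y T_def J_def by (simp add: one)
    qed
    show "T (J y) = y" for y by (cases y) (simp add: T_def J_def)
  qed
  note [measurable] = borel_measurable_linear[OF linT]
  have "(\<integral>\<^sup>+q. F q \<partial>gauss) = (\<integral>\<^sup>+q. F (T q) \<partial>gauss)"
    by (subst T[symmetric], rule nn_integral_distr) measurable
  also have "\<dots> = (\<integral>\<^sup>+p. \<integral>\<^sup>+q. F (T (p, q)) \<partial>gauss \<partial>gauss)"
    unfolding gauss_prod[where 'a="(real^'p^'p) \<times> (real^'p^'p)" and 'b="(real^'p) \<times> (real^'p)"]
    by (subst G.nn_integral_fst[symmetric]) (unfold gauss_prod[where 'a="(real^'p^'p) \<times> (real^'p^'p)" and 'b="(real^'p) \<times> (real^'p)", symmetric], auto)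
  finally show ?thesis by (simp add: T_def split_beta')
qed

text \<open>Interpolates between X and X + \<tau> Y one row at a time, so that the change of the
  normal telescopes into steps in which a single row moves.\<close>

definition shift_rows :: "'p set \<Rightarrow> real \<Rightarrow> real^'p^'p \<Rightarrow> real^'p^'p \<Rightarrow> real^'p^'p" where
  "shift_rows J \<tau> X Y = (\<chi> i. if i \<in> J then X $ i + \<tau> *\<^sub>R Y $ i else X $ i)"

lemma shift_rows_row_upd:
  assumes "i \<notin> J"
  shows "shift_rows J \<tau> (row_upd X i v) (row_upd Y i w) = row_upd (shift_rows J \<tau> X Y) i v"
    and "shift_rows (insert i J) \<tau> (row_upd X i v) (row_upd Y i w) = row_upd (shift_rows J \<tau> X Y) i (v + \<tau> *\<^sub>R w)"
  using assms by (auto simp: shift_rows_def row_upd_def vec_eq_iff)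

lemma continuous_on_shift_rows:
  "continuous_on UNIV (\<lambda>q :: (real^'p^'p) \<times> (real^'p^'p::finite). shift_rows J \<tau> (fst q) (snd q))"
  unfolding shift_rows_def
proof (rule continuous_on_vec_lambda)
  fix i show "continuous_on UNIV (\<lambda>q :: (real^'p^'p) \<times> (real^'p^'p). if i \<in> J then fst q $ i + \<tau> *\<^sub>R snd q $ i else fst q $ i)"
    by (cases "i \<in> J") (auto intro!: continuous_intros)
qed

lemma borel_measurable_sgn: "sgn \<in> borel \<rightarrow>\<^sub>M (borel :: 'a::euclidean_space measure)"
  unfolding sgn_div_norm[abs_def] by measurable

lemma borel_measurable_sgn_cofac_shift_rows:
  "(\<lambda>q. sgn (cofac k (shift_rows J \<tau> (fst q) (snd q)))) \<in> borel_measurable (borel :: ((real^'p^'p) \<times> (real^'p^'p::finite)) measure)"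
  by (rule measurable_compose[OF borel_measurable_continuous_onI[OF continuous_on_cofac[OF continuous_on_shift_rows]] borel_measurable_sgn])

lemma sqrt_cube_add_le:
  assumes "0 \<le> a" "0 \<le> b"
  shows "sqrt (a + b) ^ 3 \<le> 8 * (sqrt a ^ 3 + sqrt b ^ 3)"
proof -
  have *: "sqrt (a + b) ^ 3 \<le> 8 * sqrt (max a b) ^ 3"
  proof -
    have "sqrt (a + b) \<le> sqrt (4 * max a b)" using assms by (intro real_sqrt_le_mono) auto
    also have "\<dots> = 2 * sqrt (max a b)" by (simp add: real_sqrt_mult)
    finally have "sqrt (a + b) ^ 3 \<le> (2 * sqrt (max a b)) ^ 3" using assms by (intro power_mono) auto
    then show ?thesis by (simp add: power_mult_distrib)
  qed
  have "sqrt (max a b) ^ 3 \<le> sqrt a ^ 3 + sqrt b ^ 3" using assms by (auto simp: max_def)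
  then have "8 * sqrt (max a b) ^ 3 \<le> 8 * (sqrt a ^ 3 + sqrt b ^ 3)" by (rule mult_left_mono) simp
  with * show ?thesis by (rule order_trans)
qed

text \<open>The moment of order 3/2 of 2 |w| / |v| for independent planar Gaussian vectors v and
  w.\<close>

definition plane_bound :: ennreal where
  "plane_bound = ennreal (sqrt 2 ^ 3) * ((\<integral>\<^sup>+h. ennreal (1 / sqrt (norm h) ^ 3) \<partial>(gauss :: (real \<times> real) measure))
     * (\<integral>\<^sup>+h. ennreal (sqrt (norm h) ^ 3) \<partial>(gauss :: (real \<times> real) measure)))"

lemma plane_bound_finite: "plane_bound < \<top>"
  unfolding plane_bound_def
  using nn_integral_gauss_norm_powr_finite nn_integral_gauss_inverse_norm_powr_finite
  by (auto simp: ennreal_mult_less_top)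

text \<open>Shifting a single row turns the normal by the quotient of two plane vectors; the common factor
  \<^term>\<open>\<kappa>\<close>, which depends on the other rows, cancels.\<close>

lemma nn_integral_one_row_shift:
  fixes X :: "real^'p^'p::finite"
  assumes ik: "i \<noteq> k" and \<tau>: "\<tau> > 0"
  shows "(\<integral>\<^sup>+(v, w). ennreal (sqrt (norm (sgn (cofac k (row_upd X i v)) - sgn (cofac k (row_upd X i (v + \<tau> *\<^sub>R w)))) / \<tau>) ^ 3)
      \<partial>(gauss :: ((real^'p) \<times> (real^'p)) measure)) \<le> plane_bound"
proof -
  interpret V: prob_space "gauss :: (real^'p) measure" by (rule prob_space_gauss)
  obtain u e \<kappa> where u: "norm u = 1" "norm e = 1" "u \<bullet> e = 0"
    and N: "\<And>v. cofac k (row_upd X i v) = \<kappa> *\<^sub>R ((v \<bullet> e) *\<^sub>R u - (v \<bullet> u) *\<^sub>R e)"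
    using cofac_row_upd_plane[OF ik, of X] by blast
  let ?h = "\<lambda>v. norm (v \<bullet> u, v \<bullet> e)"
  have [measurable]: "?h \<in> borel_measurable (gauss :: (real^'p) measure)" by (simp add: norm_Pair)
  have norm_N: "norm (cofac k (row_upd X i v)) = \<bar>\<kappa>\<bar> * ?h v" for v
  proof -
    have "((v \<bullet> e) *\<^sub>R u - (v \<bullet> u) *\<^sub>R e) \<bullet> ((v \<bullet> e) *\<^sub>R u - (v \<bullet> u) *\<^sub>R e) = (v \<bullet> u)\<^sup>2 + (v \<bullet> e)\<^sup>2"
      using u by (simp add: inner_diff_left inner_diff_right norm_eq_1 inner_commute[of e u] power2_eq_square)
    then have "norm ((v \<bullet> e) *\<^sub>R u - (v \<bullet> u) *\<^sub>R e) = ?h v"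
      by (simp add: norm_eq_sqrt_inner norm_Pair power2_eq_square)
    then show ?thesis by (simp add: N)
  qed
  have bound: "ennreal (sqrt (norm (sgn (cofac k (row_upd X i v)) - sgn (cofac k (row_upd X i (v + \<tau> *\<^sub>R w)))) / \<tau>) ^ 3)
      \<le> ennreal (sqrt 2 ^ 3) * (ennreal (1 / sqrt (?h v) ^ 3) * ennreal (sqrt (?h w) ^ 3))" if v: "?h v \<noteq> 0" for v w
  proof -
    have "norm (sgn (cofac k (row_upd X i v)) - sgn (cofac k (row_upd X i (v + \<tau> *\<^sub>R w)))) / \<tau> \<le> 2 * (1 / ?h v * ?h w)"
    proof (cases "\<kappa> = 0")
      case False
      have hv: "?h v > 0" using v by simp
      then have nz: "cofac k (row_upd X i v) \<noteq> 0" using norm_N[of v] False by (metis abs_eq_0 mult_eq_0_iff norm_zero less_irrefl)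
      \<comment> \<open>By linearity in row \<open>i\<close> the increment is again such a cofactor
        vector, so its norm carries the same factor \<open>\<kappa>\<close>.\<close>
      have "cofac k (row_upd X i v) - cofac k (row_upd X i (v + \<tau> *\<^sub>R w)) = - \<tau> *\<^sub>R cofac k (row_upd X i w)"
        using linear_add[OF linear_cofac_row_upd[OF ik]] linear_scale[OF linear_cofac_row_upd[OF ik]] by simp
      then have "norm (cofac k (row_upd X i v) - cofac k (row_upd X i (v + \<tau> *\<^sub>R w))) = \<tau> * (\<bar>\<kappa>\<bar> * ?h w)"
        using \<tau> norm_N[of w] by simp
      with norm_sgn_diff_le[OF nz, of "cofac k (row_upd X i (v + \<tau> *\<^sub>R w))"]
      have "norm (sgn (cofac k (row_upd X i v)) - sgn (cofac k (row_upd X i (v + \<tau> *\<^sub>R w)))) \<le> 2 * (\<tau> * (\<bar>\<kappa>\<bar> * ?h w)) / (\<bar>\<kappa>\<bar> * ?h v)"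
        by (simp only: norm_N)
      also have "\<dots> = \<tau> * (2 * (1 / ?h v * ?h w))" using False by simp
      finally show ?thesis using \<tau> by (simp add: field_simps)
    qed (simp add: N)
    then have "sqrt (norm (sgn (cofac k (row_upd X i v)) - sgn (cofac k (row_upd X i (v + \<tau> *\<^sub>R w)))) / \<tau>) ^ 3 \<le> sqrt (2 * (1 / ?h v * ?h w)) ^ 3"
      using \<tau> by (intro power_mono real_sqrt_le_mono) auto
    also have "\<dots> = sqrt 2 ^ 3 * (1 / sqrt (?h v) ^ 3 * sqrt (?h w) ^ 3)"
      by (simp add: real_sqrt_mult real_sqrt_divide power_mult_distrib power_divide)
    finally have "ennreal (sqrt (norm (sgn (cofac k (row_upd X i v)) - sgn (cofac k (row_upd X i (v + \<tau> *\<^sub>R w)))) / \<tau>) ^ 3)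
       \<le> ennreal (sqrt 2 ^ 3 * (1 / sqrt (?h v) ^ 3 * sqrt (?h w) ^ 3))" by (rule ennreal_leI)
    moreover have "ennreal (sqrt 2 ^ 3 * (1 / sqrt (?h v) ^ 3 * sqrt (?h w) ^ 3)) = ennreal (sqrt 2 ^ 3) * (ennreal (1 / sqrt (?h v) ^ 3) * ennreal (sqrt (?h w) ^ 3))"
    proof -
      have "0 \<le> sqrt 2 ^ 3" "0 \<le> 1 / sqrt (?h v) ^ 3" "0 \<le> sqrt (?h w) ^ 3" by simp_all
      then show ?thesis by (simp only: ennreal_mult mult_nonneg_nonneg)
    qed
    ultimately show ?thesis by (simp only:)
  qed
  let ?G = "\<lambda>v w. ennreal (sqrt 2 ^ 3) * (ennreal (1 / sqrt (?h v) ^ 3) * ennreal (sqrt (?h w) ^ 3))"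
  have "AE q in (gauss :: ((real^'p) \<times> (real^'p)) measure). ?h (fst q) \<noteq> 0"
  proof -
    let ?f = "fst :: (real^'p) \<times> (real^'p) \<Rightarrow> real^'p"
    have D: "distr gauss borel ?f = gauss"
      by (rule distr_gauss_coisometry[where J="\<lambda>x. (x, 0 :: real^'p)"]) (auto intro!: linearI)
    have "AE v in distr gauss borel ?f. ?h v \<noteq> 0"
      unfolding D by (rule AE_gauss_plane_nonzero[OF u])
    moreover have "?f \<in> gauss \<rightarrow>\<^sub>M borel"
      unfolding measurable_cong_sets[OF sets_gauss refl] by (intro borel_measurable_continuous_onI continuous_intros)
    ultimately show ?thesis by (rule AE_distrD[where P="\<lambda>v. ?h v \<noteq> 0", rotated])
  qed
  then have "(\<integral>\<^sup>+(v, w). ennreal (sqrt (norm (sgn (cofac k (row_upd X i v)) - sgn (cofac k (row_upd X i (v + \<tau> *\<^sub>R w)))) / \<tau>) ^ 3) \<partial>gauss)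
     \<le> (\<integral>\<^sup>+q. ?G (fst q) (snd q) \<partial>(gauss :: ((real^'p) \<times> (real^'p)) measure))"
    by (intro nn_integral_mono_AE) (auto elim!: eventually_mono intro!: bound simp: split_beta')
  also have "\<dots> = (\<integral>\<^sup>+v. \<integral>\<^sup>+w. ?G v w \<partial>(gauss :: (real^'p) measure) \<partial>(gauss :: (real^'p) measure))"
  proof -
    have "(\<lambda>q. ?G (fst q) (snd q)) \<in> borel_measurable ((gauss :: (real^'p) measure) \<Otimes>\<^sub>M (gauss :: (real^'p) measure))"
      by measurable
    from V.nn_integral_fst[OF this] show ?thesis by (simp add: gauss_prod)
  qed
  also have "\<dots> = ennreal (sqrt 2 ^ 3) * ((\<integral>\<^sup>+v. ennreal (1 / sqrt (?h v) ^ 3) \<partial>(gauss :: (real^'p) measure)) * (\<integral>\<^sup>+w. ennreal (sqrt (?h w) ^ 3) \<partial>(gauss :: (real^'p) measure)))"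
    by (simp add: nn_integral_cmult nn_integral_multc)
  also have "(\<integral>\<^sup>+v. ennreal (1 / sqrt (?h v) ^ 3) \<partial>(gauss :: (real^'p) measure)) = (\<integral>\<^sup>+h. ennreal (1 / sqrt (norm h) ^ 3) \<partial>(gauss :: (real \<times> real) measure))"
    by (rule nn_integral_gauss_plane[OF u]) measurable
  also have "(\<integral>\<^sup>+w. ennreal (sqrt (?h w) ^ 3) \<partial>(gauss :: (real^'p) measure)) = (\<integral>\<^sup>+h. ennreal (sqrt (norm h) ^ 3) \<partial>(gauss :: (real \<times> real) measure))"
    by (rule nn_integral_gauss_plane[OF u]) measurable
  finally show ?thesis unfolding plane_bound_def .
qed

text \<open>Induction on the shifted rows: when row \<open>i\<close> is added, conditioning on all
  other rows reduces the step to \<open>nn_integral_one_row_shift\<close>, whose bound depends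
  neither on those rows nor on \<tau>. The factor 8 is the cost of splitting a sum under the power
  3/2.\<close>

lemma nn_integral_shift_rows_bound:
  fixes k :: "'p::finite"
  assumes "finite J" "k \<notin> J"
  shows "\<exists>K<\<top>. \<forall>\<tau>>0. (\<integral>\<^sup>+q. ennreal (sqrt (norm (sgn (cofac k (fst q)) - sgn (cofac k (shift_rows J \<tau> (fst q) (snd q)))) / \<tau>) ^ 3)
      \<partial>(gauss :: ((real^'p^'p) \<times> (real^'p^'p)) measure)) \<le> K"
  using assms
proof (induction J)
  case empty
  have "shift_rows {} \<tau> X Y = X" for \<tau> and X Y :: "real^'p^'p" by (simp add: shift_rows_def)
  then show ?case by (intro exI[of _ 0]) simp
next
  case (insert i J)
  then obtain K where K: "K < \<top>" "\<And>\<tau>. \<tau> > 0 \<Longrightarrow> (\<integral>\<^sup>+q. ennreal (sqrt (norm (sgn (cofac k (fst q)) - sgn (cofac k (shift_rows J \<tau> (fst q) (snd q)))) / \<tau>) ^ 3)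
      \<partial>(gauss :: ((real^'p^'p) \<times> (real^'p^'p)) measure)) \<le> K" by auto
  have ik: "i \<noteq> k" using insert by auto
  show ?case
  proof (intro exI[of _ "8 * (K + plane_bound)"] conjI allI impI)
    show "8 * (K + plane_bound) < \<top>" using K(1) plane_bound_finite by (simp add: ennreal_mult_less_top)
    fix \<tau> :: real assume \<tau>: "\<tau> > 0"
    let ?A = "\<lambda>J (q :: (real^'p^'p) \<times> (real^'p^'p)). sgn (cofac k (shift_rows J \<tau> (fst q) (snd q)))"
    let ?a = "\<lambda>q :: (real^'p^'p) \<times> (real^'p^'p). sgn (cofac k (fst q))"
    note [measurable] = borel_measurable_sgn_cofac_shift_rows[of k _ \<tau>]
    have [measurable]: "?a \<in> borel_measurable borel"
      using borel_measurable_sgn_cofac_shift_rows[of k "{}" \<tau>] by (simp add: shift_rows_def)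
    have step: "(\<integral>\<^sup>+q. ennreal (sqrt (norm (?A J q - ?A (insert i J) q) / \<tau>) ^ 3) \<partial>gauss) \<le> plane_bound"
    proof -
      interpret G: prob_space "gauss :: ((real^'p^'p) \<times> (real^'p^'p)) measure" by (rule prob_space_gauss)
      have "(\<integral>\<^sup>+q. ennreal (sqrt (norm (?A J q - ?A (insert i J) q) / \<tau>) ^ 3) \<partial>gauss)
        = (\<integral>\<^sup>+(X, Y). \<integral>\<^sup>+(v, w). ennreal (sqrt (norm (?A J (row_upd X i v, row_upd Y i w) - ?A (insert i J) (row_upd X i v, row_upd Y i w)) / \<tau>) ^ 3) \<partial>gauss \<partial>gauss)"
        by (rule nn_integral_gauss_row_upd_pair) measurable
      \<comment> \<open>Row \<open>i\<close> is sampled last in both matrices, so the rows already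
        shifted appear as a fixed matrix in the inner integral.\<close>
      also have "\<dots> \<le> (\<integral>\<^sup>+(q :: (real^'p^'p) \<times> (real^'p^'p)). plane_bound \<partial>gauss)"
        using nn_integral_one_row_shift[OF ik \<tau>] insert
        by (intro nn_integral_mono) (auto simp: shift_rows_row_upd split_beta')
      also have "\<dots> = plane_bound" using G.emeasure_space_1 by simp
      finally show ?thesis .
    qed
    have "ennreal (sqrt (norm (?a q - ?A (insert i J) q) / \<tau>) ^ 3) \<le>
       8 * (ennreal (sqrt (norm (?a q - ?A J q) / \<tau>) ^ 3) + ennreal (sqrt (norm (?A J q - ?A (insert i J) q) / \<tau>) ^ 3))" for q
    proof -
      let ?x = "norm (?a q - ?A J q) / \<tau>" and ?y = "norm (?A J q - ?A (insert i J) q) / \<tau>"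
      have "norm (?a q - ?A (insert i J) q) / \<tau> \<le> ?x + ?y"
        using \<tau> norm_triangle_ineq[of "?a q - ?A J q" "?A J q - ?A (insert i J) q"] by (simp add: divide_right_mono flip: add_divide_distrib)
      then have "sqrt (norm (?a q - ?A (insert i J) q) / \<tau>) ^ 3 \<le> sqrt (?x + ?y) ^ 3"
        using \<tau> by (intro power_mono real_sqrt_le_mono) auto
      also have "\<dots> \<le> 8 * (sqrt ?x ^ 3 + sqrt ?y ^ 3)" using \<tau> by (intro sqrt_cube_add_le) auto
      finally have "ennreal (sqrt (norm (?a q - ?A (insert i J) q) / \<tau>) ^ 3) \<le> ennreal (8 * (sqrt ?x ^ 3 + sqrt ?y ^ 3))" by (rule ennreal_leI)
      also have "\<dots> = 8 * (ennreal (sqrt ?x ^ 3) + ennreal (sqrt ?y ^ 3))" using \<tau> by (simp add: ennreal_mult')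
      finally show ?thesis .
    qed
    then have "(\<integral>\<^sup>+q. ennreal (sqrt (norm (?a q - ?A (insert i J) q) / \<tau>) ^ 3) \<partial>gauss) \<le>
       (\<integral>\<^sup>+q. 8 * (ennreal (sqrt (norm (?a q - ?A J q) / \<tau>) ^ 3) + ennreal (sqrt (norm (?A J q - ?A (insert i J) q) / \<tau>) ^ 3)) \<partial>gauss)"
      by (intro nn_integral_mono) auto
    also have "\<dots> = 8 * ((\<integral>\<^sup>+q. ennreal (sqrt (norm (?a q - ?A J q) / \<tau>) ^ 3) \<partial>gauss) + (\<integral>\<^sup>+q. ennreal (sqrt (norm (?A J q - ?A (insert i J) q) / \<tau>) ^ 3) \<partial>gauss))"
    proof -
      have "(\<lambda>q. ennreal (sqrt (norm (?a q - ?A J q) / \<tau>) ^ 3)) \<in> borel_measurable gauss"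
        "(\<lambda>q. ennreal (sqrt (norm (?A J q - ?A (insert i J) q) / \<tau>) ^ 3)) \<in> borel_measurable gauss"
        by measurable
      then show ?thesis by (simp only: nn_integral_cmult nn_integral_add borel_measurable_add)
    qed
    also have "\<dots> \<le> 8 * (K + plane_bound)"
      by (intro mult_left_mono add_mono K(2)[OF \<tau>] step) simp
    finally show "(\<integral>\<^sup>+q. ennreal (sqrt (norm (?a q - ?A (insert i J) q) / \<tau>) ^ 3) \<partial>gauss) \<le> 8 * (K + plane_bound)" .
  qed
qed

section \<open>The sign change rate of the determinant\<close>

lemma differentiable_prod:
  fixes f :: "'i \<Rightarrow> 'a::real_normed_vector \<Rightarrow> real"
  assumes "\<And>i. i \<in> I \<Longrightarrow> f i differentiable (at x)"
  shows "(\<lambda>x. \<Prod>i\<in>I. f i x) differentiable (at x)"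
  using assms by (induction I rule: infinite_finite_induct) (simp_all add: differentiable_mult)

lemma differentiable_det:
  fixes A :: "real \<Rightarrow> real^'p^'p::finite"
  assumes "\<And>i j. (\<lambda>t. A t $ i $ j) differentiable (at x)"
  shows "(\<lambda>t. det (A t)) differentiable (at x)"
  unfolding det_def
  by (intro differentiable_sum ballI differentiable_mult differentiable_const differentiable_prod assms finite_permutations) simp

lemma differentiable_cofac_line:
  fixes X Y :: "real^'p^'p::finite"
  shows "(\<lambda>t. cofac k (X + t *\<^sub>R Y)) differentiable (at x)"
proof -
  have "(\<lambda>t. det (row_upd (X + t *\<^sub>R Y) k (axis j 1))) differentiable (at x)" for j
  proof (rule differentiable_det)
    fix i m
    show "(\<lambda>t. row_upd (X + t *\<^sub>R Y) k (axis j 1) $ i $ m) differentiable (at x)"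
      by (cases "i = k") (simp_all add: row_upd_nth differentiable_add differentiable_mult)
  qed
  then show ?thesis
    by (subst differentiable_componentwise_within) (auto simp: cofac_def Basis_vec_def inner_axis)
qed

text \<open>The determinant of \<^term>\<open>X + \<tau> *\<^sub>R Y\<close> is a linear form in the pair of \<^term>\<open>k\<close>-th rows of
  \<^term>\<open>X\<close> and \<^term>\<open>Y\<close>; this is its unit normal.\<close>

definition row_dir :: "'p::finite \<Rightarrow> real \<Rightarrow> real^'p^'p \<Rightarrow> real^'p^'p \<Rightarrow> (real^'p) \<times> (real^'p)" where
  "row_dir k \<tau> X Y = sgn (cofac k (X + \<tau> *\<^sub>R Y), \<tau> *\<^sub>R cofac k (X + \<tau> *\<^sub>R Y))"

text \<open>The value 0 in the degenerate case is the correct one: if a cofactor vector vanishes,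
  the corresponding determinant is zero for every choice of row \<open>k\<close>, so no sign change
  occurs.\<close>

definition row_angle :: "'p::finite \<Rightarrow> real \<Rightarrow> real^'p^'p \<Rightarrow> real^'p^'p \<Rightarrow> real" where
  "row_angle k \<tau> X Y = (if cofac k X = 0 \<or> cofac k (X + \<tau> *\<^sub>R Y) = 0 then 0
     else arccos (row_dir k 0 X Y \<bullet> row_dir k \<tau> X Y))"

lemma sgn_pos_scaleR: "0 < r \<Longrightarrow> sgn (r *\<^sub>R x) = sgn (x :: 'a::real_normed_vector)"
  by (simp add: sgn_scaleR)

lemma row_dir_eq:
  "row_dir k \<tau> X Y = (1 / sqrt (1 + \<tau>\<^sup>2)) *\<^sub>R (sgn (cofac k (X + \<tau> *\<^sub>R Y)), \<tau> *\<^sub>R sgn (cofac k (X + \<tau> *\<^sub>R Y)))"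
proof -
  let ?n = "cofac k (X + \<tau> *\<^sub>R Y)"
  have "norm (?n, \<tau> *\<^sub>R ?n) = sqrt ((1 + \<tau>\<^sup>2) * (norm ?n)\<^sup>2)"
    by (simp add: norm_Pair power_mult_distrib distrib_right)
  also have "\<dots> = sqrt (1 + \<tau>\<^sup>2) * norm ?n" by (simp add: real_sqrt_mult)
  finally show ?thesis unfolding row_dir_def sgn_div_norm by (simp add: divide_inverse mult_ac)
qed

lemma norm_row_dir: "cofac k (X + \<tau> *\<^sub>R Y) \<noteq> 0 \<Longrightarrow> norm (row_dir k \<tau> X Y) = 1"
  by (simp add: row_dir_def norm_sgn zero_prod_def)

lemma abs_inner_row_dir_le:
  "cofac k X \<noteq> 0 \<Longrightarrow> cofac k (X + \<tau> *\<^sub>R Y) \<noteq> 0 \<Longrightarrow> \<bar>row_dir k 0 X Y \<bullet> row_dir k \<tau> X Y\<bar> \<le> 1"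
  using Cauchy_Schwarz_ineq2[of "row_dir k 0 X Y" "row_dir k \<tau> X Y"] norm_row_dir[of k X 0 Y] norm_row_dir[of k X \<tau> Y] by simp

lemma row_angle_nonneg: "0 \<le> row_angle k \<tau> X Y"
proof (cases "cofac k X = 0 \<or> cofac k (X + \<tau> *\<^sub>R Y) = 0")
  case False
  then have "\<bar>row_dir k 0 X Y \<bullet> row_dir k \<tau> X Y\<bar> \<le> 1"
    by (intro abs_inner_row_dir_le) auto
  with False show ?thesis by (simp add: row_angle_def abs_le_iff arccos_lbound)
qed (auto simp: row_angle_def)

text \<open>The angle is at most twice the chord, and normalising the pairs costs another factor 2.
  The second components differ by a vector of length \<tau>, which becomes the summand 1.\<close>

lemma row_angle_le:
  fixes X Y :: "real^'p^'p::finite"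
  assumes "\<tau> > 0"
  shows "row_angle k \<tau> X Y / \<tau> \<le> 4 * (norm (sgn (cofac k X) - sgn (cofac k (X + \<tau> *\<^sub>R Y))) / \<tau> + 1)"
proof (cases "cofac k X = 0 \<or> cofac k (X + \<tau> *\<^sub>R Y) = 0")
  case True
  then show ?thesis using assms by (simp add: row_angle_def)
next
  case False
  let ?u = "sgn (cofac k X)" and ?v = "sgn (cofac k (X + \<tau> *\<^sub>R Y))"
  have u: "norm ?u = 1" "norm ?v = 1" using False by (auto simp: norm_sgn)
  have d0: "row_dir k 0 X Y = sgn (?u, 0)" using u by (simp add: row_dir_eq sgn_div_norm[of "(?u, 0)"])
  have "0 < 1 + \<tau>\<^sup>2" by (simp add: add_pos_nonneg)
  then have d1: "row_dir k \<tau> X Y = sgn (?v, \<tau> *\<^sub>R ?v)"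
    using sgn_pos_scaleR[of "1 / sqrt (1 + \<tau>\<^sup>2)" "(?v, \<tau> *\<^sub>R ?v)"] sgn_div_norm[of "row_dir k \<tau> X Y"] norm_row_dir[of k X \<tau> Y] False
    unfolding row_dir_eq by simp
  have x: "norm (?u, 0 :: real^'p) = 1" using u by simp
  then have "(?u, 0 :: real^'p) \<noteq> 0" by (metis norm_zero zero_neq_one)
  from norm_sgn_diff_le[OF this, of "(?v, \<tau> *\<^sub>R ?v)"]
  have "norm (row_dir k 0 X Y - row_dir k \<tau> X Y) \<le> 2 * norm ((?u, 0) - (?v, \<tau> *\<^sub>R ?v))"
    by (simp only: d0 d1 x div_by_1)
  also have "norm ((?u, 0) - (?v, \<tau> *\<^sub>R ?v)) \<le> norm (?u - ?v) + \<tau>"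
    using norm_Pair_le[of "?u - ?v" "- \<tau> *\<^sub>R ?v"] u assms by simp
  finally have "norm (row_dir k 0 X Y - row_dir k \<tau> X Y) \<le> 2 * (norm (?u - ?v) + \<tau>)" by simp
  moreover have "row_angle k \<tau> X Y \<le> 2 * norm (row_dir k 0 X Y - row_dir k \<tau> X Y)"
    using False arccos_inner_le_norm_diff[of "row_dir k 0 X Y" "row_dir k \<tau> X Y"] norm_row_dir[of k X 0 Y] norm_row_dir[of k X \<tau> Y]
    by (simp add: row_angle_def)
  ultimately have "row_angle k \<tau> X Y \<le> 4 * (norm (?u - ?v) + \<tau>)" by simp
  then have "row_angle k \<tau> X Y / \<tau> \<le> 4 * (norm (?u - ?v) + \<tau>) / \<tau>" using assms by (intro divide_right_mono) auto
  also have "\<dots> = 4 * (norm (?u - ?v) / \<tau> + 1)" using assms by (simp add: field_simps)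
  finally show ?thesis .
qed

lemma has_vector_derivative_quotient_tendsto:
  assumes "(f has_vector_derivative y) (at 0)"
  shows "((\<lambda>h. (f h - f 0) /\<^sub>R h) \<longlongrightarrow> y) (at 0)"
proof -
  have "((\<lambda>h. norm (f h - f 0 - h *\<^sub>R y) / norm h) \<longlongrightarrow> 0) (at 0)"
    using assms by (simp add: has_vector_derivative_def has_derivative_at)
  moreover have "\<forall>\<^sub>F h in at 0. norm (f h - f 0 - h *\<^sub>R y) / norm h = norm ((f h - f 0) /\<^sub>R h - y)"
  proof -
    have "norm (f h - f 0 - h *\<^sub>R y) / norm h = norm ((f h - f 0) /\<^sub>R h - y)" if "h \<noteq> 0" for h
    proof -
      have "(f h - f 0) /\<^sub>R h - y = (f h - f 0 - h *\<^sub>R y) /\<^sub>R h" using that by (simp add: scaleR_diff_right)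
      then show ?thesis by (simp add: divide_inverse mult.commute)
    qed
    then show ?thesis by (simp add: eventually_at_filter)
  qed
  ultimately have "((\<lambda>h. norm ((f h - f 0) /\<^sub>R h - y)) \<longlongrightarrow> 0) (at 0)" by (rule Lim_transform_eventually)
  then have "((\<lambda>h. (f h - f 0) /\<^sub>R h - y) \<longlongrightarrow> 0) (at 0)" by (rule tendsto_norm_zero_cancel)
  then show ?thesis by (rule LIM_zero_cancel)
qed

text \<open>Differentiating the orthogonality relations of the cofactor row identifies the velocity of its
  direction with the solution of the linear system defining \<^term>\<open>speed\<close>.\<close>

lemma row_angle_tendsto:
  fixes X Y :: "real^'p^'p::finite"
  assumes nz: "cofac k X \<noteq> 0"
  shows "((\<lambda>\<tau>. row_angle k \<tau> X Y / \<tau>) \<longlongrightarrow> speed k X (Y *v sgn (cofac k X))) (at_right 0)"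
proof -
  define \<nu> where "\<nu> = (\<lambda>\<tau>. sgn (cofac k (X + \<tau> *\<^sub>R Y)))"
  have \<nu>0: "\<nu> 0 = sgn (cofac k X)" by (simp add: \<nu>_def)
  have "\<nu> differentiable (at 0)"
  proof -
    have d: "(\<lambda>t. cofac k (X + t *\<^sub>R Y)) differentiable (at 0)" by (rule differentiable_cofac_line)
    have "(\<lambda>t. norm (cofac k (X + t *\<^sub>R Y))) differentiable (at 0)"
      using differentiable_compose[of norm "\<lambda>t. cofac k (X + t *\<^sub>R Y)" 0 UNIV] d nz by simp
    then show ?thesis
      unfolding \<nu>_def sgn_div_norm using d nz by (intro differentiable_scaleR differentiable_inverse) auto
  qed
  then obtain y where y: "(\<nu> has_vector_derivative y) (at 0)" by (auto simp: vector_derivative_works)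
  have ev: "\<forall>\<^sub>F \<tau> in at 0. cofac k (X + \<tau> *\<^sub>R Y) \<noteq> 0"
  proof -
    have "isCont (\<lambda>t. cofac k (X + t *\<^sub>R Y)) 0"
      using differentiable_imp_continuous_within[OF differentiable_cofac_line[of k X Y 0]] .
    then have "(\<lambda>t. cofac k (X + t *\<^sub>R Y)) \<midarrow>0\<rightarrow> cofac k X" by (simp add: isCont_def)
    then show ?thesis using nz by (rule tendsto_imp_eventually_ne)
  qed
  have rows: "X $ i \<bullet> y = - (Y *v \<nu> 0) $ i" if "i \<noteq> k" for i
  proof -
    have "((\<lambda>\<tau>. (X $ i + \<tau> *\<^sub>R Y $ i) \<bullet> \<nu> \<tau>) has_vector_derivative (X $ i + 0 *\<^sub>R Y $ i) \<bullet> y + Y $ i \<bullet> \<nu> 0) (at 0)"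
      by (rule bounded_bilinear.has_vector_derivative[OF bounded_bilinear_inner _ y]) (auto intro!: derivative_eq_intros)
    moreover have "(X $ i + \<tau> *\<^sub>R Y $ i) \<bullet> \<nu> \<tau> = 0" for \<tau>
      using cofac_orth[OF that, of "X + \<tau> *\<^sub>R Y"] by (simp add: \<nu>_def sgn_div_norm inner_commute)
    ultimately have "((\<lambda>\<tau>. 0) has_vector_derivative X $ i \<bullet> y + Y $ i \<bullet> \<nu> 0) (at (0::real))" by simp
    then have "X $ i \<bullet> y + Y $ i \<bullet> \<nu> 0 = 0" using vector_derivative_unique_at[OF _ has_vector_derivative_const] by blast
    then show ?thesis by (simp add: matrix_vector_mul_component)
  qed
  \<comment> \<open>The unit normal has constant length near 0, so its velocity is orthogonal to
    it.\<close>
  have orth: "cofac k X \<bullet> y = 0"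
  proof -
    have "((\<lambda>\<tau>. \<nu> \<tau> \<bullet> \<nu> \<tau>) has_vector_derivative \<nu> 0 \<bullet> y + y \<bullet> \<nu> 0) (at 0)"
      by (rule bounded_bilinear.has_vector_derivative[OF bounded_bilinear_inner y y])
    moreover have "((\<lambda>\<tau>. \<nu> \<tau> \<bullet> \<nu> \<tau>) has_vector_derivative 0) (at 0)"
    proof -
      have "\<forall>\<^sub>F \<tau> in nhds 0. \<nu> \<tau> \<bullet> \<nu> \<tau> = 1"
        unfolding eventually_nhds_conv_at using ev nz by (auto elim!: eventually_mono simp: \<nu>_def norm_sgn simp flip: norm_eq_1)
      then have "((\<lambda>\<tau>. \<nu> \<tau> \<bullet> \<nu> \<tau>) has_real_derivative 0) (at 0) \<longleftrightarrow> ((\<lambda>_. 1 :: real) has_real_derivative 0) (at 0)"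
        by (intro DERIV_cong_ev refl)
      then show ?thesis by (simp add: has_real_derivative_iff_has_vector_derivative)
    qed
    ultimately have "\<nu> 0 \<bullet> y + y \<bullet> \<nu> 0 = 0" by (rule vector_derivative_unique_at)
    then show ?thesis using nz by (simp add: \<nu>0 sgn_div_norm inner_commute)
  qed
  have speed: "speed k X (Y *v sgn (cofac k X)) = norm (y, \<nu> 0)"
    using speed_eqI[OF nz rows orth] nz by (simp add: \<nu>0 norm_Pair norm_sgn add.commute)
  let ?W = "\<lambda>\<tau>. row_dir k \<tau> X Y"
  have W: "(?W has_vector_derivative (y, \<nu> 0)) (at 0)"
  proof -
    have "((\<lambda>\<tau>. (1 / sqrt (1 + \<tau>\<^sup>2)) *\<^sub>R (\<nu> \<tau>, \<tau> *\<^sub>R \<nu> \<tau>)) has_vector_derivative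
       (1 / sqrt (1 + 0\<^sup>2)) *\<^sub>R (y, 0 *\<^sub>R y + 1 *\<^sub>R \<nu> 0) + 0 *\<^sub>R (\<nu> 0, 0 *\<^sub>R \<nu> 0)) (at 0)"
      by (rule has_vector_derivative_scaleR has_vector_derivative_Pair y)+ (auto intro!: derivative_eq_intros y)
    then show ?thesis by (simp add: row_dir_eq \<nu>_def)
  qed
  \<comment> \<open>Caratheodory's form of the derivative of arcsin at 0 avoids dividing by the
    chord, which is not known to be nonzero.\<close>
  obtain g where g: "\<And>z. arcsin z - arcsin 0 = g z * (z - 0)" "isCont g 0" "g 0 = 1"
    using DERIV_arcsin[of 0] by (auto simp: CARAT_DERIV)
  have "((\<lambda>\<tau>. norm (?W 0 - ?W \<tau>) / \<tau>) \<longlongrightarrow> norm (y, \<nu> 0)) (at_right 0)"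
  proof -
    have "((\<lambda>\<tau>. norm ((?W \<tau> - ?W 0) /\<^sub>R \<tau>)) \<longlongrightarrow> norm (y, \<nu> 0)) (at_right 0)"
      using tendsto_norm[OF has_vector_derivative_quotient_tendsto[OF W]] by (simp only: filterlim_at_split)
    moreover have "\<forall>\<^sub>F \<tau> in at_right 0. norm ((?W \<tau> - ?W 0) /\<^sub>R \<tau>) = norm (?W 0 - ?W \<tau>) / \<tau>"
      using eventually_at_right_less[of "0::real"] by eventually_elim (simp add: norm_minus_commute divide_inverse mult.commute)
    ultimately show ?thesis by (rule Lim_transform_eventually)
  qed
  moreover have "((\<lambda>\<tau>. g (norm (?W 0 - ?W \<tau>) / 2)) \<longlongrightarrow> 1) (at_right 0)"
  proof -
    have "(?W \<longlongrightarrow> ?W 0) (at 0)"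
      using has_vector_derivative_continuous[OF W] by (simp add: continuous_at)
    then have "(?W \<longlongrightarrow> ?W 0) (at_right 0)" by (simp add: filterlim_at_split)
    then have "((\<lambda>\<tau>. norm (?W 0 - ?W \<tau>) / 2) \<longlongrightarrow> norm (?W 0 - ?W 0) / 2) (at_right 0)" by (intro tendsto_intros) auto
    then have "((\<lambda>\<tau>. norm (?W 0 - ?W \<tau>) / 2) \<longlongrightarrow> 0) (at_right 0)" by simp
    from isCont_tendsto_compose[OF g(2) this] show ?thesis by (simp add: g(3))
  qed
  ultimately have "((\<lambda>\<tau>. g (norm (?W 0 - ?W \<tau>) / 2) * (norm (?W 0 - ?W \<tau>) / \<tau>)) \<longlongrightarrow> 1 * norm (y, \<nu> 0)) (at_right 0)"
    by (intro tendsto_mult)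
  moreover have "\<forall>\<^sub>F \<tau> in at_right 0. g (norm (?W 0 - ?W \<tau>) / 2) * (norm (?W 0 - ?W \<tau>) / \<tau>) = row_angle k \<tau> X Y / \<tau>"
    using ev[unfolded eventually_at_split, THEN conjunct2]
  proof eventually_elim
    fix \<tau> assume nz': "cofac k (X + \<tau> *\<^sub>R Y) \<noteq> 0"
    then have "row_angle k \<tau> X Y = 2 * arcsin (norm (?W 0 - ?W \<tau>) / 2)"
      using nz arccos_inner_unit[of "?W 0" "?W \<tau>"] norm_row_dir[of k X 0 Y] norm_row_dir[of k X \<tau> Y] by (simp add: row_angle_def)
    also have "\<dots> = g (norm (?W 0 - ?W \<tau>) / 2) * norm (?W 0 - ?W \<tau>)" using g(1)[of "norm (?W 0 - ?W \<tau>) / 2"] by simp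
    finally show "g (norm (?W 0 - ?W \<tau>) / 2) * (norm (?W 0 - ?W \<tau>) / \<tau>) = row_angle k \<tau> X Y / \<tau>" by simp
  qed
  ultimately show ?thesis unfolding speed by (simp add: Lim_transform_eventually)
qed

lemma measurable_det_sign_change [measurable]:
  "{q. det (fst q) * det (fst q + \<tau> *\<^sub>R snd q) < 0} \<in> sets (borel :: ((real^'p^'p) \<times> (real^'p^'p::finite)) measure)"
  using measurable_sign_change_set[of "det :: real^'p^'p \<Rightarrow> real" 1 1 \<tau>] by simp

text \<open>Row \<open>k\<close> of both matrices is resampled. Given the rest, the two determinants
  are linear forms in the pair of new rows, so a sign change has probability angle / pi.\<close>

lemma emeasure_det_sign_change:
  fixes k :: "'p::finite"
  shows "emeasure gauss {q :: (real^'p^'p) \<times> (real^'p^'p). det (fst q) * det (fst q + \<tau> *\<^sub>R snd q) < 0}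
    = (\<integral>\<^sup>+(X, Y). ennreal (row_angle k \<tau> X Y / pi) \<partial>gauss)"
proof -
  let ?E = "{q :: (real^'p^'p) \<times> (real^'p^'p). det (fst q) * det (fst q + \<tau> *\<^sub>R snd q) < 0}"
  have "emeasure gauss ?E = (\<integral>\<^sup>+q. indicator ?E q \<partial>gauss)" by simp
  also have "\<dots> = (\<integral>\<^sup>+(X, Y). \<integral>\<^sup>+(v, w). indicator ?E (row_upd X k v, row_upd Y k w) \<partial>gauss \<partial>gauss)"
    by (rule nn_integral_gauss_row_upd_pair) measurable
  also have "\<dots> = (\<integral>\<^sup>+(X, Y). ennreal (row_angle k \<tau> X Y / pi) \<partial>gauss)"
  proof (rule nn_integral_cong, clarify)
    fix X Y :: "real^'p^'p"
    let ?n = "cofac k X" and ?m = "cofac k (X + \<tau> *\<^sub>R Y)"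
    let ?F = "{z :: (real^'p) \<times> (real^'p). (z \<bullet> (?n, 0)) * (z \<bullet> (?m, \<tau> *\<^sub>R ?m)) < 0}"
    have mem: "(row_upd X k v, row_upd Y k w) \<in> ?E \<longleftrightarrow> (v, w) \<in> ?F" for v w
    proof -
      have "row_upd X k v + \<tau> *\<^sub>R row_upd Y k w = row_upd (X + \<tau> *\<^sub>R Y) k (v + \<tau> *\<^sub>R w)"
        by (simp add: vec_eq_iff row_upd_nth)
      then have "det (row_upd X k v + \<tau> *\<^sub>R row_upd Y k w) = (v, w) \<bullet> (?m, \<tau> *\<^sub>R ?m)"
        by (simp add: cofac_inner[symmetric] inner_add_left inner_add_right inner_commute)
      moreover have "det (row_upd X k v) = (v, w) \<bullet> (?n, 0)"
        by (simp add: cofac_inner[symmetric] inner_commute)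
      ultimately show ?thesis by simp
    qed
    have "(\<integral>\<^sup>+(v, w). indicator ?E (row_upd X k v, row_upd Y k w) \<partial>gauss) = (\<integral>\<^sup>+z. indicator ?F z \<partial>gauss)"
      by (intro nn_integral_cong) (auto simp: indicator_def mem simp del: mem_Collect_eq)
    also have "\<dots> = emeasure gauss ?F"
    proof (rule nn_integral_indicator)
      have "?F \<in> sets borel" by (intro borel_open open_Collect_less continuous_intros)
      then show "?F \<in> sets gauss" by simp
    qed
    also have "\<dots> = ennreal (row_angle k \<tau> X Y / pi)"
    proof (cases "?n = 0 \<or> ?m = 0")
      case True
      then have "(z \<bullet> (?n, 0)) * (z \<bullet> (?m, \<tau> *\<^sub>R ?m)) = 0" for z by (cases z) auto
      then have "?F = {}" by (simp only: less_irrefl Collect_empty_eq not_False_eq_True simp_thms)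
      then have "emeasure gauss ?F = 0" by (simp only: emeasure_empty)
      moreover have "row_angle k \<tau> X Y = 0" using True by (simp add: row_angle_def)
      ultimately show ?thesis by simp
    next
      case False
      have pos: "x * y < 0 \<longleftrightarrow> (x / r) * (y / s) < 0" if "r > 0" "s > 0" for x y r s :: real
      proof -
        have "(x / r) * (y / s) = x * y / (r * s)" by simp
        moreover have "r * s > 0" using that by simp
        ultimately show ?thesis by (metis divide_less_0_iff order_less_not_sym)
      qed
      have nn: "norm (?n, 0 :: real^'p) > 0" "norm (?m, \<tau> *\<^sub>R ?m) > 0"
        using False by (auto simp: zero_prod_def)
      have e1: "z \<bullet> row_dir k t X Y = z \<bullet> (cofac k (X + t *\<^sub>R Y), t *\<^sub>R cofac k (X + t *\<^sub>R Y)) / norm (cofac k (X + t *\<^sub>R Y), t *\<^sub>R cofac k (X + t *\<^sub>R Y))" for z t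
        by (simp only: row_dir_def sgn_div_norm inner_scaleR_right divide_inverse mult.commute)
      have e0: "z \<bullet> row_dir k 0 X Y = z \<bullet> (?n, 0) / norm (?n, 0 :: real^'p)" for z
        using e1[of z 0] by simp
      have "?F = {z. (z \<bullet> row_dir k 0 X Y) * (z \<bullet> row_dir k \<tau> X Y) < 0}"
        by (intro Collect_cong) (simp only: e0 e1[of _ \<tau>] pos[OF nn, symmetric])
      then show ?thesis
        using emeasure_gauss_sign_change[of "row_dir k 0 X Y" "row_dir k \<tau> X Y"] norm_row_dir[of k X 0 Y] norm_row_dir[of k X \<tau> Y] False
        by (simp add: row_angle_def)
    qed
    finally show "(\<integral>\<^sup>+(v, w). indicator ?E (row_upd X k v, row_upd Y k w) \<partial>gauss) = ennreal (row_angle k \<tau> X Y / pi)" .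
  qed
  finally show ?thesis .
qed

lemma borel_measurable_row_angle:
  "(\<lambda>q. row_angle k \<tau> (fst q) (snd q)) \<in> borel_measurable (borel :: ((real^'p^'p) \<times> (real^'p^'p::finite)) measure)"
proof -
  have [measurable]: "(\<lambda>q :: (real^'p^'p) \<times> (real^'p^'p). cofac k (fst q + t *\<^sub>R snd q)) \<in> borel_measurable borel" for t
    by (intro borel_measurable_continuous_onI continuous_intros)
  have [measurable]: "(\<lambda>q :: (real^'p^'p) \<times> (real^'p^'p). cofac k (fst q)) \<in> borel_measurable borel"
    by (intro borel_measurable_continuous_onI continuous_intros)
  have clamp: "\<bar>z\<bar> \<le> 1 \<Longrightarrow> max (-1) (min 1 z) = z" for z :: real by auto
  have [measurable]: "(\<lambda>x. arccos (max (-1) (min 1 x))) \<in> borel_measurable borel"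
    by (intro borel_measurable_continuous_onI continuous_intros) auto
  have "(\<lambda>q :: (real^'p^'p) \<times> (real^'p^'p). (cofac k (fst q + t *\<^sub>R snd q), t *\<^sub>R cofac k (fst q + t *\<^sub>R snd q))) \<in> borel_measurable borel" for t
    by (intro borel_measurable_continuous_onI continuous_intros)
  from measurable_compose[OF this borel_measurable_sgn]
  have [measurable]: "(\<lambda>q :: (real^'p^'p) \<times> (real^'p^'p). row_dir k t (fst q) (snd q)) \<in> borel_measurable borel" for t
    by (simp add: row_dir_def)
  have "(\<lambda>q. row_angle k \<tau> (fst q) (snd q)) = (\<lambda>q :: (real^'p^'p) \<times> (real^'p^'p). if cofac k (fst q) = 0 \<or> cofac k (fst q + \<tau> *\<^sub>R snd q) = 0 then 0
     else arccos (max (-1) (min 1 (row_dir k 0 (fst q) (snd q) \<bullet> row_dir k \<tau> (fst q) (snd q)))))"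
    by (auto simp: fun_eq_iff row_angle_def clamp abs_inner_row_dir_le)
  then show ?thesis by (simp only:) measurable
qed

lemma AE_gauss_fst:
  assumes "AE x in (gauss :: 'a::euclidean_space measure). P x"
  shows "AE q in (gauss :: ('a \<times> 'b::euclidean_space) measure). P (fst q)"
proof -
  have D: "distr gauss borel (fst :: 'a \<times> 'b \<Rightarrow> 'a) = gauss"
    by (rule distr_gauss_coisometry[where J="\<lambda>x. (x, 0)"]) (auto intro!: linearI)
  have "(fst :: 'a \<times> 'b \<Rightarrow> 'a) \<in> gauss \<rightarrow>\<^sub>M borel"
    unfolding measurable_cong_sets[OF sets_gauss refl] by (intro borel_measurable_continuous_onI continuous_intros)
  then show ?thesis using assms unfolding D[symmetric] by (rule AE_distrD)
qed

text \<open>The probability is the expected angle divided by pi. The angle over \<tau> converges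
  almost surely to the speed, and the bounded moments of order 3/2 carry the limit through the
  expectation.\<close>

lemma det_sign_change_rate:
  "((\<lambda>\<tau>. measure gauss {q :: (real^'p^'p) \<times> (real^'p^'p::finite). det (fst q) * det (fst q + \<tau> *\<^sub>R snd q) < 0} / \<tau>)
     \<longlongrightarrow> sqrt pi * Gamma ((real CARD('p) + 1) / 2) / Gamma (real CARD('p) / 2) / pi) (at_right 0)"
  (is "((\<lambda>\<tau>. ?G \<tau> / _) \<longlongrightarrow> ?e / _) _")
proof (subst tendsto_at_iff_sequentially, intro allI impI)
  fix T :: "nat \<Rightarrow> real" assume T: "\<forall>i. T i \<in> {0<..} - {0}" "T \<longlonglongrightarrow> 0"
  then have pos: "T i > 0" for i by auto
  obtain k :: 'p where True by blast
  let ?M = "gauss :: ((real^'p^'p) \<times> (real^'p^'p)) measure"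
  let ?f = "\<lambda>i (q :: (real^'p^'p) \<times> (real^'p^'p)). row_angle k (T i) (fst q) (snd q) / T i"
  let ?g = "\<lambda>q :: (real^'p^'p) \<times> (real^'p^'p). speed k (fst q) (snd q *v sgn (cofac k (fst q)))"
  interpret M: prob_space ?M by (rule prob_space_gauss)
  obtain K where K: "K < \<top>" "\<And>\<tau>. \<tau> > 0 \<Longrightarrow> (\<integral>\<^sup>+q. ennreal (sqrt (norm (sgn (cofac k (fst q)) - sgn (cofac k (shift_rows (UNIV - {k}) \<tau> (fst q) (snd q)))) / \<tau>) ^ 3) \<partial>?M) \<le> K"
    using nn_integral_shift_rows_bound[of "UNIV - {k}" k] by auto
  \<comment> \<open>Row \<open>k\<close> does not enter the cofactor vector, so shifting all other
    rows gives the same vector as shifting all of them.\<close>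
  have shift: "cofac k (shift_rows (UNIV - {k}) \<tau> X Y) = cofac k (X + \<tau> *\<^sub>R Y)" for \<tau> and X Y :: "real^'p^'p"
  proof -
    have "shift_rows (UNIV - {k}) \<tau> X Y = row_upd (X + \<tau> *\<^sub>R Y) k (X $ k)"
      by (simp add: vec_eq_iff shift_rows_def row_upd_nth)
    then show ?thesis by simp
  qed
  have m: "(\<lambda>q. row_angle k \<tau> (fst q) (snd q)) \<in> borel_measurable ?M" for \<tau>
    using borel_measurable_row_angle[of k \<tau>] by simp
  \<comment> \<open>64 = 8 * 8: the power 3/2 of the factor 4 in \<open>row_angle_le\<close>, times
    the factor of \<open>sqrt_cube_add_le\<close>.\<close>
  have bound: "(\<integral>\<^sup>+q. ennreal (sqrt (?f i q) ^ 3) \<partial>?M) \<le> ennreal (enn2real (64 * (K + 1)))" for i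
  proof -
    let ?h = "\<lambda>q :: (real^'p^'p) \<times> (real^'p^'p). norm (sgn (cofac k (fst q)) - sgn (cofac k (shift_rows (UNIV - {k}) (T i) (fst q) (snd q)))) / T i"
    have h: "(\<lambda>q. ennreal (sqrt (?h q) ^ 3)) \<in> borel_measurable ?M"
    proof -
      note [measurable] = borel_measurable_sgn_cofac_shift_rows[of k _ "T i"]
      have [measurable]: "(\<lambda>q :: (real^'p^'p) \<times> (real^'p^'p). sgn (cofac k (fst q))) \<in> borel_measurable borel"
        using borel_measurable_sgn_cofac_shift_rows[of k "{}" "T i"] by (simp add: shift_rows_def)
      have "(\<lambda>q. ennreal (sqrt (?h q) ^ 3)) \<in> borel_measurable borel" by measurable
      then show ?thesis by simp
    qed
    have gen: "ennreal (64 * (x + 1)) = 64 * (ennreal x + 1)" if "0 \<le> x" for x :: real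
    proof -
      have "ennreal (64 * (x + 1)) = ennreal 64 * ennreal (x + 1)" by (rule ennreal_mult') simp
      also have "ennreal (x + 1) = ennreal x + ennreal 1" using that by (intro ennreal_plus) auto
      finally show ?thesis by simp
    qed
    have "ennreal (sqrt (?f i q) ^ 3) \<le> 64 * (ennreal (sqrt (?h q) ^ 3) + 1)" for q
    proof -
      have "?f i q \<le> 4 * (?h q + 1)" using row_angle_le[OF pos] by (simp add: shift)
      then have "sqrt (?f i q) \<le> sqrt (4 * (?h q + 1))" by (rule real_sqrt_le_mono)
      also have "\<dots> = 2 * sqrt (?h q + 1)" using real_sqrt_mult[of 4 "?h q + 1"] by (simp only: real_sqrt_four)
      finally have "sqrt (?f i q) ^ 3 \<le> (2 * sqrt (?h q + 1)) ^ 3"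
        using pos[of i] row_angle_nonneg[of k "T i" "fst q" "snd q"] by (intro power_mono) auto
      also have "\<dots> = 8 * sqrt (?h q + 1) ^ 3" by (simp add: power_mult_distrib)
      also have "\<dots> \<le> 8 * (8 * (sqrt (?h q) ^ 3 + sqrt 1 ^ 3))"
        using pos[of i] by (intro mult_left_mono sqrt_cube_add_le) auto
      also have "\<dots> = 64 * (sqrt (?h q) ^ 3 + 1)" by simp
      finally have "ennreal (sqrt (?f i q) ^ 3) \<le> ennreal (64 * (sqrt (?h q) ^ 3 + 1))" by (rule ennreal_leI)
      also have "\<dots> = 64 * (ennreal (sqrt (?h q) ^ 3) + 1)"
        using pos[of i] by (intro gen) simp
      finally show ?thesis .
    qed
    then have "(\<integral>\<^sup>+q. ennreal (sqrt (?f i q) ^ 3) \<partial>?M) \<le> (\<integral>\<^sup>+q. 64 * (ennreal (sqrt (?h q) ^ 3) + 1) \<partial>?M)"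
      by (intro nn_integral_mono) auto
    also have "\<dots> = 64 * ((\<integral>\<^sup>+q. ennreal (sqrt (?h q) ^ 3) \<partial>?M) + 1)"
      using h M.emeasure_space_1 by (simp only: nn_integral_cmult nn_integral_add borel_measurable_add borel_measurable_const nn_integral_const mult_1)
    also have "\<dots> \<le> 64 * (K + 1)" by (intro mult_left_mono add_right_mono K(2) pos) simp
    also have "\<dots> = ennreal (enn2real (64 * (K + 1)))" using K(1) by (simp add: ennreal_enn2real ennreal_mult_less_top)
    finally show ?thesis .
  qed
  have "(\<lambda>i. \<integral>\<^sup>+q. ennreal (?f i q) \<partial>?M) \<longlonglongrightarrow> (\<integral>\<^sup>+q. ennreal (?g q) \<partial>?M)"
  proof (rule nn_integral_tendsto_of_power_bound[OF prob_space_gauss _ _ _ bound])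
    show "?f i \<in> borel_measurable ?M" for i using m[of "T i"] by (rule borel_measurable_divide) simp
    show "?g \<in> borel_measurable ?M" using borel_measurable_speed_matrix[of k] by (simp add: split_beta')
    show "0 \<le> ?f i q" for i q using pos[of i] by (intro divide_nonneg_nonneg row_angle_nonneg) simp
    have "AE X in (gauss :: (real^'p^'p) measure). cofac k X \<noteq> 0" by (rule AE_gauss_cofac_nonzero)
    then have "AE q in ?M. cofac k (fst q) \<noteq> 0" by (rule AE_gauss_fst)
    then show "AE q in ?M. (\<lambda>i. ?f i q) \<longlonglongrightarrow> ?g q"
    proof eventually_elim
      case (elim q)
      from row_angle_tendsto[OF this, of "snd q"] show ?case
        using T unfolding tendsto_at_iff_sequentially by (auto simp: o_def)
    qed
  qed
  also have "(\<integral>\<^sup>+q. ennreal (?g q) \<partial>?M) = ennreal ?e" using nn_integral_speed_matrix[of k] by (simp add: split_beta')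
  finally have lim: "(\<lambda>i. \<integral>\<^sup>+q. ennreal (?f i q) \<partial>?M) \<longlonglongrightarrow> ennreal ?e" .
  have e: "0 \<le> ?e" by (intro mult_nonneg_nonneg divide_nonneg_nonneg Gamma_real_nonneg) auto
  have "(\<integral>\<^sup>+q. ennreal (?f i q) \<partial>?M) = ennreal (pi * (?G (T i) / T i))" for i
  proof -
    have "(\<integral>\<^sup>+q. ennreal (?f i q) \<partial>?M) = (\<integral>\<^sup>+q. ennreal (pi / T i) * ennreal (row_angle k (T i) (fst q) (snd q) / pi) \<partial>?M)"
      using pos[of i] by (intro nn_integral_cong) (simp add: ennreal_mult'[symmetric])
    also have "\<dots> = ennreal (pi / T i) * (\<integral>\<^sup>+q. ennreal (row_angle k (T i) (fst q) (snd q) / pi) \<partial>?M)"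
      by (intro nn_integral_cmult measurable_compose[OF _ measurable_ennreal] borel_measurable_divide m) simp
    also have "(\<integral>\<^sup>+q. ennreal (row_angle k (T i) (fst q) (snd q) / pi) \<partial>?M) = ennreal (?G (T i))"
      using emeasure_det_sign_change[of "T i" k] by (simp add: split_beta' M.emeasure_eq_measure)
    finally show ?thesis using pos[of i] by (simp add: ennreal_mult'[symmetric])
  qed
  with lim have "(\<lambda>i. ennreal (pi * (?G (T i) / T i))) \<longlonglongrightarrow> ennreal ?e" by (simp only:)
  moreover have ev: "\<forall>\<^sub>F i in sequentially. 0 \<le> pi * (?G (T i) / T i)"
    using pos by (intro always_eventually allI mult_nonneg_nonneg divide_nonneg_nonneg) (auto simp: less_imp_le)
  ultimately have "(\<lambda>i. pi * (?G (T i) / T i)) \<longlonglongrightarrow> ?e"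
    by (intro tendsto_ennreal_iff[THEN iffD1, OF ev e])
  then have "(\<lambda>i. pi * (?G (T i) / T i) / pi) \<longlonglongrightarrow> ?e / pi" by (intro tendsto_divide tendsto_const) auto
  then show "((\<lambda>\<tau>. ?G \<tau> / \<tau>) \<circ> T) \<longlonglongrightarrow> ?e / pi" by (simp add: o_def)
qed

section \<open>Comparison of the expected numbers of zeros\<close>

lemma sign_change_prob_1: "sign_change_prob d 1 = 0"
proof -
  have "{p :: 'a \<times> 'a. d (fst p) * d (1 *\<^sub>R fst p + sqrt (1 - 1\<^sup>2) *\<^sub>R snd p) < 0} = {}"
    by (auto simp: not_less)
  then show ?thesis unfolding sign_change_prob_def by (simp only: emeasure_empty)
qed

lemma sign_change_prob_real:
  assumes "0 < \<theta>" "\<theta> < pi"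
  shows "sign_change_prob (\<lambda>x :: real. x) (cos \<theta>) = ennreal (\<theta> / pi)"
proof -
  have s: "sin \<theta> > 0" using assms by (rule sin_gt_zero)
  then have "sqrt (1 - (cos \<theta>)\<^sup>2) = sin \<theta>" by (simp add: sin_squared_eq[symmetric])
  then show ?thesis
    using emeasure_gauss_wedge[OF s, of "cos \<theta>"] assms by (simp add: sign_change_prob_def split_beta' arccos_cos)
qed

lemma det_scaleR:
  fixes X :: "real^'p^'p::finite"
  shows "det (r *\<^sub>R X) = r ^ CARD('p) * det X"
proof -
  have "r *\<^sub>R X = (\<chi> i. r *s X $ i)" by (simp add: vec_eq_iff)
  then show ?thesis by (simp add: det_rows_mul)
qed

text \<open>Homogeneity permits pulling out the positive factor cos \<theta>, which leaves the
  tangent as the size of the perturbation.\<close>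

lemma sign_change_prob_det:
  assumes "0 < \<theta>" "\<theta> < pi / 2"
  shows "sign_change_prob (det :: real^'p^'p::finite \<Rightarrow> real) (cos \<theta>) =
    ennreal (measure gauss {q :: (real^'p^'p) \<times> (real^'p^'p). det (fst q) * det (fst q + tan \<theta> *\<^sub>R snd q) < 0})"
proof -
  interpret G: prob_space "gauss :: ((real^'p^'p) \<times> (real^'p^'p)) measure" by (rule prob_space_gauss)
  have s: "sin \<theta> > 0" using assms by (intro sin_gt_zero) auto
  then have sq: "sqrt (1 - (cos \<theta>)\<^sup>2) = sin \<theta>" by (simp add: sin_squared_eq[symmetric])
  have c: "cos \<theta> > 0" using assms by (intro cos_gt_zero) auto
  have "det (cos \<theta> *\<^sub>R X + sin \<theta> *\<^sub>R Y) = cos \<theta> ^ CARD('p) * det (X + tan \<theta> *\<^sub>R Y)" for X Y :: "real^'p^'p"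
  proof -
    have "cos \<theta> *\<^sub>R X + sin \<theta> *\<^sub>R Y = cos \<theta> *\<^sub>R (X + tan \<theta> *\<^sub>R Y)" using c by (simp add: tan_def scaleR_add_right)
    then show ?thesis by (simp add: det_scaleR)
  qed
  moreover have "x * (cos \<theta> ^ CARD('p) * y) < 0 \<longleftrightarrow> x * y < 0" for x y :: real
  proof -
    have "x * (cos \<theta> ^ CARD('p) * y) = cos \<theta> ^ CARD('p) * (x * y)" by simp
    moreover have "cos \<theta> ^ CARD('p) > 0" using c by simp
    ultimately show ?thesis by (metis mult_less_cancel_left_pos mult_zero_right)
  qed
  ultimately show ?thesis unfolding sign_change_prob_def sq by (simp add: G.emeasure_eq_measure)
qed

text \<open>The matrix probability is asymptotic to (E / pi) tan \<theta> and the scalar one equals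
  \<theta> / pi, so their quotient tends to E. At c = 1 both vanish. A negative E - \<epsilon> is
  cut off to 0 by \<open>ennreal\<close>.\<close>

lemma sign_change_prob_det_ratio:
  fixes \<epsilon> :: real
  defines "E \<equiv> sqrt pi * Gamma ((real CARD('p) + 1) / 2) / Gamma (real CARD('p::finite) / 2)"
  assumes "\<epsilon> > 0"
  shows "\<exists>\<delta>>0. \<forall>c. 1 - \<delta> < c \<and> c \<le> 1 \<longrightarrow>
    ennreal (E - \<epsilon>) * sign_change_prob (\<lambda>x :: real. x) c \<le> sign_change_prob (det :: real^'p^'p \<Rightarrow> real) c \<and>
    sign_change_prob (det :: real^'p^'p \<Rightarrow> real) c \<le> ennreal (E + \<epsilon>) * sign_change_prob (\<lambda>x :: real. x) c"
proof -
  let ?G = "\<lambda>\<tau>. measure gauss {q :: (real^'p^'p) \<times> (real^'p^'p). det (fst q) * det (fst q + \<tau> *\<^sub>R snd q) < 0}"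
  have E: "0 \<le> E" unfolding E_def by (intro mult_nonneg_nonneg divide_nonneg_nonneg Gamma_real_nonneg) auto
  have tan0: "((\<lambda>\<theta>. tan \<theta> / \<theta>) \<longlongrightarrow> 1) (at_right (0::real))"
  proof -
    have "(tan has_real_derivative 1) (at 0)" by (auto intro!: derivative_eq_intros)
    from has_vector_derivative_quotient_tendsto[OF this[unfolded has_real_derivative_iff_has_vector_derivative]]
    have "((\<lambda>\<theta>::real. tan \<theta> / \<theta>) \<longlongrightarrow> 1) (at 0)" by (simp add: divide_inverse mult.commute)
    then show ?thesis by (simp add: filterlim_at_split)
  qed
  have tanr: "filterlim tan (at_right 0) (at_right (0::real))"
  proof -
    have "(tan \<longlongrightarrow> tan 0) (at (0::real))" by (intro isCont_tan[unfolded isCont_def]) simp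
    then have "(tan \<longlongrightarrow> 0) (at_right (0::real))" by (simp add: filterlim_at_split)
    moreover have "\<forall>\<^sub>F \<theta> in at_right 0. tan \<theta> \<in> {0<..} \<and> tan \<theta> \<noteq> (0::real)"
      using eventually_at_right_real[OF pi_half_gt_zero] by eventually_elim (auto dest: tan_gt_zero)
    ultimately show ?thesis by (simp add: filterlim_at)
  qed
  have "((\<lambda>\<theta>. ?G (tan \<theta>) / tan \<theta> * (tan \<theta> / \<theta>)) \<longlongrightarrow> E / pi * 1) (at_right 0)"
    unfolding E_def by (intro tendsto_mult tan0 filterlim_compose[OF det_sign_change_rate tanr])
  then have "\<forall>\<^sub>F \<theta> in at_right 0. dist (?G (tan \<theta>) / tan \<theta> * (tan \<theta> / \<theta>)) (E / pi * 1) < \<epsilon> / pi"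
    by (rule tendstoD) (use assms in simp)
  then obtain \<eta>0 where \<eta>0: "\<eta>0 > 0" "\<And>\<theta>. 0 < \<theta> \<Longrightarrow> \<theta> < \<eta>0 \<Longrightarrow> dist (?G (tan \<theta>) / tan \<theta> * (tan \<theta> / \<theta>)) (E / pi * 1) < \<epsilon> / pi"
    unfolding eventually_at_right_field by auto
  \<comment> \<open>The bound pi / 4 keeps the angle in the range where the tangent is
    positive.\<close>
  define \<eta> where "\<eta> = min \<eta>0 (pi / 4)"
  have \<eta>: "0 < \<eta>" "\<eta> \<le> \<eta>0" "\<eta> < pi / 2" using \<eta>0(1) pi_gt_zero unfolding \<eta>_def by linarith+
  show ?thesis
  \<comment> \<open>With this \<delta> the condition on \<open>c\<close> says that the angle arccos
    c is below \<eta>.\<close>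
  proof (intro exI[of _ "1 - cos \<eta>"] conjI allI impI)
    show "0 < 1 - cos \<eta>" using cos_monotone_0_pi[of 0 \<eta>] \<eta> by simp
    fix c assume c: "1 - (1 - cos \<eta>) < c \<and> c \<le> 1"
    have "ennreal (E - \<epsilon>) * sign_change_prob (\<lambda>x :: real. x) c \<le> sign_change_prob (det :: real^'p^'p \<Rightarrow> real) c \<and>
      sign_change_prob (det :: real^'p^'p \<Rightarrow> real) c \<le> ennreal (E + \<epsilon>) * sign_change_prob (\<lambda>x :: real. x) c"
    proof (cases "c = 1")
      case True
      then show ?thesis by (simp add: sign_change_prob_1)
    next
      case False
      define \<theta> where "\<theta> = arccos c"
      have c': "-1 \<le> c" "c \<le> 1" "cos \<eta> < c" using c cos_ge_minus_one[of \<eta>] by linarith+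
      have cos: "c = cos \<theta>" using c' by (simp add: \<theta>_def)
      have \<theta>0: "0 < \<theta>" using c' False arccos_less_arccos[of c 1] by (simp add: \<theta>_def)
      have \<theta>1: "\<theta> < \<eta>" using c' arccos_less_arccos[of "cos \<eta>" c] \<eta> by (simp add: \<theta>_def arccos_cos)
      have t: "tan \<theta> > 0" using \<theta>0 \<theta>1 \<eta> by (intro tan_gt_zero) auto
      define g where "g = ?G (tan \<theta>)"
      have "\<bar>g / \<theta> - E / pi\<bar> < \<epsilon> / pi" using \<eta>0(2)[of \<theta>] \<theta>0 \<theta>1 \<eta> t by (simp add: dist_real_def g_def)
      then have "g / \<theta> < (E + \<epsilon>) / pi" "(E - \<epsilon>) / pi < g / \<theta>" by (auto simp: abs_less_iff add_divide_distrib diff_divide_distrib)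
      then have b: "g \<le> (E + \<epsilon>) * (\<theta> / pi)" "(E - \<epsilon>) * (\<theta> / pi) \<le> g" using \<theta>0 by (auto simp: field_simps)
      have 1: "sign_change_prob (\<lambda>x :: real. x) c = ennreal (\<theta> / pi)" unfolding cos using \<theta>0 \<theta>1 \<eta> by (intro sign_change_prob_real) auto
      have 2: "sign_change_prob (det :: real^'p^'p \<Rightarrow> real) c = ennreal g" unfolding cos g_def using \<theta>0 \<theta>1 \<eta> by (intro sign_change_prob_det) auto
      have nn: "0 \<le> \<theta> / pi" using \<theta>0 by simp
      show ?thesis unfolding 1 2 ennreal_mult''[OF nn, symmetric] using b by (auto intro: ennreal_leI)
    qed
    then show "ennreal (E - \<epsilon>) * sign_change_prob (\<lambda>x :: real. x) c \<le> sign_change_prob (det :: real^'p^'p \<Rightarrow> real) c"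
      "sign_change_prob (det :: real^'p^'p \<Rightarrow> real) c \<le> ennreal (E + \<epsilon>) * sign_change_prob (\<lambda>x :: real. x) c" by auto
  qed
qed

text \<open>The integral is a supremum over simple functions below f, and these pull back to
  functions below the composition with T. In this direction f may be nonmeasurable.\<close>

lemma nn_integral_distr_le:
  assumes T: "T \<in> M \<rightarrow>\<^sub>M N"
  shows "(\<integral>\<^sup>+x. f x \<partial>distr M N T) \<le> (\<integral>\<^sup>+x. f (T x) \<partial>M)"
  unfolding nn_integral_def[of "distr M N T"]
proof (rule SUP_least, clarify)
  fix g assume g: "simple_function (distr M N T) g" "g \<le> f"
  have "integral\<^sup>S (distr M N T) g = (\<integral>\<^sup>+x. g x \<partial>distr M N T)" using nn_integral_eq_simple_integral[OF g(1)] by simp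
  also have "\<dots> = (\<integral>\<^sup>+x. g (T x) \<partial>M)"
    using borel_measurable_simple_function[OF g(1)] by (intro nn_integral_distr[OF T]) simp
  also have "\<dots> \<le> (\<integral>\<^sup>+x. f (T x) \<partial>M)" using g(2) by (intro nn_integral_mono) (auto simp: le_fun_def)
  finally show "integral\<^sup>S (distr M N T) g \<le> (\<integral>\<^sup>+x. f (T x) \<partial>M)" .
qed

section \<open>Angles of the coefficient path over the cells\<close>

definition path_cos :: "nat \<Rightarrow> (nat \<Rightarrow> real \<Rightarrow> real) \<Rightarrow> real \<Rightarrow> real \<Rightarrow> real" where
  "path_cos n w s t = (\<Sum>l\<le>n. (w l s / sqrt (\<Sum>l\<le>n. (w l s)\<^sup>2)) * (w l t / sqrt (\<Sum>l\<le>n. (w l t)\<^sup>2)))"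

lemma sum_squares_normalized:
  assumes "(\<Sum>l\<in>I. (u l)\<^sup>2) > (0::real)"
  shows "(\<Sum>l\<in>I. (u l / sqrt (\<Sum>l\<in>I. (u l)\<^sup>2))\<^sup>2) = 1"
  using assms by (simp add: power_divide sum_divide_distrib[symmetric])

lemma path_cos_le_1:
  assumes "(\<Sum>l\<le>n. (w l s)\<^sup>2) > 0" "(\<Sum>l\<le>n. (w l t)\<^sup>2) > 0"
  shows "path_cos n w s t \<le> 1"
proof -
  have "path_cos n w s t \<le> (\<Sum>l\<le>n. ((w l s / sqrt (\<Sum>l\<le>n. (w l s)\<^sup>2))\<^sup>2 + (w l t / sqrt (\<Sum>l\<le>n. (w l t)\<^sup>2))\<^sup>2) / 2)"
    unfolding path_cos_def
  proof (rule sum_mono)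
    fix l show "w l s / sqrt (\<Sum>l\<le>n. (w l s)\<^sup>2) * (w l t / sqrt (\<Sum>l\<le>n. (w l t)\<^sup>2))
      \<le> ((w l s / sqrt (\<Sum>l\<le>n. (w l s)\<^sup>2))\<^sup>2 + (w l t / sqrt (\<Sum>l\<le>n. (w l t)\<^sup>2))\<^sup>2) / 2"
      using sum_squares_bound[of "w l s / sqrt (\<Sum>l\<le>n. (w l s)\<^sup>2)" "w l t / sqrt (\<Sum>l\<le>n. (w l t)\<^sup>2)"] by (simp add: mult_ac)
  qed
  also have "\<dots> = 1"
    unfolding sum_divide_distrib[symmetric] sum.distrib sum_squares_normalized[OF assms(1)] sum_squares_normalized[OF assms(2)] by simp
  finally show ?thesis .
qed

text \<open>The cosine is uniformly continuous on the square and equals 1 on the diagonal.\<close>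

lemma eventually_path_cos_grid:
  assumes ab: "a < b" and w: "\<And>l. l \<le> n \<Longrightarrow> continuous_on {a..b} (w l)"
    and pos: "\<And>t. t \<in> {a..b} \<Longrightarrow> (\<Sum>l\<le>n. (w l t)\<^sup>2) > 0" and \<delta>: "\<delta> > 0"
  shows "\<forall>\<^sub>F N in sequentially. \<forall>i<Suc N. 1 - \<delta> < path_cos n w (grid a b N i) (grid a b N (Suc i))"
proof -
  let ?S = "{a..b} \<times> {a..b}"
  let ?f = "\<lambda>p. path_cos n w (fst p) (snd p)"
  have nz: "sqrt (\<Sum>l\<le>n. (w l t)\<^sup>2) \<noteq> 0" if "t \<in> {a..b}" for t using pos[OF that] by simp
  have u: "continuous_on {a..b} (\<lambda>t. w l t / sqrt (\<Sum>l\<le>n. (w l t)\<^sup>2))" if "l \<le> n" for l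
    using nz that by (intro continuous_intros w) auto
  have "continuous_on ?S ?f"
    unfolding path_cos_def
    by (intro continuous_on_sum continuous_on_mult continuous_on_compose2[OF u] continuous_intros) auto
  moreover have "compact ?S" by (intro compact_Times compact_Icc)
  ultimately have "uniformly_continuous_on ?S ?f" by (rule compact_uniformly_continuous)
  then obtain \<eta> where \<eta>: "\<eta> > 0" "\<And>p q. p \<in> ?S \<Longrightarrow> q \<in> ?S \<Longrightarrow> dist q p < \<eta> \<Longrightarrow> dist (?f q) (?f p) < \<delta>"
    using \<delta> unfolding uniformly_continuous_on_def by metis
  obtain N0 :: nat where N0: "(b - a) / \<eta> < real N0" using reals_Archimedean2 by blast
  show ?thesis
  proof (intro eventually_sequentiallyI[of N0] allI impI)
    fix N i assume "N0 \<le> N" "i < Suc N"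
    let ?s = "grid a b N i" and ?t = "grid a b N (Suc i)"
    have mem: "?s \<in> {a..b}" "?t \<in> {a..b}" using ab \<open>i < Suc N\<close> by (auto intro!: grid_mem simp del: atLeastAtMost_iff)
    have "(b - a) / \<eta> < real (Suc N)" using N0 \<open>N0 \<le> N\<close> by simp
    then have "(b - a) / real (Suc N) < \<eta>" using \<eta>(1) by (simp add: field_simps)
    then have "dist (?s, ?t) (?s, ?s) < \<eta>" using ab by (simp add: dist_Pair_Pair dist_real_def grid_Suc)
    then have "dist (?f (?s, ?t)) (?f (?s, ?s)) < \<delta>" using mem by (intro \<eta>(2)) auto
    moreover have "?f (?s, ?s) = 1"
      using sum_squares_normalized[OF pos[OF mem(1)]] by (simp add: path_cos_def power2_eq_square)
    ultimately show "1 - \<delta> < path_cos n w ?s ?t" by (simp add: dist_real_def)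
  qed
qed

text \<open>Dividing the coefficients by their positive norms changes both values of
  \<open>d\<close> by positive factors, by homogeneity, and reduces the event to unit
  vectors.\<close>

lemma emeasure_lin_path_sign_change:
  fixes d :: "'a::euclidean_space \<Rightarrow> real"
  assumes d: "d \<in> borel_measurable borel" and hom: "\<And>r x. d (r *\<^sub>R x) = r ^ m * d x"
    and s: "(\<Sum>l\<le>n. (w l s)\<^sup>2) > 0" and t: "(\<Sum>l\<le>n. (w l t)\<^sup>2) > 0"
  shows "emeasure (PiM {..n} (\<lambda>_. gauss)) {Z \<in> space (PiM {..n} (\<lambda>_. gauss)). d (lin_path n w Z s) * d (lin_path n w Z t) < 0}
    = sign_change_prob d (path_cos n w s t)"
proof -
  let ?r = "\<lambda>t. sqrt (\<Sum>l\<le>n. (w l t)\<^sup>2)"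
  have scale: "lin_path n w Z t = ?r t *\<^sub>R (\<Sum>l\<le>n. (w l t / ?r t) *\<^sub>R Z l)" if "?r t > 0" for Z :: "nat \<Rightarrow> 'a" and t
    using that by (simp add: lin_path_def scaleR_sum_right)
  have r: "?r s > 0" "?r t > 0" using s t by auto
  have iff: "d (lin_path n w Z s) * d (lin_path n w Z t) < 0 \<longleftrightarrow>
     d (\<Sum>l\<le>n. (w l s / ?r s) *\<^sub>R Z l) * d (\<Sum>l\<le>n. (w l t / ?r t) *\<^sub>R Z l) < 0" for Z
  proof -
    have "d (lin_path n w Z s) * d (lin_path n w Z t) = (?r s ^ m * ?r t ^ m) * (d (\<Sum>l\<le>n. (w l s / ?r s) *\<^sub>R Z l) * d (\<Sum>l\<le>n. (w l t / ?r t) *\<^sub>R Z l))"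
      unfolding scale[OF r(1)] scale[OF r(2)] hom by (simp only: mult_ac)
    moreover have "?r s ^ m * ?r t ^ m > 0" using r by simp
    moreover have "r * x < 0 \<longleftrightarrow> x < 0" if "r > 0" for r x :: real using that by (auto simp: mult_less_0_iff)
    ultimately show ?thesis by (simp only:)
  qed
  show ?thesis
    unfolding iff path_cos_def
    by (rule emeasure_PiM_sign_change[OF _ d hom]) (use sum_squares_normalized[OF s] sum_squares_normalized[OF t] in auto)
qed

text \<open>The number of zeros itself is not known to be measurable, so the expectation is squeezed: below
  on the given space, above on the Gaussian space that is mapped onto it.\<close>

lemma expected_num_points_bounds:
  fixes d :: "'a::euclidean_space \<Rightarrow> real" and F :: "'b \<Rightarrow> real \<Rightarrow> real"
  assumes ab: "a < b" and path: "affine_path n w a b d B c"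
    and hom: "\<And>r x. d (r *\<^sub>R x) = r ^ m * d x"
    and pos: "\<And>t. t \<in> {a..b} \<Longrightarrow> (\<Sum>l\<le>n. (w l t)\<^sup>2) > 0"
    and \<Phi>: "\<Phi> \<in> PiM {..n} (\<lambda>_. gauss) \<rightarrow>\<^sub>M \<Omega>" and law: "\<Omega> = distr (PiM {..n} (\<lambda>_. gauss)) \<Omega> \<Phi>"
    and meas: "\<And>t. t \<in> {a..b} \<Longrightarrow> (\<lambda>\<omega>. F \<omega> t) \<in> borel_measurable \<Omega>"
    and cont: "\<And>\<omega>. \<omega> \<in> space \<Omega> \<Longrightarrow> continuous_on {a..b} (F \<omega>)"
    and F: "\<And>Z t. F (\<Phi> Z) t = d (lin_path n w Z t)"
  shows "(\<Sum>i<Suc N. sign_change_prob d (path_cos n w (grid a b N i) (grid a b N (Suc i)))) \<le> (\<integral>\<^sup>+\<omega>. num_points {t \<in> {a..b}. F \<omega> t = 0} \<partial>\<Omega>)"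
    and "(\<integral>\<^sup>+\<omega>. num_points {t \<in> {a..b}. F \<omega> t = 0} \<partial>\<Omega>) \<le>
      liminf (\<lambda>N. \<Sum>i<Suc N. sign_change_prob d (path_cos n w (grid a b N i) (grid a b N (Suc i))))"
proof -
  interpret affine_path n w a b d B c by fact
  have prob: "emeasure P {Z \<in> space P. d (lin_path n w Z (grid a b N i)) * d (lin_path n w Z (grid a b N (Suc i))) < 0}
    = sign_change_prob d (path_cos n w (grid a b N i) (grid a b N (Suc i)))" if "i < Suc N" for N i
    using ab that by (intro emeasure_lin_path_sign_change[where m=m] d_meas hom pos grid_mem) auto
  have probF: "emeasure \<Omega> {\<omega> \<in> space \<Omega>. F \<omega> (grid a b N i) * F \<omega> (grid a b N (Suc i)) < 0}
    = sign_change_prob d (path_cos n w (grid a b N i) (grid a b N (Suc i)))" if i: "i < Suc N" for N i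
  proof -
    have mem: "grid a b N i \<in> {a..b}" "grid a b N (Suc i) \<in> {a..b}" using ab i by (auto intro!: grid_mem simp del: atLeastAtMost_iff)
    note [measurable] = meas[OF mem(1)] meas[OF mem(2)]
    let ?E = "{\<omega> \<in> space \<Omega>. F \<omega> (grid a b N i) * F \<omega> (grid a b N (Suc i)) < 0}"
    have "?E \<in> sets \<Omega>" by measurable
    then have "emeasure (distr P \<Omega> \<Phi>) ?E = emeasure P (\<Phi> -` ?E \<inter> space P)" by (rule emeasure_distr[OF \<Phi>])
    also have "\<Phi> -` ?E \<inter> space P = {Z \<in> space P. d (lin_path n w Z (grid a b N i)) * d (lin_path n w Z (grid a b N (Suc i))) < 0}"
      using measurable_space[OF \<Phi>] by (auto simp: F)
    finally show ?thesis using prob[OF i] law by simp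
  qed
  show "(\<Sum>i<Suc N. sign_change_prob d (path_cos n w (grid a b N i) (grid a b N (Suc i)))) \<le> (\<integral>\<^sup>+\<omega>. num_points {t \<in> {a..b}. F \<omega> t = 0} \<partial>\<Omega>)"
  proof -
    have "(\<Sum>i<Suc N. sign_change_prob d (path_cos n w (grid a b N i) (grid a b N (Suc i)))) = (\<Sum>i<Suc N. emeasure \<Omega> {\<omega> \<in> space \<Omega>. F \<omega> (grid a b N i) * F \<omega> (grid a b N (Suc i)) < 0})"
      using probF by (intro sum.cong) auto
    also have "\<dots> \<le> (\<integral>\<^sup>+\<omega>. num_points {t \<in> {a..b}. F \<omega> t = 0} \<partial>\<Omega>)"
      by (rule sum_sign_change_prob_le[OF less_imp_le[OF ab] meas cont])
    finally show ?thesis .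
  qed
  have "(\<integral>\<^sup>+\<omega>. num_points {t \<in> {a..b}. F \<omega> t = 0} \<partial>\<Omega>) = (\<integral>\<^sup>+\<omega>. num_points {t \<in> {a..b}. F \<omega> t = 0} \<partial>distr P \<Omega> \<Phi>)"
    using law by simp
  also have "\<dots> \<le> (\<integral>\<^sup>+Z. num_points {t \<in> {a..b}. F (\<Phi> Z) t = 0} \<partial>P)" by (rule nn_integral_distr_le[OF \<Phi>])
  also have "\<dots> = (\<integral>\<^sup>+Z. num_points {t \<in> {a..b}. d (lin_path n w Z t) = 0} \<partial>P)" by (simp only: F)
  also have "\<dots> \<le> liminf (\<lambda>N. \<Sum>i<Suc N. emeasure P {Z \<in> space P. d (lin_path n w Z (grid a b N i)) * d (lin_path n w Z (grid a b N (Suc i))) < 0})"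
  proof (rule expected_num_points_le_liminf[OF ab])
    show "(\<lambda>Z. d (lin_path n w Z t)) \<in> borel_measurable P" for t by measurable
    show "continuous_on {a..b} (\<lambda>t. d (lin_path n w Z t))" for Z
      by (intro continuous_on_compose2[OF d_cont continuous_on_lin_path[OF w_cont]]) auto
  qed (rule AE_nonzero_at AE_all_zeros_cross; assumption)+
  also have "\<dots> = liminf (\<lambda>N. \<Sum>i<Suc N. sign_change_prob d (path_cos n w (grid a b N i) (grid a b N (Suc i))))"
    using prob by (intro arg_cong[where f=liminf] ext sum.cong) auto
  finally show "(\<integral>\<^sup>+\<omega>. num_points {t \<in> {a..b}. F \<omega> t = 0} \<partial>\<Omega>) \<le>
      liminf (\<lambda>N. \<Sum>i<Suc N. sign_change_prob d (path_cos n w (grid a b N i) (grid a b N (Suc i))))" .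
qed

section \<open>Realising the given law by independent Gaussian matrices\<close>

lemma measurable_component_compose:
  "i \<in> I \<Longrightarrow> f \<in> N \<rightarrow>\<^sub>M L \<Longrightarrow> (\<lambda>g. f (g i)) \<in> PiM I (\<lambda>_. N) \<rightarrow>\<^sub>M L"
  by (rule measurable_compose[OF measurable_component_singleton])

lemma measurable_nested_component:
  "i \<in> I \<Longrightarrow> k \<in> K \<Longrightarrow> (\<lambda>g. g i k) \<in> PiM I (\<lambda>_. PiM K (\<lambda>_. N)) \<rightarrow>\<^sub>M N"
  by (intro measurable_component_compose measurable_component_singleton)

text \<open>Both iterated products give a box the product of its side measures. The flat product
  over pairs serves as the common reference for the two orders.\<close>

lemma PiM_uncurry:
  fixes I :: "'i set" and K :: "'k set"
  assumes fin: "finite I" "finite K" and N: "prob_space N"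
  shows "distr (PiM I (\<lambda>_. PiM K (\<lambda>_. N))) (PiM (I \<times> K) (\<lambda>_. N)) (\<lambda>g. \<lambda>(i, k)\<in>I \<times> K. g i k) = PiM (I \<times> K) (\<lambda>_. N)"
    and "distr (PiM K (\<lambda>_. PiM I (\<lambda>_. N))) (PiM (I \<times> K) (\<lambda>_. N)) (\<lambda>g. \<lambda>(i, k)\<in>I \<times> K. g k i) = PiM (I \<times> K) (\<lambda>_. N)"
proof -
  interpret N: product_prob_space "\<lambda>_ :: 'i \<times> 'k. N" UNIV by (intro product_prob_spaceI N)
  interpret N1: product_prob_space "\<lambda>_ :: 'i. N" UNIV by (intro product_prob_spaceI N)
  interpret N2: product_prob_space "\<lambda>_ :: 'k. N" UNIV by (intro product_prob_spaceI N)
  interpret NK: product_prob_space "\<lambda>_ :: 'i. PiM K (\<lambda>_. N)" UNIV by (intro product_prob_spaceI prob_space_PiM N)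
  interpret NI: product_prob_space "\<lambda>_ :: 'k. PiM I (\<lambda>_. N)" UNIV by (intro product_prob_spaceI prob_space_PiM N)
  have m1: "(\<lambda>g. \<lambda>(i, k)\<in>I \<times> K. g i k) \<in> PiM I (\<lambda>_. PiM K (\<lambda>_. N)) \<rightarrow>\<^sub>M PiM (I \<times> K) (\<lambda>_. N)"
    unfolding split_beta' by (rule measurable_restrict) (auto intro!: measurable_nested_component)
  have m2: "(\<lambda>g. \<lambda>(i, k)\<in>I \<times> K. g k i) \<in> PiM K (\<lambda>_. PiM I (\<lambda>_. N)) \<rightarrow>\<^sub>M PiM (I \<times> K) (\<lambda>_. N)"
    unfolding split_beta' by (rule measurable_restrict) (auto intro!: measurable_nested_component)
  show "distr (PiM I (\<lambda>_. PiM K (\<lambda>_. N))) (PiM (I \<times> K) (\<lambda>_. N)) (\<lambda>g. \<lambda>(i, k)\<in>I \<times> K. g i k) = PiM (I \<times> K) (\<lambda>_. N)"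
  proof (rule N.PiM_eqI)
    fix A assume A: "\<And>i. i \<in> I \<times> K \<Longrightarrow> A i \<in> sets N"
    have sub: "y \<in> space N" if "y \<in> A (i, k)" "i \<in> I" "k \<in> K" for y i k
      using A[of "(i, k)"] sets.sets_into_space[of "A (i, k)" N] that by auto
    have "emeasure (distr (PiM I (\<lambda>_. PiM K (\<lambda>_. N))) (PiM (I \<times> K) (\<lambda>_. N)) (\<lambda>g. \<lambda>(i, k)\<in>I \<times> K. g i k)) (Pi\<^sub>E (I \<times> K) A)
      = emeasure (PiM I (\<lambda>_. PiM K (\<lambda>_. N))) ((\<lambda>g. \<lambda>(i, k)\<in>I \<times> K. g i k) -` Pi\<^sub>E (I \<times> K) A \<inter> space (PiM I (\<lambda>_. PiM K (\<lambda>_. N))))"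
      using fin A by (intro emeasure_distr[OF m1] sets_PiM_I_finite) auto
    also have "(\<lambda>g. \<lambda>(i, k)\<in>I \<times> K. g i k) -` Pi\<^sub>E (I \<times> K) A \<inter> space (PiM I (\<lambda>_. PiM K (\<lambda>_. N))) = (\<Pi>\<^sub>E i\<in>I. \<Pi>\<^sub>E k\<in>K. A (i, k))"
      using sub by (auto simp: space_PiM PiE_iff split_beta' extensional_def; blast)
    also have "emeasure (PiM I (\<lambda>_. PiM K (\<lambda>_. N))) \<dots> = (\<Prod>i\<in>I. \<Prod>k\<in>K. emeasure N (A (i, k)))"
      using fin A by (simp add: NK.emeasure_PiM N2.emeasure_PiM sets_PiM_I_finite)
    also have "\<dots> = (\<Prod>i\<in>I \<times> K. emeasure N (A i))" by (simp add: prod.cartesian_product split_beta')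
    finally show "emeasure (distr (PiM I (\<lambda>_. PiM K (\<lambda>_. N))) (PiM (I \<times> K) (\<lambda>_. N)) (\<lambda>g. \<lambda>(i, k)\<in>I \<times> K. g i k)) (Pi\<^sub>E (I \<times> K) A) = (\<Prod>i\<in>I \<times> K. emeasure N (A i))" .
  qed (use fin in auto)
  show "distr (PiM K (\<lambda>_. PiM I (\<lambda>_. N))) (PiM (I \<times> K) (\<lambda>_. N)) (\<lambda>g. \<lambda>(i, k)\<in>I \<times> K. g k i) = PiM (I \<times> K) (\<lambda>_. N)"
  proof (rule N.PiM_eqI)
    fix A assume A: "\<And>i. i \<in> I \<times> K \<Longrightarrow> A i \<in> sets N"
    have sub: "y \<in> space N" if "y \<in> A (i, k)" "i \<in> I" "k \<in> K" for y i k
      using A[of "(i, k)"] sets.sets_into_space[of "A (i, k)" N] that by auto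
    have "emeasure (distr (PiM K (\<lambda>_. PiM I (\<lambda>_. N))) (PiM (I \<times> K) (\<lambda>_. N)) (\<lambda>g. \<lambda>(i, k)\<in>I \<times> K. g k i)) (Pi\<^sub>E (I \<times> K) A)
      = emeasure (PiM K (\<lambda>_. PiM I (\<lambda>_. N))) ((\<lambda>g. \<lambda>(i, k)\<in>I \<times> K. g k i) -` Pi\<^sub>E (I \<times> K) A \<inter> space (PiM K (\<lambda>_. PiM I (\<lambda>_. N))))"
      using fin A by (intro emeasure_distr[OF m2] sets_PiM_I_finite) auto
    also have "(\<lambda>g. \<lambda>(i, k)\<in>I \<times> K. g k i) -` Pi\<^sub>E (I \<times> K) A \<inter> space (PiM K (\<lambda>_. PiM I (\<lambda>_. N))) = (\<Pi>\<^sub>E k\<in>K. \<Pi>\<^sub>E i\<in>I. A (i, k))"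
      using sub by (auto simp: space_PiM PiE_iff split_beta' extensional_def; blast)
    also have "emeasure (PiM K (\<lambda>_. PiM I (\<lambda>_. N))) \<dots> = (\<Prod>k\<in>K. \<Prod>i\<in>I. emeasure N (A (i, k)))"
      using fin A by (simp add: NI.emeasure_PiM N1.emeasure_PiM sets_PiM_I_finite)
    also have "\<dots> = (\<Prod>i\<in>I. \<Prod>k\<in>K. emeasure N (A (i, k)))" by (rule prod.swap)
    also have "\<dots> = (\<Prod>i\<in>I \<times> K. emeasure N (A i))" by (simp add: prod.cartesian_product split_beta')
    finally show "emeasure (distr (PiM K (\<lambda>_. PiM I (\<lambda>_. N))) (PiM (I \<times> K) (\<lambda>_. N)) (\<lambda>g. \<lambda>(i, k)\<in>I \<times> K. g k i)) (Pi\<^sub>E (I \<times> K) A) = (\<Prod>i\<in>I \<times> K. emeasure N (A i))" .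
  qed (use fin in auto)
qed

text \<open>Both iterated products are carried to the flat product over pairs and curried back; in
  one order this round trip is the identity.\<close>

lemma distr_PiM_swap:
  assumes fin: "finite I" "finite K" and N: "prob_space N"
  shows "distr (PiM K (\<lambda>_. PiM I (\<lambda>_. N))) (PiM I (\<lambda>_. PiM K (\<lambda>_. N))) (\<lambda>g. \<lambda>i\<in>I. \<lambda>k\<in>K. g k i) = PiM I (\<lambda>_. PiM K (\<lambda>_. N))"
proof -
  let ?c = "\<lambda>f. \<lambda>i\<in>I. \<lambda>k\<in>K. f (i, k)"
  have c: "?c \<in> PiM (I \<times> K) (\<lambda>_. N) \<rightarrow>\<^sub>M PiM I (\<lambda>_. PiM K (\<lambda>_. N))"
    by (intro measurable_restrict measurable_component_singleton) auto
  have m1: "(\<lambda>g. \<lambda>(i, k)\<in>I \<times> K. g i k) \<in> PiM I (\<lambda>_. PiM K (\<lambda>_. N)) \<rightarrow>\<^sub>M PiM (I \<times> K) (\<lambda>_. N)"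
    unfolding split_beta' by (rule measurable_restrict) (auto intro!: measurable_nested_component)
  have m2: "(\<lambda>g. \<lambda>(i, k)\<in>I \<times> K. g k i) \<in> PiM K (\<lambda>_. PiM I (\<lambda>_. N)) \<rightarrow>\<^sub>M PiM (I \<times> K) (\<lambda>_. N)"
    unfolding split_beta' by (rule measurable_restrict) (auto intro!: measurable_nested_component)
  have "distr (PiM K (\<lambda>_. PiM I (\<lambda>_. N))) (PiM I (\<lambda>_. PiM K (\<lambda>_. N))) (\<lambda>g. \<lambda>i\<in>I. \<lambda>k\<in>K. g k i)
    = distr (distr (PiM K (\<lambda>_. PiM I (\<lambda>_. N))) (PiM (I \<times> K) (\<lambda>_. N)) (\<lambda>g. \<lambda>(i, k)\<in>I \<times> K. g k i)) (PiM I (\<lambda>_. PiM K (\<lambda>_. N))) ?c"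
    by (subst distr_distr[OF c m2]) (auto simp: o_def intro!: distr_cong cong: restrict_cong)
  also have "\<dots> = distr (distr (PiM I (\<lambda>_. PiM K (\<lambda>_. N))) (PiM (I \<times> K) (\<lambda>_. N)) (\<lambda>g. \<lambda>(i, k)\<in>I \<times> K. g i k)) (PiM I (\<lambda>_. PiM K (\<lambda>_. N))) ?c"
    by (simp only: PiM_uncurry[OF fin N])
  also have "\<dots> = distr (PiM I (\<lambda>_. PiM K (\<lambda>_. N))) (PiM I (\<lambda>_. PiM K (\<lambda>_. N))) (\<lambda>g. g)"
    unfolding distr_distr[OF c m1]
    by (intro distr_cong) (auto simp: o_def space_PiM PiE_iff extensional_def fun_eq_iff)
  finally show ?thesis by simp
qed

lemma measurable_matrix_entries:
  "(\<lambda>X :: real^'p^'p::finite. \<lambda>(i, j). X $ i $ j) \<in> borel \<rightarrow>\<^sub>M PiM UNIV (\<lambda>_. density lborel std_normal_density)"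
proof -
  have "(\<lambda>X :: real^'p^'p. \<lambda>ij\<in>UNIV. X $ fst ij $ snd ij) \<in> borel \<rightarrow>\<^sub>M PiM UNIV (\<lambda>_. density lborel std_normal_density)"
  proof (rule measurable_restrict)
    fix ij :: "'p \<times> 'p"
    have "(\<lambda>X :: real^'p^'p. X $ fst ij $ snd ij) \<in> borel \<rightarrow>\<^sub>M borel"
      by (intro borel_measurable_continuous_onI continuous_intros)
    then show "(\<lambda>X :: real^'p^'p. X $ fst ij $ snd ij) \<in> borel \<rightarrow>\<^sub>M density lborel std_normal_density" by simp
  qed
  then show ?thesis by (simp add: split_beta' restrict_UNIV)
qed

text \<open>The basis vectors of the matrix space are indexed bijectively by the pairs (i, j), so
  this is a reindexing of independent scalars.\<close>

lemma distr_gauss_matrix_entries: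
  "distr (gauss :: (real^'p^'p::finite) measure) (PiM UNIV (\<lambda>_. density lborel std_normal_density)) (\<lambda>X (i, j). X $ i $ j)
    = PiM UNIV (\<lambda>_. density lborel std_normal_density)"
proof -
  let ?N = "density lborel std_normal_density"
  let ?b = "\<lambda>(i, j). axis i (axis j 1) :: real^'p^'p"
  let ?s = "\<lambda>f. \<Sum>b\<in>Basis. f b *\<^sub>R b :: real^'p^'p"
  have s: "?s \<in> PiM Basis (\<lambda>_. ?N) \<rightarrow>\<^sub>M borel" by measurable
  note e = measurable_matrix_entries[where 'p='p]
  have "distr (PiM Basis (\<lambda>_. ?N)) (PiM UNIV (\<lambda>_. ?N)) (\<lambda>f. \<lambda>ij\<in>UNIV. f (?b ij)) = PiM UNIV (\<lambda>_. ?N)"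
    by (rule distr_PiM_reindex) (auto simp: prob_space_std_normal inj_on_def axis_eq_axis Basis_vec_def)
  moreover have "distr (gauss :: (real^'p^'p) measure) (PiM UNIV (\<lambda>_. ?N)) (\<lambda>X (i, j). X $ i $ j) = distr (PiM Basis (\<lambda>_. ?N)) (PiM UNIV (\<lambda>_. ?N)) (\<lambda>f. \<lambda>ij\<in>UNIV. f (?b ij))"
    unfolding gauss_eq_distr_PiM distr_distr[OF e s]
  proof (rule distr_cong)
    fix f :: "real^'p^'p \<Rightarrow> real"
    have "?s f $ i $ j = f (?b (i, j))" for i j
    proof -
      have "?s f $ i $ j = ?s f \<bullet> ?b (i, j)" by (simp add: inner_axis)
      also have "\<dots> = f (?b (i, j))" by (intro inner_sum_left_Basis) (auto simp: Basis_vec_def)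
      finally show ?thesis .
    qed
    then show "((\<lambda>X (i, j). X $ i $ j) \<circ> ?s) f = (\<lambda>ij\<in>UNIV. f (?b ij))" by (auto simp: fun_eq_iff)
  qed auto
  ultimately show ?thesis by simp
qed

lemma measurable_gaussian_combination:
  "(\<lambda>z. \<lambda>i\<in>{..n}. \<Sum>k\<le>n. L i k * z k) \<in> PiM {..n} (\<lambda>_. density lborel std_normal_density) \<rightarrow>\<^sub>M PiM {..n} (\<lambda>_. borel :: real measure)"
  by measurable

text \<open>\<open>\<Phi>\<close> takes the n + 1 Gaussian matrices to their entries, regroups these
  by position (i, j), and applies \<open>L\<close> to the vector at each position; each of the three
  stages preserves the required product law.\<close>

lemma PiM_centered_gaussian_eq_distr:
  fixes n :: nat and L :: "nat \<Rightarrow> nat \<Rightarrow> real"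
  defines "M \<equiv> distr (PiM {..n} (\<lambda>_. density lborel std_normal_density)) (PiM {..n} (\<lambda>_. borel)) (\<lambda>z. \<lambda>i\<in>{..n}. \<Sum>k\<le>n. L i k * z k)"
  defines "\<Phi> \<equiv> \<lambda>Z (i, j). \<lambda>k\<in>{..n}. \<Sum>l\<le>n. L k l * Z l $ i $ j"
  shows "\<Phi> \<in> PiM {..n} (\<lambda>_. gauss :: (real^'p^'p::finite) measure) \<rightarrow>\<^sub>M PiM UNIV (\<lambda>_. M)"
    and "PiM UNIV (\<lambda>_. M) = distr (PiM {..n} (\<lambda>_. gauss :: (real^'p^'p) measure)) (PiM UNIV (\<lambda>_. M)) \<Phi>"
proof -
  let ?N = "density lborel std_normal_density"
  let ?L = "\<lambda>z. \<lambda>i\<in>{..n}. \<Sum>k\<le>n. L i k * z k"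
  let ?J = "UNIV :: ('p \<times> 'p) set"
  let ?e = "\<lambda>X :: real^'p^'p. \<lambda>(i, j). X $ i $ j"
  interpret N: prob_space ?N by (rule prob_space_std_normal)
  have pN: "prob_space (PiM I (\<lambda>_. ?N))" for I by (rule prob_space_PiM) (rule prob_space_std_normal)
  have setsM: "sets M = sets (PiM {..n} (\<lambda>_. borel))" by (simp add: M_def)
  have L: "?L \<in> PiM {..n} (\<lambda>_. ?N) \<rightarrow>\<^sub>M M"
    using measurable_gaussian_combination[where n=n and L=L] by (simp add: measurable_cong_sets[OF refl setsM])
  have M: "distr (PiM {..n} (\<lambda>_. ?N)) M ?L = M"
    unfolding M_def by (rule distr_cong) auto
  have pM: "prob_space M" unfolding M_def by (rule prob_space.prob_space_distr[OF pN measurable_gaussian_combination])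
  have e: "?e \<in> gauss \<rightarrow>\<^sub>M PiM ?J (\<lambda>_. ?N)"
    using measurable_matrix_entries by (simp add: measurable_cong_sets[OF sets_gauss refl])
  have 1: "PiM {..n} (\<lambda>_. PiM ?J (\<lambda>_. ?N)) = distr (PiM {..n} (\<lambda>_. gauss)) (PiM {..n} (\<lambda>_. PiM ?J (\<lambda>_. ?N))) (compose {..n} ?e)"
    by (subst distr_PiM_finite_prob_space') (auto simp: distr_gauss_matrix_entries prob_space_gauss pN e)
  have 2: "PiM ?J (\<lambda>_. M) = distr (PiM ?J (\<lambda>_. PiM {..n} (\<lambda>_. ?N))) (PiM ?J (\<lambda>_. M)) (compose ?J ?L)"
    by (subst distr_PiM_finite_prob_space') (auto simp: M pM pN L)
  have 3: "PiM ?J (\<lambda>_. PiM {..n} (\<lambda>_. ?N)) = distr (PiM {..n} (\<lambda>_. PiM ?J (\<lambda>_. ?N))) (PiM ?J (\<lambda>_. PiM {..n} (\<lambda>_. ?N))) (\<lambda>g. \<lambda>i\<in>?J. \<lambda>k\<in>{..n}. g k i)"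
    by (rule distr_PiM_swap[symmetric]) (auto simp: prob_space_std_normal)
  have m1: "compose {..n} ?e \<in> PiM {..n} (\<lambda>_. gauss) \<rightarrow>\<^sub>M PiM {..n} (\<lambda>_. PiM ?J (\<lambda>_. ?N))"
    unfolding compose_def by (intro measurable_restrict measurable_component_compose e)
  have m2: "compose ?J ?L \<in> PiM ?J (\<lambda>_. PiM {..n} (\<lambda>_. ?N)) \<rightarrow>\<^sub>M PiM ?J (\<lambda>_. M)"
    unfolding compose_def by (intro measurable_restrict measurable_component_compose L)
  have m3: "(\<lambda>g. \<lambda>i\<in>?J. \<lambda>k\<in>{..n}. g k i) \<in> PiM {..n} (\<lambda>_. PiM ?J (\<lambda>_. ?N)) \<rightarrow>\<^sub>M PiM ?J (\<lambda>_. PiM {..n} (\<lambda>_. ?N))"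
    by (intro measurable_restrict measurable_nested_component) auto
  have \<Phi>: "\<Phi> Z = compose ?J ?L ((\<lambda>g. \<lambda>i\<in>?J. \<lambda>k\<in>{..n}. g k i) (compose {..n} ?e Z))" for Z
    by (auto simp: \<Phi>_def compose_def fun_eq_iff intro!: sum.cong)
  show "\<Phi> \<in> PiM {..n} (\<lambda>_. gauss) \<rightarrow>\<^sub>M PiM UNIV (\<lambda>_. M)"
    unfolding \<Phi>[abs_def] by (rule measurable_compose[OF measurable_compose[OF m1 m3] m2])
  have "PiM ?J (\<lambda>_. M) = distr (distr (distr (PiM {..n} (\<lambda>_. gauss)) (PiM {..n} (\<lambda>_. PiM ?J (\<lambda>_. ?N))) (compose {..n} ?e))
      (PiM ?J (\<lambda>_. PiM {..n} (\<lambda>_. ?N))) (\<lambda>g. \<lambda>i\<in>?J. \<lambda>k\<in>{..n}. g k i)) (PiM ?J (\<lambda>_. M)) (compose ?J ?L)"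
    by (simp only: 1[symmetric] 3[symmetric] 2[symmetric])
  also have "\<dots> = distr (PiM {..n} (\<lambda>_. gauss)) (PiM UNIV (\<lambda>_. M)) \<Phi>"
    unfolding distr_distr[OF m3 m1] distr_distr[OF m2 measurable_comp[OF m1 m3]] by (rule distr_cong) (simp_all add: \<Phi> o_def)
  finally show "PiM UNIV (\<lambda>_. M) = distr (PiM {..n} (\<lambda>_. gauss)) (PiM UNIV (\<lambda>_. M)) \<Phi>" .
qed

lemma affine_path_real:
  assumes "\<And>l. l \<le> n \<Longrightarrow> continuous_on {a..b} (w l)" and "\<And>t. t \<in> {a..b} \<Longrightarrow> \<exists>l\<le>n. w l t \<noteq> 0"
  shows "affine_path n w a b (\<lambda>x :: real. x) {1} (\<lambda>_ _. 1)"
  by standard (use assms in auto)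

text \<open>Expansion along row \<open>k\<close>: the directions are the unit matrices in that row
  and the slopes are the entries of the cofactor vector. Nondegeneracy is the almost sure
  nonvanishing of that vector along the whole path.\<close>

lemma affine_path_det:
  assumes w: "\<And>l t. l \<le> n \<Longrightarrow> w l differentiable (at t)" and nz: "\<And>t. t \<in> {a..b} \<Longrightarrow> \<exists>l\<le>n. w l t \<noteq> 0"
  shows "affine_path n w a b (det :: real^'p^'p::finite \<Rightarrow> real) (range (\<lambda>j. axis k (axis j 1))) (\<lambda>v X. cofac k X \<bullet> v $ k)"
proof
  show "continuous_on {a..b} (w l)" if "l \<le> n" for l
    using w[OF that] by (intro continuous_at_imp_continuous_on ballI differentiable_imp_continuous_within) auto
  show "continuous_on UNIV (det :: real^'p^'p \<Rightarrow> real)" by (intro continuous_on_det continuous_on_id)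
  show "countable (range (\<lambda>j :: 'p. axis k (axis j 1) :: real^'p^'p))" by (intro countable_finite) simp
  show "norm v = 1" if "v \<in> range (\<lambda>j :: 'p. axis k (axis j 1) :: real^'p^'p)" for v using that by auto
  show "continuous_on UNIV (\<lambda>X :: real^'p^'p. cofac k X \<bullet> v $ k)" for v by (intro continuous_intros)
  show "det (X + z *\<^sub>R v) = det X + z * (cofac k X \<bullet> v $ k)" if "v \<in> range (\<lambda>j. axis k (axis j 1))" for v X :: "real^'p^'p" and z
  proof -
    have "X + z *\<^sub>R v = row_upd X k (X $ k + z *\<^sub>R v $ k)"
      using that by (auto simp: vec_eq_iff row_upd_nth axis_def)
    then have "det (X + z *\<^sub>R v) = cofac k X \<bullet> (X $ k + z *\<^sub>R v $ k)" by (simp add: cofac_inner)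
    also have "\<dots> = det X + z * (cofac k X \<bullet> v $ k)" by (simp add: inner_add_right det_eq_inner_cofac[of X k] inner_commute)
    finally show ?thesis .
  qed
  have "AE Z in PiM {..n} (\<lambda>_. gauss :: (real^'p^'p) measure). \<forall>t\<in>{a..b}. cofac k (lin_path n w Z t) \<noteq> 0"
    using w nz by (intro AE_path_cofac_nonzero) auto
  then show "AE Z in PiM {..n} (\<lambda>_. gauss :: (real^'p^'p) measure).
    \<forall>t\<in>{a..b}. \<exists>l\<le>n. \<exists>v\<in>range (\<lambda>j. axis k (axis j 1)). w l t * (cofac k (lin_path n w Z t) \<bullet> v $ k) \<noteq> 0"
  proof eventually_elim
    case (elim Z)
    show ?case
    proof
      fix t assume t: "t \<in> {a..b}"
      then obtain l where "l \<le> n" "w l t \<noteq> 0" using nz by blast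
      moreover have "cofac k (lin_path n w Z t) \<noteq> 0" using elim t by blast
      moreover from this obtain j where "cofac k (lin_path n w Z t) $ j \<noteq> 0" by (auto simp: vec_eq_iff)
      ultimately show "\<exists>l\<le>n. \<exists>v\<in>range (\<lambda>j. axis k (axis j 1)). w l t * (cofac k (lin_path n w Z t) \<bullet> v $ k) \<noteq> 0"
        by (intro exI[of _ l] conjI bexI[of _ "axis k (axis j 1)"]) (auto simp: inner_axis)
    qed
  qed
qed

text \<open>Each limit value dominates its sequence and is dominated by the liminf, so it is the
  limit. The ratio bounds then pass to the limits; finiteness of \<open>\<alpha>\<close> lets the
  error \<epsilon> * \<alpha> tend to zero.\<close>

lemma eq_mult_of_eventual_ratio:
  fixes S T :: "nat \<Rightarrow> ennreal"
  assumes E: "0 \<le> E" and S: "\<And>N. S N \<le> \<alpha>" "\<alpha> \<le> liminf S" and T: "\<And>N. T N \<le> \<beta>" "\<beta> \<le> liminf T" and fin: "\<alpha> \<noteq> \<infinity>"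
    and ratio: "\<And>\<epsilon>. \<epsilon> > 0 \<Longrightarrow> \<forall>\<^sub>F N in sequentially. ennreal (E - \<epsilon>) * S N \<le> T N \<and> T N \<le> ennreal (E + \<epsilon>) * S N"
  shows "\<beta> = ennreal E * \<alpha>"
proof -
  obtain r where r: "0 \<le> r" "\<alpha> = ennreal r" using fin by (cases \<alpha>) auto
  have "\<beta> \<le> ennreal E * \<alpha>"
  proof (rule ennreal_le_epsilon)
    fix e :: real assume e: "0 < e"
    \<comment> \<open>The denominator r + 1 also covers r = 0.\<close>
    define \<epsilon> where "\<epsilon> = e / (r + 1)"
    have \<epsilon>: "\<epsilon> > 0" "\<epsilon> * r \<le> e" using e r by (auto simp: \<epsilon>_def field_simps)
    have "\<forall>\<^sub>F N in sequentially. T N \<le> ennreal (E + \<epsilon>) * \<alpha>"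
      using ratio[OF \<epsilon>(1)] by eventually_elim (meson S(1) mult_left_mono order_trans zero_le)
    then have "limsup T \<le> ennreal (E + \<epsilon>) * \<alpha>" by (rule Limsup_bounded)
    moreover have "liminf T \<le> limsup T" by (rule Liminf_le_Limsup) simp
    ultimately have "\<beta> \<le> ennreal (E + \<epsilon>) * \<alpha>" using T(2) by (blast intro: order_trans)
    also have "\<dots> = ennreal (E * r + \<epsilon> * r)" using r E \<epsilon> by (simp add: ennreal_mult'[symmetric] distrib_right del: ennreal_plus)
    also have "\<dots> \<le> ennreal (E * r + e)" using \<epsilon> by (intro ennreal_leI) auto
    also have "\<dots> = ennreal E * \<alpha> + ennreal e" using r E e by (simp add: ennreal_mult')
    finally show "\<beta> \<le> ennreal E * \<alpha> + ennreal e" .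
  qed
  moreover from this obtain q where q: "0 \<le> q" "\<beta> = ennreal q" using r by (cases \<beta>) (auto simp: ennreal_mult'[symmetric] E top_unique)
  have "E * r \<le> q"
  proof (rule field_le_epsilon)
    fix e :: real assume e: "0 < e"
    define \<epsilon> where "\<epsilon> = e / (r + 1)"
    have \<epsilon>: "\<epsilon> > 0" "\<epsilon> * r \<le> e" using e r by (auto simp: \<epsilon>_def field_simps)
    have "(E - \<epsilon>) * r \<le> q"
    \<comment> \<open>Division by E - \<epsilon> needs it positive; otherwise the left side is
      nonpositive and the bound is immediate.\<close>
    proof (cases "E - \<epsilon> > 0")
      case False
      then have "(E - \<epsilon>) * r \<le> 0" using r by (simp add: mult_nonpos_nonneg)
      then show ?thesis using q by simp
    next
      case True
      have "\<forall>\<^sub>F N in sequentially. S N \<le> ennreal (q / (E - \<epsilon>))"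
        using ratio[OF \<epsilon>(1)]
      proof eventually_elim
        case (elim N)
        obtain s where s: "0 \<le> s" "S N = ennreal s" using S(1)[of N] r by (cases "S N") (auto simp: top_unique)
        have "ennreal ((E - \<epsilon>) * s) \<le> ennreal q"
          using order_trans[OF conjunct1[OF elim] T(1)] True by (simp add: s(2) q(2) ennreal_mult' del: ennreal_le_iff)
        then have "(E - \<epsilon>) * s \<le> q" using q by (simp add: ennreal_le_iff)
        then show ?case using True s by (simp add: field_simps ennreal_leI)
      qed
      then have "limsup S \<le> ennreal (q / (E - \<epsilon>))" by (rule Limsup_bounded)
      moreover have "liminf S \<le> limsup S" by (rule Liminf_le_Limsup) simp
      ultimately have "ennreal r \<le> ennreal (q / (E - \<epsilon>))" using S(2) r by (metis order_trans)
      then have "r \<le> q / (E - \<epsilon>)" using q True by (simp add: ennreal_le_iff)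
      then show ?thesis using True by (simp add: field_simps)
    qed
    then show "E * r \<le> q + e" using \<epsilon> by (simp add: algebra_simps)
  qed
  then have "ennreal E * \<alpha> \<le> \<beta>" using q r E by (simp add: ennreal_mult'[symmetric] ennreal_leI)
  ultimately show ?thesis by (rule antisym)
qed

theorem theorem6p1:
  fixes n :: nat
    and f :: "nat \<Rightarrow> real \<Rightarrow> real"
    and C :: "nat \<Rightarrow> nat \<Rightarrow> real"
    and M :: "(nat \<Rightarrow> real) measure"
    and a b :: real
    and \<alpha>p \<alpha>1 :: ennreal
  assumes diff: "\<forall>k\<le>n. \<forall>t. f k differentiable (at t)"
    and gauss: "is_centered_gaussian n C M"
    and nondeg: "\<forall>t\<in>{a..b}. (\<Sum>i\<le>n. \<Sum>j\<le>n. f i t * C i j * f j t) > 0"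
    and alpha_p: "\<alpha>p = (\<integral>\<^sup>+ \<omega>. num_points
              {t \<in> {a..b}. det (\<Sum>k\<le>n. f k t *\<^sub>R
                   (\<chi> (i::'p::finite) (j::'p). \<omega> (i, j) k)) = 0}
            \<partial>(PiM (UNIV :: ('p \<times> 'p) set) (\<lambda>_. M)))"
    and alpha_1: "\<alpha>1 = (\<integral>\<^sup>+ x. num_points {t \<in> {a..b}. (\<Sum>k\<le>n. x k * f k t) = 0} \<partial>M)"
    and pos: "\<alpha>1 \<noteq> 0" and fin: "\<alpha>1 \<noteq> \<infinity>"
  shows "\<alpha>p = ennreal (sqrt pi * Gamma ((real CARD('p) + 1) / 2) / Gamma (real CARD('p) / 2)) * \<alpha>1"
proof -
  obtain L :: "nat \<Rightarrow> nat \<Rightarrow> real" where L: "\<And>i j. i \<le> n \<Longrightarrow> j \<le> n \<Longrightarrow> (\<Sum>k\<le>n. L i k * L j k) = C i j"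
    and M: "M = distr (PiM {..n} (\<lambda>_. density lborel std_normal_density)) (PiM {..n} (\<lambda>_. borel)) (\<lambda>z. \<lambda>i\<in>{..n}. \<Sum>k\<le>n. L i k * z k)"
    using gauss unfolding is_centered_gaussian_def by blast
  define w where "w = (\<lambda>l t. \<Sum>k\<le>n. L k l * f k t)"
  define E where "E = sqrt pi * Gamma ((real CARD('p) + 1) / 2) / Gamma (real CARD('p) / 2)"
  have E: "0 \<le> E" unfolding E_def by (intro mult_nonneg_nonneg divide_nonneg_nonneg Gamma_real_nonneg) auto
  have w_diff: "w l differentiable (at t)" for l t
    unfolding w_def using diff by (intro differentiable_sum ballI differentiable_mult differentiable_const) auto
  have w_cont: "continuous_on S (w l)" for S l
    using w_diff by (intro continuous_at_imp_continuous_on ballI differentiable_imp_continuous_within) auto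
  have f_cont: "continuous_on S (f k)" if "k \<le> n" for S k
    using diff that by (intro continuous_at_imp_continuous_on ballI differentiable_imp_continuous_within) auto
  \<comment> \<open>With C = L L^T the squared norm of w is the quadratic form of C at f, so
    \<open>nondeg\<close> says that the path w never passes through the origin.\<close>
  have w_pos: "(\<Sum>l\<le>n. (w l t)\<^sup>2) > 0" if "t \<in> {a..b}" for t
  proof -
    have "(\<Sum>l\<le>n. (w l t)\<^sup>2) = (\<Sum>l\<le>n. \<Sum>i\<le>n. \<Sum>j\<le>n. f i t * (L i l * L j l) * f j t)"
      unfolding w_def power2_eq_square sum_product by (intro sum.cong refl) (simp only: mult_ac)
    also have "\<dots> = (\<Sum>i\<le>n. \<Sum>l\<le>n. \<Sum>j\<le>n. f i t * (L i l * L j l) * f j t)" by (rule sum.swap)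
    also have "\<dots> = (\<Sum>i\<le>n. \<Sum>j\<le>n. \<Sum>l\<le>n. f i t * (L i l * L j l) * f j t)"
      by (rule sum.cong[OF refl], rule sum.swap)
    also have "\<dots> = (\<Sum>i\<le>n. \<Sum>j\<le>n. f i t * C i j * f j t)"
      by (intro sum.cong refl) (simp add: L[symmetric] sum_distrib_left sum_distrib_right)
    finally show ?thesis using nondeg that by simp
  qed
  have w_nz: "\<exists>l\<le>n. w l t \<noteq> 0" if "t \<in> {a..b}" for t
  proof (rule ccontr)
    assume "\<not> ?thesis"
    then have "(\<Sum>l\<le>n. (w l t)\<^sup>2) = 0" by simp
    with w_pos[OF that] show False by simp
  qed
  have path1: "affine_path n w a b (\<lambda>x :: real. x) {1} (\<lambda>_ _. 1)"
    by (rule affine_path_real[OF w_cont w_nz])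
  interpret path1: affine_path n w a b "\<lambda>x :: real. x" "{1}" "\<lambda>_ _. 1" by (rule path1)
  \<comment> \<open>An arbitrary row for the expansion of the determinant; index types are
    nonempty.\<close>
  obtain k :: 'p where True by blast
  have pathp: "affine_path n w a b (det :: real^'p^'p \<Rightarrow> real) (range (\<lambda>j. axis k (axis j 1))) (\<lambda>v X. cofac k X \<bullet> v $ k)"
    by (rule affine_path_det[OF w_diff w_nz])
  let ?L = "\<lambda>z. \<lambda>i\<in>{..n}. \<Sum>k\<le>n. L i k * z k"
  let ?F1 = "\<lambda>x t. \<Sum>k\<le>n. x k * f k t"
  have setsM: "sets M = sets (PiM {..n} (\<lambda>_. borel))" by (simp add: M)
  have compM: "(\<lambda>x. x i) \<in> borel_measurable M" if "i \<le> n" for i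
    unfolding measurable_cong_sets[OF setsM refl] using that by (intro measurable_component_singleton) simp
  have L1: "?L \<in> PiM {..n} (\<lambda>_. gauss :: real measure) \<rightarrow>\<^sub>M M"
    unfolding gauss_real measurable_cong_sets[OF refl setsM] by (rule measurable_gaussian_combination)
  have law1: "M = distr (PiM {..n} (\<lambda>_. gauss :: real measure)) M ?L"
    unfolding gauss_real by (subst M, rule distr_cong[OF refl setsM[symmetric] refl])
  have F1_meas: "(\<lambda>x. ?F1 x t) \<in> borel_measurable M" for t
    by (intro borel_measurable_sum borel_measurable_times borel_measurable_const compM) simp
  have F1_cont: "continuous_on {a..b} (?F1 x)" for x
    by (intro continuous_on_sum continuous_on_mult continuous_on_const f_cont) simp
  have F1: "?F1 (?L Z) t = lin_path n w Z t" for Z t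
  proof -
    have "?F1 (?L Z) t = (\<Sum>k\<le>n. \<Sum>l\<le>n. L k l * f k t * Z l)"
      by (intro sum.cong refl) (simp add: sum_distrib_left sum_distrib_right mult_ac)
    also have "\<dots> = (\<Sum>l\<le>n. \<Sum>k\<le>n. L k l * f k t * Z l)" by (rule sum.swap)
    also have "\<dots> = lin_path n w Z t" by (simp add: lin_path_def w_def sum_distrib_right)
    finally show ?thesis .
  qed
  \<comment> \<open>Otherwise the interval has at most one point, which is almost surely not a zero;
    then \<open>\<alpha>1\<close> would be 0, against \<open>pos\<close>.\<close>
  have ab: "a < b"
  proof (rule ccontr)
    assume "\<not> a < b"
    then have sub: "{a..b} \<subseteq> {a}" by auto
    have "\<alpha>1 \<le> (\<integral>\<^sup>+Z. num_points {t \<in> {a..b}. ?F1 (?L Z) t = 0} \<partial>PiM {..n} (\<lambda>_. gauss :: real measure))"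
      unfolding alpha_1 by (subst law1) (rule nn_integral_distr_le[OF L1])
    also have "\<dots> = (\<integral>\<^sup>+Z. 0 \<partial>PiM {..n} (\<lambda>_. gauss :: real measure))"
    proof (rule nn_integral_cong_AE)
      have "AE Z in PiM {..n} (\<lambda>_. gauss :: real measure). a \<in> {a..b} \<longrightarrow> lin_path n w Z a \<noteq> 0"
        using path1.AE_nonzero_at[of a] by (cases "a \<in> {a..b}") auto
      then show "AE Z in PiM {..n} (\<lambda>_. gauss :: real measure). num_points {t \<in> {a..b}. ?F1 (?L Z) t = 0} = 0"
      proof eventually_elim
        case (elim Z)
        then have "{t \<in> {a..b}. ?F1 (?L Z) t = 0} = {}" unfolding F1 using sub by blast
        then show ?case by (simp only: num_points_def emeasure_empty)
      qed
    qed
    finally show False using pos by simp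
  qed
  let ?\<Omega> = "PiM (UNIV :: ('p \<times> 'p) set) (\<lambda>_. M)"
  let ?Fp = "\<lambda>(\<omega> :: 'p \<times> 'p \<Rightarrow> nat \<Rightarrow> real) t. det (\<Sum>k\<le>n. f k t *\<^sub>R (\<chi> (i::'p) (j::'p). \<omega> (i, j) k))"
  let ?\<Phi> = "\<lambda>(Z :: nat \<Rightarrow> real^'p^'p) (i, j). \<lambda>k\<in>{..n}. \<Sum>l\<le>n. L k l * Z l $ i $ j"
  have \<Phi>: "?\<Phi> \<in> PiM {..n} (\<lambda>_. gauss) \<rightarrow>\<^sub>M ?\<Omega>" and lawp: "?\<Omega> = distr (PiM {..n} (\<lambda>_. gauss)) ?\<Omega> ?\<Phi>"
    unfolding M by (rule PiM_centered_gaussian_eq_distr)+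
  have Fp: "?Fp (?\<Phi> Z) t = det (lin_path n w Z t)" for Z t
  proof -
    have "(\<Sum>k\<le>n. f k t *\<^sub>R (\<chi> (i::'p) (j::'p). ?\<Phi> Z (i, j) k)) = lin_path n w Z t"
    proof (unfold vec_eq_iff, intro allI)
      fix i j
      have "(\<Sum>k\<le>n. f k t *\<^sub>R (\<chi> (i::'p) (j::'p). ?\<Phi> Z (i, j) k)) $ i $ j = (\<Sum>k\<le>n. \<Sum>l\<le>n. L k l * f k t * Z l $ i $ j)"
        by (simp add: sum_distrib_left mult_ac)
      also have "\<dots> = (\<Sum>l\<le>n. \<Sum>k\<le>n. L k l * f k t * Z l $ i $ j)" by (rule sum.swap)
      also have "\<dots> = lin_path n w Z t $ i $ j" by (simp add: lin_path_def w_def sum_distrib_right)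
      finally show "(\<Sum>k\<le>n. f k t *\<^sub>R (\<chi> (i::'p) (j::'p). ?\<Phi> Z (i, j) k)) $ i $ j = lin_path n w Z t $ i $ j" .
    qed
    then show ?thesis by (rule arg_cong)
  qed
  have Fp_meas: "(\<lambda>\<omega>. ?Fp \<omega> t) \<in> borel_measurable ?\<Omega>" for t
  proof -
    have entry: "(\<lambda>\<omega>. \<omega> (i, j) k) \<in> borel_measurable ?\<Omega>" if "k \<le> n" for i j k
      by (rule measurable_component_compose[OF UNIV_I compM[OF that]])
    have sum: "(\<Sum>k\<le>n. f k t *\<^sub>R (\<chi> (i::'p) (j::'p). \<omega> (i, j) k)) $ i $ j = (\<Sum>k\<le>n. f k t * \<omega> (i, j) k)" for \<omega> i j
      by simp
    show ?thesis
      unfolding det_def sum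
      by (intro borel_measurable_sum borel_measurable_times borel_measurable_prod borel_measurable_const entry) simp
  qed
  have Fp_cont: "continuous_on {a..b} (?Fp \<omega>)" for \<omega>
    by (intro continuous_on_det continuous_on_sum continuous_on_scaleR continuous_on_const f_cont) simp
  let ?c = "\<lambda>N i. path_cos n w (grid a b N i) (grid a b N (Suc i))"
  let ?S = "\<lambda>N. \<Sum>i<Suc N. sign_change_prob (\<lambda>x :: real. x) (?c N i)"
  let ?T = "\<lambda>N. \<Sum>i<Suc N. sign_change_prob (det :: real^'p^'p \<Rightarrow> real) (?c N i)"
  note bounds1 = expected_num_points_bounds[where d="\<lambda>x :: real. x" and m=1 and \<Phi>="?L" and F="?F1", OF ab path1 _ w_pos L1 law1 F1_meas F1_cont F1]
  note boundsp = expected_num_points_bounds[where d="det :: real^'p^'p \<Rightarrow> real" and m="CARD('p)" and \<Phi>="?\<Phi>" and F="?Fp",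
      OF ab pathp det_scaleR w_pos \<Phi> lawp Fp_meas Fp_cont Fp]
  have S: "?S N \<le> \<alpha>1" "\<alpha>1 \<le> liminf ?S" for N unfolding alpha_1 by (rule bounds1; simp)+
  have T: "?T N \<le> \<alpha>p" "\<alpha>p \<le> liminf ?T" for N unfolding alpha_p by (rule boundsp; assumption)+
  have grid_cos: "\<forall>\<^sub>F N in sequentially. \<forall>i<Suc N. 1 - \<delta> < ?c N i" if "\<delta> > 0" for \<delta>
    by (rule eventually_path_cos_grid[OF ab _ _ that]) (rule w_cont w_pos; assumption)+
  have "\<alpha>p = ennreal E * \<alpha>1"
  proof (rule eq_mult_of_eventual_ratio[where S="?S" and T="?T"])
    fix \<epsilon> :: real assume "\<epsilon> > 0"
    then obtain \<delta> where \<delta>: "\<delta> > 0" "\<And>c. 1 - \<delta> < c \<Longrightarrow> c \<le> 1 \<Longrightarrow>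
        ennreal (E - \<epsilon>) * sign_change_prob (\<lambda>x :: real. x) c \<le> sign_change_prob (det :: real^'p^'p \<Rightarrow> real) c \<and>
        sign_change_prob (det :: real^'p^'p \<Rightarrow> real) c \<le> ennreal (E + \<epsilon>) * sign_change_prob (\<lambda>x :: real. x) c"
      using sign_change_prob_det_ratio[where 'p='p] unfolding E_def by metis
    show "\<forall>\<^sub>F N in sequentially. ennreal (E - \<epsilon>) * ?S N \<le> ?T N \<and> ?T N \<le> ennreal (E + \<epsilon>) * ?S N"
      using grid_cos[OF \<delta>(1)]
    proof eventually_elim
      case (elim N)
      have "?c N i \<le> 1" if "i < Suc N" for i
        using ab that by (intro path_cos_le_1 w_pos grid_mem) auto
      with elim \<delta>(2) show ?case unfolding sum_distrib_left by (intro conjI sum_mono) auto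
    qed
  qed (rule E S T fin)+
  then show ?thesis by (simp only: E_def)
qed

end
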